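(* Let $H=\mathbb{F}_q(t,\zeta)$ be the (Hilbert) class field of $\mathcal{A}$. The minimal modular curves $\mathbf{x}_0(I_\infty^k)$, $k\ge 0$, of Drinfeld $\mathcal{A}$-modules are represented by the function field tower $$\mathcal{G}_0\xrightarrow{\,q+1\,}\mathcal{G}_1\xrightarrow{\,q\,}\mathcal{G}_2\xrightarrow{\,q\,}\mathcal{G}_3\xrightarrow{\,q\,}\mathcal{G}_4\xrightarrow{\,q\,}\cdots,$$ where the number on each arrow denotes the extension degree, and where $\mathcal{G}_k$ is generated by $j_0$ and $w_1,\dots,w_k$ as follows. 1. For $k=0$, $\mathcal{G}_0=H(j_0)$ (with $j_0$ an independent variable). 2. For $k=1$, $\mathcal{G}_1=H(j_0,w_1)=H(w_1)$, and the inclusion $\mathcal{G}_0\to\mathcal{G}_1$ is given by $$j_0\mapsto-\frac{1+\zeta^{-1}(t-\zeta^q)w_1}{w_1^{q+1}+(1-\zeta^{1-q})^{-1}w_1}.$$ 3. For $k\ge 2$, $\mathcal{G}_k=H(w_1,w_2,\dots,w_k)$, where for every $m$ with $2\le m\le k$ the variables satisfy $$\sum_{i=0}^{q-1}(w_{m-1}^\nabla)^{i}\,w_m^{q-i}=\frac{w_{m-1}^q}{1-(\zeta^{q^{m+1}-q^m}-1)w_{m-1}}\left(w_{m-1}^\nabla\,(t-\zeta^{q^{m+1}})\right)^{q-1},$$ with $$w_{m-1}^{\nabla}=\frac{1}{(\zeta^{q^{m}-q^{m+1}}-1)\left(1+\zeta^{-q^m}(t-\zeta^{q^{m+1}})w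_{m-1}\right)}.$$
   Context: Let $q$ be a prime power, $\zeta\in\mathbb{F}_{q^2}\setminus\mathbb{F}_q$, $\rho(t)=(t-\zeta)(t-\zeta^q)\in\mathbb{F}_q[t]$, $K=\mathbb{F}_q(t)$, and let $P_\rho$ be the degree-two place of $K$ given by $\rho$. $\mathcal{A}$ is the ring of elements of $K$ regular away from $P_\rho$ (so $P_\rho$ is the place at infinity); with $x=1/\rho(t)$, $y=t/\rho(t)$ one has $\mathcal{A}=\mathbb{F}_q[x,y]$ with the single relation $y^2-(\zeta+\zeta^q)xy+\zeta^{q+1}x^2-x=0$. Put $I_\infty=(x,y)\subset\mathcal{A}$, $T=1/(t-\zeta^q)$, $T^\sigma=1/(t-\zeta)$. For a field $L$ with an $\mathbb{F}_q$-homomorphism $\mathcal{A}\to L$ (here $L$ is an extension of $H$ with the inclusion map), $L\{\tau\}$ is the twisted polynomial ring with $\tau a=a^q\tau$. For $a\in\mathcal A$, $\deg a=\log_q|\mathcal{A}/(a)|$. A Drinfeld $\mathcal{A}$-module of rank $r$ over $L$ is an $\mathbb{F}_q$-algebra homomorphism $\phi:\mathcal{A}\to L\{\tau\}$, $a\mapsto\phi_a$ (with constant coefficient of $\phi_a$ the image of $a$ in $L$), with $\deg_\tau\phi_a=r\deg a$. A rank-two $\phi$ is of $\zeta^q$-type if (leading coefficient of $\phi_y$)/(leading coefficient of $\phi_x$) equals $\zeta^q$. For an ideal $\mathfrak{n}$, $\phi[\mathfrak{n}]=\bigcap_{f\in\mathfrak{n}}\ker\phi_f$, an $\mathcal{A}$-module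 via $\phi$; a primitive $\mathfrak{n}$-torsion of $\phi$ is an $\mathcal{A}$-submodule of $\phi[\mathfrak{n}]$ isomorphic to $\mathcal{A}/\mathfrak{n}$. Pairs $(\phi,G)$ and $(\psi,G')$ are equivalent if there is an isomorphism $c\in\bar L^*$ from $\phi$ to $\psi$ (i.e. $c\,\phi_a=\psi_a\,c$ for all $a\in\mathcal{A}$) with $cG=G'$. The ($\zeta^q$-type) minimal modular curve $\mathbf{x}_0(\mathfrak{n})$ is the algebraic curve parametrizing pairs $(\phi,G)$ modulo equivalence, where $\phi$ is a $\zeta^q$-type rank-two Drinfeld $\mathcal{A}$-module and $G$ is a primitive $\mathfrak{n}$-torsion of $\phi$. The covering $\mathbf{x}_0(I_\infty^{k+1})\to\mathbf{x}_0(I_\infty^{k})$ is $(\phi,G)\mapsto(\phi,I_\infty\cdot G)$, where $I_\infty\cdot G=\{\phi_z(\mu):\mu\in G,\ z\in I_\infty\}$. The isomorphism classes of $\zeta^q$-type rank-two Drinfeld $\mathcal{A}$-modules are represented by the complete family (minimal model) $\Phi^j$, parametrized by the $j$-invariant $j$: $$\Phi^j_x=\left(-j^{q(q+1)}(T^\sigma T^q)^q\tau^2+\left(\tfrac{(T^{\sigma})^q j^q}{\zeta}+\tfrac{j^{q+1}T^\sigma T^q}{1-\zeta^{1-q}}\right)\tau+xj\right)\Phi^j_{I_\infty},$$ $$\Phi^j_y=\left(-j^{q(q+1)}(T^\sigma T^q)^q\zeta^q\tau^2+\left(\zeta^{q-1}j^q(T^{\sigma})^q-\tfrac{\zeta^q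 T^\sigma T^q j^{q+1}}{1-\zeta^{q-1}}\right)\tau+yj\right)\Phi^j_{I_\infty},$$ $$\Phi^j_{I_\infty}=\tau^2+\left(\tfrac{1}{1-\zeta^{1-q}}+\tfrac{1}{\zeta T j}\right)\tau+\tfrac1j .$$ "Represented" means that $\mathcal{G}_k$ is the function field of $\mathbf{x}_0(I_\infty^k)$, with $j_0$ being the $j$-invariant parameter of $\Phi^{j_0}$, so that the parameters $(j_0,w_1,\dots,w_k)$ correspond one-to-one to pairs consisting of $\Phi^{j_0}$ and a primitive $I_\infty^k$-torsion of $\Phi^{j_0}$. *)

theory Defs
  imports
    "HOL-Algebra.Algebraic_Closure_Type"
    "HOL-Algebra.Generated_Fields"
    "HOL-Algebra.Ideal_Product"
begin

text \<open>
  Everything lives inside one field \<^typ>\<open>'a\<close> containing \<open>H = \<F>\<^sub>q(t, \<zeta>)\<close>; the fields \<open>K\<close> and \<open>H\<close>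
  and the ring \<open>\<A>\<close> are subsets of it. The definitions are meant for algebraically closed \<^typ>\<open>'a\<close>
  of characteristic dividing \<open>q\<close>: only then is \<open>{a. a\<^sup>q = a}\<close> the field with \<open>q\<close> elements, and do
  torsion sets and isomorphisms taken in \<^typ>\<open>'a\<close> agree with the geometric ones.
\<close>

abbreviation ambient :: "'a::field ring" where
  "ambient \<equiv> ring_of_type_algebra"

definition Fq :: "nat \<Rightarrow> 'a::field set" where
  "Fq q = {a. a ^ q = a}"

definition Kfield :: "nat \<Rightarrow> 'a::field \<Rightarrow> 'a set" where
  "Kfield q t = generate_field ambient (Fq q \<union> {t})"

definition Hfield :: "nat \<Rightarrow> 'a::field \<Rightarrow> 'a \<Rightarrow> 'a set" where
  "Hfield q \<zeta> t = generate_field ambient (Fq q \<union> {t, \<zeta>})"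

definition rho :: "nat \<Rightarrow> 'a::field \<Rightarrow> 'a \<Rightarrow> 'a" where
  "rho q \<zeta> t = (t - \<zeta>) * (t - \<zeta> ^ q)"

text \<open>Places of \<open>K/\<F>\<^sub>q\<close>, represented by their valuation rings.\<close>

definition is_place :: "nat \<Rightarrow> 'a::field \<Rightarrow> 'a set \<Rightarrow> bool" where
  "is_place q t V \<longleftrightarrow>
     subring V ambient \<and> Fq q \<subseteq> V \<and> V \<subset> Kfield q t \<and>
     (\<forall>z \<in> Kfield q t. z \<in> V \<or> inverse z \<in> V)"

text \<open>\<open>P\<^sub>\<rho>\<close> is the place whose maximal ideal contains \<open>\<rho>(t)\<close>.\<close>

definition at_P_rho :: "nat \<Rightarrow> 'a::field \<Rightarrow> 'a \<Rightarrow> 'a set \<Rightarrow> bool" where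
  "at_P_rho q \<zeta> t V \<longleftrightarrow>
     is_place q t V \<and> rho q \<zeta> t \<in> V \<and> inverse (rho q \<zeta> t) \<notin> V"

definition Aset :: "nat \<Rightarrow> 'a::field \<Rightarrow> 'a \<Rightarrow> 'a set" where
  "Aset q \<zeta> t = {a \<in> Kfield q t. \<forall>V. is_place q t V \<and> \<not> at_P_rho q \<zeta> t V \<longrightarrow> a \<in> V}"

definition Aring :: "nat \<Rightarrow> 'a::field \<Rightarrow> 'a \<Rightarrow> 'a ring" where
  "Aring q \<zeta> t = ambient \<lparr>carrier := Aset q \<zeta> t\<rparr>"

definition xA :: "nat \<Rightarrow> 'a::field \<Rightarrow> 'a \<Rightarrow> 'a" where
  "xA q \<zeta> t = 1 / rho q \<zeta> t"

definition yA :: "nat \<Rightarrow> 'a::field \<Rightarrow> 'a \<Rightarrow> 'a" where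
  "yA q \<zeta> t = t / rho q \<zeta> t"

definition Iinf :: "nat \<Rightarrow> 'a::field \<Rightarrow> 'a \<Rightarrow> 'a set" where
  "Iinf q \<zeta> t = genideal (Aring q \<zeta> t) {xA q \<zeta> t, yA q \<zeta> t}"

definition Iinf_power :: "nat \<Rightarrow> 'a::field \<Rightarrow> 'a \<Rightarrow> nat \<Rightarrow> 'a set" where
  "Iinf_power q \<zeta> t k = Iinf q \<zeta> t [^]\<^bsub>ideals_set (Aring q \<zeta> t)\<^esub> k"

definition A_deg :: "nat \<Rightarrow> 'a::field \<Rightarrow> 'a \<Rightarrow> 'a \<Rightarrow> real" where
  "A_deg q \<zeta> t a =
     log (real q) (real (card (carrier (Aring q \<zeta> t Quot (PIdl\<^bsub>Aring q \<zeta> t\<^esub> a)))))"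

text \<open>
  The polynomial with coefficients \<open>c\<^sub>0, c\<^sub>1, \<dots>\<close> stands for \<open>c\<^sub>0 + c\<^sub>1 \<tau> + \<dots>\<close>; the multiplication
  is determined by \<open>\<tau> a = a\<^sup>q \<tau>\<close>.
\<close>

definition twist_mult :: "nat \<Rightarrow> 'a::field poly \<Rightarrow> 'a poly \<Rightarrow> 'a poly" where
  "twist_mult q f g =
     (\<Sum>i\<le>Polynomial.degree f. \<Sum>k\<le>Polynomial.degree g.
        Polynomial.monom (Polynomial.coeff f i * Polynomial.coeff g k ^ (q ^ i)) (i + k))"

definition twisted_ring :: "nat \<Rightarrow> 'a::field poly ring" where
  "twisted_ring q =
     \<lparr>carrier = UNIV, monoid.mult = twist_mult q, one = 1, ring.zero = 0, add = (+)\<rparr>"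

definition twist_eval :: "nat \<Rightarrow> 'a::field poly \<Rightarrow> 'a \<Rightarrow> 'a" where
  "twist_eval q f z = (\<Sum>i\<le>Polynomial.degree f. Polynomial.coeff f i * z ^ (q ^ i))"

definition Fq_algebra_hom :: "nat \<Rightarrow> 'a::field \<Rightarrow> 'a \<Rightarrow> ('a \<Rightarrow> 'a poly) \<Rightarrow> bool" where
  "Fq_algebra_hom q \<zeta> t \<phi> \<longleftrightarrow>
     \<phi> \<in> ring_hom (Aring q \<zeta> t) (twisted_ring q) \<and> (\<forall>c \<in> Fq q. \<phi> c = [:c:])"

definition drinfeld_module :: "nat \<Rightarrow> 'a::field \<Rightarrow> 'a \<Rightarrow> nat \<Rightarrow> ('a \<Rightarrow> 'a poly) \<Rightarrow> bool" where
  "drinfeld_module q \<zeta> t r \<phi> \<longleftrightarrow>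
     Fq_algebra_hom q \<zeta> t \<phi> \<and>
     (\<forall>a \<in> Aset q \<zeta> t. Polynomial.coeff (\<phi> a) 0 = a) \<and>
     (\<forall>a \<in> Aset q \<zeta> t - {0}. real (Polynomial.degree (\<phi> a)) = real r * A_deg q \<zeta> t a)"

definition leading :: "'a::field poly \<Rightarrow> 'a" where
  "leading f = Polynomial.coeff f (Polynomial.degree f)"

definition zeta_q_type :: "nat \<Rightarrow> 'a::field \<Rightarrow> 'a \<Rightarrow> ('a \<Rightarrow> 'a poly) \<Rightarrow> bool" where
  "zeta_q_type q \<zeta> t \<phi> \<longleftrightarrow>
     leading (\<phi> (yA q \<zeta> t)) / leading (\<phi> (xA q \<zeta> t)) = \<zeta> ^ q"

definition torsion :: "nat \<Rightarrow> ('a::field \<Rightarrow> 'a poly) \<Rightarrow> 'a set \<Rightarrow> 'a set" where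
  "torsion q \<phi> N = {z. \<forall>a \<in> N. twist_eval q (\<phi> a) z = 0}"

definition submodule_via :: "nat \<Rightarrow> 'a::field \<Rightarrow> 'a \<Rightarrow> ('a \<Rightarrow> 'a poly) \<Rightarrow> 'a set \<Rightarrow> bool" where
  "submodule_via q \<zeta> t \<phi> G \<longleftrightarrow>
     0 \<in> G \<and> (\<forall>u \<in> G. \<forall>v \<in> G. u - v \<in> G) \<and>
     (\<forall>a \<in> Aset q \<zeta> t. \<forall>u \<in> G. twist_eval q (\<phi> a) u \<in> G)"

definition primitive_torsion ::
    "nat \<Rightarrow> 'a::field \<Rightarrow> 'a \<Rightarrow> ('a \<Rightarrow> 'a poly) \<Rightarrow> 'a set \<Rightarrow> 'a set \<Rightarrow> bool" where
  "primitive_torsion q \<zeta> t \<phi> N G \<longleftrightarrow>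
     G \<subseteq> torsion q \<phi> N \<and> submodule_via q \<zeta> t \<phi> G \<and>
     (\<exists>f. bij_betw f (carrier (Aring q \<zeta> t Quot N)) G \<and>
        (\<forall>u \<in> carrier (Aring q \<zeta> t Quot N). \<forall>v \<in> carrier (Aring q \<zeta> t Quot N).
           f (u \<oplus>\<^bsub>Aring q \<zeta> t Quot N\<^esub> v) = f u + f v) \<and>
        (\<forall>a \<in> Aset q \<zeta> t. \<forall>u \<in> carrier (Aring q \<zeta> t Quot N).
           f ((N +>\<^bsub>Aring q \<zeta> t\<^esub> a) \<otimes>\<^bsub>Aring q \<zeta> t Quot N\<^esub> u) = twist_eval q (\<phi> a) (f u)))"

definition Iinf_times :: "nat \<Rightarrow> 'a::field \<Rightarrow> 'a \<Rightarrow> ('a \<Rightarrow> 'a poly) \<Rightarrow> 'a set \<Rightarrow> 'a set" where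
  "Iinf_times q \<zeta> t \<phi> G = {twist_eval q (\<phi> z) \<mu> | \<mu> z. \<mu> \<in> G \<and> z \<in> Iinf q \<zeta> t}"

definition modular_pairs ::
    "nat \<Rightarrow> 'a::field \<Rightarrow> 'a \<Rightarrow> 'a set \<Rightarrow> (('a \<Rightarrow> 'a poly) \<times> 'a set) set" where
  "modular_pairs q \<zeta> t N =
     {(\<phi>, G). drinfeld_module q \<zeta> t 2 \<phi> \<and> zeta_q_type q \<zeta> t \<phi> \<and>
              primitive_torsion q \<zeta> t \<phi> N G}"

definition pair_equiv ::
    "nat \<Rightarrow> 'a::field \<Rightarrow> 'a \<Rightarrow> 'a set \<Rightarrow>
       ((('a \<Rightarrow> 'a poly) \<times> 'a set) \<times> (('a \<Rightarrow> 'a poly) \<times> 'a set)) set" where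
  "pair_equiv q \<zeta> t N =
     {((\<phi>, G), (\<psi>, G')).
        (\<phi>, G) \<in> modular_pairs q \<zeta> t N \<and> (\<psi>, G') \<in> modular_pairs q \<zeta> t N \<and>
        (\<exists>c. c \<noteq> 0 \<and>
           (\<forall>a \<in> Aset q \<zeta> t. twist_mult q [:c:] (\<phi> a) = twist_mult q (\<psi> a) [:c:]) \<and>
           (\<lambda>z. c * z) ` G = G')}"

definition modular_curve ::
    "nat \<Rightarrow> 'a::field \<Rightarrow> 'a \<Rightarrow> 'a set \<Rightarrow> (('a \<Rightarrow> 'a poly) \<times> 'a set) set set" where
  "modular_curve q \<zeta> t N = modular_pairs q \<zeta> t N // pair_equiv q \<zeta> t N"

definition modular_point ::
    "nat \<Rightarrow> 'a::field \<Rightarrow> 'a \<Rightarrow> 'a set \<Rightarrow> ('a \<Rightarrow> 'a poly) \<Rightarrow> 'a set \<Rightarrow>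
       (('a \<Rightarrow> 'a poly) \<times> 'a set) set" where
  "modular_point q \<zeta> t N \<phi> G = pair_equiv q \<zeta> t N `` {(\<phi>, G)}"

definition Tpar :: "nat \<Rightarrow> 'a::field \<Rightarrow> 'a \<Rightarrow> 'a" where
  "Tpar q \<zeta> t = 1 / (t - \<zeta> ^ q)"

definition Tsigma :: "'a::field \<Rightarrow> 'a \<Rightarrow> 'a" where
  "Tsigma \<zeta> t = 1 / (t - \<zeta>)"

definition model_I :: "nat \<Rightarrow> 'a::field \<Rightarrow> 'a \<Rightarrow> 'a \<Rightarrow> 'a poly" where
  "model_I q \<zeta> t j =
     [: 1 / j,
        1 / (1 - \<zeta> powi (1 - int q)) + 1 / (\<zeta> * Tpar q \<zeta> t * j),
        1 :]"

definition model_x :: "nat \<Rightarrow> 'a::field \<Rightarrow> 'a \<Rightarrow> 'a \<Rightarrow> 'a poly" where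
  "model_x q \<zeta> t j = twist_mult q
     [: xA q \<zeta> t * j,
        Tsigma \<zeta> t ^ q * j ^ q / \<zeta>
          + j ^ (q + 1) * Tsigma \<zeta> t * Tpar q \<zeta> t ^ q / (1 - \<zeta> powi (1 - int q)),
        - (j ^ (q * (q + 1))) * (Tsigma \<zeta> t * Tpar q \<zeta> t ^ q) ^ q :]
     (model_I q \<zeta> t j)"

definition model_y :: "nat \<Rightarrow> 'a::field \<Rightarrow> 'a \<Rightarrow> 'a \<Rightarrow> 'a poly" where
  "model_y q \<zeta> t j = twist_mult q
     [: yA q \<zeta> t * j,
        \<zeta> ^ (q - 1) * j ^ q * Tsigma \<zeta> t ^ q
          - \<zeta> ^ q * Tsigma \<zeta> t * Tpar q \<zeta> t ^ q * j ^ (q + 1) / (1 - \<zeta> ^ (q - 1)),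
        - (j ^ (q * (q + 1))) * (Tsigma \<zeta> t * Tpar q \<zeta> t ^ q) ^ q * \<zeta> ^ q :]
     (model_I q \<zeta> t j)"

text \<open>
  On \<open>\<A> = \<F>\<^sub>q[x,y]\<close> the homomorphism is determined by its values at \<open>x\<close> and \<open>y\<close>, so only its
  irrelevant values outside \<open>\<A>\<close> depend on the choice. That it exists for \<open>j \<noteq> 0\<close> is part
  of the theorem.
\<close>

definition minimal_model :: "nat \<Rightarrow> 'a::field \<Rightarrow> 'a \<Rightarrow> 'a \<Rightarrow> ('a \<Rightarrow> 'a poly)" where
  "minimal_model q \<zeta> t j =
     (SOME \<phi>. Fq_algebra_hom q \<zeta> t \<phi> \<and>
              \<phi> (xA q \<zeta> t) = model_x q \<zeta> t j \<and> \<phi> (yA q \<zeta> t) = model_y q \<zeta> t j)"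

definition nabla :: "nat \<Rightarrow> 'a::field \<Rightarrow> 'a \<Rightarrow> nat \<Rightarrow> 'a \<Rightarrow> 'a" where
  "nabla q \<zeta> t m w =
     1 / ((\<zeta> powi (int (q ^ m) - int (q ^ (m + 1))) - 1)
          * (1 + \<zeta> powi (- int (q ^ m)) * (t - \<zeta> ^ (q ^ (m + 1))) * w))"

text \<open>
  The relation between \<open>w = w\<^sub>m\<^sub>-\<^sub>1\<close> and \<open>w' = w\<^sub>m\<close>; the two disequations say that the denominators
  in it (that of \<open>\<nabla>\<close> included) do not vanish.
\<close>

definition step_relation :: "nat \<Rightarrow> 'a::field \<Rightarrow> 'a \<Rightarrow> nat \<Rightarrow> 'a \<Rightarrow> 'a \<Rightarrow> bool" where
  "step_relation q \<zeta> t m w w' \<longleftrightarrow>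
     1 + \<zeta> powi (- int (q ^ m)) * (t - \<zeta> ^ (q ^ (m + 1))) * w \<noteq> 0 \<and>
     1 - (\<zeta> powi (int (q ^ (m + 1)) - int (q ^ m)) - 1) * w \<noteq> 0 \<and>
     (\<Sum>i<q. nabla q \<zeta> t m w ^ i * w' ^ (q - i)) =
       w ^ q / (1 - (\<zeta> powi (int (q ^ (m + 1)) - int (q ^ m)) - 1) * w)
         * (nabla q \<zeta> t m w * (t - \<zeta> ^ (q ^ (m + 1)))) ^ (q - 1)"

definition first_relation :: "nat \<Rightarrow> 'a::field \<Rightarrow> 'a \<Rightarrow> 'a \<Rightarrow> 'a \<Rightarrow> bool" where
  "first_relation q \<zeta> t j w \<longleftrightarrow>
     w ^ (q + 1) + inverse (1 - \<zeta> powi (1 - int q)) * w \<noteq> 0 \<and>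
     j = - ((1 + inverse \<zeta> * (t - \<zeta> ^ q) * w)
            / (w ^ (q + 1) + inverse (1 - \<zeta> powi (1 - int q)) * w))"

text \<open>The tuples \<open>(j\<^sub>0, w\<^sub>1, \<dots>, w\<^sub>k)\<close>; \<open>w\<^sub>m\<close> is the entry \<open>ws ! (m - 1)\<close>.\<close>

definition tower_points :: "nat \<Rightarrow> 'a::field \<Rightarrow> 'a \<Rightarrow> nat \<Rightarrow> ('a \<times> 'a list) set" where
  "tower_points q \<zeta> t k =
     {(j, ws). j \<noteq> 0 \<and> length ws = k \<and>
        (k \<ge> 1 \<longrightarrow> first_relation q \<zeta> t j (ws ! 0)) \<and>
        (\<forall>m. 2 \<le> m \<and> m \<le> k \<longrightarrow> step_relation q \<zeta> t m (ws ! (m - 2)) (ws ! (m - 1)))}"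

definition over_H :: "nat \<Rightarrow> 'a::field \<Rightarrow> 'a \<Rightarrow> 'a set \<Rightarrow> 'a set" where
  "over_H q \<zeta> t S = generate_field ambient (Hfield q \<zeta> t \<union> S)"

definition tower_field :: "nat \<Rightarrow> 'a::field \<Rightarrow> 'a \<Rightarrow> 'a \<Rightarrow> 'a list \<Rightarrow> 'a set" where
  "tower_field q \<zeta> t j ws = over_H q \<zeta> t ({j} \<union> set ws)"

text \<open>
  The field of definition over \<open>H\<close> of \<open>(\<Phi>\<^sup>j, G)\<close>, generated by \<open>j\<close> and the coefficients of the
  polynomial with simple roots \<open>G\<close>. For \<open>j\<close> transcendental over \<open>H\<close>, i.e. for a generic
  pair, it is the function field of the modular curve.
\<close>

definition field_of_definition :: "nat \<Rightarrow> 'a::field \<Rightarrow> 'a \<Rightarrow> 'a \<Rightarrow> 'a set \<Rightarrow> 'a set" where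
  "field_of_definition q \<zeta> t j G =
     over_H q \<zeta> t ({j} \<union> range (Polynomial.coeff (\<Prod>\<mu>\<in>G. [:- \<mu>, 1:])))"

end

theory Submission
  imports Defs
begin

text \<open>
  A module of type \<open>\<zeta>\<^sup>q\<close> is given by two parameters \<open>(m, k)\<close>, and its \<open>I\<^sub>\<infinity>\<close>-torsion is the kernel of a
  twisted polynomial \<open>M = \<tau>\<^sup>2 + m\<^sub>1 \<tau> + m\<close>. A line \<open>{z. z\<^sup>q = v z}\<close> in it is the kernel of an isogeny to a
  module of the conjugate type, whose parameters are rational in \<open>m, k, v\<close>. A primitive
  \<open>I\<^sub>\<infinity>\<^sup>n\<close>-torsion is the same as a chain of \<open>n\<close> such lines in which no line is the image of the
  \<open>I\<^sub>\<infinity>\<close>-torsion of the preceding module; measured by \<open>w = \<kappa> v / k\<close>, where \<open>\<kappa> = 1 / (1 - Z\<^sup>q\<^sup>-\<^sup>1)\<close>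
  for \<open>Z = \<zeta>, \<zeta>\<^sup>q\<close> in turn, consecutive lines satisfy the equations of the tower.

  For the degrees, \<open>j\<^sub>0\<close> is a rational function of degree \<open>q + 1\<close> in \<open>w\<^sub>1\<close>. At a place with a pole of \<open>w\<^sub>1\<close>
  all later steps are totally ramified: \<open>w\<^sub>m\<close> has a pole for odd \<open>m\<close>, and \<open>w\<^sub>m + \<kappa>\<close> is a
  uniformizer for even \<open>m\<close>.
\<close>

text \<open>A tower equation is the line equation of the next module divided by its one forbidden
  root. If \<open>M = (\<tau> - u)(\<tau> - v)\<close>, the target of the isogeny
  \<open>\<tau> - v\<close> has \<open>M' = (\<tau> - u')(\<tau> - u)\<close>, and the line
  \<open>u\<close> is the image of the full torsion. A line \<open>V\<close> of the target satisfies
  \<open>V (V^q - u^q) = u' (V - u)\<close>, and \<open>V (V^q - u^q) / (V - u)\<close> is the sum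
  on the left of a tower equation. In the coordinate \<open>w\<close>, \<open>nabla\<close> is
  \<open>u\<close> and the right side is \<open>u'\<close>. Isogenies are tested on \<open>M\<close>
  and on \<open>B\<close>, where they are identities between cubics, instead of on the quartic
  images of \<open>x\<close> and \<open>y\<close>. Rescaling a module normalizes \<open>k\<close> to
  \<open>kap \<zeta>\<close>; then only \<open>j = 1 / m\<close> is left, isomorphisms lie in
  \<open>F_q\<close>, and the first \<open>w\<close> is the first \<open>v\<close>. For the degrees
  a valuation ring of the whole ambient field is produced by Zorn's lemma, and on the fields of the
  tower only integer powers of one parameter are measured. After a pole the leading terms cancel,
  since \<open>w'\<close> is congruent to a nonzero constant, so that ramification shows only in the
  residue of the next coefficient.\<close>

lemma infinite_UNIV_alg_closed: "infinite (UNIV :: 'a::alg_closed_field set)"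
proof
  assume fin: "finite (UNIV :: 'a set)"
  let ?p = "(\<Prod>a\<in>UNIV. [:- a, 1:]) + 1 :: 'a poly"
  have "degree (\<Prod>a\<in>(UNIV :: 'a set). [:- a, 1:]) = card (UNIV :: 'a set)"
    by (subst degree_prod_eq_sum_degree) auto
  moreover have "card (UNIV :: 'a set) > 0" using fin by (simp add: card_gt_0_iff)
  ultimately have "degree ?p > 0" by (simp add: degree_add_eq_left)
  then obtain x where "poly ?p x = 0" using alg_closed_imp_poly_has_root by blast
  moreover have "poly ?p x = 1" using fin by (auto simp: poly_prod)
  ultimately show False by simp
qed

lemma poly_splits:
  fixes p :: "'a::alg_closed_field poly"
  assumes p0: "p \<noteq> 0"
  shows "p = smult (lead_coeff p) (\<Prod>x\<in>#proots p. [:- x, 1:])" "size (proots p) = degree p"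
proof -
  obtain A where A: "size A = degree p" "p = smult (lead_coeff p) (\<Prod>x\<in>#A. [:- x, 1:])"
    using alg_closed_imp_factorization[OF p0] by blast
  have lin: "proots (\<Prod>x\<in>#B. [:- x, 1:]) = B \<and> (\<Prod>x\<in>#B. [:- x, 1:]) \<noteq> 0" for B :: "'a multiset"
    by (induction B) (auto simp: proots_mult simp del: mult_pCons_left)
  have "proots p = proots (smult (lead_coeff p) (\<Prod>x\<in>#A. [:- x, 1:]))"
    using A(2) by (rule arg_cong)
  also have "\<dots> = A" using p0 lin[of A] proots_smult leading_coeff_0_iff by metis
  finally have "proots p = A" .
  thus "p = smult (lead_coeff p) (\<Prod>x\<in>#proots p. [:- x, 1:])" "size (proots p) = degree p"
    using A by auto
qed

section \<open>The standing hypotheses and the Frobenius of order q\<close>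

locale setting =
  fixes q e :: nat and \<zeta> t :: "'a::alg_closed_field"
  assumes prime_char: "prime CHAR('a)" and e_pos: "e > 0" and q_def: "q = CHAR('a) ^ e"
    and zeta_q2: "\<zeta> ^ (q ^ 2) = \<zeta>" and zeta_notin: "\<zeta> \<notin> Fq q"
    and transc: "ring.transcendental ambient (Fq q) t"
begin

text \<open>A name of its own keeps q-th powers opaque, so that \<open>F_simps\<close> treats them
  as a field endomorphism and explicit identities can be checked with \<open>F a\<close>,
  \<open>F (F a)\<close> as further atoms.\<close>

definition F :: "'a \<Rightarrow> 'a" where "F z = z ^ q"

lemma q_gt1: "q > 1"
  using prime_char e_pos unfolding q_def by (metis one_less_power prime_gt_1_nat)

lemma q_pos [simp]: "q > 0" and q_neq_0 [simp]: "q \<noteq> 0"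
  using q_gt1 by auto

lemma F_0 [simp]: "F 0 = 0" and F_1 [simp]: "F 1 = 1"
  and F_mult: "F (a * b) = F a * F b" and F_divide: "F (a / b) = F a / F b"
  and F_inverse: "F (inverse a) = inverse (F a)" and F_power: "F (a ^ n) = F a ^ n"
  by (simp_all add: F_def power_mult_distrib power_divide power_inverse flip: power_mult)
     (simp_all add: mult.commute)

lemma F_add: "F (a + b) = F a + F b"
  unfolding F_def using freshmans_dream'[OF prime_char q_def, of a b] .

lemma F_minus: "F (- a) = - F a"
  using F_add[of a "-a"] by (simp add: eq_neg_iff_add_eq_0 add.commute)

lemma F_diff: "F (a - b) = F a - F b"
  using F_add[of a "-b"] by (simp add: F_minus)

lemma F_eq_0 [simp]: "F a = 0 \<longleftrightarrow> a = 0"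
  by (simp add: F_def)

lemma F_inj [simp]: "F a = F b \<longleftrightarrow> a = b"
  using F_diff[of a b] F_eq_0[of "a - b"] by auto

lemma F_sum: "F (sum f A) = (\<Sum>x\<in>A. F (f x))"
  by (induction A rule: infinite_finite_induct) (auto simp: F_add)

lemma F_funpow: "(F ^^ n) z = z ^ (q ^ n)"
  by (induction n) (auto simp: F_def mult.commute simp flip: power_mult)

lemma Fn_props: "(F ^^ n) 0 = 0" "(F ^^ n) (a + b) = (F ^^ n) a + (F ^^ n) b"
  "(F ^^ n) (a * b) = (F ^^ n) a * (F ^^ n) b" "(F ^^ n) a = 0 \<longleftrightarrow> a = 0" "(F ^^ n) 1 = 1"
  "(F ^^ n) (- a) = - (F ^^ n) a" "(F ^^ n) (a - b) = (F ^^ n) a - (F ^^ n) b"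
  by (induction n) (auto simp: F_add F_mult F_minus F_diff)

lemmas F_simps = F_add F_mult F_divide F_inverse F_power F_minus F_diff

lemma in_Fq: "c \<in> Fq q \<longleftrightarrow> F c = c"
  by (simp add: Fq_def F_def)

lemma Fq_Fn: "c \<in> Fq q \<Longrightarrow> (F ^^ n) c = c"
  by (induction n) (auto simp: in_Fq)

text \<open>\<open>X\<^sup>q - X\<close> is separable because its derivative is \<open>-1\<close>.\<close>

lemma card_Fq: "card (Fq q :: 'a set) = q" and finite_Fq: "finite (Fq q :: 'a set)"
proof -
  let ?p = "Polynomial.monom 1 q + [:0, -1:] :: 'a poly"
  have deg: "degree ?p = q"
    using q_gt1 by (subst degree_add_eq_left) (auto simp: degree_monom_eq)
  hence p0: "?p \<noteq> 0" using q_gt1 by auto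
  have roots: "{x. poly ?p x = 0} = Fq q"
    by (auto simp: poly_monom Fq_def)
  have "of_nat q = (0 :: 'a)"
    unfolding q_def using e_pos by simp
  hence der: "pderiv ?p = [:-1:]"
    by (simp add: pderiv_add pderiv_monom pderiv_pCons)
  have simple: "order x ?p = 1" if "poly ?p x = 0" for x
  proof (rule ccontr)
    assume "order x ?p \<noteq> 1"
    moreover have "order x ?p \<noteq> 0" using that p0 order_root by blast
    ultimately have "[:-x, 1:] ^ 2 dvd ?p"
      using order_divides[of x 2 ?p] by auto
    then obtain r where r: "?p = [:-x, 1:] ^ 2 * r" by (auto elim: dvdE)
    have "poly (pderiv ?p) x = 0"
      unfolding r power2_eq_square pderiv_mult by (simp add: pderiv_pCons)
    thus False by (simp add: der)
  qed
  have "size (proots ?p) = q" using poly_splits(2)[OF p0] by (simp only: deg)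
  also have "size (proots ?p) = (\<Sum>x\<in>{x. poly ?p x = 0}. order x ?p)"
    using p0 by (simp add: size_multiset_overloaded_eq)
  also have "\<dots> = card {x. poly ?p x = 0}"
    using simple by simp
  finally show "card (Fq q :: 'a set) = q" by (simp only: roots)
  show "finite (Fq q :: 'a set)" using poly_roots_finite[OF p0] by (simp only: roots)
qed

subsection \<open>Twisted polynomials\<close>

abbreviation tmult :: "'a poly \<Rightarrow> 'a poly \<Rightarrow> 'a poly" (infixl "\<star>" 70) where
  "f \<star> g \<equiv> twist_mult q f g"

abbreviation ev :: "'a poly \<Rightarrow> 'a \<Rightarrow> 'a" where "ev \<equiv> twist_eval q"

definition Ker :: "'a poly \<Rightarrow> 'a set" where "Ker f = {z. ev f z = 0}"

text \<open>The commutation rule reads \<open>\<tau> g = (Fp g) \<tau>\<close>.\<close>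

definition Fp :: "'a poly \<Rightarrow> 'a poly" where "Fp = map_poly F"

lemma coeff_Fp [simp]: "coeff (Fp g) n = F (coeff g n)"
  by (simp add: Fp_def coeff_map_poly)

text \<open>The double sum of \<open>twist_mult\<close> is cut off at the degrees of the factors.
  The convolution form does not mention degrees, so the ring laws can be compared coefficient by
  coefficient.\<close>

lemma coeff_tmult: "coeff (f \<star> g) n = (\<Sum>i\<le>n. coeff f i * (F ^^ i) (coeff g (n - i)))"
proof -
  have "coeff (f \<star> g) n = (\<Sum>i\<le>degree f. \<Sum>k\<le>degree g.
      if i + k = n then coeff f i * (F ^^ i) (coeff g k) else 0)"
    unfolding twist_mult_def F_funpow by (simp add: coeff_sum)
  also have "\<dots> = (\<Sum>i\<le>degree f. if i \<le> n then coeff f i * (F ^^ i) (coeff g (n - i)) else 0)"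
  proof (rule sum.cong)
    fix i
    show "(\<Sum>k\<le>degree g. if i + k = n then coeff f i * (F ^^ i) (coeff g k) else 0) =
      (if i \<le> n then coeff f i * (F ^^ i) (coeff g (n - i)) else 0)"
    proof (cases "i \<le> n")
      case True
      hence "(\<Sum>k\<le>degree g. if i + k = n then coeff f i * (F ^^ i) (coeff g k) else 0) =
        (\<Sum>k\<le>degree g. if k = n - i then coeff f i * (F ^^ i) (coeff g k) else 0)"
        by (intro sum.cong) auto
      also have "\<dots> = (if n - i \<le> degree g then coeff f i * (F ^^ i) (coeff g (n - i)) else 0)"
        by simp
      finally show ?thesis using True by (auto simp: coeff_eq_0 Fn_props)
    qed (auto intro!: sum.neutral)
  qed simp
  also have "\<dots> = (\<Sum>i\<in>{..degree f} \<inter> {..n}. coeff f i * (F ^^ i) (coeff g (n - i)))"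
    by (subst sum.inter_restrict) (auto simp del: Int_atMost)
  also have "\<dots> = (\<Sum>i\<le>n. coeff f i * (F ^^ i) (coeff g (n - i)))"
    by (rule sum.mono_neutral_left) (auto simp: coeff_eq_0)
  finally show ?thesis .
qed

lemma tmult_0 [simp]: "f \<star> 0 = 0" "0 \<star> f = 0"
  by (rule poly_eqI; simp add: coeff_tmult Fn_props)+

lemma tmult_add: "(f + g) \<star> h = f \<star> h + g \<star> h" "f \<star> (g + h) = f \<star> g + f \<star> h"
  by (rule poly_eqI; simp add: coeff_tmult Fn_props ring_distribs sum.distrib)+

lemma tmult_minus: "(- f) \<star> h = - (f \<star> h)" "f \<star> (- h) = - (f \<star> h)"
  by (rule poly_eqI; simp add: coeff_tmult Fn_props ring_distribs sum_negf)+

lemma tmult_diff: "(f - g) \<star> h = f \<star> h - g \<star> h" "f \<star> (g - h) = f \<star> g - f \<star> h"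
  using tmult_add(1)[of f "- g" h] tmult_add(2)[of f g "- h"] by (simp_all add: tmult_minus)

lemma smult_tmult: "smult c f \<star> h = smult c (f \<star> h)"
  by (rule poly_eqI) (simp add: coeff_tmult sum_distrib_left mult.assoc)

text \<open>Constants fixed by \<open>F\<close> commute with \<open>\<tau>\<close>, hence are
  central.\<close>

lemma tmult_smult: "c \<in> Fq q \<Longrightarrow> f \<star> smult c h = smult c (f \<star> h)"
  by (rule poly_eqI) (simp add: coeff_tmult sum_distrib_left Fn_props Fq_Fn mult.left_commute)

lemma const_tmult: "[:c:] \<star> h = smult c h"
proof (rule poly_eqI)
  fix n
  have "(\<Sum>i\<le>n. coeff [:c:] i * (F ^^ i) (coeff h (n - i))) =
    (\<Sum>i\<in>{0}. coeff [:c:] i * (F ^^ i) (coeff h (n - i)))"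
    by (rule sum.mono_neutral_right) (auto simp: coeff_pCons split: nat.splits)
  thus "coeff ([:c:] \<star> h) n = coeff (smult c h) n" by (simp add: coeff_tmult)
qed

text \<open>\<open>pCons a f\<close> is \<open>a + f \<tau>\<close>, and \<open>\<tau>\<close>
  passes \<open>g\<close> by turning it into \<open>Fp g\<close>. This drives inductions on the left
  factor and unfolds products of explicit polynomials.\<close>

lemma tmult_pCons: "pCons a f \<star> g = smult a g + pCons 0 (f \<star> Fp g)"
proof (rule poly_eqI)
  fix n
  show "coeff (pCons a f \<star> g) n = coeff (smult a g + pCons 0 (f \<star> Fp g)) n"
  proof (cases n)
    case (Suc m)
    have "coeff (pCons a f \<star> g) (Suc m) =
       a * coeff g (Suc m) + (\<Sum>i\<le>m. coeff f i * (F ^^ Suc i) (coeff g (m - i)))"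
      unfolding coeff_tmult by (subst sum.atMost_Suc_shift) simp
    thus ?thesis using Suc by (simp add: coeff_tmult funpow_swap1)
  qed (simp add: coeff_tmult)
qed

lemma one_tmult [simp]: "1 \<star> h = h"
  using const_tmult[of 1 h] by (simp add: one_pCons)

lemma Fp_simps: "Fp 0 = 0" "Fp (pCons a f) = pCons (F a) (Fp f)" "Fp (f + g) = Fp f + Fp g"
  "Fp (smult c f) = smult (F c) (Fp f)"
  by (auto intro!: poly_eqI simp: coeff_pCons F_add F_mult split: nat.splits)

lemma ev_eq: "n \<ge> degree f \<Longrightarrow> ev f z = (\<Sum>i\<le>n. coeff f i * (F ^^ i) z)"
  unfolding twist_eval_def F_funpow[symmetric]
  by (rule sum.mono_neutral_left) (auto simp: coeff_eq_0)

lemma ev_pCons: "ev (pCons a f) z = a * z + ev f (F z)"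
proof -
  have "ev (pCons a f) z = (\<Sum>i\<le>Suc (degree f). coeff (pCons a f) i * (F ^^ i) z)"
    by (rule ev_eq) (simp add: degree_pCons_le)
  also have "\<dots> = a * z + ev f (F z)"
    by (subst sum.atMost_Suc_shift) (simp add: ev_eq[of f "degree f"] funpow_swap1)
  finally show ?thesis .
qed

lemma ev_0 [simp]: "ev 0 z = 0" by (simp add: twist_eval_def)

lemma ev_1 [simp]: "ev 1 z = z" by (simp add: one_pCons ev_pCons)

lemma ev_add: "ev (f + g) z = ev f z + ev g z"
proof -
  let ?n = "max (degree f) (degree g)"
  have "degree (f + g) \<le> ?n" by (rule degree_add_le_max)
  thus ?thesis by (simp add: ev_eq[of _ ?n] sum.distrib ring_distribs)
qed

lemma ev_smult: "ev (smult c f) z = c * ev f z"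
  by (simp add: ev_eq[of _ "degree f"] degree_smult_le sum_distrib_left mult.assoc)

lemma ev_minus: "ev (- f) z = - ev f z"
  using ev_smult[of "-1" f z] by simp

lemma ev_diff: "ev (f - g) z = ev f z - ev g z"
  using ev_add[of f "- g" z] by (simp add: ev_minus)

lemma ev_arg_0 [simp]: "ev f 0 = 0"
  unfolding twist_eval_def F_funpow[symmetric] by (simp add: Fn_props)

lemma ev_arg_add: "ev f (y + z) = ev f y + ev f z"
  by (simp add: ev_eq[of f "degree f"] sum.distrib Fn_props ring_distribs)

lemma ev_arg_minus: "ev f (- z) = - ev f z"
  using ev_arg_add[of f z "-z"] by (simp add: eq_neg_iff_add_eq_0 add.commute)

lemma ev_arg_diff: "ev f (y - z) = ev f y - ev f z"
  using ev_arg_add[of f y "- z"] by (simp add: ev_arg_minus)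

lemma F_ev: "F (ev f z) = ev (Fp f) (F z)"
  by (induction f arbitrary: z) (auto simp: Fp_simps ev_pCons F_add F_mult)

lemma ev_tmult: "ev (f \<star> g) z = ev f (ev g z)"
proof (induction f arbitrary: g z)
  case (pCons a f)
  show ?case by (simp add: tmult_pCons ev_add ev_smult ev_pCons pCons.IH F_ev)
qed simp

text \<open>The ordinary additive polynomial with the same values; zeros are counted and degrees
  bounded through it.\<close>

definition qpoly :: "'a poly \<Rightarrow> 'a poly" where
  "qpoly f = (\<Sum>i\<le>degree f. Polynomial.monom (coeff f i) (q ^ i))"

lemma poly_qpoly: "poly (qpoly f) z = ev f z"
  by (simp add: qpoly_def poly_sum poly_monom twist_eval_def)

lemma q_pow_inj [simp]: "q ^ i = q ^ j \<longleftrightarrow> i = j"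
  using q_gt1 by (simp add: power_inject_exp)

lemma coeff_qpoly: "coeff (qpoly f) (q ^ i) = coeff f i"
  by (simp add: qpoly_def coeff_sum coeff_eq_0)

lemma coeff_qpoly_0: "n \<notin> range (\<lambda>i. q ^ i) \<Longrightarrow> coeff (qpoly f) n = 0"
  by (auto simp: qpoly_def coeff_sum intro!: sum.neutral)

lemma degree_qpoly: "f \<noteq> 0 \<Longrightarrow> degree (qpoly f) = q ^ degree f"
proof (rule antisym)
  show "degree (qpoly f) \<le> q ^ degree f" unfolding qpoly_def
    by (intro degree_sum_le) (auto intro!: order.trans[OF degree_monom_le] power_increasing simp: Suc_leI)
  show "f \<noteq> 0 \<Longrightarrow> q ^ degree f \<le> degree (qpoly f)"
    by (rule le_degree) (simp add: coeff_qpoly)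
qed

lemma qpoly_eq_0: "qpoly f = 0 \<Longrightarrow> f = 0"
  by (rule poly_eqI) (use coeff_qpoly in \<open>metis coeff_0\<close>)

lemma ev_zero_imp: assumes "\<And>z. ev f z = 0" shows "f = 0"
proof (rule qpoly_eq_0, rule ccontr)
  assume "qpoly f \<noteq> 0"
  from poly_roots_finite[OF this] show False
    using assms infinite_UNIV_alg_closed[where 'a = 'a] by (simp add: poly_qpoly)
qed

lemma ev_inject: assumes "\<And>z. ev f z = ev g z" shows "f = g"
  using ev_zero_imp[of "f - g"] assms by (simp add: ev_diff)

text \<open>Evaluation is faithful on the infinite field and turns products into compositions, so
  associativity is inherited.\<close>

lemma tmult_assoc: "f \<star> g \<star> h = f \<star> (g \<star> h)"
  by (rule ev_inject) (simp add: ev_tmult)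

lemma tmult_1 [simp]: "f \<star> 1 = f"
  by (rule ev_inject) (simp add: ev_tmult)

lemma tmult_Fq: "c \<in> Fq q \<Longrightarrow> f \<star> [:c:] = smult c f"
  using tmult_smult[of c f 1] smult_one[of c] by simp

lemma coeff_tmult_degree: "coeff (f \<star> g) (degree f + degree g) = lead_coeff f * (F ^^ degree f) (lead_coeff g)"
proof -
  have "coeff (f \<star> g) (degree f + degree g) =
     (\<Sum>i\<in>{degree f}. coeff f i * (F ^^ i) (coeff g (degree f + degree g - i)))"
    unfolding coeff_tmult
  proof (rule sum.mono_neutral_right)
    show "\<forall>i\<in>{..degree f + degree g} - {degree f}. coeff f i * (F ^^ i) (coeff g (degree f + degree g - i)) = 0"
    proof
      fix i assume i: "i \<in> {..degree f + degree g} - {degree f}"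
      show "coeff f i * (F ^^ i) (coeff g (degree f + degree g - i)) = 0"
      proof (cases "i > degree f")
        case False
        hence "degree f + degree g - i > degree g" using i by auto
        thus ?thesis by (simp add: coeff_eq_0 Fn_props)
      qed (simp add: coeff_eq_0)
    qed
  qed auto
  thus ?thesis by simp
qed

lemma degree_tmult: "f \<noteq> 0 \<Longrightarrow> g \<noteq> 0 \<Longrightarrow> degree (f \<star> g) = degree f + degree g"
proof (rule antisym)
  show "degree (f \<star> g) \<le> degree f + degree g" unfolding twist_mult_def
    by (intro degree_sum_le) (auto intro!: order.trans[OF degree_monom_le])
  show "f \<noteq> 0 \<Longrightarrow> g \<noteq> 0 \<Longrightarrow> degree f + degree g \<le> degree (f \<star> g)"
    by (rule le_degree) (simp add: coeff_tmult_degree Fn_props)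
qed

lemma lead_coeff_tmult:
  "f \<noteq> 0 \<Longrightarrow> g \<noteq> 0 \<Longrightarrow> lead_coeff (f \<star> g) = lead_coeff f * (F ^^ degree f) (lead_coeff g)"
  using coeff_tmult_degree[of f g] by (simp add: degree_tmult)

lemma tmult_eq_0 [simp]: "f \<star> g = 0 \<longleftrightarrow> f = 0 \<or> g = 0"
proof -
  have "f \<star> g \<noteq> 0" if "f \<noteq> 0" "g \<noteq> 0"
    using coeff_tmult_degree[of f g] that by (auto simp: Fn_props)
  thus ?thesis by auto
qed

lemma tmult_left_cancel: "f \<noteq> 0 \<Longrightarrow> f \<star> g = f \<star> h \<Longrightarrow> g = h"
  using tmult_eq_0[of f "g - h"] by (simp add: tmult_diff)

lemma tmult_right_cancel: "f \<noteq> 0 \<Longrightarrow> g \<star> f = h \<star> f \<Longrightarrow> g = h"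
  using tmult_eq_0[of "g - h" f] by (simp add: tmult_diff)

lemma coeff_tmult_0: "coeff (f \<star> g) 0 = coeff f 0 * coeff g 0"
  by (simp add: coeff_tmult)

section \<open>Coefficient subfields and right division\<close>

text \<open>Subfields in type class terms; closure under \<open>inverse\<close> includes the
  convention \<open>inverse 0 = 0\<close>. The translation to and from HOL-Algebra is
  \<open>sfield_subfield\<close> and \<open>subfield_sfield\<close>.\<close>

definition sfield :: "'a set \<Rightarrow> bool" where
  "sfield E \<longleftrightarrow> 1 \<in> E \<and> (\<forall>a\<in>E. \<forall>b\<in>E. a + b \<in> E \<and> a * b \<in> E \<and> - a \<in> E \<and> inverse a \<in> E)"

lemma sfieldD: assumes "sfield E" shows "1 \<in> E" "0 \<in> E" "a \<in> E \<Longrightarrow> b \<in> E \<Longrightarrow> a + b \<in> E"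
  "a \<in> E \<Longrightarrow> b \<in> E \<Longrightarrow> a * b \<in> E" "a \<in> E \<Longrightarrow> - a \<in> E" "a \<in> E \<Longrightarrow> inverse a \<in> E"
  "a \<in> E \<Longrightarrow> b \<in> E \<Longrightarrow> a - b \<in> E" "a \<in> E \<Longrightarrow> b \<in> E \<Longrightarrow> a / b \<in> E"
proof -
  have 0: "1 \<in> E" "\<And>a b. a \<in> E \<Longrightarrow> b \<in> E \<Longrightarrow> a + b \<in> E" "\<And>a b. a \<in> E \<Longrightarrow> b \<in> E \<Longrightarrow> a * b \<in> E"
    "\<And>a. a \<in> E \<Longrightarrow> - a \<in> E" "\<And>a. a \<in> E \<Longrightarrow> inverse a \<in> E"
    using assms unfolding sfield_def by auto
  show "1 \<in> E" "a \<in> E \<Longrightarrow> b \<in> E \<Longrightarrow> a + b \<in> E"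
    "a \<in> E \<Longrightarrow> b \<in> E \<Longrightarrow> a * b \<in> E" "a \<in> E \<Longrightarrow> - a \<in> E" "a \<in> E \<Longrightarrow> inverse a \<in> E" by (fact 0)+
  show "0 \<in> E" using 0(2)[OF 0(1) 0(4)[OF 0(1)]] by simp
  show "a \<in> E \<Longrightarrow> b \<in> E \<Longrightarrow> a - b \<in> E" using 0(2)[OF _ 0(4)] by fastforce
  show "a \<in> E \<Longrightarrow> b \<in> E \<Longrightarrow> a / b \<in> E" using 0(3)[OF _ 0(5)] by (fastforce simp: field_simps)
qed

lemma sfield_sum: "sfield E \<Longrightarrow> (\<And>x. x \<in> A \<Longrightarrow> f x \<in> E) \<Longrightarrow> sum f A \<in> E"
  by (induction A rule: infinite_finite_induct) (auto simp: sfieldD)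

lemma sfield_power: "sfield E \<Longrightarrow> x \<in> E \<Longrightarrow> x ^ n \<in> E"
  by (induction n) (auto simp: sfieldD)

lemma sfield_Fn: "sfield E \<Longrightarrow> x \<in> E \<Longrightarrow> (F ^^ n) x \<in> E"
  by (simp add: F_funpow sfield_power)

definition coeffs_in :: "'a set \<Rightarrow> 'a poly set" where "coeffs_in E = {f. \<forall>i. coeff f i \<in> E}"

lemma coeffs_in_intros: assumes "sfield E"
  shows "0 \<in> coeffs_in E" "1 \<in> coeffs_in E" "f \<in> coeffs_in E \<Longrightarrow> g \<in> coeffs_in E \<Longrightarrow> f + g \<in> coeffs_in E"
    "f \<in> coeffs_in E \<Longrightarrow> g \<in> coeffs_in E \<Longrightarrow> f - g \<in> coeffs_in E"
    "f \<in> coeffs_in E \<Longrightarrow> g \<in> coeffs_in E \<Longrightarrow> f \<star> g \<in> coeffs_in E"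
    "f \<in> coeffs_in E \<Longrightarrow> g \<in> coeffs_in E \<Longrightarrow> f * g \<in> coeffs_in E"
    "a \<in> E \<Longrightarrow> f \<in> coeffs_in E \<Longrightarrow> pCons a f \<in> coeffs_in E"
    "a \<in> E \<Longrightarrow> f \<in> coeffs_in E \<Longrightarrow> smult a f \<in> coeffs_in E"
    "a \<in> E \<Longrightarrow> Polynomial.monom a n \<in> coeffs_in E"
    "f \<in> coeffs_in E \<Longrightarrow> f ^ n \<in> coeffs_in E"
proof -
  show 1: "1 \<in> coeffs_in E" "f \<in> coeffs_in E \<Longrightarrow> g \<in> coeffs_in E \<Longrightarrow> f * g \<in> coeffs_in E" for f g
    using assms by (auto simp: coeffs_in_def sfieldD coeff_mult intro!: sfield_sum sfieldD)
  show "f \<in> coeffs_in E \<Longrightarrow> f ^ n \<in> coeffs_in E" by (induction n) (auto simp: 1)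
qed (use assms in \<open>auto simp: coeffs_in_def sfieldD coeff_tmult coeff_mult coeff_pCons sfield_Fn
    intro!: sfield_sum sfieldD split: nat.splits\<close>)

text \<open>Twisting by a power of \<open>F\<close> fixes the leading coefficient 1 of
  \<open>g\<close>. Hence the leading term of \<open>f\<close> is removed by a monomial with that
  same coefficient, and quotient and remainder stay over \<open>E\<close>.\<close>

lemma tmult_division:
  assumes E: "sfield E" and g: "g \<in> coeffs_in E" "lead_coeff g = 1" and f: "f \<in> coeffs_in E"
  shows "\<exists>h\<in>coeffs_in E. \<exists>r\<in>coeffs_in E. f = h \<star> g + r \<and> (r = 0 \<or> degree r < degree g)"
  using f
\<comment> \<open>The measure separates 0 from the nonzero constants, which have the same
  degree.\<close>
proof (induction "if f = 0 then 0 else Suc (degree f)" arbitrary: f rule: less_induct)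
  case less
  show ?case
  proof (cases "f = 0 \<or> degree f < degree g")
    case True
    thus ?thesis using E less.prems by (intro bexI[of _ 0] bexI[of _ f]) (auto simp: coeffs_in_intros)
  next
    case False
    define c where "c = Polynomial.monom (lead_coeff f) (degree f - degree g)"
    have f0: "f \<noteq> 0" and le: "degree g \<le> degree f" using False by auto
    have g0: "g \<noteq> 0" using g by auto
    have c0: "c \<noteq> 0" using f0 by (simp add: c_def)
    have cE: "c \<in> coeffs_in E" using less.prems unfolding c_def coeffs_in_def by (auto simp: sfieldD[OF E])
    have dc: "degree c = degree f - degree g" using f0 by (simp add: c_def degree_monom_eq)
    define f' where "f' = f - c \<star> g"
    have f'E: "f' \<in> coeffs_in E" unfolding f'_def by (intro coeffs_in_intros E less.prems cE g)
    have deg: "degree (c \<star> g) = degree f" using degree_tmult[OF c0 g0] dc le by simp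
    have "lead_coeff (c \<star> g) = lead_coeff f"
      using lead_coeff_tmult[OF c0 g0] g dc by (simp add: Fn_props c_def)
    hence z: "coeff f' (degree f) = 0" unfolding f'_def using deg by simp
    have d: "degree f' \<le> degree f" unfolding f'_def using deg by (intro degree_diff_le) auto
    have "f' = 0 \<or> degree f' < degree f"
      using d z by (metis le_neq_implies_less leading_coeff_0_iff)
    hence "(if f' = 0 then 0 else Suc (degree f')) < (if f = 0 then 0 else Suc (degree f))"
      using f0 by auto
    from less.hyps[OF this f'E] obtain h r where hr: "h \<in> coeffs_in E" "r \<in> coeffs_in E" "f' = h \<star> g + r"
      "r = 0 \<or> degree r < degree g" by blast
    show ?thesis
      by (rule bexI[of _ "h + c"], rule bexI[of _ r])
         (use hr cE E in \<open>auto simp: f'_def tmult_add coeffs_in_intros algebra_simps\<close>)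
  qed
qed

lemma tmult_division_unique:
  assumes "h \<star> g + r = h' \<star> g" "r = 0 \<or> degree r < degree g"
  shows "r = 0" "h \<star> g = h' \<star> g"
proof -
  have eq: "(h' - h) \<star> g = r" using assms(1) by (simp add: tmult_diff) (metis add_diff_cancel_left')
  show "r = 0"
  proof (rule ccontr)
    assume r: "r \<noteq> 0"
    hence "h' - h \<noteq> 0" "g \<noteq> 0" using eq by auto
    from degree_tmult[OF this] eq assms(2) r show False by simp
  qed
  thus "h \<star> g = h' \<star> g" using assms(1) by simp
qed

lemma coeffs_in_UNIV [simp]: "f \<in> coeffs_in UNIV" and sfield_UNIV [simp]: "sfield UNIV"
  by (simp_all add: coeffs_in_def sfield_def)

section \<open>Kernels of twisted polynomials\<close>

abbreviation lin :: "'a \<Rightarrow> 'a poly" where "lin v \<equiv> [:- v, 1:]"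

lemma ev_lin: "ev (lin v) z = F z - v * z"
  by (simp add: ev_pCons)

text \<open>\<open>qpoly f\<close> has degree \<open>q ^ degree f\<close>, which is positive even
  for a constant \<open>f\<close>; subtracting \<open>y\<close> leaves a nonconstant polynomial,
  which has a root.\<close>

lemma ev_surj: assumes "f \<noteq> 0" shows "\<exists>z. ev f z = y"
proof -
  have "degree (qpoly f + [:- y:]) = degree (qpoly f)"
    using assms by (intro degree_add_eq_left) (simp add: degree_qpoly)
  hence "degree (qpoly f + [:- y:]) > 0" using assms by (simp add: degree_qpoly)
  then obtain z where "poly (qpoly f + [:- y:]) z = 0" using alg_closed_imp_poly_has_root by blast
  thus ?thesis by (auto simp: poly_qpoly)
qed

lemma finite_Ker: "f \<noteq> 0 \<Longrightarrow> finite (Ker f)"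
  using poly_roots_finite[of "qpoly f"] qpoly_eq_0 by (auto simp: Ker_def poly_qpoly)

text \<open>The fibres of an additive map are translates of its kernel.\<close>

lemma card_additive:
  fixes h :: "'b::ab_group_add \<Rightarrow> 'c::ab_group_add"
  assumes fin: "finite A" and A: "\<And>a b. a \<in> A \<Longrightarrow> b \<in> A \<Longrightarrow> a - b \<in> A"
    and h: "\<And>a b. a \<in> A \<Longrightarrow> b \<in> A \<Longrightarrow> h (a - b) = h a - h b"
  shows "card A = card (h ` A) * card {a\<in>A. h a = 0}"
proof -
  have "card A = (\<Sum>y\<in>h ` A. card {a\<in>A. h a = y})"
    using sum.image_gen[OF fin, of "\<lambda>_. 1::nat" h] by simp
  also have "\<dots> = (\<Sum>y\<in>h ` A. card {a\<in>A. h a = 0})"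
  proof (rule sum.cong)
    fix y assume "y \<in> h ` A"
    then obtain b where b: "b \<in> A" "y = h b" by auto
    have *: "a + b \<in> A" if "a \<in> A" for a
      using A[OF that A[OF A[OF b(1) b(1)] b(1)]] by simp
    have "h (a + b) = h a + h b" if "a \<in> A" for a
    proof -
      have "h a = h (a + b) - h b" using h[OF *[OF that] b(1)] by (simp only: add_diff_cancel_right')
      thus ?thesis by (simp only: diff_add_cancel)
    qed
    note h' = this
    have "bij_betw (\<lambda>a. a + b) {a\<in>A. h a = 0} {a\<in>A. h a = y}"
    proof (rule bij_betwI[where g = "\<lambda>a. a - b"])
      show "(\<lambda>a. a + b) \<in> {a\<in>A. h a = 0} \<rightarrow> {a\<in>A. h a = y}" using * h' b by simp
      show "(\<lambda>a. a - b) \<in> {a\<in>A. h a = y} \<rightarrow> {a\<in>A. h a = 0}"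
      proof
        fix a assume a: "a \<in> {a\<in>A. h a = y}"
        hence "h (a - b) = h a - h b" using h b by blast
        thus "a - b \<in> {a\<in>A. h a = 0}" using a b A by simp
      qed
    qed simp_all
    from bij_betw_same_card[OF this] show "card {a\<in>A. h a = y} = card {a\<in>A. h a = 0}" by (rule sym)
  qed simp
  finally show ?thesis by simp
qed

lemma Ker_lin: assumes "z \<noteq> 0" "F z = v * z" shows "Ker (lin v) = (\<lambda>c. c * z) ` Fq q"
proof -
  have "y \<in> (\<lambda>c. c * z) ` Fq q" if "F y = v * y" for y
  proof
    show "y = (y / z) * z" using assms by simp
    have "v \<noteq> 0" using assms by auto
    thus "y / z \<in> Fq q" using assms that by (simp add: in_Fq F_divide)
  qed
  thus ?thesis using assms by (auto simp: Ker_def ev_lin in_Fq F_mult)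
qed

lemma Ker_lin_nonzero: assumes "v \<noteq> 0" shows "\<exists>z. z \<noteq> 0 \<and> F z = v * z"
proof -
  obtain z where z: "z ^ (q - 1) = v"
    using nth_root_exists[of "q - 1" v] q_gt1 by auto
  have "F z = z ^ (q - 1) * z" unfolding F_def using power_minus_mult[of q z] by simp
  thus ?thesis using z assms q_gt1 by (intro exI[of _ z]) (auto simp: power_0_left)
qed

lemma card_Fq_span: "(z :: 'a) \<noteq> 0 \<Longrightarrow> card ((\<lambda>c. c * z) ` Fq q) = q"
  by (subst card_image) (auto simp: inj_on_def card_Fq)

lemma card_Ker_lin: "v \<noteq> 0 \<Longrightarrow> card (Ker (lin v)) = q"
  using Ker_lin_nonzero[of v] Ker_lin card_Fq_span by metis

text \<open>By surjectivity \<open>ev g\<close> maps the kernel of the product onto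
  \<open>Ker f\<close>, with fibres of the size of \<open>Ker g\<close>.\<close>

lemma Ker_tmult_card: assumes "f \<noteq> 0" "g \<noteq> 0" shows "card (Ker (f \<star> g)) = card (Ker f) * card (Ker g)"
proof -
  have "card (Ker (f \<star> g)) = card (ev g ` Ker (f \<star> g)) * card {a\<in>Ker (f \<star> g). ev g a = 0}"
    by (rule card_additive) (use assms finite_Ker[of "f \<star> g"] in \<open>simp_all add: ev_arg_diff Ker_def\<close>)
  also have "ev g ` Ker (f \<star> g) = Ker f"
    using ev_surj[OF assms(2)] by (auto simp: Ker_def ev_tmult image_iff) metis
  also have "{a\<in>Ker (f \<star> g). ev g a = 0} = Ker g" by (auto simp: Ker_def ev_tmult)
  finally show ?thesis .
qed

lemma Ker_eq_imp: assumes "Ker (lin v) = Ker (lin w)" "v \<noteq> 0" shows "v = w"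
proof -
  obtain z where z: "z \<noteq> 0" "F z = v * z" using Ker_lin_nonzero assms by blast
  hence "z \<in> Ker (lin v)" by (auto simp: Ker_def ev_lin)
  hence "z \<in> Ker (lin w)" using assms(1) by blast
  hence "F z = w * z" by (simp add: Ker_def ev_lin)
  thus ?thesis using z by simp
qed

end

section \<open>Translation between the type class field and HOL-Algebra\<close>

lemma ambient_simps [simp]:
  "carrier (ambient :: 'a::field ring) = UNIV" "monoid.mult (ambient :: 'a ring) = (*)"
  "monoid.one (ambient :: 'a ring) = 1" "ring.zero (ambient :: 'a ring) = 0"
  "ring.add (ambient :: 'a ring) = (+)"
  by (simp_all add: ring_of_type_algebra_def)

lemma ambient_minus [simp]: "a_inv (ambient :: 'a::field ring) x = - x"
proof -
  interpret R: field "ambient :: 'a ring" by (rule field_from_type_algebra)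
  show ?thesis using R.minus_equality[of "-x" x] by simp
qed

lemma ambient_inv: "x \<noteq> 0 \<Longrightarrow> m_inv (ambient :: 'a::field ring) x = inverse x"
proof -
  interpret R: field "ambient :: 'a ring" by (rule field_from_type_algebra)
  show "x \<noteq> 0 \<Longrightarrow> ?thesis" using R.inv_char[of x "inverse x"] by simp
qed

lemma ambient_pow [simp]: "x [^]\<^bsub>(ambient :: 'a::field ring)\<^esub> (n::nat) = x ^ n"
proof -
  interpret R: field "ambient :: 'a ring" by (rule field_from_type_algebra)
  show ?thesis by (induction n) (auto simp: mult.commute)
qed

text \<open>Coefficient lists in HOL-Algebra start with the leading coefficient, hence the
  \<open>rev\<close>.\<close>

lemma ambient_eval: "ring.eval (ambient :: 'a::field ring) l x = poly (Poly (rev l)) x"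
proof -
  interpret R: field "ambient :: 'a ring" by (rule field_from_type_algebra)
  show ?thesis
    by (induction l) (auto simp: Poly_snoc poly_monom)
qed

context setting
begin

lemma sfield_generate: "sfield (generate_field ambient S)"
proof -
  interpret R: field "ambient :: 'a ring" by (rule field_from_type_algebra)
  show ?thesis unfolding sfield_def
  proof safe
    fix a b assume ab: "a \<in> generate_field ambient S" "b \<in> generate_field ambient S"
    show "a + b \<in> generate_field ambient S" using generate_field.eng_add[OF ab] by simp
    show "a * b \<in> generate_field ambient S" using generate_field.eng_mult[OF ab] by simp
    show "- a \<in> generate_field ambient S" using generate_field.a_inv[OF ab(1)] by simp
    show "inverse a \<in> generate_field ambient S"
      using generate_field.m_inv[OF ab(1)] R.zero_in_generate[of S] by (cases "a = 0") (simp_all add: ambient_inv)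
  next
    show "1 \<in> generate_field ambient S" using generate_field.one[of ambient S] by simp
  qed
qed

lemma generate_field_least: assumes "sfield E" "S \<subseteq> E" shows "generate_field ambient S \<subseteq> E"
proof
  fix x assume "x \<in> generate_field ambient S"
  thus "x \<in> E"
  proof (induction rule: generate_field.induct)
    case (m_inv h) thus ?case using assms by (simp add: ambient_inv sfieldD)
  qed (use assms in \<open>auto simp: sfieldD\<close>)
qed

lemma generate_field_superset: "S \<subseteq> generate_field ambient S"
  by (auto intro: generate_field.incl)

lemma sfield_Fq: "sfield (Fq q)"
  unfolding sfield_def by (auto simp: in_Fq F_simps)

lemma sfield_subfield: assumes "sfield E" shows "subfield E ambient"
proof -
  interpret R: field "ambient :: 'a ring" by (rule field_from_type_algebra)
  show ?thesis
    by (rule R.subfieldI', rule R.subringI) (use assms in \<open>auto simp: sfieldD ambient_inv\<close>)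
qed

lemma transcendental_iff:
  assumes E: "sfield E"
  shows "ring.transcendental ambient E x \<longleftrightarrow> (\<forall>p\<in>coeffs_in E. poly p x = 0 \<longrightarrow> p = 0)"
proof
  interpret R: field "ambient :: 'a ring" by (rule field_from_type_algebra)
  assume tr: "R.transcendental E x"
  show "\<forall>p\<in>coeffs_in E. poly p x = 0 \<longrightarrow> p = 0"
  proof (intro ballI impI, rule ccontr)
    fix p assume p: "p \<in> coeffs_in E" "poly p x = 0" "p \<noteq> 0"
    let ?l = "rev (coeffs p)"
    have "?l \<noteq> []" using p by simp
    have "last (coeffs p) \<noteq> 0" using p by (simp add: last_coeffs_eq_coeff_degree)
    hence pol: "polynomial\<^bsub>ambient\<^esub> E ?l" unfolding polynomial_def
      using p by (auto simp: coeffs_in_def coeffs_def hd_rev)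
    moreover have "polynomial\<^bsub>ambient\<^esub> E []" by (simp add: polynomial_def)
    moreover have "R.eval ?l x = R.eval [] x" using p by (simp add: ambient_eval)
    ultimately have "?l = []" using tr unfolding R.transcendental_def inj_on_def univ_poly_def
      by (metis (no_types, lifting) mem_Collect_eq partial_object.select_convs(1))
    thus False using \<open>?l \<noteq> []\<close> by simp
  qed
next
  interpret R: field "ambient :: 'a ring" by (rule field_from_type_algebra)
  assume *: "\<forall>p\<in>coeffs_in E. poly p x = 0 \<longrightarrow> p = 0"
  show "R.transcendental E x"
  proof (rule ccontr)
    assume "R.algebraic E x"
    then obtain p where p: "p \<in> carrier (univ_poly ambient E)" "p \<noteq> []" "R.eval p x = 0"
      using R.algebraicE[OF subfieldE(1)[OF sfield_subfield[OF E]], of x] by (auto simp: over_def)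
    hence pol: "set p \<subseteq> E" "hd p \<noteq> 0" by (auto simp: univ_poly_def polynomial_def)
    have "Poly (rev p) \<in> coeffs_in E"
      using pol E by (auto simp: coeffs_in_def nth_default_def sfieldD simp: subset_iff) (metis length_rev nth_mem set_rev)
    hence "Poly (rev p) = 0" using * p by (simp add: ambient_eval)
    hence "coeff (Poly (rev p)) (length p - 1) = 0" by simp
    thus False using p(2) pol(2) by (simp add: nth_default_def rev_nth hd_conv_nth)
  qed
qed

lemma coeffs_in_pCons: "pCons a f \<in> coeffs_in E \<longleftrightarrow> a \<in> E \<and> f \<in> coeffs_in E"
proof
  assume *: "pCons a f \<in> coeffs_in E"
  have "coeff (pCons a f) 0 \<in> E" "\<And>i. coeff (pCons a f) (Suc i) \<in> E" using * unfolding coeffs_in_def by blast+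
  thus "a \<in> E \<and> f \<in> coeffs_in E" by (simp add: coeffs_in_def)
qed (auto simp: coeffs_in_def coeff_pCons split: nat.splits)

lemma transc_poly: "p \<in> coeffs_in (Fq q) \<Longrightarrow> poly p t = 0 \<Longrightarrow> p = 0"
  using transc transcendental_iff[OF sfield_Fq] by blast

text \<open>The two conjugates of \<open>\<zeta>\<close>; everything but the type of a module is symmetric in them.\<close>

definition conj :: "'a \<Rightarrow> bool" where "conj Z \<longleftrightarrow> Z = \<zeta> \<or> Z = F \<zeta>"

definition tr :: 'a where "tr = \<zeta> + F \<zeta>"
definition nm :: 'a where "nm = \<zeta> * F \<zeta>"

lemma F_F_zeta [simp]: "F (F \<zeta>) = \<zeta>"
  using zeta_q2 by (simp add: F_def power2_eq_square flip: power_mult)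

lemma zeta_neq: "F \<zeta> \<noteq> \<zeta>"
  using zeta_notin by (simp add: in_Fq)

lemma tr_Fq: "tr \<in> Fq q" and nm_Fq: "nm \<in> Fq q"
  by (auto simp: in_Fq tr_def nm_def F_add F_mult)

lemma conj_zeta [simp]: "conj \<zeta>" and conj_F: "conj Z \<Longrightarrow> conj (F Z)"
  by (auto simp: conj_def)

lemma conj_props: assumes "conj Z"
  shows "F (F Z) = Z" "F Z \<noteq> Z" "Z + F Z = tr" "Z * F Z = nm" "Z \<noteq> 0"
  using assms zeta_neq by (auto simp: conj_def tr_def nm_def)

text \<open>The minimal polynomial of \<open>\<zeta>\<close> over \<open>F_q\<close>; its value at
  \<open>t\<close> is \<open>\<rho>\<close>.\<close>

definition rp :: "'a poly" where "rp = [:nm, - tr, 1:]"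

lemma rp_in: "rp \<in> coeffs_in (Fq q)"
  unfolding rp_def by (intro coeffs_in_intros sfieldD(5) sfield_Fq nm_Fq tr_Fq sfieldD(1))

lemma poly_rp: "conj Z \<Longrightarrow> poly rp u = (u - Z) * (u - F Z)"
  using conj_props[of Z] by (simp add: rp_def algebra_simps flip: conj_props(3,4)[of Z])

lemma rp_root: "poly rp u = 0 \<longleftrightarrow> conj u"
  using poly_rp[OF conj_zeta] by (auto simp: conj_def)

lemma degree_rp [simp]: "degree rp = 2" and lead_rp [simp]: "lead_coeff rp = 1" and rp_neq_0 [simp]: "rp \<noteq> 0"
  by (simp_all add: rp_def)

abbreviation "\<rho> \<equiv> rho q \<zeta> t"
abbreviation "x \<equiv> xA q \<zeta> t"
abbreviation "y \<equiv> yA q \<zeta> t"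

lemma rho_eq: "\<rho> = poly rp t" "conj Z \<Longrightarrow> \<rho> = (t - Z) * (t - F Z)"
proof -
  show "\<rho> = poly rp t" using poly_rp[OF conj_zeta, of t] by (simp add: rho_def F_def)
  thus "conj Z \<Longrightarrow> \<rho> = (t - Z) * (t - F Z)" using poly_rp by simp
qed

lemma rho_neq_0 [simp]: "\<rho> \<noteq> 0"
  using transc_poly[OF rp_in] by (auto simp: rho_eq)

lemma xy_eq: "x = 1 / \<rho>" "y = t / \<rho>" "y = t * x"
  by (simp_all add: xA_def yA_def)

lemma x_neq_0 [simp]: "x \<noteq> 0" by (simp add: xy_eq)

lemma xy_relation: "y * y - tr * x * y + nm * x * x = x"
proof -
  have "\<rho> = nm - tr * t + t * t" by (simp add: rho_eq(1) rp_def algebra_simps)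
  moreover have "y * y - tr * x * y + nm * x * x = (nm - tr * t + t * t) * x * x"
    by (simp add: xy_eq(3) algebra_simps)
  ultimately have "y * y - tr * x * y + nm * x * x = \<rho> * x * x" by simp
  thus ?thesis by (simp add: xy_eq(1))
qed

lemma t_not_conj: assumes "conj Z" shows "t \<noteq> Z"
  using rho_neq_0 rho_eq(2)[OF assms] by auto

lemma t_notin_Fq: "t \<notin> Fq q"
proof
  assume "t \<in> Fq q"
  hence "[:- t, 1:] = (0 :: 'a poly)"
    by (intro transc_poly coeffs_in_intros sfield_Fq sfieldD) simp_all
  thus False by simp
qed

lemma F_poly: "h \<in> coeffs_in (Fq q) \<Longrightarrow> F (poly h u) = poly h (F u)"
  by (simp add: poly_altdef F_sum F_mult F_power coeffs_in_def in_Fq)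

text \<open>Horner's scheme: after prepending a coefficient, the quadratic term of the shifted
  remainder is traded for a multiple of \<open>rp\<close>. Coefficients visibly stay in
  \<open>F_q\<close>.\<close>

lemma rp_division:
  assumes "h \<in> coeffs_in (Fq q)"
  shows "\<exists>g\<in>coeffs_in (Fq q). \<exists>\<alpha>\<in>Fq q. \<exists>\<beta>\<in>Fq q. h = rp * g + [:\<alpha>, \<beta>:]"
  using assms
proof (induction h)
  case 0
  show ?case by (intro bexI[of _ 0]) (auto intro: coeffs_in_intros sfield_Fq sfieldD)
next
  case (pCons a h)
  have a: "a \<in> Fq q" and h: "h \<in> coeffs_in (Fq q)"
    using pCons.prems by (auto simp: coeffs_in_pCons)
  from pCons.IH[OF h] obtain g \<alpha> \<beta> where *: "g \<in> coeffs_in (Fq q)" "\<alpha> \<in> Fq q" "\<beta> \<in> Fq q"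
    "h = rp * g + [:\<alpha>, \<beta>:]" by blast
  have "pCons a h = rp * pCons \<beta> g + [:a - \<beta> * nm, \<alpha> + \<beta> * tr:]"
    by (simp add: * rp_def algebra_simps)
  thus ?case using * a tr_Fq nm_Fq
    by (intro bexI[of _ "pCons \<beta> g"] bexI[of _ "a - \<beta> * nm"] bexI[of _ "\<alpha> + \<beta> * tr"])
       (auto intro!: coeffs_in_intros sfield_Fq sfieldD)
qed

text \<open>Apply \<open>F\<close> to the relation and subtract:
  \<open>\<beta> (F Z - Z) = 0\<close>.\<close>

lemma lin_indep_zeta:
  assumes "conj Z" "\<alpha> \<in> Fq q" "\<beta> \<in> Fq q" "\<alpha> + \<beta> * Z = 0" shows "\<alpha> = 0 \<and> \<beta> = 0"
proof -
  have "\<alpha> + \<beta> * F Z = F (\<alpha> + \<beta> * Z)" using assms(2,3) by (simp add: F_simps in_Fq)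
  also have "\<dots> = 0" unfolding assms(4) by simp
  finally have "(\<alpha> + \<beta> * F Z) - (\<alpha> + \<beta> * Z) = 0" using assms(4) by (simp only: diff_self)
  hence "\<beta> * (F Z - Z) = 0" by (simp add: algebra_simps)
  thus ?thesis using conj_props(2)[OF assms(1)] assms(4) by auto
qed

lemma rp_dvd:
  assumes h: "h \<in> coeffs_in (Fq q)" and Z: "conj Z" "poly h Z = 0"
  shows "\<exists>g\<in>coeffs_in (Fq q). h = rp * g"
proof -
  obtain g \<alpha> \<beta> where *: "g \<in> coeffs_in (Fq q)" "\<alpha> \<in> Fq q" "\<beta> \<in> Fq q" "h = rp * g + [:\<alpha>, \<beta>:]"
    using rp_division[OF h] by blast
  have "\<alpha> + \<beta> * Z = 0" using Z * rp_root[of Z] by (simp add: algebra_simps)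
  hence "\<alpha> = 0 \<and> \<beta> = 0" using lin_indep_zeta Z * by blast
  thus ?thesis using * by auto
qed

text \<open>Having coefficients in \<open>F_q\<close> means being fixed by \<open>Fp\<close>, which
  is multiplicative for ordinary polynomials; so \<open>g * Fp h = g * h\<close> and
  \<open>g\<close> cancels.\<close>

lemma coeffs_in_quotient:
  assumes "g \<in> coeffs_in (Fq q)" "g * h \<in> coeffs_in (Fq q)" "g \<noteq> 0" shows "h \<in> coeffs_in (Fq q)"
proof -
  have Fp: "Fp f = f \<longleftrightarrow> f \<in> coeffs_in (Fq q)" for f
    by (simp add: coeffs_in_def in_Fq poly_eq_iff)
  have "Fp (g * h) = Fp g * Fp h"
    by (rule poly_eqI) (simp add: coeff_mult F_sum F_mult)
  moreover have "Fp (g * h) = g * h" by (rule Fp[THEN iffD2, OF assms(2)])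
  moreover have "Fp g = g" by (rule Fp[THEN iffD2, OF assms(1)])
  ultimately have "g * Fp h = g * h" by metis
  hence "Fp h = h" using assms(3) by (metis mult_cancel_left)
  thus ?thesis by (rule Fp[THEN iffD1])
qed

lemma Kfield_eq: "Kfield q t =
  {poly f t / poly g t | f g. f \<in> coeffs_in (Fq q) \<and> g \<in> coeffs_in (Fq q) \<and> g \<noteq> 0}" (is "_ = ?K")
proof
  have nz: "poly g t \<noteq> 0" if "g \<in> coeffs_in (Fq q)" "g \<noteq> 0" for g
    using transc_poly that by blast
  have KI: "poly f t / poly g t \<in> ?K" if "f \<in> coeffs_in (Fq q)" "g \<in> coeffs_in (Fq q)" "g \<noteq> 0" for f g
    using that by blast
  have sf: "sfield ?K" unfolding sfield_def
  proof (intro conjI ballI)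
    show "1 \<in> ?K" using KI[of 1 1] by (simp add: coeffs_in_intros sfield_Fq)
    fix a b assume "a \<in> ?K" "b \<in> ?K"
    then obtain f g f' g' where *: "a = poly f t / poly g t" "b = poly f' t / poly g' t"
      "f \<in> coeffs_in (Fq q)" "g \<in> coeffs_in (Fq q)" "g \<noteq> 0"
      "f' \<in> coeffs_in (Fq q)" "g' \<in> coeffs_in (Fq q)" "g' \<noteq> 0" by blast
    note [simp] = nz[OF *(4,5)] nz[OF *(7,8)]
    have "a + b = poly (f * g' + f' * g) t / poly (g * g') t" by (simp add: * field_simps)
    also have "\<dots> \<in> ?K" by (intro KI coeffs_in_intros sfield_Fq *) (use * in simp)
    finally show "a + b \<in> ?K" .
    have "a * b = poly (f * f') t / poly (g * g') t" by (simp add: *)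
    also have "\<dots> \<in> ?K" by (intro KI coeffs_in_intros sfield_Fq *) (use * in simp)
    finally show "a * b \<in> ?K" .
    have "- a = poly (0 - f) t / poly g t" by (simp add: *)
    also have "\<dots> \<in> ?K" by (intro KI coeffs_in_intros sfield_Fq *)
    finally show "- a \<in> ?K" .
    show "inverse a \<in> ?K"
    proof (cases "f = 0")
      case True thus ?thesis using KI[of 0 1] by (simp add: * coeffs_in_intros sfield_Fq)
    next
      case False thus ?thesis using KI[of g f] * by simp
    qed
  qed
  have "Fq q \<subseteq> ?K"
  proof
    fix c :: 'a assume "c \<in> Fq q"
    thus "c \<in> ?K" by (intro CollectI exI[of _ "[:c:]"] exI[of _ 1]) (auto intro!: coeffs_in_intros sfield_Fq)
  qed
  moreover have "t \<in> ?K"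
    by (intro CollectI exI[of _ "[:0,1:]"] exI[of _ 1]) (auto intro!: coeffs_in_intros sfield_Fq sfieldD)
  ultimately show "Kfield q t \<subseteq> ?K" unfolding Kfield_def using generate_field_least[OF sf] by auto
  have "poly f t \<in> Kfield q t" if "f \<in> coeffs_in (Fq q)" for f
  proof -
    have sK: "sfield (Kfield q t)" unfolding Kfield_def by (rule sfield_generate)
    have "Fq q \<subseteq> Kfield q t" "t \<in> Kfield q t"
      using generate_field_superset[of "Fq q \<union> {t}"] unfolding Kfield_def by auto
    thus ?thesis using that unfolding poly_altdef coeffs_in_def
      by (auto intro!: sfield_sum sK sfieldD(4)[OF sK] sfield_power)
  qed
  thus "?K \<subseteq> Kfield q t"
    using sfieldD(8)[OF sfield_generate[of "Fq q \<union> {t}"]] unfolding Kfield_def by blast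
qed

subsection \<open>The ring of functions regular away from \<open>P\<^sub>\<rho>\<close>\<close>

text \<open>\<open>Ipow k\<close> consists of the functions of pole order at most \<open>n\<close> at \<open>P\<^sub>\<rho>\<close>, for some \<open>n\<close>, that
  vanish to order at least \<open>k\<close> at \<open>t = \<infinity>\<close>.\<close>

definition Ipow :: "nat \<Rightarrow> 'a set" where
  "Ipow k = {poly h t / \<rho> ^ n | h n. h \<in> coeffs_in (Fq q) \<and> (h = 0 \<or> degree h + k \<le> 2 * n)}"

lemma IpowI: "h \<in> coeffs_in (Fq q) \<Longrightarrow> h = 0 \<or> degree h + k \<le> 2 * n \<Longrightarrow> poly h t / \<rho> ^ n \<in> Ipow k"
  unfolding Ipow_def by blast

text \<open>Expanding a fraction by \<open>\<rho>\<close> raises both sides of the degree condition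
  by 2, so the exponent of the denominator may be taken as large as desired; \<open>IpowE'\<close>
  uses this for a common denominator.\<close>

lemma IpowE: assumes "a \<in> Ipow k"
  obtains h n where "h \<in> coeffs_in (Fq q)" "h = 0 \<or> degree h + k \<le> 2 * n" "a = poly h t / \<rho> ^ n" "n \<ge> n0"
proof -
  from assms obtain h n where h: "h \<in> coeffs_in (Fq q)" "h = 0 \<or> degree h + k \<le> 2 * n" "a = poly h t / \<rho> ^ n"
    unfolding Ipow_def by blast
  have "degree (h * rp ^ n0) = degree h + 2 * n0" if "h \<noteq> 0"
    using that by (simp add: degree_mult_eq degree_power_eq)
  hence "h * rp ^ n0 = 0 \<or> degree (h * rp ^ n0) + k \<le> 2 * (n + n0)"
    using h by (cases "h = 0") auto
  moreover have "a = poly (h * rp ^ n0) t / \<rho> ^ (n + n0)"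
    using rho_neq_0 by (simp add: h rho_eq(1)[symmetric] power_add)
  moreover have "h * rp ^ n0 \<in> coeffs_in (Fq q)" by (intro coeffs_in_intros sfield_Fq rp_in h)
  ultimately show ?thesis using that[of "h * rp ^ n0" "n + n0"] by simp
qed

lemma IpowE': assumes "a \<in> Ipow k" "b \<in> Ipow l"
  obtains h g n where "h \<in> coeffs_in (Fq q)" "h = 0 \<or> degree h + k \<le> 2 * n" "a = poly h t / \<rho> ^ n" "n \<ge> n0"
    "g \<in> coeffs_in (Fq q)" "g = 0 \<or> degree g + l \<le> 2 * n" "b = poly g t / \<rho> ^ n"
proof -
  obtain h n where h: "h \<in> coeffs_in (Fq q)" "h = 0 \<or> degree h + k \<le> 2 * n" "a = poly h t / \<rho> ^ n" "n \<ge> n0"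
    by (rule IpowE[OF assms(1)])
  obtain g m where g: "g \<in> coeffs_in (Fq q)" "g = 0 \<or> degree g + l \<le> 2 * m" "b = poly g t / \<rho> ^ m" "m \<ge> n"
    by (rule IpowE[OF assms(2)])
  have "degree (h * rp ^ (m - n)) = degree h + 2 * (m - n)" if "h \<noteq> 0"
    using that by (simp add: degree_mult_eq degree_power_eq)
  hence "h * rp ^ (m - n) = 0 \<or> degree (h * rp ^ (m - n)) + k \<le> 2 * m"
    using h g by (cases "h = 0") auto
  moreover have "\<rho> ^ m = \<rho> ^ n * \<rho> ^ (m - n)" using g by (simp flip: power_add)
  hence "a = poly (h * rp ^ (m - n)) t / \<rho> ^ m"
    using rho_neq_0 by (simp add: h rho_eq(1)[symmetric])
  moreover have "h * rp ^ (m - n) \<in> coeffs_in (Fq q)" by (intro coeffs_in_intros sfield_Fq rp_in h)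
  ultimately show ?thesis using that[of "h * rp ^ (m - n)" m g] g h by simp
qed

lemma Ipow_add: assumes "a \<in> Ipow k" "b \<in> Ipow k" shows "a + b \<in> Ipow k"
proof -
  obtain h g n where *: "h \<in> coeffs_in (Fq q)" "h = 0 \<or> degree h + k \<le> 2 * n" "a = poly h t / \<rho> ^ n" "n \<ge> 0"
    "g \<in> coeffs_in (Fq q)" "g = 0 \<or> degree g + k \<le> 2 * n" "b = poly g t / \<rho> ^ n"
    by (rule IpowE'[OF assms])
  have "h + g = 0 \<or> degree (h + g) + k \<le> 2 * n"
    using degree_add_le_max[of h g] * by (cases "h = 0"; cases "g = 0") auto
  hence "poly (h + g) t / \<rho> ^ n \<in> Ipow k" by (intro IpowI coeffs_in_intros sfield_Fq *)
  thus ?thesis by (simp add: * add_divide_distrib)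
qed

lemma Ipow_mult: assumes "a \<in> Ipow k" "b \<in> Ipow l" shows "a * b \<in> Ipow (k + l)"
proof -
  obtain h g n where *: "h \<in> coeffs_in (Fq q)" "h = 0 \<or> degree h + k \<le> 2 * n" "a = poly h t / \<rho> ^ n" "n \<ge> 0"
    "g \<in> coeffs_in (Fq q)" "g = 0 \<or> degree g + l \<le> 2 * n" "b = poly g t / \<rho> ^ n"
    by (rule IpowE'[OF assms])
  have "h * g = 0 \<or> degree (h * g) + (k + l) \<le> 2 * (n + n)"
    using *(2,6) degree_mult_le[of h g] by auto
  hence "poly (h * g) t / \<rho> ^ (n + n) \<in> Ipow (k + l)"
    by (intro IpowI coeffs_in_intros sfield_Fq *)
  thus ?thesis by (simp add: *(3,7) power_add)
qed

lemma Ipow_mono: "k \<le> l \<Longrightarrow> Ipow l \<subseteq> Ipow k"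
proof
  fix a assume "k \<le> l" "a \<in> Ipow l"
  from this(2) obtain h n where "h \<in> coeffs_in (Fq q)" "h = 0 \<or> degree h + l \<le> 2 * n" "a = poly h t / \<rho> ^ n"
    by (rule IpowE)
  thus "a \<in> Ipow k" using IpowI[of h k n] \<open>k \<le> l\<close> by auto
qed

lemma Fq_Ipow: "c \<in> Fq q \<Longrightarrow> c \<in> Ipow 0"
  using IpowI[of "[:c:]" 0 0] by (simp add: coeffs_in_intros sfield_Fq)

lemma zero_Ipow [simp]: "0 \<in> Ipow k"
  using IpowI[of 0 k 0] by (simp add: coeffs_in_intros sfield_Fq)

lemma Ipow_absorb: "a \<in> Ipow 0 \<Longrightarrow> b \<in> Ipow k \<Longrightarrow> a * b \<in> Ipow k"
  using Ipow_mult[of a 0 b k] by simp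

lemma Ipow_minus: "a \<in> Ipow k \<Longrightarrow> - a \<in> Ipow k"
  using Ipow_absorb[OF Fq_Ipow[of "-1"], of a k] sfieldD(1,5)[OF sfield_Fq] by simp

lemma Ipow_diff: "a \<in> Ipow k \<Longrightarrow> b \<in> Ipow k \<Longrightarrow> a - b \<in> Ipow k"
  using Ipow_add[of a k "- b"] Ipow_minus by simp

lemma x_Ipow: "x \<in> Ipow 2" and y_Ipow: "y \<in> Ipow 1"
  using IpowI[of 1 2 1] IpowI[of "[:0,1:]" 1 1]
  by (simp_all add: xy_eq coeffs_in_intros sfield_Fq sfieldD[OF sfield_Fq])

lemma poly_Ipow: "f \<in> coeffs_in (Fq q) \<Longrightarrow> u \<in> Ipow 0 \<Longrightarrow> poly f u \<in> Ipow 0"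
proof (induction f)
  case (pCons a f)
  have "a \<in> Fq q" "f \<in> coeffs_in (Fq q)"
    using pCons.prems by (auto simp: coeffs_in_pCons)
  thus ?case using pCons by (simp add: Ipow_add Fq_Ipow Ipow_absorb)
qed simp

text \<open>Divide the numerator by \<open>rp\<close>: the quotient has a denominator exponent one
  smaller, and the remainder \<open>\<alpha> + \<beta> t\<close> over \<open>\<rho> ^ Suc n\<close>
  is \<open>\<alpha> x ^ Suc n + \<beta> x ^ n y\<close>.\<close>

lemma Ipow_rep:
  assumes "a \<in> Ipow 0"
  shows "\<exists>P\<in>coeffs_in (Fq q). \<exists>Q\<in>coeffs_in (Fq q). a = poly P x + poly Q x * y"
proof -
  have "\<exists>P\<in>coeffs_in (Fq q). \<exists>Q\<in>coeffs_in (Fq q). poly h t / \<rho> ^ n = poly P x + poly Q x * y"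
    if "h \<in> coeffs_in (Fq q)" "h = 0 \<or> degree h \<le> 2 * n" for h n
    using that
  proof (induction n arbitrary: h)
    case 0
    then obtain c where c: "h = [:c:]" by (metis degree_0 degree_eq_zeroE le_zero_eq mult_0_right)
    show ?case by (intro bexI[of _ h] bexI[of _ 0]) (use 0 c in \<open>auto intro: coeffs_in_intros sfield_Fq\<close>)
  next
    case (Suc n)
    obtain g \<alpha> \<beta> where *: "g \<in> coeffs_in (Fq q)" "\<alpha> \<in> Fq q" "\<beta> \<in> Fq q" "h = rp * g + [:\<alpha>, \<beta>:]"
      using rp_division[OF Suc.prems(1)] by blast
    have "degree g \<le> 2 * n" if "g \<noteq> 0"
    proof -
      have "degree (rp * g) = 2 + degree g" using that by (simp add: degree_mult_eq)
      moreover have "degree [:\<alpha>, \<beta>:] < 2" by (simp add: degree_pCons_eq_if)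
      ultimately have "degree h = 2 + degree g" using * by (simp add: degree_add_eq_left)
      thus ?thesis using Suc.prems(2) by auto
    qed
    then obtain P Q where PQ: "P \<in> coeffs_in (Fq q)" "Q \<in> coeffs_in (Fq q)" "poly g t / \<rho> ^ n = poly P x + poly Q x * y"
      using Suc.IH[OF *(1)] by auto
    have "poly h t / \<rho> ^ Suc n = poly g t / \<rho> ^ n + \<alpha> * x ^ Suc n + \<beta> * x ^ n * y"
      using rho_neq_0 by (simp add: * rho_eq(1)[symmetric] xy_eq(1,2) field_simps)
    also have "\<dots> = poly (P + Polynomial.monom \<alpha> (Suc n)) x + poly (Q + Polynomial.monom \<beta> n) x * y"
      by (simp add: PQ poly_monom algebra_simps)
    finally show ?case using PQ *
      by (intro bexI[of _ "P + Polynomial.monom \<alpha> (Suc n)"] bexI[of _ "Q + Polynomial.monom \<beta> n"])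
         (auto intro!: coeffs_in_intros sfield_Fq)
  qed
  thus ?thesis using assms unfolding Ipow_def by auto
qed

text \<open>A nonzero \<open>P(x) + Q(x) y\<close> has pole order exactly \<open>max (deg P) (deg Q + 1)\<close> at \<open>P\<^sub>\<rho>\<close>, because
  \<open>1, \<zeta>\<close> are independent over \<open>\<F>\<^sub>q\<close>.\<close>

definition pole_order :: "'a poly \<Rightarrow> 'a poly \<Rightarrow> nat" where
  "pole_order P Q = max (degree P) (if Q = 0 then 0 else Suc (degree Q))"

lemma rep_pole:
  assumes P: "P \<in> coeffs_in (Fq q)" and Q: "Q \<in> coeffs_in (Fq q)" and nz: "P \<noteq> 0 \<or> Q \<noteq> 0"
  shows "\<exists>h\<in>coeffs_in (Fq q). degree h \<le> 2 * pole_order P Q \<and> poly h \<zeta> \<noteq> 0 \<and>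
    poly P x + poly Q x * y = poly h t / \<rho> ^ pole_order P Q"
proof -
  define n where "n = pole_order P Q"
  \<comment> \<open>The numerator over the common denominator \<open>\<rho> ^ n\<close>; a factor
    \<open>y\<close> uses up one \<open>\<rho>\<close>, hence \<open>n - 1 - i\<close>. At
    \<open>\<zeta>\<close> all positive powers of \<open>rp\<close> vanish and
    \<open>coeff P n + coeff Q (n - 1) \<zeta>\<close> remains.\<close>
  define h where "h = (\<Sum>i\<le>n. smult (coeff P i) (rp ^ (n - i))) + (\<Sum>i<n. smult (coeff Q i) ([:0,1:] * rp ^ (n - 1 - i)))"
  have PQ: "coeff P i \<in> Fq q" "coeff Q i \<in> Fq q" for i using P Q by (auto simp: coeffs_in_def)
  have sum_in: "sum f A \<in> coeffs_in (Fq q)" if "\<And>i. i \<in> A \<Longrightarrow> f i \<in> coeffs_in (Fq q)" for f and A :: "nat set"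
    using that by (induction A rule: infinite_finite_induct) (auto intro: coeffs_in_intros sfield_Fq)
  have X: "[:0,1:] \<in> coeffs_in (Fq q)" by (intro coeffs_in_intros sfield_Fq sfieldD)
  have "h \<in> coeffs_in (Fq q)" unfolding h_def
    by (intro coeffs_in_intros(3) sum_in) (intro coeffs_in_intros(6,8,10) sfield_Fq PQ rp_in X)+
  moreover have "degree h \<le> 2 * n" unfolding h_def
  proof (intro degree_add_le degree_sum_le)
    fix i assume "i \<in> {..<n}"
    hence "degree ([:0, 1:] * rp ^ (n - 1 - i)) \<le> 2 * n"
      by (simp add: degree_mult_eq degree_power_eq)
    thus "degree (smult (coeff Q i) ([:0, 1:] * rp ^ (n - 1 - i))) \<le> 2 * n"
      using degree_smult_le order.trans by blast
  qed (auto intro!: order.trans[OF degree_smult_le] simp: degree_power_eq)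
  moreover have "poly h \<zeta> \<noteq> 0"
  proof
    have z: "poly rp \<zeta> = 0" by (simp add: rp_root)
    assume 0: "poly h \<zeta> = 0"
    have "(\<Sum>i\<le>n. coeff P i * poly rp \<zeta> ^ (n - i)) = (\<Sum>i\<in>{n}. coeff P i * poly rp \<zeta> ^ (n - i))"
      by (rule sum.mono_neutral_right) (auto simp: z)
    moreover have "(\<Sum>i<n. \<zeta> * (coeff Q i * poly rp \<zeta> ^ (n - Suc i))) =
      (\<Sum>i\<in>{..<n} \<inter> {n - 1}. \<zeta> * (coeff Q i * poly rp \<zeta> ^ (n - Suc i)))"
      by (rule sum.mono_neutral_right) (auto simp: z)
    moreover have "{..<n} \<inter> {n - 1} = (if n = 0 then {} else {n - 1})" by auto
    ultimately have "coeff P n + (if n = 0 then 0 else coeff Q (n - 1)) * \<zeta> = 0"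
      using 0 unfolding h_def by (auto simp: poly_sum mult.commute split: if_splits)
    hence 1: "coeff P n = 0 \<and> (if n = 0 then 0 else coeff Q (n - 1)) = 0"
      using lin_indep_zeta[OF conj_zeta PQ(1), of "if n = 0 then 0 else coeff Q (n - 1)"] PQ(2) sfieldD(2)[OF sfield_Fq] by auto
    show False
    proof (cases "Q \<noteq> 0 \<and> Suc (degree Q) = n")
      case True thus False using 1 by auto
    next
      case False
      hence "degree P = n" using n_def by (auto simp: pole_order_def max_def split: if_splits)
      moreover have "P \<noteq> 0" using nz False calculation n_def unfolding pole_order_def by fastforce
      ultimately show False using 1 by auto
    qed
  qed
  moreover have "poly P x + poly Q x * y = poly h t / \<rho> ^ n"
  proof -
    have "poly P x = (\<Sum>i\<le>n. coeff P i * x ^ i)"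
      unfolding poly_altdef by (rule sum.mono_neutral_left) (auto simp: n_def pole_order_def coeff_eq_0)
    also have "\<dots> = (\<Sum>i\<le>n. coeff P i * \<rho> ^ (n - i) / \<rho> ^ n)"
      by (rule sum.cong) (auto simp: xy_eq(1) power_diff field_simps)
    finally have 1: "poly P x = (\<Sum>i\<le>n. coeff P i * \<rho> ^ (n - i)) / \<rho> ^ n" by (simp add: sum_divide_distrib)
    have "poly Q x * y = (\<Sum>i<n. coeff Q i * x ^ i) * y"
    proof (cases "Q = 0")
      case False
      hence "degree Q < n" by (auto simp: n_def pole_order_def)
      hence "poly Q x = (\<Sum>i<n. coeff Q i * x ^ i)"
        unfolding poly_altdef by (intro sum.mono_neutral_left) (auto simp: coeff_eq_0)
      thus ?thesis by simp
    qed simp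
    also have "\<dots> = (\<Sum>i<n. coeff Q i * (t * \<rho> ^ (n - 1 - i)) / \<rho> ^ n)"
      unfolding sum_distrib_right
    proof (rule sum.cong)
      fix i assume "i \<in> {..<n}"
      hence "\<rho> ^ n = \<rho> * \<rho> ^ i * \<rho> ^ (n - 1 - i)"
        by (simp flip: power_add power_Suc)
      thus "coeff Q i * x ^ i * y = coeff Q i * (t * \<rho> ^ (n - 1 - i)) / \<rho> ^ n"
        using rho_neq_0 by (simp add: xy_eq(1,2) power_one_over field_simps)
    qed simp
    finally have 2: "poly Q x * y = (\<Sum>i<n. coeff Q i * (t * \<rho> ^ (n - 1 - i))) / \<rho> ^ n" by (simp add: sum_divide_distrib)
    show ?thesis unfolding 1 2 h_def by (simp add: poly_sum rho_eq(1)[symmetric] add_divide_distrib mult.left_commute)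
  qed
  ultimately show ?thesis unfolding n_def by blast
qed

lemma rep_unique:
  assumes "P \<in> coeffs_in (Fq q)" "Q \<in> coeffs_in (Fq q)" "P' \<in> coeffs_in (Fq q)" "Q' \<in> coeffs_in (Fq q)"
    "poly P x + poly Q x * y = poly P' x + poly Q' x * y"
  shows "P = P'" "Q = Q'"
proof -
  have "P - P' = 0 \<and> Q - Q' = 0"
  proof (rule ccontr)
    assume "\<not> ?thesis"
    then obtain h where h: "h \<in> coeffs_in (Fq q)" "poly h \<zeta> \<noteq> 0"
      "poly (P - P') x + poly (Q - Q') x * y = poly h t / \<rho> ^ pole_order (P - P') (Q - Q')"
      using rep_pole[of "P - P'" "Q - Q'"] assms by (auto simp: coeffs_in_intros sfield_Fq)
    have "poly h t = 0" using h(3) assms(5) by (simp add: algebra_simps)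
    thus False using transc_poly h by fastforce
  qed
  thus "P = P'" "Q = Q'" by auto
qed

lemma Fq_simps [simp]: "(0 :: 'a) \<in> Fq q" "(1 :: 'a) \<in> Fq q" "sfield (Fq q)" "0 \<in> coeffs_in (Fq q)" "1 \<in> coeffs_in (Fq q)"
  "[:c:] \<in> coeffs_in (Fq q) \<longleftrightarrow> c \<in> Fq q"
  by (simp_all add: sfieldD[OF sfield_Fq] sfield_Fq coeffs_in_intros coeffs_in_pCons)

lemma KfieldI: "f \<in> coeffs_in (Fq q) \<Longrightarrow> g \<in> coeffs_in (Fq q) \<Longrightarrow> g \<noteq> 0 \<Longrightarrow> poly f t / poly g t \<in> Kfield q t"
  unfolding Kfield_eq by blast

lemma KfieldE:
  assumes "z \<in> Kfield q t"
  obtains f g where "z = poly f t / poly g t" "f \<in> coeffs_in (Fq q)" "g \<in> coeffs_in (Fq q)" "g \<noteq> 0"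
proof -
  from assms have "\<exists>f g. z = poly f t / poly g t \<and> f \<in> coeffs_in (Fq q) \<and> g \<in> coeffs_in (Fq q) \<and> g \<noteq> 0"
    unfolding Kfield_eq by simp
  thus ?thesis using that by (elim exE conjE)
qed

text \<open>Valuations of \<open>K\<close> are given by their values on polynomials.\<close>

definition val_place :: "('a poly \<Rightarrow> int) \<Rightarrow> 'a set" where
  "val_place v = {poly f t / poly g t | f g. f \<in> coeffs_in (Fq q) \<and> g \<in> coeffs_in (Fq q) \<and> g \<noteq> 0 \<and>
     (f = 0 \<or> v g \<le> v f)}"

definition valuation :: "('a poly \<Rightarrow> int) \<Rightarrow> bool" where
  "valuation v \<longleftrightarrow> (\<forall>f g. f \<noteq> 0 \<longrightarrow> g \<noteq> 0 \<longrightarrow> v (f * g) = v f + v g) \<and>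
     (\<forall>f g. f \<noteq> 0 \<longrightarrow> g \<noteq> 0 \<longrightarrow> f + g \<noteq> 0 \<longrightarrow> min (v f) (v g) \<le> v (f + g)) \<and>
     (\<forall>c. c \<noteq> 0 \<longrightarrow> v [:c:] = 0)"

text \<open>A place of \<open>K\<close> over a finite point is given by any of its geometric points
  \<open>\<alpha>\<close> in the ambient field, so irreducible polynomials over \<open>F_q\<close>
  never appear.\<close>

lemma valuation_order: "valuation (\<lambda>f. int (order \<alpha> f))"
  unfolding valuation_def
proof (intro conjI allI impI)
  fix f g :: "'a poly" assume nz: "f \<noteq> 0" "g \<noteq> 0" "f + g \<noteq> 0"
  let ?m = "min (order \<alpha> f) (order \<alpha> g)"
  have "[:- \<alpha>, 1:] ^ ?m dvd f" "[:- \<alpha>, 1:] ^ ?m dvd g"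
    using nz by (auto simp: order_divides)
  hence "[:- \<alpha>, 1:] ^ ?m dvd f + g" by (rule dvd_add)
  hence "?m \<le> order \<alpha> (f + g)" using nz by (simp add: order_divides)
  thus "min (int (order \<alpha> f)) (int (order \<alpha> g)) \<le> int (order \<alpha> (f + g))" by linarith
qed (auto simp: order_mult order_0I)

lemma valuation_degree: "valuation (\<lambda>f. - int (degree f))"
  unfolding valuation_def
proof (intro conjI allI impI)
  fix f g :: "'a poly"
  show "min (- int (degree f)) (- int (degree g)) \<le> - int (degree (f + g))"
    using degree_add_le_max[of f g] by linarith
qed (auto simp: degree_mult_eq)

lemma poly_t_eq: assumes "f \<in> coeffs_in (Fq q)" "g \<in> coeffs_in (Fq q)" "poly f t = poly g t" shows "f = g"
  using transc_poly[of "f - g"] assms by (auto simp: coeffs_in_intros sfield_Fq)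

lemma val_place_iff:
  assumes v: "valuation v" and f: "f \<in> coeffs_in (Fq q)" and g: "g \<in> coeffs_in (Fq q)" "g \<noteq> 0"
  shows "poly f t / poly g t \<in> val_place v \<longleftrightarrow> f = 0 \<or> v g \<le> v f"
proof
  assume "poly f t / poly g t \<in> val_place v"
  then obtain f' g' where *: "poly f t / poly g t = poly f' t / poly g' t" "f' \<in> coeffs_in (Fq q)"
    "g' \<in> coeffs_in (Fq q)" "g' \<noteq> 0" "f' = 0 \<or> v g' \<le> v f'" unfolding val_place_def by blast
  have "poly g t \<noteq> 0" "poly g' t \<noteq> 0" using transc_poly g * by blast+
  hence "poly (f * g') t = poly (f' * g) t" using *(1) by (simp add: field_simps)
  hence eq: "f * g' = f' * g" by (intro poly_t_eq coeffs_in_intros sfield_Fq f g *)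
  show "f = 0 \<or> v g \<le> v f"
  proof (rule disjCI)
    assume "\<not> v g \<le> v f"
    show "f = 0"
    proof (rule ccontr)
      assume f0: "f \<noteq> 0"
      hence "f' \<noteq> 0" using eq * by auto
      hence "v f + v g' = v f' + v g" using v eq f0 * g unfolding valuation_def by metis
      thus False using * \<open>f' \<noteq> 0\<close> \<open>\<not> v g \<le> v f\<close> by auto
    qed
  qed
qed (use f g in \<open>auto simp: val_place_def\<close>)

text \<open>The polynomial \<open>f0\<close> witnesses that \<open>v\<close> is nontrivial: either
  it or its inverse lies in \<open>K\<close> but outside the ring, as properness of a place
  demands.\<close>

lemma place_val:
  assumes v: "valuation v" and f0: "f0 \<in> coeffs_in (Fq q)" "f0 \<noteq> 0" "v f0 \<noteq> 0"
  shows "is_place q t (val_place v)"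
proof -
  interpret R: field "ambient :: 'a ring" by (rule field_from_type_algebra)
  have vm: "v (f * g) = v f + v g" if "f \<noteq> 0" "g \<noteq> 0" for f g using v that unfolding valuation_def by blast
  have va: "min (v f) (v g) \<le> v (f + g)" if "f \<noteq> 0" "g \<noteq> 0" "f + g \<noteq> 0" for f g
    using v that unfolding valuation_def by blast
  have vc: "v [:c:] = 0" if "c \<noteq> 0" for c using v that unfolding valuation_def by blast
  have nz: "poly g t \<noteq> 0" if "g \<in> coeffs_in (Fq q)" "g \<noteq> 0" for g
    using transc_poly that by blast
  have VI: "poly f t / poly g t \<in> val_place v" if "f \<in> coeffs_in (Fq q)" "g \<in> coeffs_in (Fq q)" "g \<noteq> 0" "f = 0 \<or> v g \<le> v f" for f g
    using val_place_iff[OF v that(1-3)] that(4) by blast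
  have Fq: "Fq q \<subseteq> val_place v"
  proof
    fix c :: 'a assume c: "c \<in> Fq q"
    have "poly [:c:] t / poly 1 t \<in> val_place v"
      using vc[of c] vc[of 1] c
      by (cases "c = 0"; intro VI) (auto simp: one_pCons[symmetric])
    thus "c \<in> val_place v" by simp
  qed
  have sub: "subring (val_place v) ambient"
  proof (rule R.subringI)
    show "\<one>\<^bsub>ambient\<^esub> \<in> val_place v" using Fq sfieldD(1)[OF sfield_Fq] by auto
    fix a b assume "a \<in> val_place v" "b \<in> val_place v"
    then obtain f g f' g' where *: "a = poly f t / poly g t" "b = poly f' t / poly g' t"
      "f \<in> coeffs_in (Fq q)" "g \<in> coeffs_in (Fq q)" "g \<noteq> 0" "f = 0 \<or> v g \<le> v f"
      "f' \<in> coeffs_in (Fq q)" "g' \<in> coeffs_in (Fq q)" "g' \<noteq> 0" "f' = 0 \<or> v g' \<le> v f'"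
      unfolding val_place_def by blast
    note [simp] = nz[OF *(4,5)] nz[OF *(8,9)]
    have "a + b = poly (f * g' + f' * g) t / poly (g * g') t" by (simp add: * field_simps)
    also have "\<dots> \<in> val_place v"
    proof (intro VI coeffs_in_intros sfield_Fq *)
      show "g * g' \<noteq> 0" using * by simp
      show "f * g' + f' * g = 0 \<or> v (g * g') \<le> v (f * g' + f' * g)"
      proof (cases "f = 0 \<or> f' = 0 \<or> f * g' + f' * g = 0")
        case True thus ?thesis using * vm[of f g'] vm[of f' g] vm[of g g']
          by (cases "f = 0"; cases "f' = 0") auto
      next
        case False
        hence "min (v (f * g')) (v (f' * g)) \<le> v (f * g' + f' * g)" using * by (intro va) auto
        thus ?thesis using False * vm[of f g'] vm[of f' g] vm[of g g'] by auto
      qed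
    qed
    finally show "a \<oplus>\<^bsub>ambient\<^esub> b \<in> val_place v" by simp
    have "a * b = poly (f * f') t / poly (g * g') t" by (simp add: *)
    also have "\<dots> \<in> val_place v"
    proof (intro VI coeffs_in_intros sfield_Fq *)
      show "f * f' = 0 \<or> v (g * g') \<le> v (f * f')" using * vm[of f f'] vm[of g g'] by (cases "f = 0"; cases "f' = 0") auto
    qed (use * in simp)
    finally show ab: "a \<otimes>\<^bsub>ambient\<^esub> b \<in> val_place v" by simp
  next
    fix a assume "a \<in> val_place v"
    then obtain f g where *: "a = poly f t / poly g t"
      "f \<in> coeffs_in (Fq q)" "g \<in> coeffs_in (Fq q)" "g \<noteq> 0" "f = 0 \<or> v g \<le> v f"
      unfolding val_place_def by blast
    have "v (f * [:-1:]) = v f" if "f \<noteq> 0" using vm[OF that, of "[:-1:]"] vc[of "-1"] by simp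
    hence "v (- f) = v f" if "f \<noteq> 0" using that by simp
    moreover have "0 - f \<in> coeffs_in (Fq q)" by (intro coeffs_in_intros sfield_Fq *)
    ultimately have "poly (- f) t / poly g t \<in> val_place v" using * by (cases "f = 0"; intro VI) auto
    thus "\<ominus>\<^bsub>ambient\<^esub> a \<in> val_place v" by (simp add: *)
  qed simp
  have subK: "val_place v \<subseteq> Kfield q t" unfolding val_place_def Kfield_eq by blast
  have one: "1 \<in> coeffs_in (Fq q)" "v 1 = 0"
    using vc[of 1] by (auto simp: one_pCons[symmetric])
  have "\<exists>z\<in>Kfield q t. z \<notin> val_place v"
  proof (cases "v f0 > 0")
    case True
    have "poly 1 t / poly f0 t \<in> Kfield q t" by (intro KfieldI one f0)
    moreover have "poly 1 t / poly f0 t \<notin> val_place v"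
      using True one f0 val_place_iff[OF v, of 1 f0] by auto
    ultimately show ?thesis by blast
  next
    case False
    have "poly f0 t / poly 1 t \<in> Kfield q t" by (intro KfieldI one f0) simp
    moreover have "poly f0 t / poly 1 t \<notin> val_place v"
      using False one f0 val_place_iff[OF v, of f0 1] by auto
    ultimately show ?thesis by blast
  qed
  hence "val_place v \<subset> Kfield q t" using subK by blast
  moreover have "z \<in> val_place v \<or> inverse z \<in> val_place v" if zK: "z \<in> Kfield q t" for z
  proof -
    obtain f g where *: "z = poly f t / poly g t"
      "f \<in> coeffs_in (Fq q)" "g \<in> coeffs_in (Fq q)" "g \<noteq> 0" using KfieldE[OF zK] by metis
    show ?thesis
    proof (cases "f = 0 \<or> v g \<le> v f")
      case True thus ?thesis using VI * by auto
    next
      case False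
      hence "poly g t / poly f t \<in> val_place v" using * by (intro VI) auto
      thus ?thesis by (simp add: *)
    qed
  qed
  ultimately show ?thesis unfolding is_place_def using Fq sub by blast
qed

lemma poly_dvd_order:
  assumes "g \<noteq> (0 :: 'a poly)" "p \<noteq> 0" "\<And>\<alpha>. order \<alpha> g \<le> order \<alpha> p" shows "g dvd p"
proof -
  have "proots g \<subseteq># proots p" using assms by (auto simp: subseteq_mset_def)
  hence "(\<Prod>x\<in>#proots g. [:- x, 1:]) dvd (\<Prod>x\<in>#proots p. [:- x, 1:])"
    by (intro prod_mset_subset_imp_dvd image_mset_subseteq_mono)
  also have "\<dots> dvd p" by (subst (2) poly_splits(1)[OF assms(2)]) (rule dvd_smult, simp)
  finally have "smult (lead_coeff g) (\<Prod>x\<in>#proots g. [:- x, 1:]) dvd p"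
    using assms(1) by (simp add: smult_dvd_iff)
  thus ?thesis using poly_splits(1)[OF assms(1)] by simp
qed

text \<open>From left to right, regularity at the points other than the two conjugates makes the
  denominator divide a power of \<open>rp\<close> times the numerator, and regularity at
  \<open>t = \<infinity>\<close> bounds the degree. From right to left, \<open>x\<close> lies in
  every other valuation ring by the choice of the place, and \<open>y\<close> is integral over
  \<open>F_q[x]\<close>.\<close>

lemma Aset_eq: "Aset q \<zeta> t = Ipow 0"
proof
  show "Aset q \<zeta> t \<subseteq> Ipow 0"
  proof
    fix a assume a: "a \<in> Aset q \<zeta> t"
    have aV: "a \<in> val_place v" if v: "valuation v" "v rp \<le> 0" "is_place q t (val_place v)" for v
    proof -
      have "v 1 = 0" using v unfolding valuation_def one_pCons by simp
      hence "poly 1 t / poly rp t \<in> val_place v" using v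
        by (subst val_place_iff) (auto intro: coeffs_in_intros sfield_Fq rp_in)
      hence "inverse \<rho> \<in> val_place v" by (simp add: rho_eq(1) inverse_eq_divide)
      hence "\<not> at_P_rho q \<zeta> t (val_place v)" by (simp add: at_P_rho_def)
      thus ?thesis using a v unfolding Aset_def by blast
    qed
    obtain f g where fg: "a = poly f t / poly g t"
      "f \<in> coeffs_in (Fq q)" "g \<in> coeffs_in (Fq q)" "g \<noteq> 0"
      using a KfieldE[of a] unfolding Aset_def by (metis (no_types, lifting) mem_Collect_eq)
    show "a \<in> Ipow 0"
    proof (cases "f = 0")
      case False
      \<comment> \<open>No zero of \<open>g\<close> has order above \<open>N\<close>, and
        \<open>rp ^ N\<close> has order at least \<open>N\<close> at both conjugates.\<close>
      define N where "N = degree g"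
      have ord: "order \<alpha> g \<le> order \<alpha> (f * rp ^ N)" for \<alpha>
      proof (cases "conj \<alpha>")
        case True
        hence "[:- \<alpha>, 1:] dvd rp" using rp_root by (simp add: poly_eq_0_iff_dvd)
        hence "[:- \<alpha>, 1:] ^ N dvd rp ^ N" by (rule dvd_power_same)
        hence "[:- \<alpha>, 1:] ^ N dvd f * rp ^ N" by simp
        hence "N \<le> order \<alpha> (f * rp ^ N)" using False by (simp add: order_divides)
        thus ?thesis using order_degree[OF fg(4), of \<alpha>] unfolding N_def by simp
      next
        case nc: False
        show ?thesis
        proof (cases "order \<alpha> g = 0")
          case g0: False
          have "int (order \<alpha> rp) \<le> 0" using nc rp_root by (simp add: order_0I)
          hence "a \<in> val_place (\<lambda>f. int (order \<alpha> f))"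
            using g0 by (intro aV valuation_order place_val[OF valuation_order fg(3,4)]) auto
          hence "order \<alpha> g \<le> order \<alpha> f"
            using val_place_iff[OF valuation_order fg(2-4)] fg(1) False by auto
          also have "\<dots> \<le> order \<alpha> (f * rp ^ N)" using False by (subst order_mult) auto
          finally show ?thesis .
        qed simp
      qed
      have "g dvd f * rp ^ N" using ord fg False by (intro poly_dvd_order) auto
      then obtain h where h: "f * rp ^ N = g * h" by (auto elim: dvdE)
      have hF: "h \<in> coeffs_in (Fq q)"
        by (rule coeffs_in_quotient[OF fg(3) _ fg(4)], subst h[symmetric]) (intro coeffs_in_intros sfield_Fq fg rp_in)
      have "poly g t \<noteq> 0" using transc_poly fg by blast
      moreover have "poly f t * \<rho> ^ N = poly g t * poly h t"
        using arg_cong[OF h, of "\<lambda>p. poly p t"] by (simp add: rho_eq(1))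
      ultimately have ah: "a = poly h t / poly (rp ^ N) t"
        using rho_neq_0 by (simp add: fg(1) rho_eq(1)[symmetric] field_simps)
      have "is_place q t (val_place (\<lambda>f. - int (degree f)))"
        by (rule place_val[OF valuation_degree rp_in]) auto
      hence "a \<in> val_place (\<lambda>f. - int (degree f))" by (intro aV valuation_degree) auto
      moreover have "rp ^ N \<in> coeffs_in (Fq q)" by (intro coeffs_in_intros sfield_Fq rp_in)
      ultimately have "h = 0 \<or> degree h \<le> degree (rp ^ N)"
        using val_place_iff[OF valuation_degree hF, of "rp ^ N"] ah by auto
      hence "h = 0 \<or> degree h + 0 \<le> 2 * N" by (auto simp: degree_power_eq)
      from IpowI[OF hF this] show ?thesis using ah by (simp add: rho_eq(1))
    qed (simp add: fg)
  qed
  show "Ipow 0 \<subseteq> Aset q \<zeta> t"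
  proof
    fix a assume "a \<in> Ipow 0"
    then obtain P Q where PQ: "P \<in> coeffs_in (Fq q)" "Q \<in> coeffs_in (Fq q)" "a = poly P x + poly Q x * y"
      using Ipow_rep by blast
    have inV: "x \<in> V \<and> y \<in> V" "\<And>c. c \<in> Fq q \<Longrightarrow> c \<in> V" "\<And>u v. u \<in> V \<Longrightarrow> v \<in> V \<Longrightarrow> u + v \<in> V"
      "\<And>u v. u \<in> V \<Longrightarrow> v \<in> V \<Longrightarrow> u * v \<in> V"
      if V: "is_place q t V" "\<not> at_P_rho q \<zeta> t V" for V
    proof -
      interpret R: field "ambient :: 'a ring" by (rule field_from_type_algebra)
      have sub: "subring V ambient" and Fq: "Fq q \<subseteq> V" and K: "\<forall>z \<in> Kfield q t. z \<in> V \<or> inverse z \<in> V"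
        using V unfolding is_place_def by auto
      show add: "u + v \<in> V" if "u \<in> V" "v \<in> V" for u v using subringE(7)[OF sub that] by simp
      show mult: "u * v \<in> V" if "u \<in> V" "v \<in> V" for u v using subringE(6)[OF sub that] by simp
      have neg: "- u \<in> V" if "u \<in> V" for u using subringE(5)[OF sub that] by simp
      show "c \<in> V" if "c \<in> Fq q" for c using Fq that by blast
      note Fq = this
      have xK: "\<rho> \<in> Kfield q t" "y \<in> Kfield q t"
      proof -
        have "poly rp t / poly 1 t \<in> Kfield q t" "poly [:0,1:] t / poly rp t \<in> Kfield q t"
          by (intro KfieldI rp_in; simp add: coeffs_in_pCons)+
        thus "\<rho> \<in> Kfield q t" "y \<in> Kfield q t" by (simp_all add: rho_eq(1) xy_eq(2))
      qed
      have x: "x \<in> V" using V K xK(1) unfolding at_P_rho_def by (auto simp: xy_eq(1) inverse_eq_divide)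
      have "y \<in> V"
      proof (cases "y = 0")
        case False
        show ?thesis
        proof (rule ccontr)
          assume "y \<notin> V"
          hence "inverse y \<in> V" using K xK by blast
          \<comment> \<open>The quadratic relation divided by \<open>y\<close>; everything on its
            right side lies in \<open>V\<close>.\<close>
          moreover have "y = tr * x + - (nm * x * x * inverse y) + x * inverse y"
            using xy_relation False by (simp add: field_simps)
          ultimately show False
            using \<open>y \<notin> V\<close> add[OF add[OF mult[OF Fq[OF tr_Fq] x]
              neg[OF mult[OF mult[OF mult[OF Fq[OF nm_Fq] x] x]]]] mult[OF x]] by metis
        qed
      qed (use Fq sfieldD(2)[OF sfield_Fq] in auto)
      thus "x \<in> V \<and> y \<in> V" using x by blast
    qed
    have polyV: "poly P x \<in> V" if V: "is_place q t V" "\<not> at_P_rho q \<zeta> t V" and P: "P \<in> coeffs_in (Fq q)" for V P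
      using P by (induction P) (use inV[OF V] sfieldD(2)[OF sfield_Fq] in \<open>auto simp: coeffs_in_pCons\<close>)
    have aV: "a \<in> V" if V: "is_place q t V" "\<not> at_P_rho q \<zeta> t V" for V
      using polyV[OF V] PQ inV[OF V] by simp
    \<comment> \<open>Membership in one such ring already gives \<open>a \<in> K\<close>; the place
      at \<open>t = \<infinity>\<close> serves, because \<open>1 / \<rho>\<close> is regular
      there.\<close>
    have "is_place q t (val_place (\<lambda>f. - int (degree f)))"
      by (rule place_val[OF valuation_degree rp_in]) auto
    moreover have "poly 1 t / poly rp t \<in> val_place (\<lambda>f. - int (degree f))"
      by (subst val_place_iff) (auto intro: coeffs_in_intros sfield_Fq rp_in valuation_degree)
    ultimately have "is_place q t (val_place (\<lambda>f. - int (degree f)))"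
       "\<not> at_P_rho q \<zeta> t (val_place (\<lambda>f. - int (degree f)))"
      by (auto simp: at_P_rho_def rho_eq(1) inverse_eq_divide)
    from this(1) aV[OF this] have "a \<in> Kfield q t" unfolding is_place_def by auto
    thus "a \<in> Aset q \<zeta> t" using aV unfolding Aset_def by blast
  qed
qed

abbreviation "A \<equiv> Aring q \<zeta> t"

lemma A_simps [simp]:
  "carrier A = Ipow 0" "monoid.mult A = (*)" "monoid.one A = 1" "ring.zero A = 0" "ring.add A = (+)"
  by (simp_all add: Aring_def Aset_eq)

lemma one_Ipow [simp]: "1 \<in> Ipow 0"
  using Fq_Ipow sfieldD(1)[OF sfield_Fq] by blast

lemma A_cring: "cring A"
proof (rule cringI)
  show "abelian_group A"
  proof (rule abelian_groupI)
    fix a assume "a \<in> carrier A"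
    thus "\<exists>b\<in>carrier A. b \<oplus>\<^bsub>A\<^esub> a = \<zero>\<^bsub>A\<^esub>" using Ipow_minus[of a 0] by (intro bexI[of _ "- a"]) auto
  qed (auto simp: Ipow_add)
  show "Group.comm_monoid A"
    by (rule comm_monoidI) (auto simp: Ipow_absorb)
qed (auto simp: algebra_simps)

lemma A_ring: "ring A" using A_cring by (simp add: cring_def)

lemma A_minus: "a \<in> Ipow 0 \<Longrightarrow> \<ominus>\<^bsub>A\<^esub> a = - a"
proof -
  interpret R: cring A by (rule A_cring)
  show "a \<in> Ipow 0 \<Longrightarrow> ?thesis" using R.minus_equality[of "- a" a] Ipow_minus[of a 0] by simp
qed

lemma A_idealI:
  assumes "N \<subseteq> Ipow 0" "0 \<in> N" "\<And>a b. a \<in> N \<Longrightarrow> b \<in> N \<Longrightarrow> a + b \<in> N" "\<And>a b. a \<in> Ipow 0 \<Longrightarrow> b \<in> N \<Longrightarrow> a * b \<in> N"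
  shows "ideal N A"
proof (rule idealI[OF A_ring])
  interpret R: cring A by (rule A_cring)
  show "subgroup N (add_monoid A)"
  proof (rule R.add.subgroupI)
    fix a assume a: "a \<in> N"
    have "- 1 * a \<in> N" using assms(4)[OF Ipow_minus[OF one_Ipow] a] .
    thus "\<ominus>\<^bsub>A\<^esub> a \<in> N" using a assms(1) by (auto simp: A_minus)
  qed (use assms in auto)
next
  fix a b assume ab: "a \<in> N" "b \<in> carrier A"
  show "b \<otimes>\<^bsub>A\<^esub> a \<in> N" using assms(4)[of b a] ab by simp
  thus "a \<otimes>\<^bsub>A\<^esub> b \<in> N" by (simp add: mult.commute)
qed

lemma Ipow_ideal: "ideal (Ipow k) A"
  by (rule A_idealI) (use Ipow_mono[of 0 k] in \<open>auto simp: Ipow_add Ipow_absorb\<close>)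

lemma const_Ipow1: "c \<in> Fq q \<Longrightarrow> c \<in> Ipow 1 \<Longrightarrow> c = 0"
proof (rule ccontr)
  assume c: "c \<in> Fq q" "c \<in> Ipow 1" "c \<noteq> 0"
  obtain h n where h: "h \<in> coeffs_in (Fq q)" "h = 0 \<or> degree h + 1 \<le> 2 * n" "c = poly h t / \<rho> ^ n" "n \<ge> 0"
    using IpowE[OF c(2)] by metis
  have "poly h t = poly (smult c (rp ^ n)) t" using rho_neq_0 by (simp add: h(3) rho_eq(1)[symmetric])
  hence "h = smult c (rp ^ n)" using h c by (intro poly_t_eq) (auto intro: coeffs_in_intros sfield_Fq rp_in)
  hence "degree h = 2 * n" "h \<noteq> 0" using c by (auto simp: degree_power_eq)
  thus False using h(2) by simp
qed

text \<open>Split the numerator as \<open>c + t h'\<close> and use \<open>y = t x\<close>. The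
  exponent is taken at least \<open>k + 1\<close> so that the constant part, over the denominator of
  exponent one less, still vanishes to order \<open>k\<close>.\<close>

lemma Ipow_Suc_rep: assumes "a \<in> Ipow (Suc k)" shows "\<exists>u\<in>Ipow k. \<exists>v\<in>Ipow k. a = u * x + v * y"
proof -
  obtain h n where h: "h \<in> coeffs_in (Fq q)" "h = 0 \<or> degree h + Suc k \<le> 2 * n" "a = poly h t / \<rho> ^ n" "n \<ge> k + 1"
    by (rule IpowE[OF assms])
  obtain m where n: "n = Suc m" using h(4) by (cases n) auto
  obtain c h' where hc: "h = pCons c h'" by (cases h)
  have c: "c \<in> Fq q" "h' \<in> coeffs_in (Fq q)" using h(1) unfolding hc coeffs_in_pCons by auto
  have "poly [:c:] t / \<rho> ^ m \<in> Ipow k" using c h(4) n by (intro IpowI) auto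
  moreover have "poly h' t / \<rho> ^ m \<in> Ipow k"
    using h(2) n hc by (intro IpowI c) (auto split: if_splits)
  moreover have "a = poly [:c:] t / \<rho> ^ m * x + poly h' t / \<rho> ^ m * y"
    using rho_neq_0 by (simp add: h(3) hc n xy_eq(1,2) field_simps)
  ultimately show ?thesis by blast
qed

lemma Iinf_eq: "Iinf q \<zeta> t = Ipow 1"
proof
  have "x \<in> Ipow 1" using x_Ipow Ipow_mono[of 1 2] by auto
  thus "Iinf q \<zeta> t \<subseteq> Ipow 1" unfolding Iinf_def genideal_def using Ipow_ideal[of 1] y_Ipow by auto
  show "Ipow 1 \<subseteq> Iinf q \<zeta> t"
  proof
    fix a assume "a \<in> Ipow 1"
    then obtain u v where eq: "a = u * x + v * y" "u \<in> Ipow 0" "v \<in> Ipow 0"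
      using Ipow_Suc_rep[of a 0] by auto
    show "a \<in> Iinf q \<zeta> t" unfolding Iinf_def genideal_def
    proof safe
      fix J assume J: "ideal J A" "{x, y} \<subseteq> J"
      then interpret J: ideal J A by simp
      have "u * x \<in> J" using J.I_l_closed[of x u] eq J(2) by simp
      moreover have "v * y \<in> J" using J.I_l_closed[of y v] eq J(2) by simp
      ultimately show "a \<in> J"
        using additive_subgroup.a_closed[OF ideal.axioms(1)[OF J(1)], of "u * x" "v * y"] by (simp add: eq)
    qed
  qed
qed

lemma Iinf_power_eq: "Iinf_power q \<zeta> t k = Ipow k"
proof (induction k)
  case 0
  show ?case by (simp add: Iinf_power_def nat_pow_def ideals_set_def)
next
  case (Suc k)
  have "Iinf_power q \<zeta> t (Suc k) = ideal_prod A (Ipow k) (Ipow 1)"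
    using Suc by (simp add: Iinf_power_def nat_pow_def Iinf_eq) (simp add: ideals_set_def)
  also have "\<dots> = Ipow (Suc k)"
  proof
    show "ideal_prod A (Ipow k) (Ipow 1) \<subseteq> Ipow (Suc k)"
    proof
      fix s assume "s \<in> ideal_prod A (Ipow k) (Ipow 1)"
      thus "s \<in> Ipow (Suc k)"
        by (induction rule: ideal_prod.induct) (use Ipow_mult[of _ k _ 1] in \<open>auto simp: Ipow_add\<close>)
    qed
    show "Ipow (Suc k) \<subseteq> ideal_prod A (Ipow k) (Ipow 1)"
    proof
      fix a assume "a \<in> Ipow (Suc k)"
      then obtain u v where uv: "u \<in> Ipow k" "v \<in> Ipow k" "a = u * x + v * y"
        using Ipow_Suc_rep by blast
      have "x \<in> Ipow 1" using x_Ipow Ipow_mono[of 1 2] by auto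
      hence 1: "u * x \<in> ideal_prod A (Ipow k) (Ipow 1)" using ideal_prod.prod[of u "Ipow k" x "Ipow 1" A] uv by simp
      have 2: "v * y \<in> ideal_prod A (Ipow k) (Ipow 1)" using ideal_prod.prod[of v "Ipow k" y "Ipow 1" A] uv y_Ipow by simp
      thus "a \<in> ideal_prod A (Ipow k) (Ipow 1)" using ideal_prod.sum[OF 1 2] uv by simp
    qed
  qed
  finally show ?case .
qed

lemma rcoset_eq: "N +>\<^bsub>A\<^esub> a = {n + a | n. n \<in> N}"
  by (auto simp: a_r_coset_def r_coset_def)

lemma Quot_carrier: "carrier (A Quot N) = (\<lambda>a. N +>\<^bsub>A\<^esub> a) ` Ipow 0"
  by (auto simp: FactRing_def A_RCOSETS_def RCOSETS_def a_r_coset_def)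

lemma Quot_eq:
  assumes N: "ideal N A" and a: "a \<in> Ipow 0" and b: "b \<in> Ipow 0"
  shows "N +>\<^bsub>A\<^esub> a = N +>\<^bsub>A\<^esub> b \<longleftrightarrow> a - b \<in> N"
proof -
  interpret N: ideal N A by fact
  interpret R: cring A by (rule A_cring)
  have add: "u + v \<in> N" if "u \<in> N" "v \<in> N" for u v
    using additive_subgroup.a_closed[OF ideal.axioms(1)[OF N] that] by simp
  have neg: "- u \<in> N" if "u \<in> N" for u
    using N.I_l_closed[OF that, of "- 1"] Ipow_minus[OF one_Ipow] by simp
  have 0: "0 \<in> N" using additive_subgroup.zero_closed[OF ideal.axioms(1)[OF N]] by simp
  show ?thesis
  proof
    assume "N +>\<^bsub>A\<^esub> a = N +>\<^bsub>A\<^esub> b"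
    moreover have "0 + a \<in> N +>\<^bsub>A\<^esub> a" unfolding rcoset_eq using 0 by blast
    ultimately obtain n where "n \<in> N" "a = n + b" by (auto simp: rcoset_eq)
    thus "a - b \<in> N" by simp
  next
    assume ab: "a - b \<in> N"
    have "n + a = (n + (a - b)) + b" "n + b = (n + - (a - b)) + a" for n by simp_all
    thus "N +>\<^bsub>A\<^esub> a = N +>\<^bsub>A\<^esub> b" unfolding rcoset_eq using add[OF _ ab] add[OF _ neg[OF ab]] by blast
  qed
qed

lemma Quot_ops:
  assumes N: "ideal N A" and a: "a \<in> Ipow 0" and b: "b \<in> Ipow 0"
  shows "(N +>\<^bsub>A\<^esub> a) \<oplus>\<^bsub>A Quot N\<^esub> (N +>\<^bsub>A\<^esub> b) = N +>\<^bsub>A\<^esub> (a + b)"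
    "(N +>\<^bsub>A\<^esub> a) \<otimes>\<^bsub>A Quot N\<^esub> (N +>\<^bsub>A\<^esub> b) = N +>\<^bsub>A\<^esub> (a * b)"
proof -
  interpret N: ideal N A by fact
  show "(N +>\<^bsub>A\<^esub> a) \<otimes>\<^bsub>A Quot N\<^esub> (N +>\<^bsub>A\<^esub> b) = N +>\<^bsub>A\<^esub> (a * b)"
    using N.rcoset_mult_add[of a b] a b by (simp add: FactRing_def)
  show "(N +>\<^bsub>A\<^esub> a) \<oplus>\<^bsub>A Quot N\<^esub> (N +>\<^bsub>A\<^esub> b) = N +>\<^bsub>A\<^esub> (a + b)"
    using N.a_rcos_sum[of a b] a b by (simp add: FactRing_def)
qed

lemma card_Quot:
  assumes N: "ideal N A" and S: "S \<subseteq> Ipow 0" "\<And>a. a \<in> Ipow 0 \<Longrightarrow> \<exists>s\<in>S. a - s \<in> N"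
    "\<And>s s'. s \<in> S \<Longrightarrow> s' \<in> S \<Longrightarrow> s - s' \<in> N \<Longrightarrow> s = s'"
  shows "card (carrier (A Quot N)) = card S"
proof -
  have "carrier (A Quot N) = (\<lambda>a. N +>\<^bsub>A\<^esub> a) ` S"
    unfolding Quot_carrier using Quot_eq[OF N] S by (auto simp: image_iff) (metis subsetD)
  moreover have "inj_on (\<lambda>a. N +>\<^bsub>A\<^esub> a) S"
    by (rule inj_onI) (use Quot_eq[OF N] S in blast)
  ultimately show ?thesis by (simp add: card_image)
qed

text \<open>Transversals of the quotients of \<open>A\<close> are images of such sets: support
  \<open>{..<k}\<close> for powers of \<open>I\<^sub>\<infinity>\<close>, and all degrees up to
  \<open>2 n\<close> except one for principal ideals.\<close>

definition polys_on :: "nat set \<Rightarrow> 'a poly set" where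
  "polys_on J = {p \<in> coeffs_in (Fq q). \<forall>i. i \<notin> J \<longrightarrow> coeff p i = 0}"

lemma card_polys_on: assumes "finite J" shows "card (polys_on J) = q ^ card J"
proof -
  have fin: "coeff (Abs_poly (\<lambda>i. if i \<in> J then f i else 0)) n = (if n \<in> J then f n else 0)" for f :: "nat \<Rightarrow> 'a" and n
  proof (subst Abs_poly_inverse)
    have "finite {i. (if i \<in> J then f i else 0) \<noteq> 0}" by (rule finite_subset[OF _ assms]) auto
    thus "(\<lambda>i. if i \<in> J then f i else 0) \<in> {f. \<forall>\<^sub>\<infinity>n. f n = 0}"
      by (simp add: eventually_cofinite)
  qed simp
  have "bij_betw (\<lambda>p. restrict (coeff p) J) (polys_on J) (PiE J (\<lambda>_. Fq q))"
  proof (rule bij_betwI[where g = "\<lambda>f. Abs_poly (\<lambda>i. if i \<in> J then f i else 0)"])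
    show "(\<lambda>f. Abs_poly (\<lambda>i. if i \<in> J then f i else 0)) \<in> (PiE J (\<lambda>_. Fq q)) \<rightarrow> polys_on J"
      by (auto simp: polys_on_def coeffs_in_def fin)
    show "Abs_poly (\<lambda>i. if i \<in> J then restrict (coeff p) J i else 0) = p" if "p \<in> polys_on J" for p
      by (rule poly_eqI) (use that in \<open>auto simp: fin polys_on_def\<close>)
    show "restrict (coeff (Abs_poly (\<lambda>i. if i \<in> J then f i else 0))) J = f" if "f \<in> PiE J (\<lambda>_. Fq q)" for f :: "nat \<Rightarrow> 'a"
    proof
      fix i show "restrict (coeff (Abs_poly (\<lambda>i. if i \<in> J then f i else 0))) J i = f i"
        using that by (cases "i \<in> J") (auto simp: fin PiE_def extensional_def)
    qed
  qed (auto simp: polys_on_def coeffs_in_def)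
  hence "card (polys_on J) = card (PiE J (\<lambda>_. Fq q :: 'a set))" by (rule bij_betw_same_card)
  thus ?thesis using assms by (simp add: card_PiE card_Fq)
qed

lemma polys_on_diff: "p \<in> polys_on J \<Longrightarrow> p' \<in> polys_on J \<Longrightarrow> p - p' \<in> polys_on J"
  by (auto simp: polys_on_def intro: coeffs_in_intros)

subsection \<open>Residue rings of \<open>\<A>\<close>\<close>

text \<open>The residue field at \<open>P_rho\<close> has basis \<open>1, \<zeta>\<close> over
  \<open>F_q\<close>. The residue \<open>u\<close> of \<open>g / h\<close> is fixed by
  \<open>F\<close> applied twice, and its coordinates come from solving
  \<open>u = a + b \<zeta>\<close> together with the conjugate equation.\<close>

lemma conj_dual: assumes h: "h \<in> coeffs_in (Fq q)" "poly h \<zeta> \<noteq> 0" and g: "g \<in> coeffs_in (Fq q)"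
  shows "\<exists>f\<in>coeffs_in (Fq q). degree f \<le> 1 \<and> poly (g - h * f) \<zeta> = 0"
proof -
  define u where "u = poly g \<zeta> / poly h \<zeta>"
  have Fu: "F (F u) = u" using h g by (simp add: u_def F_divide F_poly)
  define b where "b = (u - F u) / (\<zeta> - F \<zeta>)"
  have nz: "\<zeta> - F \<zeta> \<noteq> 0" using zeta_neq by auto
  have "F b = (F u - u) / (F \<zeta> - \<zeta>)" by (simp add: b_def F_divide F_diff Fu)
  also have "\<dots> = b" unfolding b_def by (metis minus_diff_eq minus_divide_divide)
  finally have b: "F b = b" .
  define a where "a = u - b * \<zeta>"
  have bz: "b * (\<zeta> - F \<zeta>) = u - F u" using nz by (simp add: b_def)
  have "F a = F u - b * F \<zeta>" by (simp add: a_def F_diff F_mult b)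
  also have "\<dots> = a" using bz by (simp add: a_def algebra_simps)
  finally have a: "F a = a" .
  have "poly (g - h * [:a, b:]) \<zeta> = poly g \<zeta> - poly h \<zeta> * u" by (simp add: a_def algebra_simps)
  also have "\<dots> = 0" using h by (simp add: u_def)
  finally show ?thesis using a b by (intro bexI[of _ "[:a, b:]"]) (auto simp: coeffs_in_pCons in_Fq)
qed

text \<open>The assumption \<open>poly h \<zeta> \<noteq> 0\<close> says that \<open>a\<close> has
  pole order exactly \<open>n\<close>. Multiples of \<open>a\<close> lower the pole order of any
  element down to \<open>n\<close>; one more constant multiple kills the coefficient at
  \<open>degree h\<close>. So fractions of exponent \<open>n\<close> without that coefficient form a
  transversal, of dimension \<open>2 n\<close>.\<close>

lemma card_principal:
  assumes h: "h \<in> coeffs_in (Fq q)" "degree h \<le> 2 * n" "poly h \<zeta> \<noteq> 0" and a: "a = poly h t / \<rho> ^ n"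
  shows "card (carrier (A Quot (PIdl\<^bsub>A\<^esub> a))) = q ^ (2 * n)"
proof -
  have aA: "a \<in> Ipow 0" unfolding a using h by (intro IpowI) auto
  interpret R: cring A by (rule A_cring)
  have N: "ideal (PIdl\<^bsub>A\<^esub> a) A" using R.cgenideal_ideal aA by simp
  have PI: "PIdl\<^bsub>A\<^esub> a = {c * a | c. c \<in> Ipow 0}" by (simp add: cgenideal_def)
  have h0: "h \<noteq> 0" using h by auto
  define d where "d = degree h"
  let ?J = "{..2 * n} - {d}"
  let ?S = "(\<lambda>p. poly p t / \<rho> ^ n) ` polys_on ?J"
  have JP: "p \<in> coeffs_in (Fq q)" "degree p \<le> 2 * n" "coeff p d = 0" if "p \<in> polys_on ?J" for p
    using that by (auto simp: polys_on_def intro!: degree_le)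
  have inj: "inj_on (\<lambda>p. poly p t / \<rho> ^ n) (polys_on ?J)"
    by (rule inj_onI) (use rho_neq_0 in \<open>auto intro!: poly_t_eq simp: polys_on_def\<close>)
  have "card (carrier (A Quot (PIdl\<^bsub>A\<^esub> a))) = card ?S"
  proof (rule card_Quot[OF N])
    show "?S \<subseteq> Ipow 0" using JP by (auto intro!: IpowI)
    fix b assume "b \<in> Ipow 0"
    have "\<exists>s\<in>?S. poly g t / \<rho> ^ m - s \<in> PIdl\<^bsub>A\<^esub> a" if "g \<in> coeffs_in (Fq q)" "degree g \<le> 2 * m" "m \<ge> n" for g m
      using that(3,1,2)
    proof (induction m arbitrary: g rule: dec_induct)
      case base
      define c where "c = coeff g d / coeff h d"
      have "coeff h d \<noteq> 0" using h0 by (simp add: d_def)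
      moreover have c: "c \<in> Fq q" using base(1) h(1) unfolding c_def coeffs_in_def by (auto intro!: sfieldD(8))
      ultimately have "g - smult c h \<in> polys_on ?J"
        using base h by (auto simp: polys_on_def c_def coeff_eq_0 intro!: coeffs_in_intros)
      moreover have "poly g t / \<rho> ^ n - poly (g - smult c h) t / \<rho> ^ n = c * a"
        by (simp add: a diff_divide_distrib)
      moreover have "c * a \<in> PIdl\<^bsub>A\<^esub> a" unfolding PI using Fq_Ipow[OF c] by blast
      ultimately show ?case by (metis image_eqI)
    next
      case (step m)
      \<comment> \<open>The leading pole is removed: \<open>g - h f\<close> vanishes at
        \<open>\<zeta>\<close>, hence is divisible by \<open>rp\<close>, which lowers the exponent
        by one.\<close>
      obtain f where f: "f \<in> coeffs_in (Fq q)" "degree f \<le> 1" "poly (g - h * f) \<zeta> = 0"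
        using conj_dual[OF h(1,3) step.prems(1)] by blast
      have "g - h * f \<in> coeffs_in (Fq q)" by (intro coeffs_in_intros sfield_Fq f h step.prems)
      from rp_dvd[OF this conj_zeta f(3)] obtain g' where g': "g' \<in> coeffs_in (Fq q)" "g - h * f = rp * g'" by blast
      have "degree (h * f) \<le> 2 * Suc m"
      proof -
        have "degree (h * f) \<le> 2 * n + 1" using degree_mult_le[of h f] f(2) h(2) by linarith
        also have "\<dots> \<le> 2 * Suc m" using step.hyps by simp
        finally show ?thesis .
      qed
      hence "degree (rp * g') \<le> 2 * Suc m" using step.prems(2) by (simp flip: g'(2) add: degree_diff_le)
      hence "degree g' \<le> 2 * m" by (cases "g' = 0") (auto simp: degree_mult_eq)
      from step.IH[OF g'(1) this] obtain s where s: "s \<in> ?S" "poly g' t / \<rho> ^ m - s \<in> PIdl\<^bsub>A\<^esub> a" by blast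
      define c where "c = poly f t / \<rho> ^ (Suc m - n)"
      have c: "c \<in> Ipow 0" unfolding c_def using f step.hyps by (intro IpowI) auto
      have "poly g t = \<rho> * poly g' t + poly h t * poly f t"
        using arg_cong[OF g'(2), of "\<lambda>p. poly p t"] by (simp add: rho_eq(1) algebra_simps)
      hence "poly g t / \<rho> ^ Suc m = poly g' t / \<rho> ^ m + poly f t * poly h t / \<rho> ^ Suc m"
        using rho_neq_0 by (simp add: add_divide_distrib mult.commute)
      also have "poly f t * poly h t / \<rho> ^ Suc m = c * a"
      proof -
        have "\<rho> ^ Suc m = \<rho> ^ (Suc m - n) * \<rho> ^ n" using step.hyps by (simp flip: power_add del: power_Suc)
        thus ?thesis by (simp only: c_def a times_divide_times_eq)
      qed
      finally have "poly g t / \<rho> ^ Suc m = poly g' t / \<rho> ^ m + c * a" .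
      moreover obtain c' where "poly g' t / \<rho> ^ m - s = c' * a" "c' \<in> Ipow 0" using s unfolding PI by blast
      ultimately have "poly g t / \<rho> ^ Suc m - s = (c' + c) * a" "c' + c \<in> Ipow 0"
        using c by (simp_all add: algebra_simps Ipow_add)
      thus ?case using s(1) unfolding PI by blast
    qed
    moreover obtain g m where "g \<in> coeffs_in (Fq q)" "g = 0 \<or> degree g + 0 \<le> 2 * m" "b = poly g t / \<rho> ^ m" "m \<ge> n"
      using IpowE[OF \<open>b \<in> Ipow 0\<close>] by metis
    ultimately show "\<exists>s\<in>?S. b - s \<in> PIdl\<^bsub>A\<^esub> a"
      by (metis (no_types, lifting) add_0_right degree_0 zero_le)
  next
    fix s s' assume "s \<in> ?S" "s' \<in> ?S" and d: "s - s' \<in> PIdl\<^bsub>A\<^esub> a"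
    then obtain p p' where p: "p \<in> polys_on ?J" "s = poly p t / \<rho> ^ n" and p': "p' \<in> polys_on ?J" "s' = poly p' t / \<rho> ^ n"
      by blast
    define g where "g = p - p'"
    have g: "g \<in> polys_on ?J" "s - s' = poly g t / \<rho> ^ n"
      using p p' by (auto simp: g_def polys_on_diff diff_divide_distrib)
    from d obtain c where c: "s - s' = c * a" "c \<in> Ipow 0" unfolding PI by blast
    \<comment> \<open>Pole orders add, and \<open>c a\<close> has pole order at most
      \<open>n\<close>, as \<open>a\<close> itself has exactly \<open>n\<close>. So \<open>c\<close>
      has no pole at all and is a constant; the comparison is made by evaluating at
      \<open>\<zeta>\<close>.\<close>
    have c': "c \<in> Fq q"
    proof (cases "c = 0")
      case False
      obtain P Q where PQ: "P \<in> coeffs_in (Fq q)" "Q \<in> coeffs_in (Fq q)" "c = poly P x + poly Q x * y"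
        using Ipow_rep[OF c(2)] by blast
      define m where "m = pole_order P Q"
      obtain f where f: "f \<in> coeffs_in (Fq q)" "degree f \<le> 2 * m" "poly f \<zeta> \<noteq> 0" "c = poly f t / \<rho> ^ m"
      proof -
        have "P \<noteq> 0 \<or> Q \<noteq> 0" using PQ(3) False by auto
        from rep_pole[OF PQ(1,2) this] PQ(3) that show ?thesis unfolding m_def by metis
      qed
      have "poly (g * rp ^ m) t = poly (f * h) t"
        using c(1) g(2) rho_neq_0 by (simp add: f(4) a rho_eq(1)[symmetric] field_simps)
      hence eq: "g * rp ^ m = f * h"
        by (intro poly_t_eq coeffs_in_intros sfield_Fq f h rp_in JP[OF g(1)])
      have "m = 0"
      proof (rule ccontr)
        assume "m \<noteq> 0"
        hence "poly (g * rp ^ m) \<zeta> = 0" using rp_root[of \<zeta>] by (simp add: power_0_left)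
        thus False unfolding eq using f h by simp
      qed
      then obtain b where "f = [:b:]" using f(2) degree_eq_zeroE by auto
      thus ?thesis using f \<open>m = 0\<close> by simp
    qed simp
    have "poly g t = poly (smult c h) t" using c(1) g(2) rho_neq_0 by (simp add: a field_simps)
    hence eq: "g = smult c h" by (intro poly_t_eq coeffs_in_intros sfield_Fq h c' JP[OF g(1)])
    hence "c * coeff h d = 0" using JP(3)[OF g(1)] by simp
    hence "c = 0" using h0 by (simp add: d_def)
    thus "s = s'" using c(1) by simp
  qed
  also have "\<dots> = q ^ card ?J" by (simp add: card_image[OF inj] card_polys_on)
  also have "card ?J = 2 * n" using h(2) by (simp add: d_def)
  finally show ?thesis .
qed

lemma A_deg_eq:
  assumes "h \<in> coeffs_in (Fq q)" "degree h \<le> 2 * n" "poly h \<zeta> \<noteq> 0" "a = poly h t / \<rho> ^ n"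
  shows "A_deg q \<zeta> t a = real (2 * n)"
  unfolding A_deg_def card_principal[OF assms] using q_gt1 by (simp add: log_nat_power)

text \<open>Both elements vanish to order exactly \<open>k\<close> at
  \<open>t = \<infinity>\<close>. Over the common denominator \<open>\<rho> ^ (m + n)\<close> the
  quotient of the leading coefficients cancels the top terms.\<close>

lemma cancel_lead:
  assumes g: "g \<in> coeffs_in (Fq q)" "g \<noteq> 0" "degree g + k = 2 * m"
    and h: "h \<in> coeffs_in (Fq q)" "h \<noteq> 0" "degree h + k = 2 * n"
  shows "\<exists>c\<in>Fq q. poly g t / \<rho> ^ m - c * (poly h t / \<rho> ^ n) \<in> Ipow (Suc k)"
proof -
  define c where "c = lead_coeff g / lead_coeff h"
  have c: "c \<in> Fq q" "c \<noteq> 0" using g h unfolding c_def coeffs_in_def by (auto intro!: sfieldD(8))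
  define f where "f = g * rp ^ n - smult c (h * rp ^ m)"
  have lc: "lead_coeff (f * rp ^ l) = lead_coeff f" for f l
    by (simp only: lead_coeff_mult lead_coeff_power lead_rp power_one mult_1_right)
  have dg: "degree (f * rp ^ l) = degree f + 2 * l" if "f \<noteq> 0" for f l
    using that by (simp add: degree_mult_eq degree_power_eq)
  have d1: "degree (g * rp ^ n) = degree g + 2 * n" "lead_coeff (g * rp ^ n) = lead_coeff g"
    using dg[OF g(2)] lc by blast+
  have d2: "degree (smult c (h * rp ^ m)) = degree h + 2 * m" using dg[OF h(2)] c by simp
  have "lead_coeff (smult c (h * rp ^ m)) = c * lead_coeff h" by (simp only: lead_coeff_smult lc)
  also have "\<dots> = lead_coeff g" using h by (simp add: c_def)
  finally have d3: "lead_coeff (smult c (h * rp ^ m)) = lead_coeff g" .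
  have d: "degree g + 2 * n = degree h + 2 * m" using g h by simp
  have "degree f \<le> degree g + 2 * n" unfolding f_def using d1 d2 d by (intro degree_diff_le) auto
  moreover have "coeff f (degree g + 2 * n) = 0"
    using d1 d2 d3 d unfolding f_def coeff_diff by (metis diff_self)
  ultimately have "f = 0 \<or> degree f < degree g + 2 * n" by (metis le_neq_implies_less leading_coeff_0_iff)
  hence "f = 0 \<or> degree f + Suc k \<le> 2 * (m + n)" using g(3) by auto
  moreover have "f \<in> coeffs_in (Fq q)" unfolding f_def by (intro coeffs_in_intros sfield_Fq g h c rp_in)
  ultimately have "poly f t / \<rho> ^ (m + n) \<in> Ipow (Suc k)" by (intro IpowI)
  moreover have "poly f t / \<rho> ^ (m + n) = poly g t / \<rho> ^ m - c * (poly h t / \<rho> ^ n)"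
    using rho_neq_0 by (simp add: f_def rho_eq(1)[symmetric] power_add diff_divide_distrib)
  ultimately show ?thesis using c by auto
qed

lemma X_pow_in: "[:0, 1:] ^ k \<in> coeffs_in (Fq q)"
  by (intro coeffs_in_intros(10)) (auto simp: coeffs_in_pCons)

lemma X_pow: "degree ([:0, 1:] ^ k :: 'a poly) = k" "poly ([:0, 1:] ^ k) t / \<rho> ^ k = y ^ k" "[:0, 1:] ^ k \<noteq> (0 :: 'a poly)"
  by (simp_all add: degree_power_eq xy_eq(2) power_divide)

text \<open>\<open>y\<close> is a uniformizer at \<open>t = \<infinity>\<close>, so each graded
  piece of the \<open>I\<^sub>\<infinity>\<close>-adic filtration is the line spanned by
  \<open>y ^ k\<close>.\<close>

lemma Ipow_step: assumes "a \<in> Ipow k" shows "\<exists>c\<in>Fq q. a - c * y ^ k \<in> Ipow (Suc k)"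
proof -
  obtain g m where g: "g \<in> coeffs_in (Fq q)" "g = 0 \<or> degree g + k \<le> 2 * m" "a = poly g t / \<rho> ^ m" "m \<ge> 0"
    using IpowE[OF assms] by metis
  show ?thesis
  proof (cases "g \<noteq> 0 \<and> degree g + k = 2 * m")
    case True
    hence True': "g \<noteq> 0" "degree g + k = 2 * m" by auto
    have "degree ([:0, 1:] ^ k :: 'a poly) + k = 2 * k" by (simp add: X_pow)
    from cancel_lead[OF g(1) True' X_pow_in X_pow(3) this]
    show ?thesis unfolding X_pow(2) g(3) .
  next
    case False
    hence "a \<in> Ipow (Suc k)" unfolding g(3) using g(2) by (intro IpowI g) auto
    thus ?thesis by (intro bexI[of _ 0]) auto
  qed
qed

text \<open>\<open>\<A>/I\<^sup>k\<close> is local with principal maximal ideal: every element outside \<open>I\<^sup>k\<close> divides the socle.\<close>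

lemma Ipow_socle:
  assumes b: "b \<in> Ipow 0" "b \<notin> Ipow (Suc k)" and a: "a \<in> Ipow k"
  shows "\<exists>c\<in>Ipow 0. a - b * c \<in> Ipow (Suc k)"
proof -
  obtain h n where h: "h \<in> coeffs_in (Fq q)" "h = 0 \<or> degree h + 0 \<le> 2 * n" "b = poly h t / \<rho> ^ n" "n \<ge> 0"
    using IpowE[OF b(1)] by metis
  have nd: "\<not> (h = 0 \<or> degree h + Suc k \<le> 2 * n)"
    using b(2) IpowI[OF h(1), of "Suc k" n] unfolding h(3) by blast
  hence h0: "h \<noteq> 0" and hk: "degree h + Suc k > 2 * n" by auto
  define r where "r = 2 * n - degree h"
  have r: "degree h + r = 2 * n" "r \<le> k" using h(2) h0 hk by (auto simp: r_def)
  define s where "s = k - r"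
  let ?h = "h * [:0, 1:] ^ s"
  have dh: "?h \<in> coeffs_in (Fq q)" "?h \<noteq> 0" "degree ?h + k = 2 * (n + s)"
    using h(1) h0 r X_pow_in[of s] X_pow[of s] by (auto simp: degree_mult_eq s_def intro!: coeffs_in_intros(6))
  have ph: "poly ?h t / \<rho> ^ (n + s) = b * y ^ s"
    by (simp add: h(3) xy_eq(2) power_add power_divide)
  have ys: "y ^ s \<in> Ipow 0"
    using y_Ipow Ipow_mono[of 0 1] by (induction s) (auto intro: Ipow_absorb)
  obtain g m where g: "g \<in> coeffs_in (Fq q)" "g = 0 \<or> degree g + k \<le> 2 * m" "a = poly g t / \<rho> ^ m" "m \<ge> 0"
    using IpowE[OF a] by metis
  show ?thesis
  proof (cases "g \<noteq> 0 \<and> degree g + k = 2 * m")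
    case True
    hence True': "g \<noteq> 0" "degree g + k = 2 * m" by auto
    obtain c where "c \<in> Fq q" "a - c * (b * y ^ s) \<in> Ipow (Suc k)"
      using cancel_lead[OF g(1) True' dh] unfolding ph g(3)[symmetric] by (elim bexE)
    thus ?thesis using ys by (intro bexI[of _ "c * y ^ s"]) (auto simp: Ipow_absorb Fq_Ipow mult.left_commute)
  next
    case False
    hence "a \<in> Ipow (Suc k)" unfolding g(3) using g(2) by (intro IpowI g) auto
    thus ?thesis by (intro bexI[of _ 0]) auto
  qed
qed

text \<open>\<open>y\<close> vanishes to order exactly one at \<open>t = \<infinity>\<close>;
  compare degrees in \<open>X h rp ^ m = g rp ^ Suc n\<close>.\<close>

lemma y_cancel: assumes "b \<in> Ipow 0" "y * b \<in> Ipow (Suc k)" shows "b \<in> Ipow k"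
proof -
  obtain h n where h: "h \<in> coeffs_in (Fq q)" "h = 0 \<or> degree h + 0 \<le> 2 * n" "b = poly h t / \<rho> ^ n" "n \<ge> 0"
    using IpowE[OF assms(1)] by metis
  obtain g m where g: "g \<in> coeffs_in (Fq q)" "g = 0 \<or> degree g + Suc k \<le> 2 * m" "y * b = poly g t / \<rho> ^ m" "m \<ge> 0"
    using IpowE[OF assms(2)] by metis
  have "poly ([:0,1:] * h * rp ^ m) t = poly (g * rp ^ Suc n) t"
    using g(3) rho_neq_0 by (simp add: h(3) xy_eq(2) rho_eq(1)[symmetric] field_simps)
  hence eq: "[:0,1:] * h * rp ^ m = g * rp ^ Suc n"
    by (intro poly_t_eq coeffs_in_intros(6,10) sfield_Fq h g rp_in) (simp add: coeffs_in_pCons)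
  show ?thesis
  proof (cases "h = 0")
    case False
    have "degree ([:0,1:] * h * rp ^ m) = 1 + degree h + 2 * m"
      using False by (simp add: degree_mult_eq degree_power_eq)
    moreover have "g \<noteq> 0" using False eq by auto
    moreover from this have "degree (g * rp ^ Suc n) = degree g + 2 * Suc n"
      by (subst degree_mult_eq) (simp_all add: degree_power_eq del: power_Suc)
    ultimately have "1 + degree h + 2 * m = degree g + 2 * Suc n" by (simp only: eq)
    moreover have "degree g + Suc k \<le> 2 * m" using g(2) \<open>g \<noteq> 0\<close> by simp
    ultimately have "degree h + k \<le> 2 * n" by auto
    thus ?thesis unfolding h(3) by (intro IpowI h) simp
  qed (simp add: h)
qed

text \<open>Truncated \<open>y\<close>-adic expansions with coefficients in \<open>F_q\<close> form
  a transversal.\<close>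

lemma card_Ipow_Quot: "card (carrier (A Quot Ipow k)) = q ^ k"
proof -
  have rep: "\<exists>c\<in>polys_on {..<k}. a - poly c y \<in> Ipow k" if "a \<in> Ipow 0" for a
  proof (induction k)
    case 0
    show ?case using that by (intro bexI[of _ 0]) (auto simp: polys_on_def)
  next
    case (Suc k)
    then obtain c where c: "c \<in> polys_on {..<k}" "a - poly c y \<in> Ipow k" by blast
    obtain b where b: "b \<in> Fq q" "a - poly c y - b * y ^ k \<in> Ipow (Suc k)" using Ipow_step[OF c(2)] by blast
    show ?case
    proof (intro bexI)
      show "a - poly (c + Polynomial.monom b k) y \<in> Ipow (Suc k)" using b by (simp add: poly_monom algebra_simps)
      show "c + Polynomial.monom b k \<in> polys_on {..<Suc k}"
        using b c by (auto simp: polys_on_def intro!: coeffs_in_intros)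
    qed
  qed
  have uniq: "c = 0" if "c \<in> polys_on {..<k}" "poly c y \<in> Ipow k" for c
    using that
  proof (induction k arbitrary: c)
    case 0
    thus ?case by (auto simp: polys_on_def poly_eq_iff)
  next
    case (Suc k)
    obtain b c' where c: "c = pCons b c'" by (cases c)
    have bc: "b \<in> Fq q" "c' \<in> coeffs_in (Fq q)" using Suc.prems(1) unfolding c polys_on_def by (auto simp: coeffs_in_pCons)
    have y0: "y \<in> Ipow 0" using y_Ipow Ipow_mono[of 0 1] by auto
    have c'I: "poly c' y \<in> Ipow 0" by (intro poly_Ipow bc y0)
    have "b + y * poly c' y \<in> Ipow 1" using Suc.prems(2) Ipow_mono[of 1 "Suc k"] by (auto simp: c)
    moreover have "y * poly c' y \<in> Ipow 1" using Ipow_absorb[OF c'I y_Ipow] by (simp add: mult.commute)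
    ultimately have "b + y * poly c' y - y * poly c' y \<in> Ipow 1" by (rule Ipow_diff)
    hence b0: "b = 0" using const_Ipow1 bc by simp
    have "poly c y = y * poly c' y" by (simp add: c b0)
    hence "poly c' y \<in> Ipow k" using Suc.prems(2) by (intro y_cancel[OF c'I]) (simp only:)
    moreover have "c' \<in> polys_on {..<k}"
      unfolding polys_on_def
    proof (intro CollectI conjI allI impI bc)
      fix i assume "i \<notin> {..<k}"
      hence "coeff c (Suc i) = 0" using Suc.prems(1) by (auto simp: polys_on_def)
      thus "coeff c' i = 0" by (simp add: c)
    qed
    ultimately have "c' = 0" by (rule Suc.IH[rotated])
    thus ?case using b0 c by simp
  qed
  have y0: "y \<in> Ipow 0" using y_Ipow Ipow_mono[of 0 1] by auto
  have inj: "inj_on (\<lambda>c. poly c y) (polys_on {..<k})"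
  proof (rule inj_onI)
    fix c c' assume c: "c \<in> polys_on {..<k}" "c' \<in> polys_on {..<k}" "poly c y = poly c' y"
    have "c - c' = 0" by (rule uniq) (use c in \<open>auto intro: polys_on_diff\<close>)
    thus "c = c'" by simp
  qed
  have "card (carrier (A Quot Ipow k)) = card ((\<lambda>c. poly c y) ` polys_on {..<k})"
  proof (rule card_Quot[OF Ipow_ideal])
    show "(\<lambda>c. poly c y) ` polys_on {..<k} \<subseteq> Ipow 0"
      using poly_Ipow[OF _ y0] by (auto simp: polys_on_def)
    show "\<exists>s\<in>(\<lambda>c. poly c y) ` polys_on {..<k}. a - s \<in> Ipow k" if "a \<in> Ipow 0" for a
      using rep[OF that] by blast
    fix s s' assume "s \<in> (\<lambda>c. poly c y) ` polys_on {..<k}" "s' \<in> (\<lambda>c. poly c y) ` polys_on {..<k}" "s - s' \<in> Ipow k"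
    then obtain c c' where c: "c \<in> polys_on {..<k}" "s = poly c y" "c' \<in> polys_on {..<k}" "s' = poly c' y" by blast
    have "c - c' = 0" by (rule uniq) (use c \<open>s - s' \<in> Ipow k\<close> in \<open>auto intro: polys_on_diff\<close>)
    thus "s = s'" using c by simp
  qed
  thus ?thesis by (simp add: card_image[OF inj] card_polys_on)
qed

subsection \<open>Rank two modules from pairs of quadratic twisted polynomials\<close>

text \<open>\<open>M\<close> generates the left ideal of \<open>I\<^sub>\<infinity>\<close>, and \<open>B\<close> is the image of \<open>M\<close> under multiplication by \<open>t\<close>;
  the module is \<open>x \<mapsto> U M\<close>, \<open>y \<mapsto> V M\<close>. In the skew field of fractions \<open>U\<inverse> = B M\<inverse> B - tr B + nm M\<close>.\<close>

definition module_data :: "'a poly \<Rightarrow> 'a poly \<Rightarrow> 'a poly \<Rightarrow> 'a poly \<Rightarrow> bool" where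
  "module_data M B U V \<longleftrightarrow> U \<noteq> 0 \<and> U \<star> B = V \<star> M \<and> B \<star> U = M \<star> V \<and>
     V \<star> B - smult tr (V \<star> M) + smult nm (U \<star> M) = 1"

text \<open>Consequences of the skew field picture proved without inverses: associate a product in
  two ways, or multiply by \<open>U\<close> and cancel it. The first two become the relations
  between the images of \<open>x\<close> and \<open>y\<close>; the third shows that these images
  generate \<open>M\<close> as a left ideal.\<close>

lemma module_data_props:
  assumes "module_data M B U V"
  shows "U \<star> M \<star> V = V \<star> M \<star> U"
    "V \<star> M \<star> V - smult tr (U \<star> M \<star> V) + smult nm (U \<star> M \<star> U) = U"
    "B \<star> V - smult tr (M \<star> V) + smult nm (M \<star> U) = 1"
    "M \<noteq> 0"
proof -
  have U: "U \<noteq> 0" and d: "U \<star> B = V \<star> M" "B \<star> U = M \<star> V"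
    "V \<star> B - smult tr (V \<star> M) + smult nm (U \<star> M) = 1"
    using assms unfolding module_data_def by auto
  show "M \<noteq> 0"
  proof
    assume "M = 0"
    hence "B = 0" using d(1) U by simp
    thus False using d(3) \<open>M = 0\<close> by simp
  qed
  show 1: "U \<star> M \<star> V = V \<star> M \<star> U"
    by (simp only: tmult_assoc d(2)[symmetric]) (simp only: d(1) flip: tmult_assoc)
  have "(V \<star> B - smult tr (V \<star> M) + smult nm (U \<star> M)) \<star> U = U" using d(3) by simp
  hence "V \<star> (B \<star> U) - smult tr (V \<star> M \<star> U) + smult nm (U \<star> M \<star> U) = U"
    by (simp add: tmult_add tmult_diff smult_tmult tmult_assoc)
  thus 2: "V \<star> M \<star> V - smult tr (U \<star> M \<star> V) + smult nm (U \<star> M \<star> U) = U"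
    using 1 by (simp add: d(2) tmult_assoc)
  have "U \<star> (B \<star> V - smult tr (M \<star> V) + smult nm (M \<star> U)) =
     V \<star> M \<star> V - smult tr (U \<star> M \<star> V) + smult nm (U \<star> M \<star> U)"
    by (simp add: tmult_add tmult_diff tmult_smult tr_Fq nm_Fq d(1) flip: tmult_assoc)
  also have "\<dots> = U \<star> 1" using 2 by simp
  finally show "B \<star> V - smult tr (M \<star> V) + smult nm (M \<star> U) = 1" using U tmult_left_cancel by blast
qed

text \<open>An isogeny need only be checked on \<open>M\<close> and \<open>B\<close>. The defects
  \<open>a\<close> and \<open>b\<close> of the two conclusions satisfy the homogeneous form of the
  defining identities; multiplying \<open>a\<close> by the third identity of
  \<open>module_data_props\<close> then gives \<open>a = 0\<close>, and \<open>b M = a B\<close>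
  finishes.\<close>

lemma isogeny_data:
  assumes D: "module_data M B U V" and D': "module_data M' B' U' V'"
    and M: "M' \<star> w = g \<star> M" and B: "B' \<star> w = g \<star> B"
  shows "U' \<star> g = w \<star> U" "V' \<star> g = w \<star> V"
proof -
  note d = D[unfolded module_data_def] and d' = D'[unfolded module_data_def]
  define a where "a = U' \<star> g - w \<star> U"
  define b where "b = V' \<star> g - w \<star> V"
  have "U' \<star> g \<star> B = U' \<star> B' \<star> w" by (simp add: tmult_assoc B)
  also have "\<dots> = V' \<star> M' \<star> w" using d' by simp
  also have "\<dots> = V' \<star> g \<star> M" by (simp add: tmult_assoc M)
  finally have aR: "a \<star> B = b \<star> M" using d by (simp add: a_def b_def tmult_diff tmult_assoc)
  have "(V' \<star> B' - smult tr (V' \<star> M') + smult nm (U' \<star> M')) \<star> w = w" using d' by simp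
  hence 1: "V' \<star> g \<star> B - smult tr (V' \<star> g \<star> M) + smult nm (U' \<star> g \<star> M) = w"
    by (simp add: tmult_add tmult_diff smult_tmult tmult_assoc B M)
  have "w \<star> (V \<star> B - smult tr (V \<star> M) + smult nm (U \<star> M)) = w" using d by simp
  hence 2: "w \<star> V \<star> B - smult tr (w \<star> V \<star> M) + smult nm (w \<star> U \<star> M) = w"
    by (simp add: tmult_add tmult_diff tmult_smult tr_Fq nm_Fq flip: tmult_assoc)
  have bR: "b \<star> B - smult tr (b \<star> M) + smult nm (a \<star> M) = 0"
  proof -
    have "b \<star> B - smult tr (b \<star> M) + smult nm (a \<star> M) =
      (V' \<star> g \<star> B - smult tr (V' \<star> g \<star> M) + smult nm (U' \<star> g \<star> M)) -
      (w \<star> V \<star> B - smult tr (w \<star> V \<star> M) + smult nm (w \<star> U \<star> M))"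
      unfolding a_def b_def by (simp add: tmult_diff smult_diff_right)
    also have "\<dots> = 0" unfolding 1 2 by simp
    finally show ?thesis .
  qed
  have eq: "a \<star> (M \<star> V) = b \<star> (M \<star> U)"
    using d by (simp add: aR flip: tmult_assoc) (metis aR d tmult_assoc)
  have "b \<star> B \<star> U = smult tr (b \<star> M \<star> U) - smult nm (a \<star> M \<star> U)"
    using arg_cong[OF bR, of "\<lambda>f. f \<star> U"] by (simp add: tmult_add tmult_diff smult_tmult algebra_simps)
  hence bMY: "b \<star> (M \<star> V) = smult tr (b \<star> (M \<star> U)) - smult nm (a \<star> (M \<star> U))"
    using d by (simp add: tmult_assoc)
  have "a = a \<star> (B \<star> V - smult tr (M \<star> V) + smult nm (M \<star> U))"
    using module_data_props(3)[OF D] by simp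
  also have "\<dots> = a \<star> B \<star> V - smult tr (a \<star> (M \<star> V)) + smult nm (a \<star> (M \<star> U))"
    by (simp add: tmult_add tmult_diff tmult_smult tr_Fq nm_Fq tmult_assoc)
  also have "\<dots> = b \<star> (M \<star> V) - smult tr (b \<star> (M \<star> U)) + smult nm (a \<star> (M \<star> U))"
    by (simp add: aR eq tmult_assoc)
  also have "\<dots> = 0" using bMY by simp
  finally have a0: "a = 0" .
  hence "b \<star> M = 0" using aR by simp
  moreover have "M \<noteq> 0" by (rule module_data_props(4)[OF D])
  ultimately have "b = 0" by simp
  show "U' \<star> g = w \<star> U" "V' \<star> g = w \<star> V" using a0 \<open>b = 0\<close> by (simp_all add: a_def b_def)
qed

section \<open>Homomorphisms out of A from its presentation\<close>

text \<open>The value of the polynomial \<open>P\<close> at \<open>f\<close> in the twisted ring. It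
  is multiplicative for \<open>P\<close> over \<open>F_q\<close>, where the coefficients are
  central.\<close>

definition pev :: "'a poly \<Rightarrow> 'a poly \<Rightarrow> 'a poly" where
  "pev f P = foldr (\<lambda>a g. [:a:] + f \<star> g) (coeffs P) 0"

lemma pev_0 [simp]: "pev f 0 = 0" by (simp add: pev_def)

lemma pev_pCons: "pev f (pCons a P) = [:a:] + f \<star> pev f P"
  by (cases "a = 0 \<and> P = 0") (auto simp: pev_def cCons_def)

lemma pev_1 [simp]: "pev f 1 = 1"
  by (simp add: pev_pCons one_pCons)

lemma pev_add: "pev f (P + Q) = pev f P + pev f Q"
  by (induction P Q rule: poly_induct2) (auto simp: pev_pCons tmult_add)

lemma pev_smult: "c \<in> Fq q \<Longrightarrow> pev f (smult c P) = smult c (pev f P)"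
  by (induction P) (auto simp: pev_pCons tmult_smult smult_add_right)

lemma pev_mult: "P \<in> coeffs_in (Fq q) \<Longrightarrow> pev f (P * Q) = pev f P \<star> pev f Q"
proof (induction P)
  case (pCons a P)
  thus ?case
    by (simp add: coeffs_in_pCons pev_add pev_smult pev_pCons tmult_add tmult_assoc const_tmult)
qed simp

lemma pev_commute: "g \<star> f = f \<star> g \<Longrightarrow> P \<in> coeffs_in (Fq q) \<Longrightarrow> g \<star> pev f P = pev f P \<star> g"
proof (induction P)
  case (pCons a P)
  have "g \<star> (f \<star> pev f P) = f \<star> (g \<star> pev f P)" using pCons.prems(1) by (metis tmult_assoc)
  thus ?case using pCons
    by (simp add: coeffs_in_pCons pev_pCons tmult_add tmult_assoc tmult_Fq const_tmult)
qed simp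

text \<open>For \<open>a\<close> in \<open>A\<close> the chosen pair exists by
  \<open>Ipow_rep\<close> and is unique by \<open>rep_unique\<close>.\<close>

definition alg_hom :: "'a poly \<Rightarrow> 'a poly \<Rightarrow> 'a \<Rightarrow> 'a poly" where
  "alg_hom fx fy a = (let (P, Q) = (SOME (P, Q). P \<in> coeffs_in (Fq q) \<and> Q \<in> coeffs_in (Fq q) \<and>
     a = poly P x + poly Q x * y) in pev fx P + pev fx Q \<star> fy)"

lemma alg_hom_rep:
  assumes "P \<in> coeffs_in (Fq q)" "Q \<in> coeffs_in (Fq q)"
  shows "alg_hom fx fy (poly P x + poly Q x * y) = pev fx P + pev fx Q \<star> fy"
proof -
  have "(SOME (P', Q'). P' \<in> coeffs_in (Fq q) \<and> Q' \<in> coeffs_in (Fq q) \<and>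
     poly P x + poly Q x * y = poly P' x + poly Q' x * y) = (P, Q)"
    by (rule some_equality) (use assms rep_unique[OF assms] in \<open>auto\<close>)
  thus ?thesis by (simp add: alg_hom_def)
qed

lemma twisted_ring_simps [simp]: "carrier (twisted_ring q) = UNIV" "monoid.mult (twisted_ring q) = twist_mult q"
  "monoid.one (twisted_ring q) = 1" "ring.add (twisted_ring q) = (+)"
  by (simp_all add: twisted_ring_def)

text \<open>Multiplying two normal forms \<open>P(x) + Q(x) y\<close> uses only commutativity and
  the replacement of \<open>y * y\<close>, so the hypotheses on \<open>fx\<close> and
  \<open>fy\<close> carry over every product.\<close>

lemma alg_hom_hom:
  assumes comm: "fx \<star> fy = fy \<star> fx" and rel: "fy \<star> fy - smult tr (fx \<star> fy) + smult nm (fx \<star> fx) = fx"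
  shows "Fq_algebra_hom q \<zeta> t (alg_hom fx fy)" "alg_hom fx fy x = fx" "alg_hom fx fy y = fy"
proof -
  let ?\<phi> = "alg_hom fx fy"
  have U: "[:0,1:] \<in> coeffs_in (Fq q)" by (simp add: coeffs_in_pCons)
  have pX: "pev fx [:0,1:] = fx" by (simp add: pev_pCons flip: one_pCons)
  show "?\<phi> x = fx" using alg_hom_rep[OF U Fq_simps(4), of fx fy] by (simp add: pX)
  show "?\<phi> y = fy" using alg_hom_rep[OF Fq_simps(4,5), of fx fy] by simp
  have const: "?\<phi> c = [:c:]" if "c \<in> Fq q" for c
    using alg_hom_rep[of "[:c:]" 0 fx fy] that by (simp add: pev_pCons)
  have "?\<phi> \<in> ring_hom A (twisted_ring q)"
  proof (rule ring_hom_memI)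
    show "?\<phi> \<one>\<^bsub>A\<^esub> = \<one>\<^bsub>twisted_ring q\<^esub>" using const[of 1] by (simp add: one_pCons)
    fix a b assume "a \<in> carrier A" "b \<in> carrier A"
    then obtain P Q P' Q' where a: "P \<in> coeffs_in (Fq q)" "Q \<in> coeffs_in (Fq q)" "a = poly P x + poly Q x * y"
      and b: "P' \<in> coeffs_in (Fq q)" "Q' \<in> coeffs_in (Fq q)" "b = poly P' x + poly Q' x * y"
      using Ipow_rep[of a] Ipow_rep[of b] by auto
    note intros = coeffs_in_intros[OF sfield_Fq]
    have "a + b = poly (P + P') x + poly (Q + Q') x * y" using a b by (simp add: algebra_simps)
    hence "?\<phi> (a + b) = ?\<phi> (poly (P + P') x + poly (Q + Q') x * y)" by (simp only:)
    also have "\<dots> = pev fx (P + P') + pev fx (Q + Q') \<star> fy" by (intro alg_hom_rep intros(3) a b)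
    also have "\<dots> = ?\<phi> a + ?\<phi> b" using a b by (simp add: alg_hom_rep pev_add tmult_add)
    finally show "?\<phi> (a \<oplus>\<^bsub>A\<^esub> b) = ?\<phi> a \<oplus>\<^bsub>twisted_ring q\<^esub> ?\<phi> b" by simp
    \<comment> \<open>Chosen so that \<open>y * y = U2(x) + T(x) y\<close>.\<close>
    define U2 where "U2 = [:0,1:] - smult nm ([:0,1:] * [:0,1:])"
    define T where "T = smult tr [:0,1:]"
    have XT: "U2 \<in> coeffs_in (Fq q)" "T \<in> coeffs_in (Fq q)" unfolding U2_def T_def by (intro intros(4,6,8) U nm_Fq tr_Fq)+
    define P1 where "P1 = P * P' + Q * Q' * U2"
    define Q1 where "Q1 = P * Q' + Q * P' + Q * Q' * T"
    have in1: "P1 \<in> coeffs_in (Fq q)" "Q1 \<in> coeffs_in (Fq q)"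
      unfolding P1_def Q1_def by (intro intros(3,6) a b XT)+
    have yy: "y * y = (x - nm * (x * x)) + tr * x * y" using xy_relation by (simp add: algebra_simps)
    have "a * b = poly P x * poly P' x + poly Q x * poly Q' x * (y * y) + (poly P x * poly Q' x + poly Q x * poly P' x) * y"
      using a b by (simp add: algebra_simps)
    also have "\<dots> = poly P1 x + poly Q1 x * y"
      unfolding yy P1_def Q1_def U2_def T_def by (simp add: algebra_simps)
    finally have ab: "?\<phi> (a * b) = pev fx P1 + pev fx Q1 \<star> fy" using alg_hom_rep[OF in1] by simp
    have pXX: "pev fx U2 = fx - smult nm (fx \<star> fx)"
    proof -
      have "pev fx (U2 + smult nm ([:0,1:] * [:0,1:])) = pev fx U2 + smult nm (fx \<star> fx)"
        by (simp only: pev_add pev_smult[OF nm_Fq] pev_mult[OF U] pX)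
      moreover have "U2 + smult nm ([:0,1:] * [:0,1:]) = [:0,1:]" by (simp add: U2_def)
      ultimately show ?thesis by (simp add: pX algebra_simps)
    qed
    have pT: "pev fx T = smult tr fx" unfolding T_def by (simp only: pev_smult[OF tr_Fq] pX)
    have ff: "fy \<star> fy = fx - smult nm (fx \<star> fx) + smult tr (fx \<star> fy)" using rel by (simp add: algebra_simps)
    have PQ: "P * P' \<in> coeffs_in (Fq q)" "Q * Q' \<in> coeffs_in (Fq q)" "P * Q' \<in> coeffs_in (Fq q)"
      by (intro intros(6) a b)+
    have c: "fy \<star> pev fx P' = pev fx P' \<star> fy" "fy \<star> pev fx Q' = pev fx Q' \<star> fy"
      using pev_commute[of fy fx] comm b by auto
    have "?\<phi> a \<star> ?\<phi> b = (pev fx P + pev fx Q \<star> fy) \<star> (pev fx P' + pev fx Q' \<star> fy)"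
      using a b by (simp add: alg_hom_rep)
    also have "\<dots> = pev fx P \<star> pev fx P' + pev fx Q \<star> (fy \<star> pev fx P') + pev fx P \<star> pev fx Q' \<star> fy
        + pev fx Q \<star> (fy \<star> pev fx Q') \<star> fy"
      by (simp add: tmult_add tmult_assoc)
    also have "\<dots> = pev fx P \<star> pev fx P' + pev fx Q \<star> pev fx Q' \<star> (fy \<star> fy)
        + (pev fx P \<star> pev fx Q' + pev fx Q \<star> pev fx P') \<star> fy"
      unfolding c by (simp add: tmult_add tmult_assoc)
    also have "\<dots> = pev fx P1 + pev fx Q1 \<star> fy"
      unfolding P1_def Q1_def ff pev_add
      by (simp add: pev_mult a b PQ pXX pT tmult_add tmult_diff tmult_smult tr_Fq nm_Fq tmult_assoc smult_tmult
          del: mult_pCons_left mult_pCons_right smult_pCons)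
    finally show "?\<phi> (a \<otimes>\<^bsub>A\<^esub> b) = ?\<phi> a \<otimes>\<^bsub>twisted_ring q\<^esub> ?\<phi> b" using ab by simp
  qed simp
  thus "Fq_algebra_hom q \<zeta> t ?\<phi>" using const by (simp add: Fq_algebra_hom_def)
qed

lemma Fq_homD:
  assumes "Fq_algebra_hom q \<zeta> t \<phi>"
  shows "a \<in> Ipow 0 \<Longrightarrow> b \<in> Ipow 0 \<Longrightarrow> \<phi> (a + b) = \<phi> a + \<phi> b"
    "a \<in> Ipow 0 \<Longrightarrow> b \<in> Ipow 0 \<Longrightarrow> \<phi> (a * b) = \<phi> a \<star> \<phi> b"
    "c \<in> Fq q \<Longrightarrow> \<phi> c = [:c:]" "\<phi> 0 = 0" "\<phi> 1 = 1"
  using assms ring_hom_add[of \<phi> A "twisted_ring q" a b] ring_hom_mult[of \<phi> A "twisted_ring q" a b]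
  by (auto simp: Fq_algebra_hom_def one_pCons)

lemma xy_Ipow0 [simp]: "x \<in> Ipow 0" "y \<in> Ipow 0"
  using x_Ipow y_Ipow Ipow_mono[of 0 1] Ipow_mono[of 0 2] by auto

lemma Fq_hom_poly:
  assumes \<phi>: "Fq_algebra_hom q \<zeta> t \<phi>" and P: "P \<in> coeffs_in (Fq q)"
  shows "\<phi> (poly P x) = pev (\<phi> x) P"
  using P
proof (induction P)
  case (pCons a P)
  thus ?case using Fq_homD[OF \<phi>] poly_Ipow[of P x]
    by (simp add: coeffs_in_pCons pev_pCons Fq_Ipow Ipow_absorb)
qed (simp add: Fq_homD[OF \<phi>])

lemma Fq_hom_rep:
  assumes \<phi>: "Fq_algebra_hom q \<zeta> t \<phi>" and P: "P \<in> coeffs_in (Fq q)" and Q: "Q \<in> coeffs_in (Fq q)"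
  shows "\<phi> (poly P x + poly Q x * y) = pev (\<phi> x) P + pev (\<phi> x) Q \<star> \<phi> y"
  using Fq_homD[OF \<phi>] poly_Ipow[OF P] poly_Ipow[OF Q] by (simp add: Ipow_absorb Fq_hom_poly[OF \<phi>] P Q)

lemma pev_intertwine:
  "w \<star> f = g \<star> w \<Longrightarrow> P \<in> coeffs_in (Fq q) \<Longrightarrow> w \<star> pev f P = pev g P \<star> w"
proof (induction P)
  case (pCons a P)
  have "w \<star> (f \<star> pev f P) = g \<star> (w \<star> pev f P)" using pCons.prems(1) by (metis tmult_assoc)
  thus ?case using pCons
    by (simp add: coeffs_in_pCons pev_pCons tmult_add tmult_assoc tmult_Fq const_tmult)
qed simp

lemma hom_intertwine:
  assumes \<phi>: "Fq_algebra_hom q \<zeta> t \<phi>" and \<psi>: "Fq_algebra_hom q \<zeta> t \<psi>"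
    and x: "w \<star> \<phi> x = \<psi> x \<star> w" and y: "w \<star> \<phi> y = \<psi> y \<star> w" and a: "a \<in> Ipow 0"
  shows "w \<star> \<phi> a = \<psi> a \<star> w"
proof -
  obtain P Q where PQ: "P \<in> coeffs_in (Fq q)" "Q \<in> coeffs_in (Fq q)" "a = poly P x + poly Q x * y"
    using Ipow_rep[OF a] by blast
  have "w \<star> (pev (\<phi> x) Q \<star> \<phi> y) = (w \<star> pev (\<phi> x) Q) \<star> \<phi> y" by (simp only: tmult_assoc)
  also have "\<dots> = pev (\<psi> x) Q \<star> (w \<star> \<phi> y)" by (simp only: pev_intertwine[OF x PQ(2)] tmult_assoc)
  finally show ?thesis
    by (simp add: PQ Fq_hom_rep[OF \<phi>] Fq_hom_rep[OF \<psi>] tmult_add pev_intertwine[OF x] tmult_assoc y)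
qed

lemma hom_unique:
  assumes "Fq_algebra_hom q \<zeta> t \<phi>" "Fq_algebra_hom q \<zeta> t \<psi>" "\<phi> x = \<psi> x" "\<phi> y = \<psi> y" "a \<in> Ipow 0"
  shows "\<phi> a = \<psi> a"
  using hom_intertwine[OF assms(1,2), of 1 a] assms(3-) by simp

text \<open>The leading coefficient of the n-th twisted power of a quartic with leading coefficient
  \<open>l\<close>.\<close>

primrec lead_pow :: "'a \<Rightarrow> nat \<Rightarrow> 'a" where
  "lead_pow l 0 = 1"
| "lead_pow l (Suc n) = l * (F ^^ 4) (lead_pow l n)"

lemma lead_pow_Suc: "lead_pow l (Suc n) = lead_pow l n * (F ^^ (4 * n)) l"
proof (induction n)
  case (Suc n)
  have "lead_pow l (Suc (Suc n)) = l * (F ^^ 4) (lead_pow l (Suc n))" by simp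
  also have "\<dots> = l * (F ^^ 4) (lead_pow l n) * (F ^^ 4) ((F ^^ (4 * n)) l)"
    by (simp only: Suc Fn_props(3) mult.assoc)
  also have "(F ^^ 4) ((F ^^ (4 * n)) l) = (F ^^ (4 * Suc n)) l"
    by (simp only: mult_Suc_right funpow_add o_apply)
  finally show ?case by simp
qed (simp add: Fn_props del: funpow.simps)

lemma lead_pow_neq_0: "l \<noteq> 0 \<Longrightarrow> lead_pow l n \<noteq> 0"
  by (induction n) (auto simp: Fn_props simp del: funpow.simps)

lemma degree_pev:
  assumes f: "degree f = 4" and P: "P \<in> coeffs_in (Fq q)" "P \<noteq> 0"
  shows "degree (pev f P) = 4 * degree P" "lead_coeff (pev f P) = lead_coeff P * lead_pow (lead_coeff f) (degree P)"
proof -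
  have f0: "f \<noteq> 0" using f by auto
  have "degree (pev f P) = 4 * degree P \<and> lead_coeff (pev f P) = lead_coeff P * lead_pow (lead_coeff f) (degree P)"
    using P
  proof (induction P)
    case (pCons a P)
    show ?case
    proof (cases "P = 0")
      case False
      with pCons have IH: "degree (pev f P) = 4 * degree P"
        "lead_coeff (pev f P) = lead_coeff P * lead_pow (lead_coeff f) (degree P)" and P: "P \<in> coeffs_in (Fq q)"
        by (auto simp: coeffs_in_pCons)
      have "lead_coeff (pev f P) \<noteq> 0"
        unfolding IH(2) using False f0 lead_pow_neq_0 by simp
      hence nz: "pev f P \<noteq> 0" by auto
      have deg: "degree (f \<star> pev f P) = 4 + 4 * degree P" using degree_tmult[OF f0 nz] f IH by simp
      have "lead_coeff P \<in> Fq q" using P by (simp add: coeffs_in_def)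
      hence lc: "lead_coeff (f \<star> pev f P) = lead_coeff P * lead_pow (lead_coeff f) (Suc (degree P))"
        unfolding lead_coeff_tmult[OF f0 nz] f IH(2) Fn_props(3) by (simp add: Fq_Fn del: funpow.simps)
      have "degree [:a:] < degree (f \<star> pev f P)" using deg by simp
      thus ?thesis using False deg lc by (simp add: pev_pCons degree_add_eq_right coeff_eq_0)
    qed (simp add: pev_pCons)
  qed simp
  thus "degree (pev f P) = 4 * degree P" "lead_coeff (pev f P) = lead_coeff P * lead_pow (lead_coeff f) (degree P)"
    by auto
qed

text \<open>Leading terms can only meet when \<open>degree P = degree Q + 1\<close>. Then the top
  coefficient contains the factor \<open>lead P + r lead Q\<close>, which is nonzero because
  \<open>1, r\<close> are independent over \<open>F_q\<close>. So the degree is four times the pole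
  order, while \<open>A_deg\<close> is twice it.\<close>

lemma drinfeld_degree:
  assumes \<phi>: "Fq_algebra_hom q \<zeta> t \<phi>" and deg: "degree (\<phi> x) = 4" "degree (\<phi> y) = 4"
    and lead: "lead_coeff (\<phi> y) = r * lead_coeff (\<phi> x)" and r: "conj r" and a: "a \<in> Ipow 0" "a \<noteq> 0"
  shows "real (degree (\<phi> a)) = real 2 * A_deg q \<zeta> t a"
proof -
  obtain P Q where PQ: "P \<in> coeffs_in (Fq q)" "Q \<in> coeffs_in (Fq q)" "a = poly P x + poly Q x * y"
    using Ipow_rep[OF a(1)] by blast
  have nz: "P \<noteq> 0 \<or> Q \<noteq> 0" using PQ a by auto
  define n where "n = pole_order P Q"
  obtain h where h: "h \<in> coeffs_in (Fq q)" "degree h \<le> 2 * n" "poly h \<zeta> \<noteq> 0" "a = poly h t / \<rho> ^ n"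
    using rep_pole[OF PQ(1,2) nz] PQ(3) unfolding n_def by metis
  let ?l = "lead_coeff (\<phi> x)"
  have l0: "\<phi> x \<noteq> 0" "\<phi> y \<noteq> 0" using deg by auto
  have FF: "(F ^^ (4 * i)) r = r" for i
    by (induction i) (simp_all add: funpow_add numeral_eq_Suc conj_props[OF r])
  have Qd: "degree (pev (\<phi> x) Q \<star> \<phi> y) = 4 * Suc (degree Q)"
    "lead_coeff (pev (\<phi> x) Q \<star> \<phi> y) = lead_coeff Q * r * lead_pow ?l (Suc (degree Q))" if "Q \<noteq> 0"
  proof -
    note dp = degree_pev[OF deg(1) PQ(2) that]
    have nz: "pev (\<phi> x) Q \<noteq> 0" using dp(2) that l0 lead_pow_neq_0[of ?l] by (metis leading_coeff_0_iff mult_eq_0_iff)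
    show "degree (pev (\<phi> x) Q \<star> \<phi> y) = 4 * Suc (degree Q)" using degree_tmult[OF nz l0(2)] dp(1) deg by simp
    show "lead_coeff (pev (\<phi> x) Q \<star> \<phi> y) = lead_coeff Q * r * lead_pow ?l (Suc (degree Q))"
      unfolding lead_coeff_tmult[OF nz l0(2)] dp(1) dp(2)[unfolded dp(1)] lead Fn_props(3) FF lead_pow_Suc by simp
  qed
  have Pd: "degree (pev (\<phi> x) P) = 4 * degree P" "lead_coeff (pev (\<phi> x) P) = lead_coeff P * lead_pow ?l (degree P)" if "P \<noteq> 0"
    using degree_pev[OF deg(1) PQ(1) that] by auto
  have rep: "\<phi> a = pev (\<phi> x) P + pev (\<phi> x) Q \<star> \<phi> y" unfolding PQ(3) by (rule Fq_hom_rep[OF \<phi> PQ(1,2)])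
  have "degree (\<phi> a) = 4 * n"
  proof (cases "P = 0 \<or> Q = 0 \<or> degree P \<noteq> Suc (degree Q)")
    case True
    consider "P = 0" "Q \<noteq> 0" | "Q = 0" "P \<noteq> 0" | "P \<noteq> 0" "Q \<noteq> 0" "degree P < Suc (degree Q)"
      | "P \<noteq> 0" "Q \<noteq> 0" "Suc (degree Q) < degree P" using True nz by fastforce
    thus ?thesis
    proof cases
      case 3
      hence "degree (pev (\<phi> x) P) < degree (pev (\<phi> x) Q \<star> \<phi> y)" using Pd Qd by simp
      thus ?thesis using 3 Qd unfolding rep by (simp add: degree_add_eq_right n_def pole_order_def)
    next
      case 4
      hence "degree (pev (\<phi> x) Q \<star> \<phi> y) < degree (pev (\<phi> x) P)" using Pd Qd by simp
      thus ?thesis using 4 Pd unfolding rep by (simp add: degree_add_eq_left n_def pole_order_def)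
    qed (use Pd Qd in \<open>auto simp: rep n_def pole_order_def\<close>)
  next
    case False
    hence F: "P \<noteq> 0" "Q \<noteq> 0" "degree P = Suc (degree Q)" by auto
    have n: "n = degree P" using F by (simp add: n_def pole_order_def)
    have "coeff (\<phi> a) (4 * n) = (lead_coeff P + lead_coeff Q * r) * lead_pow ?l (degree P)"
      using Pd[OF F(1)] Qd[OF F(2)] F(3) unfolding rep coeff_add n by (simp add: algebra_simps)
    moreover have "lead_coeff P + lead_coeff Q * r \<noteq> 0"
      using lin_indep_zeta[OF r, of "lead_coeff P" "lead_coeff Q"] PQ F by (auto simp: coeffs_in_def)
    ultimately have "coeff (\<phi> a) (4 * n) \<noteq> 0" using lead_pow_neq_0[of ?l] l0 by simp
    hence "4 * n \<le> degree (\<phi> a)" by (rule le_degree)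
    moreover have "degree (\<phi> a) \<le> 4 * n" unfolding rep n
      using Pd[OF F(1)] Qd[OF F(2)] F by (intro degree_add_le) auto
    ultimately show ?thesis by simp
  qed
  thus ?thesis using A_deg_eq[OF h] by simp
qed

text \<open>The module of type \<open>F Z\<close> with parameters \<open>m\<close> (constant term of \<open>M\<close>) and \<open>k\<close> (ratio of the
  coefficients of the linear polynomial \<open>B - F Z M\<close>).\<close>

definition cs :: "'a \<Rightarrow> 'a \<Rightarrow> 'a \<Rightarrow> 'a" where "cs Z m k = m * (t - F Z) / k"

definition dM :: "'a \<Rightarrow> 'a \<Rightarrow> 'a \<Rightarrow> 'a poly" where
  "dM Z m k = [:m, cs Z m k / (Z - F Z) + F k, 1:]"

definition dB :: "'a \<Rightarrow> 'a \<Rightarrow> 'a \<Rightarrow> 'a poly" where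
  "dB Z m k = [:t * m, Z * cs Z m k / (Z - F Z) + F Z * F k, F Z:]"

text \<open>Together with \<open>dV\<close> forced by the choice of parameters: these are the values
  that \<open>classification\<close> finds on solving the coefficient equations.\<close>

definition dU :: "'a \<Rightarrow> 'a \<Rightarrow> 'a \<Rightarrow> 'a poly" where
  "dU Z m k = [: 1 / ((t - Z) * (t - F Z) * m),
     1 / (k * F ((t - Z) * m) * (Z - F Z)) + 1 / ((t - Z) * m * F (cs Z m k)),
     - 1 / (k * F ((t - Z) * m) * F (F (cs Z m k))) :]"

definition dV :: "'a \<Rightarrow> 'a \<Rightarrow> 'a \<Rightarrow> 'a poly" where
  "dV Z m k = [: t / ((t - Z) * (t - F Z) * m),
     F Z / (k * F ((t - Z) * m) * (Z - F Z)) + Z / ((t - Z) * m * F (cs Z m k)),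
     - F Z / (k * F ((t - Z) * m) * F (F (cs Z m k))) :]"

text \<open>In the next three lemmas \<open>a = t - Z\<close>, \<open>d = Z - F Z\<close> and \<open>W = F Z\<close>.\<close>

lemma data_identity_1:
  assumes nz: "a \<noteq> 0" "a + d \<noteq> 0" "d \<noteq> 0" "m \<noteq> 0" "k \<noteq> 0"
    "F a - d \<noteq> 0" "F (F a) + d \<noteq> 0" "F (F (F a)) - d \<noteq> 0" and FW: "F W = W + d" "F d = - d"
  shows "[: 1 / (a * (a + d) * m),
     1 / (k * F (a * m) * d) + 1 / (a * m * F (m * (a + d) / k)),
     - 1 / (k * F (a * m) * F (F (m * (a + d) / k))) :] \<star>
    [:(a + (W + d)) * m, (W + d) * (m * (a + d) / k) / d + W * F k, W:] =
    [: (a + (W + d)) / (a * (a + d) * m),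
     W / (k * F (a * m) * d) + (W + d) / (a * m * F (m * (a + d) / k)),
     - W / (k * F (a * m) * F (F (m * (a + d) / k))) :] \<star>
    [:m, m * (a + d) / k / d + F k, 1:]"
  apply (simp add: tmult_pCons Fp_simps F_simps FW)
  apply (intro impI conjI)
  using nz by (simp_all add: divide_simps) (simp_all add: algebra_simps)

lemma data_identity_2:
  assumes nz: "a \<noteq> 0" "a + d \<noteq> 0" "d \<noteq> 0" "m \<noteq> 0" "k \<noteq> 0"
    "F a - d \<noteq> 0" "F (F a) + d \<noteq> 0" "F (F (F a)) - d \<noteq> 0" and FW: "F W = W + d" "F d = - d"
  shows "[:(a + (W + d)) * m, (W + d) * (m * (a + d) / k) / d + W * F k, W:] \<star>
    [: 1 / (a * (a + d) * m),
     1 / (k * F (a * m) * d) + 1 / (a * m * F (m * (a + d) / k)),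
     - 1 / (k * F (a * m) * F (F (m * (a + d) / k))) :] =
    [:m, m * (a + d) / k / d + F k, 1:] \<star>
    [: (a + (W + d)) / (a * (a + d) * m),
     W / (k * F (a * m) * d) + (W + d) / (a * m * F (m * (a + d) / k)),
     - W / (k * F (a * m) * F (F (m * (a + d) / k))) :]"
  apply (simp add: tmult_pCons Fp_simps F_simps FW)
  apply (intro impI conjI)
  using nz by (simp_all add: divide_simps) (simp_all add: algebra_simps)

lemma data_identity_3:
  assumes nz: "a \<noteq> 0" "a + d \<noteq> 0" "d \<noteq> 0" "m \<noteq> 0" "k \<noteq> 0"
    "F a - d \<noteq> 0" "F (F a) + d \<noteq> 0" "F (F (F a)) - d \<noteq> 0" and FW: "F W = W + d" "F d = - d"
  shows "[: (a + (W + d)) / (a * (a + d) * m),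
     W / (k * F (a * m) * d) + (W + d) / (a * m * F (m * (a + d) / k)),
     - W / (k * F (a * m) * F (F (m * (a + d) / k))) :] \<star>
    [:(a + (W + d)) * m, (W + d) * (m * (a + d) / k) / d + W * F k, W:] -
    smult (W + d + W) ([: (a + (W + d)) / (a * (a + d) * m),
     W / (k * F (a * m) * d) + (W + d) / (a * m * F (m * (a + d) / k)),
     - W / (k * F (a * m) * F (F (m * (a + d) / k))) :] \<star>
    [:m, m * (a + d) / k / d + F k, 1:]) +
    smult ((W + d) * W) ([: 1 / (a * (a + d) * m),
     1 / (k * F (a * m) * d) + 1 / (a * m * F (m * (a + d) / k)),
     - 1 / (k * F (a * m) * F (F (m * (a + d) / k))) :] \<star>
    [:m, m * (a + d) / k / d + F k, 1:]) = 1"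
  apply (simp add: tmult_pCons Fp_simps F_simps one_pCons FW)
  apply (intro impI conjI)
  using nz by (simp_all add: divide_simps) (simp_all add: algebra_simps)

lemma module_data_D:
  assumes Z: "conj Z" and m: "m \<noteq> 0" and k: "k \<noteq> 0"
  shows "module_data (dM Z m k) (dB Z m k) (dU Z m k) (dV Z m k)"
proof -
  have FFZ: "F (F Z) = Z" using conj_props[OF Z] by simp
  define a where "a = t - Z"
  define d where "d = Z - F Z"
  define W where "W = F Z"
  have eqs: "t - Z = a" "t - F Z = a + d" "Z - F Z = d" "F Z = W" "Z = W + d" "t = a + (W + d)"
    by (simp_all add: a_def d_def W_def)
  have ab: "a \<noteq> 0" "a + d \<noteq> 0" using t_not_conj[OF Z] t_not_conj[OF conj_F[OF Z]] by (auto simp: a_def d_def)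
  have d0: "d \<noteq> 0" using conj_props(2)[OF Z] by (auto simp: d_def)
  have FW: "F W = W + d" "F d = - d" by (simp_all add: W_def d_def FFZ F_simps)
  have "F (a + d) \<noteq> 0" "F (F (a + d)) \<noteq> 0" "F (F (F (a + d))) \<noteq> 0" using ab by auto
  hence nz: "F a - d \<noteq> 0" "F (F a) + d \<noteq> 0" "F (F (F a)) - d \<noteq> 0" by (simp_all add: F_simps FW)
  note I = ab d0 m k nz FW
  have defs: "dM Z m k = [:m, m * (a + d) / k / d + F k, 1:]"
    "dB Z m k = [:(a + (W + d)) * m, (W + d) * (m * (a + d) / k) / d + W * F k, W:]"
    "dU Z m k = [: 1 / (a * (a + d) * m),
     1 / (k * F (a * m) * d) + 1 / (a * m * F (m * (a + d) / k)),
     - 1 / (k * F (a * m) * F (F (m * (a + d) / k))) :]"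
    "dV Z m k = [: (a + (W + d)) / (a * (a + d) * m),
     W / (k * F (a * m) * d) + (W + d) / (a * m * F (m * (a + d) / k)),
     - W / (k * F (a * m) * F (F (m * (a + d) / k))) :]"
    unfolding dM_def dB_def dU_def dV_def cs_def eqs(1-3) unfolding eqs(4) unfolding eqs(6) unfolding eqs(5) by simp_all
  have tn: "tr = W + d + W" "nm = (W + d) * W"
    using conj_props(3,4)[OF Z] by (simp_all add: W_def d_def)
  have "dU Z m k \<noteq> 0" using ab m unfolding defs by simp
  thus ?thesis unfolding module_data_def defs tn
    using data_identity_1[OF I] data_identity_2[OF I] data_identity_3[OF I] by blast
qed

definition dmod :: "'a \<Rightarrow> 'a \<Rightarrow> 'a \<Rightarrow> 'a \<Rightarrow> 'a poly" where
  "dmod Z m k = alg_hom (dU Z m k \<star> dM Z m k) (dV Z m k \<star> dM Z m k)"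

lemma module_data_relation:
  assumes "module_data M B U V"
  shows "U \<star> M \<star> (V \<star> M) = V \<star> M \<star> (U \<star> M)"
    "V \<star> M \<star> (V \<star> M) - smult tr (U \<star> M \<star> (V \<star> M)) + smult nm (U \<star> M \<star> (U \<star> M)) = U \<star> M"
proof -
  show "U \<star> M \<star> (V \<star> M) = V \<star> M \<star> (U \<star> M)"
    using module_data_props(1)[OF assms] by (simp flip: tmult_assoc)
  have "(V \<star> M \<star> V - smult tr (U \<star> M \<star> V) + smult nm (U \<star> M \<star> U)) \<star> M = U \<star> M"
    using module_data_props(2)[OF assms] by simp
  thus "V \<star> M \<star> (V \<star> M) - smult tr (U \<star> M \<star> (V \<star> M)) + smult nm (U \<star> M \<star> (U \<star> M)) = U \<star> M"
    by (simp add: tmult_add tmult_diff smult_tmult tmult_assoc)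
qed

lemma dmod_hom:
  assumes "conj Z" "m \<noteq> 0" "k \<noteq> 0"
  shows "Fq_algebra_hom q \<zeta> t (dmod Z m k)" "dmod Z m k x = dU Z m k \<star> dM Z m k" "dmod Z m k y = dV Z m k \<star> dM Z m k"
  unfolding dmod_def
  using alg_hom_hom[OF module_data_relation[OF module_data_D[OF assms]]] by blast+

lemma coeff_pev_0: "coeff (pev f P) 0 = poly P (coeff f 0)"
  by (induction P) (auto simp: pev_pCons coeff_tmult_0)

lemma coeff_hom_0:
  assumes \<phi>: "Fq_algebra_hom q \<zeta> t \<phi>" and xy: "coeff (\<phi> x) 0 = x" "coeff (\<phi> y) 0 = y" and a: "a \<in> Ipow 0"
  shows "coeff (\<phi> a) 0 = a"
proof -
  obtain P Q where PQ: "P \<in> coeffs_in (Fq q)" "Q \<in> coeffs_in (Fq q)" "a = poly P x + poly Q x * y"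
    using Ipow_rep[OF a] by blast
  show ?thesis using Fq_hom_rep[OF \<phi> PQ(1,2)] by (simp add: PQ(3) coeff_tmult_0 coeff_pev_0 xy)
qed

lemma dmod_leads:
  assumes Z: "conj Z" and mk: "m \<noteq> 0" "k \<noteq> 0"
  shows "degree (dM Z m k) = 2" "degree (dU Z m k) = 2" "degree (dV Z m k) = 2"
    "degree (dmod Z m k x) = 4" "degree (dmod Z m k y) = 4"
    "lead_coeff (dmod Z m k y) = F Z * lead_coeff (dmod Z m k x)"
    "coeff (dmod Z m k x) 0 = x" "coeff (dmod Z m k y) 0 = y"
proof -
  have nz: "t - Z \<noteq> 0" "t - F Z \<noteq> 0" "Z \<noteq> 0"
    using t_not_conj[OF Z] t_not_conj[OF conj_F[OF Z]] conj_props(5)[OF Z] by auto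
  have s: "cs Z m k \<noteq> 0" using mk nz by (simp add: cs_def)
  show d: "degree (dM Z m k) = 2" "degree (dU Z m k) = 2" "degree (dV Z m k) = 2"
    using mk nz s by (auto simp: dM_def dU_def dV_def)
  have n: "dM Z m k \<noteq> 0" "dU Z m k \<noteq> 0" "dV Z m k \<noteq> 0" using d by auto
  show "degree (dmod Z m k x) = 4" "degree (dmod Z m k y) = 4"
    using degree_tmult n d by (simp_all add: dmod_hom Z mk)
  have "coeff (dM Z m k) 2 = 1" "coeff (dV Z m k) 2 = F Z * coeff (dU Z m k) 2"
    by (simp_all add: dM_def dU_def dV_def numeral_2_eq_2)
  thus "lead_coeff (dmod Z m k y) = F Z * lead_coeff (dmod Z m k x)"
    unfolding dmod_hom(2,3)[OF Z mk] lead_coeff_tmult[OF n(2,1)] lead_coeff_tmult[OF n(3,1)] d by simp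
  have "x = 1 / ((t - Z) * (t - F Z))" "y = t / ((t - Z) * (t - F Z))"
    using rho_eq(2)[OF Z] by (simp_all add: xy_eq(1,2))
  thus "coeff (dmod Z m k x) 0 = x" "coeff (dmod Z m k y) 0 = y"
    using mk unfolding dmod_hom(2,3)[OF Z mk] coeff_tmult_0 by (simp_all add: dM_def dU_def dV_def)
qed

lemma dmod_drinfeld:
  assumes Z: "conj Z" and mk: "m \<noteq> 0" "k \<noteq> 0"
  shows "drinfeld_module q \<zeta> t 2 (dmod Z m k)"
  unfolding drinfeld_module_def Aset_eq
proof (intro conjI ballI)
  note d = dmod_leads[OF assms] and h = dmod_hom(1)[OF assms]
  show "Fq_algebra_hom q \<zeta> t (dmod Z m k)" by (rule h)
  fix a
  show "a \<in> Ipow 0 \<Longrightarrow> coeff (dmod Z m k a) 0 = a" by (rule coeff_hom_0[OF h d(7,8)])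
  show "a \<in> Ipow 0 - {0} \<Longrightarrow> real (degree (dmod Z m k a)) = real 2 * A_deg q \<zeta> t a"
    using drinfeld_degree[OF h d(4-6) conj_F[OF Z]] by blast
qed

text \<open>The normal value of \<open>k\<close>: for \<open>k = kap \<zeta>\<close>,
  \<open>F k\<close> is the constant \<open>1 / (1 - \<zeta> powi (1 - int q))\<close> in
  \<open>model_I\<close>.\<close>

definition kap :: "'a \<Rightarrow> 'a" where "kap Z = Z / (Z - F Z)"

lemma kap_props: assumes "conj Z" shows "kap Z \<noteq> 0" "F (kap Z) = F Z / (F Z - Z)" "F (kap Z) = kap (F Z)" "F (F (kap Z)) = kap Z"
  using conj_props[OF assms] by (auto simp: kap_def F_simps)

lemma power_q_minus_1: "z \<noteq> 0 \<Longrightarrow> z ^ (q - 1) = F z / z"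
  unfolding F_def using power_minus_mult[of q z] by (simp add: field_simps)

lemma powi_1_minus_q: "z \<noteq> 0 \<Longrightarrow> z powi (1 - int q) = z / F z"
  by (simp add: power_int_diff F_def)

lemma model_eqs:
  assumes j: "j \<noteq> 0"
  shows "model_I q \<zeta> t j = dM \<zeta> (1 / j) (kap \<zeta>)"
    "model_x q \<zeta> t j = dU \<zeta> (1 / j) (kap \<zeta>) \<star> dM \<zeta> (1 / j) (kap \<zeta>)"
    "model_y q \<zeta> t j = dV \<zeta> (1 / j) (kap \<zeta>) \<star> dM \<zeta> (1 / j) (kap \<zeta>)"
proof -
  define a where "a = t - \<zeta>"
  define Z1 where "Z1 = F \<zeta>"
  define b where "b = t - Z1"
  define d where "d = \<zeta> - Z1"
  have nz: "a \<noteq> 0" "b \<noteq> 0" "\<zeta> \<noteq> 0" "Z1 \<noteq> 0" "\<zeta> \<noteq> Z1" "Z1 \<noteq> \<zeta>"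
    using t_not_conj[OF conj_zeta] t_not_conj[OF conj_F[OF conj_zeta]] conj_props(5)[OF conj_zeta] zeta_neq
    by (auto simp: a_def b_def Z1_def)
  have F1: "F Z1 = \<zeta>" by (simp add: Z1_def)
  have jp: "j ^ (q + 1) = F j * j" "j ^ (q * (q + 1)) = F (F j) * F j" "j ^ q = F j" "\<zeta> ^ q = Z1"
    by (simp_all add: F_def Z1_def power_add power_mult[symmetric] power_mult_distrib algebra_simps)
  have zp: "\<zeta> powi (1 - int q) = \<zeta> / Z1" "\<zeta> ^ (q - 1) = Z1 / \<zeta>"
    using powi_1_minus_q[OF nz(3)] power_q_minus_1[OF nz(3)] by (simp_all only: Z1_def)
  have T: "Tpar q \<zeta> t = 1 / b" "Tsigma \<zeta> t = 1 / a" by (simp_all add: Tpar_def Tsigma_def a_def b_def Z1_def F_def)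
  have xA: "xA q \<zeta> t = 1 / (a * b)" "yA q \<zeta> t = t / (a * b)" using rho_eq(2)[OF conj_zeta] by (simp_all add: xy_eq(1,2) a_def b_def Z1_def)
  have pq: "z ^ q = F z" for z :: 'a by (simp add: F_def)
  have d0: "d \<noteq> 0" using nz by (simp add: d_def)
  have Fd: "F d = - d" by (simp add: d_def F_simps F1 flip: Z1_def)
  have ds: "1 - \<zeta> / Z1 = - (d / Z1)" "1 - Z1 / \<zeta> = d / \<zeta>" using nz by (simp_all add: d_def field_simps)
  note folds = a_def[symmetric] b_def[symmetric] Z1_def[symmetric]
  show I: "model_I q \<zeta> t j = dM \<zeta> (1 / j) (kap \<zeta>)"
    unfolding model_I_def dM_def cs_def zp T kap_def folds ds d_def[symmetric] using nz j d0
    by (simp add: F_simps folds F1 Fd field_simps)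
  have U: "dU \<zeta> (1 / j) (kap \<zeta>) = [: xA q \<zeta> t * j,
        Tsigma \<zeta> t ^ q * j ^ q / \<zeta>
          + j ^ (q + 1) * Tsigma \<zeta> t * Tpar q \<zeta> t ^ q / (1 - \<zeta> powi (1 - int q)),
        - (j ^ (q * (q + 1))) * (Tsigma \<zeta> t * Tpar q \<zeta> t ^ q) ^ q :]"
    unfolding dU_def cs_def zp T jp xA kap_def folds pq ds d_def[symmetric] using nz j d0
    by (simp add: F_simps folds F1 Fd field_simps)
  have V: "dV \<zeta> (1 / j) (kap \<zeta>) = [: yA q \<zeta> t * j,
        \<zeta> ^ (q - 1) * j ^ q * Tsigma \<zeta> t ^ q
          - \<zeta> ^ q * Tsigma \<zeta> t * Tpar q \<zeta> t ^ q * j ^ (q + 1) / (1 - \<zeta> ^ (q - 1)),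
        - (j ^ (q * (q + 1))) * (Tsigma \<zeta> t * Tpar q \<zeta> t ^ q) ^ q * \<zeta> ^ q :]"
    unfolding dV_def cs_def zp T jp xA kap_def folds pq ds d_def[symmetric] using nz j d0
    by (simp add: F_simps folds F1 Fd field_simps)
  show "model_x q \<zeta> t j = dU \<zeta> (1 / j) (kap \<zeta>) \<star> dM \<zeta> (1 / j) (kap \<zeta>)"
    "model_y q \<zeta> t j = dV \<zeta> (1 / j) (kap \<zeta>) \<star> dM \<zeta> (1 / j) (kap \<zeta>)"
    unfolding model_x_def model_y_def I U V by simp_all
qed

abbreviation "mmod \<equiv> minimal_model q \<zeta> t"

text \<open>\<open>dmod\<close> with \<open>m = 1 / j\<close> and \<open>k = kap \<zeta>\<close>
  witnesses that the choice in \<open>minimal_model\<close> succeeds, and the two generators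
  determine its values on \<open>A\<close>.\<close>

lemma minimal_model_hom:
  assumes j: "j \<noteq> 0"
  shows "Fq_algebra_hom q \<zeta> t (mmod j)" "mmod j x = model_x q \<zeta> t j" "mmod j y = model_y q \<zeta> t j"
    "a \<in> Ipow 0 \<Longrightarrow> mmod j a = dmod \<zeta> (1 / j) (kap \<zeta>) a"
proof -
  have k: "kap \<zeta> \<noteq> 0" "1 / j \<noteq> 0" using kap_props[OF conj_zeta] j by auto
  note h = dmod_hom[OF conj_zeta k(2,1)]
  have "Fq_algebra_hom q \<zeta> t (mmod j) \<and> mmod j x = model_x q \<zeta> t j \<and> mmod j y = model_y q \<zeta> t j"
    unfolding minimal_model_def
    by (rule someI[of _ "dmod \<zeta> (1 / j) (kap \<zeta>)"]) (simp add: h model_eqs[OF j])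
  thus *: "Fq_algebra_hom q \<zeta> t (mmod j)" "mmod j x = model_x q \<zeta> t j" "mmod j y = model_y q \<zeta> t j" by auto
  show "a \<in> Ipow 0 \<Longrightarrow> mmod j a = dmod \<zeta> (1 / j) (kap \<zeta>) a"
    by (rule hom_unique[OF *(1) h(1)]) (simp_all add: * h model_eqs[OF j])
qed

lemma drinfeld_cong:
  assumes "\<And>a. a \<in> Ipow 0 \<Longrightarrow> \<phi> a = \<psi> a" "drinfeld_module q \<zeta> t r \<phi>" "Fq_algebra_hom q \<zeta> t \<psi>"
  shows "drinfeld_module q \<zeta> t r \<psi>"
  using assms unfolding drinfeld_module_def Aset_eq by auto

lemma minimal_model_drinfeld:
  assumes j: "j \<noteq> 0"
  shows "drinfeld_module q \<zeta> t 2 (mmod j)" "zeta_q_type q \<zeta> t (mmod j)"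
proof -
  have k: "1 / j \<noteq> 0" "kap \<zeta> \<noteq> 0" using kap_props[OF conj_zeta] j by auto
  note m = minimal_model_hom[OF j] and d = dmod_leads[OF conj_zeta k]
  show "drinfeld_module q \<zeta> t 2 (mmod j)"
    by (rule drinfeld_cong[OF _ dmod_drinfeld[OF conj_zeta k] m(1)]) (simp add: m)
  have "dmod \<zeta> (1 / j) (kap \<zeta>) x \<noteq> 0" using d(4) by auto
  hence "lead_coeff (dmod \<zeta> (1 / j) (kap \<zeta>) x) \<noteq> 0" by (simp only: leading_coeff_0_iff not_False_eq_True)
  thus "zeta_q_type q \<zeta> t (mmod j)"
    unfolding zeta_q_type_def leading_def using d(6) by (simp add: m(4) F_def)
qed

subsection \<open>Isogenies along lines in the \<open>I\<^sub>\<infinity>\<close>-torsion\<close>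

text \<open>The condition for the line of \<open>v\<close> to lie in \<open>Ker (dM Z m k)\<close>:
  substitute \<open>F z = v z\<close> and divide by \<open>z\<close>.\<close>

definition is_root :: "'a \<Rightarrow> 'a \<Rightarrow> 'a \<Rightarrow> 'a \<Rightarrow> bool" where
  "is_root Z m k v \<longleftrightarrow> v * (F v + (cs Z m k / (Z - F Z) + F k)) + m = 0"

text \<open>With \<open>next_k\<close> the parameters of the target of the isogeny
  \<open>\<tau> - v\<close>, which has the conjugate type; they are chosen to satisfy the two
  factorizations at the end of \<open>root_step\<close>.\<close>

definition next_m :: "'a \<Rightarrow> 'a \<Rightarrow> 'a \<Rightarrow> 'a \<Rightarrow> 'a" where
  "next_m Z m k v = m * F (cs Z m k * (v + k)) / (cs Z m k * (v + k))"

definition next_k :: "'a \<Rightarrow> 'a \<Rightarrow> 'a" where "next_k k v = F (v + k)"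

lemma lin_lin: "lin u \<star> lin v = [:u * v, - (F v + u), 1:]"
  by (simp add: tmult_pCons Fp_simps F_simps)

lemma is_root_factor:
  assumes "is_root Z m k v" "v \<noteq> 0" shows "dM Z m k = lin (m / v) \<star> lin v"
proof -
  define c where "c = cs Z m k / (Z - F Z) + F k"
  have "v * (F v + c) = - m" using assms(1) unfolding is_root_def c_def[symmetric] by (simp add: eq_neg_iff_add_eq_0)
  moreover have "c = v * (F v + c) / v - F v" using assms(2) by simp
  ultimately have "c = - m / v - F v" by (simp only:)
  hence "c = - (F v + m / v)" by simp
  hence "cs Z m k / (Z - F Z) + F k = - (F v + m / v)" by (simp only: c_def)
  thus ?thesis using assms(2) by (simp add: dM_def lin_lin)
qed

lemma is_root_nonzero: "is_root Z m k v \<Longrightarrow> m \<noteq> 0 \<Longrightarrow> v \<noteq> 0"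
  by (auto simp: is_root_def)

lemma is_root_iff: assumes "z \<noteq> 0" "F z = v * z"
  shows "is_root Z m k v \<longleftrightarrow> ev (dM Z m k) z = 0"
proof -
  have "ev (dM Z m k) z = (v * (F v + (cs Z m k / (Z - F Z) + F k)) + m) * z"
    using assms by (simp add: dM_def ev_pCons F_mult algebra_simps)
  thus ?thesis using assms by (simp add: is_root_def)
qed

text \<open>Here \<open>a = t - Z\<close>, \<open>d = Z - F Z\<close>, \<open>W = F Z\<close>; the equation for the line \<open>v\<close> is linear in \<open>m\<close>
  and has been solved for it.\<close>

lemma isogeny_identity:
  fixes a d k v W :: 'a
  defines "E \<equiv> k * d + (a + d) * v"
  defines "m \<equiv> - (v * (F v + F k) * k * d / E)"
  defines "s \<equiv> m * (a + d) / k"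
  defines "u' \<equiv> v * F (s * (v + k)) / (s * (v + k))"
  defines "m' \<equiv> m * F (s * (v + k)) / (s * (v + k))"
  assumes nz: "a \<noteq> 0" "a + d \<noteq> 0" "d \<noteq> 0" "k \<noteq> 0" "v \<noteq> 0" "v + k \<noteq> 0" "E \<noteq> 0"
    and FW: "F W = W + d" "F d = - d"
  shows "[:m', m' * a / F (v + k) / (- d) + F (F (v + k)), 1:] \<star> lin v = lin u' \<star> [:m, s / d + F k, 1:]"
    "[:(a + (W + d)) * m', W * (m' * a / F (v + k)) / (- d) + (W + d) * F (F (v + k)), W + d:] \<star> lin v =
     lin u' \<star> [:(a + (W + d)) * m, (W + d) * s / d + W * F k, W:]"
proof -
  have nz1: "F a - d \<noteq> 0" "F v + F k \<noteq> 0" "F (F v) + F (F k) \<noteq> 0" "(F a - d) * F v - F k * d \<noteq> 0"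
  proof -
    have "F (a + d) \<noteq> 0" "F (v + k) \<noteq> 0" "F (F (v + k)) \<noteq> 0" "F E \<noteq> 0" using nz by simp_all
    thus "F a - d \<noteq> 0" "F v + F k \<noteq> 0" "F (F v) + F (F k) \<noteq> 0" "(F a - d) * F v - F k * d \<noteq> 0"
      by (simp_all add: E_def F_simps FW algebra_simps)
  qed
  define E1 where "E1 = (F a - d) * F v - F k * d"
  define p where "p = F v + F k"
  define p2 where "p2 = F (F v) + F (F k)"
  define w where "w = v + k"
  define b where "b = a + d"
  define b1 where "b1 = F a - d"
  have FE: "F E = E1" by (simp add: E_def E1_def F_simps FW algebra_simps)
  have Fs: "F p = p2" "F w = p" "F b = b1" by (simp_all add: p_def p2_def w_def b_def b1_def F_simps FW)
  have nn: "E \<noteq> 0" "E1 \<noteq> 0" "p \<noteq> 0" "p2 \<noteq> 0" "w \<noteq> 0" "b \<noteq> 0" "b1 \<noteq> 0"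
    using nz nz1 by (simp_all add: E1_def p_def p2_def w_def b_def b1_def)
  have m: "m = - (v * p * k * d / E)" by (simp add: m_def p_def)
  have s: "s = - (v * p * d * b / E)" using nz by (simp add: s_def m b_def field_simps)
  have Fs': "F s = F v * p2 * d * b1 / E1" by (simp add: s F_simps Fs FW FE)
  have u': "u' = - (E * F v * p2 * b1 / (E1 * b * w))"
    unfolding u'_def s F_mult w_def[symmetric] using nz nn by (simp add: F_simps Fs FW FE mult_ac)
  have m': "m' = F v * p2 * b1 * p * k * d / (E1 * b * w)"
    unfolding m'_def s m F_mult w_def[symmetric] using nz nn by (simp add: F_simps Fs FW FE mult_ac)
  have Fm: "F m = F v * p2 * F k * d / E1" by (simp add: m F_simps Fs FW FE)
  have Ee: "E = k * d + b * v" by (simp add: E_def b_def)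
  have E1e: "E1 = b1 * F v - F k * d" by (simp add: E1_def b1_def)
  have ab: "a = b - d" "F a = b1 + d" by (simp_all add: b_def b1_def)
  have vk: "F (v + k) = p" "F (F (v + k)) = p2" by (simp_all add: p_def p2_def F_simps)
  have Fk: "F k = p - F v" "F (F k) = p2 - F (F v)" "k = w - v" by (simp_all add: p_def p2_def w_def)
  show M: "[:m', m' * a / F (v + k) / (- d) + F (F (v + k)), 1:] \<star> lin v = lin u' \<star> [:m, s / d + F k, 1:]"
    unfolding vk
    apply (simp add: tmult_pCons Fp_simps F_simps FW Fs' Fm)
    unfolding m' u' s m ab
    using nz nn apply (simp add: field_simps)
    unfolding Ee E1e
    unfolding Fk(2)
    unfolding Fk(1)
    unfolding Fk(3)
    by (simp add: Fs(1) algebra_simps)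
  \<comment> \<open>The identity for \<open>B\<close> is checked modulo the one for
    \<open>M\<close>: \<open>B'\<close> minus \<open>W + d\<close> times \<open>M'\<close> is this
    linear polynomial, so only three coefficients are left to compare.\<close>
  have S: "[:m' * a, m' * a / F (v + k):] \<star> lin v = lin u' \<star> [:m * b, s:] + smult (d * u') [:m, s / d + F k, 1:]"
  proof -
    have ka: "k * a = b * w - E" by (simp add: b_def w_def E_def algebra_simps)
    have "m' * a / p = F v * p2 * d * b1 * (k * a) / (E1 * b * w)" using nn by (simp add: m' mult_ac)
    also have "\<dots> = F s + d * u'" unfolding ka Fs' u' using nn by (simp add: field_simps)
    finally have c2: "m' * a / p = F s + d * u'" .
    hence m'a: "m' * a = (F s + d * u') * p" using nn(3) by (simp add: field_simps)
    have "F (m * b) = F (s * k)" using nz by (simp add: s_def b_def)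
    hence Fmb: "F m * F b = F s * F k" by (simp add: F_mult)
    have c1: "m' * a - m' * a / p * F v = - (u' * s) + F m * F b + d * u' * (s / d + F k)"
      unfolding c2 unfolding m'a Fmb p_def using nz(3) by (simp add: field_simps)
    have "m' * v = u' * m" using nz by (simp add: m'_def u'_def)
    hence c0: "- (m' * a * v) = - (u' * (m * b)) + d * u' * m" by (simp add: ab algebra_simps)
    show ?thesis unfolding vk using c0 c1 c2 by (simp add: tmult_pCons Fp_simps F_simps)
  qed
  have "[:(a + (W + d)) * m', W * (m' * a / F (v + k)) / (- d) + (W + d) * F (F (v + k)), W + d:] =
     [:m' * a, m' * a / F (v + k):] + smult (W + d) [:m', m' * a / F (v + k) / (- d) + F (F (v + k)), 1:]"
    using nz by (simp add: field_simps)
  hence "[:(a + (W + d)) * m', W * (m' * a / F (v + k)) / (- d) + (W + d) * F (F (v + k)), W + d:] \<star> lin v =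
     lin u' \<star> [:m * b, s:] + smult (d * u') [:m, s / d + F k, 1:] + smult (W + d) (lin u' \<star> [:m, s / d + F k, 1:])"
    by (simp only: tmult_add smult_tmult S M)
  also have "\<dots> = lin u' \<star> ([:m * b, s:] + smult W [:m, s / d + F k, 1:])"
    unfolding tmult_add(2) using nz(3) by (simp add: tmult_pCons Fp_simps F_simps FW field_simps)
  also have "[:m * b, s:] + smult W [:m, s / d + F k, 1:] = [:(a + (W + d)) * m, (W + d) * s / d + W * F k, W:]"
    using nz by (simp add: b_def field_simps)
  finally show "[:(a + (W + d)) * m', W * (m' * a / F (v + k)) / (- d) + (W + d) * F (F (v + k)), W + d:] \<star> lin v =
     lin u' \<star> [:(a + (W + d)) * m, (W + d) * s / d + W * F k, W:]" .
qed

text \<open>The root equation, cleared of denominators, is \<open>v F (v + k) k d = - m E\<close>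
  with \<open>d = Z - F Z\<close> and \<open>E = k d + (t - F Z) v\<close>. If
  \<open>v = - k\<close> then \<open>E = - k (t - Z)\<close> would vanish, which the transcendence
  of \<open>t\<close> forbids. Thus the target parameters are defined and nonzero.\<close>

lemma root_step:
  assumes Z: "conj Z" and mk: "m \<noteq> 0" "k \<noteq> 0" and root: "is_root Z m k v"
  shows "v + k \<noteq> 0" "next_m Z m k v \<noteq> 0" "next_k k v \<noteq> 0"
    "k * (Z - F Z) + (t - F Z) * v \<noteq> 0"
    "v * F (v + k) = - (m * (k * (Z - F Z) + (t - F Z) * v) / (k * (Z - F Z)))"
    "dM (F Z) (next_m Z m k v) (next_k k v) \<star> lin v = lin (v * next_m Z m k v / m) \<star> dM Z m k"
    "dB (F Z) (next_m Z m k v) (next_k k v) \<star> lin v = lin (v * next_m Z m k v / m) \<star> dB Z m k"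
proof -
  define a where "a = t - Z"
  define d where "d = Z - F Z"
  define W where "W = F Z"
  have eqs: "t - Z = a" "t - F Z = a + d" "Z - F Z = d" "F Z - Z = - d"
    by (simp_all add: a_def d_def)
  have ab: "a \<noteq> 0" "a + d \<noteq> 0" using t_not_conj[OF Z] t_not_conj[OF conj_F[OF Z]] by (auto simp: a_def d_def)
  have d0: "d \<noteq> 0" using conj_props(2)[OF Z] by (auto simp: d_def)
  have FFZ: "F (F Z) = Z" using conj_props[OF Z] by simp
  have FW: "F W = W + d" "F d = - d" by (simp_all add: W_def d_def FFZ F_simps)
  have v0: "v \<noteq> 0" by (rule is_root_nonzero[OF root mk(1)])
  define E where "E = k * d + (a + d) * v"
  have "v * (F v + F k) * (k * d) = - (m * (k * d + (a + d) * v))"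
  proof -
    have "v * (F v + F k) * (k * d) + m * (k * d + (a + d) * v) =
      (v * (F v + (m * (a + d) / k / d + F k)) + m) * (k * d)"
      using mk(2) d0 by (simp add: field_simps)
    also have "\<dots> = 0" using root unfolding is_root_def cs_def eqs by simp
    finally show ?thesis by (simp only: eq_neg_iff_add_eq_0)
  qed
  hence E1: "v * F (v + k) * (k * d) = - (m * E)" by (simp add: F_add E_def)
  show vk: "v + k \<noteq> 0"
  proof
    assume "v + k = 0"
    hence "m * E = 0" using E1 by simp
    hence "E = 0" using mk by simp
    moreover have "v = - k" using \<open>v + k = 0\<close> by (simp add: eq_neg_iff_add_eq_0)
    ultimately have "k * a = 0" by (simp add: E_def algebra_simps)
    thus False using mk ab by simp
  qed
  have E0: "E \<noteq> 0" using E1 v0 vk mk d0 by auto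
  thus "k * (Z - F Z) + (t - F Z) * v \<noteq> 0" unfolding eqs E_def .
  show "v * F (v + k) = - (m * (k * (Z - F Z) + (t - F Z) * v) / (k * (Z - F Z)))"
    using E1 mk d0 unfolding eqs E_def[symmetric] by (simp add: field_simps)
  have cs0: "cs Z m k \<noteq> 0" using mk ab by (simp add: cs_def eqs)
  show nm: "next_m Z m k v \<noteq> 0" "next_k k v \<noteq> 0" using cs0 vk mk by (auto simp: next_m_def next_k_def)
  have m: "m = - (v * (F v + F k) * k * d / E)"
    using E1 E0 by (simp add: F_add field_simps)
  have csE: "cs Z m k = m * (a + d) / k" by (simp add: cs_def eqs)
  have u': "v * next_m Z m k v / m = v * F (m * (a + d) / k * (v + k)) / (m * (a + d) / k * (v + k))"
    using mk by (simp add: next_m_def csE mult_ac)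
  have m': "next_m Z m k v = m * F (m * (a + d) / k * (v + k)) / (m * (a + d) / k * (v + k))"
    by (simp add: next_m_def csE)
  note I = isogeny_identity[OF ab d0 mk(2) v0 vk E0[unfolded E_def] FW, folded E_def, folded m, folded u' m']
  have tz: "t = a + (W + d)" by (simp add: a_def d_def W_def)
  have csE': "cs (F Z) (next_m Z m k v) (next_k k v) = next_m Z m k v * a / F (v + k)"
    by (simp add: cs_def next_k_def FFZ a_def)
  have M': "dM (F Z) (next_m Z m k v) (next_k k v) = [:next_m Z m k v, next_m Z m k v * a / F (v + k) / (- d) + F (F (v + k)), 1:]"
    unfolding dM_def csE' FFZ eqs by (simp add: next_k_def)
  have M: "dM Z m k = [:m, m * (a + d) / k / d + F k, 1:]" unfolding dM_def csE eqs by simp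
  show "dM (F Z) (next_m Z m k v) (next_k k v) \<star> lin v = lin (v * next_m Z m k v / m) \<star> dM Z m k"
    unfolding M' M by (rule I(1))
  have B': "dB (F Z) (next_m Z m k v) (next_k k v) = [:(a + (W + d)) * next_m Z m k v,
      W * (next_m Z m k v * a / F (v + k)) / (- d) + (W + d) * F (F (v + k)), W + d:]"
    unfolding dB_def csE' FFZ eqs tz[symmetric] by (simp add: W_def d_def next_k_def FFZ)
  have B: "dB Z m k = [:(a + (W + d)) * m, (W + d) * (m * (a + d) / k) / d + W * F k, W:]"
    unfolding dB_def csE eqs tz[symmetric] by (simp add: W_def d_def)
  show "dB (F Z) (next_m Z m k v) (next_k k v) \<star> lin v = lin (v * next_m Z m k v / m) \<star> dB Z m k"
    unfolding B' B by (rule I(2))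
qed

lemma root_isogeny:
  assumes Z: "conj Z" and mk: "m \<noteq> 0" "k \<noteq> 0" and root: "is_root Z m k v" and a: "a \<in> Ipow 0"
  shows "lin v \<star> dmod Z m k a = dmod (F Z) (next_m Z m k v) (next_k k v) a \<star> lin v"
proof (rule hom_intertwine[OF _ _ _ _ a])
  note st = root_step[OF Z mk root]
  note D = module_data_D[OF Z mk] and D' = module_data_D[OF conj_F[OF Z] st(2,3)]
  note h = dmod_hom[OF Z mk] and h' = dmod_hom[OF conj_F[OF Z] st(2,3)]
  note iso = isogeny_data[OF D D' st(6,7)]
  show "Fq_algebra_hom q \<zeta> t (dmod Z m k)" "Fq_algebra_hom q \<zeta> t (dmod (F Z) (next_m Z m k v) (next_k k v))"
    by (fact h h')+
  show "lin v \<star> dmod Z m k x = dmod (F Z) (next_m Z m k v) (next_k k v) x \<star> lin v"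
    unfolding h h' by (simp only: tmult_assoc st(6)) (simp only: iso flip: tmult_assoc)
  show "lin v \<star> dmod Z m k y = dmod (F Z) (next_m Z m k v) (next_k k v) y \<star> lin v"
    unfolding h h' by (simp only: tmult_assoc st(6)) (simp only: iso flip: tmult_assoc)
qed

text \<open>With \<open>M = (\<tau> - m / v)(\<tau> - v)\<close> the right factor
  \<open>\<tau> - v\<close> cancels from the isogeny identity. The line \<open>m / v\<close> of the
  target is the image of the whole torsion of the source.\<close>

lemma next_factor:
  assumes Z: "conj Z" and mk: "m \<noteq> 0" "k \<noteq> 0" and root: "is_root Z m k v"
  shows "dM (F Z) (next_m Z m k v) (next_k k v) = lin (v * next_m Z m k v / m) \<star> lin (m / v)"
proof -
  have v0: "v \<noteq> 0" by (rule is_root_nonzero[OF root mk(1)])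
  have "dM (F Z) (next_m Z m k v) (next_k k v) \<star> lin v = lin (v * next_m Z m k v / m) \<star> lin (m / v) \<star> lin v"
    unfolding root_step(6)[OF assms] is_root_factor[OF root v0] by (simp only: tmult_assoc)
  thus ?thesis by (rule tmult_right_cancel[rotated]) simp
qed

subsection \<open>Cyclic torsion submodules as chains of lines\<close>

abbreviation "submod \<equiv> submodule_via q \<zeta> t"
abbreviation "tors \<phi> k \<equiv> torsion q \<phi> (Ipow k)"

lemma submodD:
  assumes "submod \<phi> G"
  shows "0 \<in> G" "u \<in> G \<Longrightarrow> v \<in> G \<Longrightarrow> u - v \<in> G" "u \<in> G \<Longrightarrow> v \<in> G \<Longrightarrow> u + v \<in> G"
    "a \<in> Ipow 0 \<Longrightarrow> u \<in> G \<Longrightarrow> ev (\<phi> a) u \<in> G"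
proof -
  have *: "0 \<in> G" "\<And>u v. u \<in> G \<Longrightarrow> v \<in> G \<Longrightarrow> u - v \<in> G" "\<And>a u. a \<in> Ipow 0 \<Longrightarrow> u \<in> G \<Longrightarrow> ev (\<phi> a) u \<in> G"
    using assms unfolding submodule_via_def Aset_eq by auto
  show "0 \<in> G" "u \<in> G \<Longrightarrow> v \<in> G \<Longrightarrow> u - v \<in> G" "a \<in> Ipow 0 \<Longrightarrow> u \<in> G \<Longrightarrow> ev (\<phi> a) u \<in> G" by (fact *)+
  show "u + v \<in> G" if "u \<in> G" "v \<in> G" using *(2)[OF that(1) *(2)[OF *(1) that(2)]] by simp
qed

lemma submod_scale: "submod \<phi> G \<Longrightarrow> Fq_algebra_hom q \<zeta> t \<phi> \<Longrightarrow> c \<in> Fq q \<Longrightarrow> u \<in> G \<Longrightarrow> c * u \<in> G"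
  using submodD(4)[of \<phi> G c u] Fq_homD(3)[of \<phi> c] Fq_Ipow[of c] by (simp add: ev_pCons)

text \<open>\<open>x\<close> and \<open>y\<close> act through \<open>U M\<close> and
  \<open>V M\<close>, so \<open>M\<close> kills no more than they do. Conversely the third identity
  of \<open>module_data_props\<close>, multiplied by \<open>M\<close>, writes \<open>M\<close> as a
  left combination of these two.\<close>

lemma Ker_M:
  assumes Z: "conj Z" and mk: "m \<noteq> 0" "k \<noteq> 0"
  shows "z \<in> Ker (dM Z m k) \<longleftrightarrow> (\<forall>a\<in>Ipow 1. ev (dmod Z m k a) z = 0)"
proof
  note h = dmod_hom[OF Z mk]
  have xy: "x \<in> Ipow 1" "y \<in> Ipow 1" using x_Ipow y_Ipow Ipow_mono[of 1 2] by auto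
  {
    assume z: "z \<in> Ker (dM Z m k)"
    show "\<forall>a\<in>Ipow 1. ev (dmod Z m k a) z = 0"
    proof
      fix a assume "a \<in> Ipow 1"
      then obtain u v where uv: "u \<in> Ipow 0" "v \<in> Ipow 0" "a = u * x + v * y" using Ipow_Suc_rep[of a 0] by auto
      have "dmod Z m k a = dmod Z m k u \<star> dmod Z m k x + dmod Z m k v \<star> dmod Z m k y"
        using uv Fq_homD[OF h(1)] by (simp add: Ipow_absorb)
      thus "ev (dmod Z m k a) z = 0" using z by (simp add: h(2,3) Ker_def ev_add ev_tmult)
    qed
  next
    assume 0: "\<forall>a\<in>Ipow 1. ev (dmod Z m k a) z = 0"
    let ?M = "dM Z m k" and ?B = "dB Z m k" and ?U = "dU Z m k" and ?V = "dV Z m k"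
    have "(?B \<star> ?V - smult tr (?M \<star> ?V) + smult nm (?M \<star> ?U)) \<star> ?M = ?M"
      using module_data_props(3)[OF module_data_D[OF Z mk]] by simp
    hence "?M = ?B \<star> (?V \<star> ?M) - smult tr (?M \<star> (?V \<star> ?M)) + smult nm (?M \<star> (?U \<star> ?M))"
      by (simp add: tmult_add tmult_diff smult_tmult tmult_assoc)
    hence "ev ?M z = ev (?B \<star> (?V \<star> ?M) - smult tr (?M \<star> (?V \<star> ?M)) + smult nm (?M \<star> (?U \<star> ?M))) z" by simp
    also have "\<dots> = ev ?B (ev (dmod Z m k y) z) - tr * ev ?M (ev (dmod Z m k y) z) + nm * ev ?M (ev (dmod Z m k x) z)"
      by (simp add: ev_add ev_diff ev_smult ev_tmult h(2,3))
    also have "\<dots> = 0" using 0 xy by simp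
    finally show "z \<in> Ker ?M" by (simp add: Ker_def)
  }
qed

text \<open>Cyclicity without reference to \<open>A / I\<^sup>n\<close>: the socle
  \<open>G \<inter> Ker M\<close> is at most one line over \<open>F_q\<close>.\<close>

definition qgood :: "('a \<Rightarrow> 'a poly) \<Rightarrow> 'a poly \<Rightarrow> nat \<Rightarrow> 'a set \<Rightarrow> bool" where
  "qgood \<phi> M n G \<longleftrightarrow> submod \<phi> G \<and> G \<subseteq> tors \<phi> n \<and> finite G \<and> card (G \<inter> Ker M) \<le> q"

text \<open>If \<open>r\<close> is least such that \<open>Ipow r\<close> kills \<open>g0\<close>,
  some element of \<open>Ipow (r - 1)\<close> moves \<open>g0\<close> to a nonzero element killed by
  \<open>I\<^sub>\<infinity>\<close>.\<close>

lemma socle_nontrivial: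
  assumes Z: "conj Z" and mk: "m \<noteq> 0" "k \<noteq> 0"
    and G: "submod (dmod Z m k) G" "G \<subseteq> tors (dmod Z m k) n" "G \<noteq> {0}"
  shows "\<exists>g\<in>G. g \<noteq> 0 \<and> g \<in> Ker (dM Z m k)"
proof -
  note h = dmod_hom(1)[OF Z mk]
  obtain g0 where g0: "g0 \<in> G" "g0 \<noteq> 0" using G(1,3) submodD(1)[OF G(1)] by blast
  let ?P = "\<lambda>r. \<forall>a\<in>Ipow r. ev (dmod Z m k a) g0 = 0"
  have Pn: "?P n" using G(2) g0 by (auto simp: torsion_def)
  define r where "r = (LEAST r. ?P r)"
  have Pr: "?P r" unfolding r_def using Pn by (rule LeastI)
  have "r \<noteq> 0"
  proof
    assume "r = 0"
    hence "ev (dmod Z m k 1) g0 = 0" using Pr one_Ipow by blast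
    thus False using g0 Fq_homD(5)[OF h] by simp
  qed
  then obtain r' where r': "r = Suc r'" by (cases r) auto
  have "\<not> ?P r'" using not_less_Least[of r' ?P] r' unfolding r_def by simp
  then obtain a where a: "a \<in> Ipow r'" "ev (dmod Z m k a) g0 \<noteq> 0" by blast
  have a0: "a \<in> Ipow 0" using a Ipow_mono[of 0 r'] by auto
  have "ev (dmod Z m k b) (ev (dmod Z m k a) g0) = 0" if b: "b \<in> Ipow 1" for b
  proof -
    have b0: "b \<in> Ipow 0" using b Ipow_mono[of 0 1] by auto
    have "b * a \<in> Ipow r" using Ipow_mult[OF b a(1)] r' by simp
    hence "ev (dmod Z m k (b * a)) g0 = 0" using Pr by blast
    thus ?thesis by (simp add: Fq_homD(2)[OF h b0 a0] ev_tmult)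
  qed
  hence "ev (dmod Z m k a) g0 \<in> Ker (dM Z m k)" unfolding Ker_M[OF Z mk] by blast
  thus ?thesis using a submodD(4)[OF G(1) a0 g0(1)] by blast
qed

lemma line_root:
  assumes "g \<noteq> 0" "g \<in> Ker (dM Z m k)"
  shows "is_root Z m k (F g / g)" "Ker (lin (F g / g)) = (\<lambda>c. c * g) ` Fq q"
  using assms is_root_iff[of g "F g / g" Z m k] Ker_lin[of g "F g / g"] by (auto simp: Ker_def)

lemma Ker_lin_cases:
  assumes G: "submod \<phi> G" "Fq_algebra_hom q \<zeta> t \<phi>" and z: "z \<in> G" "z \<noteq> 0" "z \<in> Ker (lin v)"
  shows "Ker (lin v) \<subseteq> G"
proof -
  have "F z = v * z" using z by (simp add: Ker_def ev_lin)
  thus ?thesis using Ker_lin[OF z(2)] submod_scale[OF G _ z(1)] by auto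
qed

lemma finite_vimage_ev: assumes "f \<noteq> 0" "finite S" shows "finite {z. ev f z \<in> S}"
proof -
  have "finite {z. ev f z = s}" for s
  proof (cases "\<exists>z0. ev f z0 = s")
    case True
    then obtain z0 where z0: "ev f z0 = s" by blast
    have "{z. ev f z = s} \<subseteq> (\<lambda>z. z + z0) ` Ker f"
    proof
      fix z assume "z \<in> {z. ev f z = s}"
      hence "z - z0 \<in> Ker f" using z0 by (simp add: Ker_def ev_arg_diff)
      thus "z \<in> (\<lambda>z. z + z0) ` Ker f" by (intro image_eqI[of _ _ "z - z0"]) auto
    qed
    thus ?thesis using finite_Ker[OF assms(1)] finite_subset by blast
  qed simp
  moreover have "{z. ev f z \<in> S} = (\<Union>s\<in>S. {z. ev f z = s})" by auto
  ultimately show ?thesis using assms(2) by simp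
qed

end

text \<open>One isogeny \<open>\<tau> - v\<close> from \<open>\<phi>\<close> to
  \<open>\<psi>\<close>. The abbreviations follow \<open>M = (\<tau> - u)(\<tau> - v)\<close> and
  \<open>M' = (\<tau> - u')(\<tau> - u)\<close>; \<open>u\<close> is the line that must not follow
  \<open>v\<close>.\<close>

locale line_step = setting q e \<zeta> t for q e and \<zeta> t :: "'a::alg_closed_field" +
  fixes Z m k v :: 'a
  assumes Z: "conj Z" and mk: "m \<noteq> 0" "k \<noteq> 0" and root: "is_root Z m k v"
begin

abbreviation "\<phi> \<equiv> dmod Z m k"
abbreviation "M \<equiv> dM Z m k"
abbreviation "m' \<equiv> next_m Z m k v"
abbreviation "k' \<equiv> next_k k v"
abbreviation "\<psi> \<equiv> dmod (F Z) m' k'"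
abbreviation "M' \<equiv> dM (F Z) m' k'"
abbreviation "u \<equiv> m / v"
abbreviation "u' \<equiv> v * m' / m"

lemmas st = root_step[OF Z mk root]
lemmas Z' = conj_F[OF Z]

lemma v0: "v \<noteq> 0" using is_root_nonzero[OF root mk(1)] .

lemma uu: "u \<noteq> 0" "u' \<noteq> 0" using v0 mk st by auto

lemma M_factor: "M = lin u \<star> lin v" by (rule is_root_factor[OF root v0])

lemma M'_factor: "M' = lin u' \<star> lin u"
  by (rule next_factor[OF Z mk root])

lemma M'_lin: "M' \<star> lin v = lin u' \<star> M" by (simp add: M_factor M'_factor tmult_assoc)

lemma phi_hom: "Fq_algebra_hom q \<zeta> t \<phi>" by (rule dmod_hom(1)[OF Z mk])
lemma psi_hom: "Fq_algebra_hom q \<zeta> t \<psi>" by (rule dmod_hom(1)[OF Z' st(2,3)])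

lemma intertwine: "a \<in> Ipow 0 \<Longrightarrow> ev (lin v) (ev (\<phi> a) z) = ev (\<psi> a) (ev (lin v) z)"
  using arg_cong[OF root_isogeny[OF Z mk root], of a "\<lambda>f. ev f z"]
  by (simp add: ev_tmult )

lemma KerM: "z \<in> Ker M \<longleftrightarrow> (\<forall>a\<in>Ipow 1. ev (\<phi> a) z = 0)"
  by (rule Ker_M[OF Z mk])

lemma Ker_lin_M: "Ker (lin v) \<subseteq> Ker M"
  by (auto simp: M_factor Ker_def ev_tmult)

lemma card_Ker: "card (Ker (lin v)) = q" "card (Ker (lin u)) = q" "card (Ker (lin u')) = q" "card (Ker M) = q * q"
  using card_Ker_lin[OF v0] card_Ker_lin[OF uu(1)] card_Ker_lin[OF uu(2)]
    Ker_tmult_card[of "lin u" "lin v"] by (auto simp: M_factor)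

lemma fin_Ker: "finite (Ker (lin v))" "finite (Ker (lin u))" "finite (Ker (lin u'))"
  by (rule finite_Ker, simp)+

text \<open>Elements of \<open>Ipow n\<close> send \<open>G\<close> into its socle, which is the
  kernel of the isogeny, so the torsion level of the image drops by one. If the image contained the
  line \<open>u\<close>, then \<open>G\<close> would contain all of \<open>Ker M\<close>, whose
  \<open>q * q\<close> elements exceed the socle bound.\<close>

lemma down:
  assumes G: "qgood \<phi> M (Suc n) G" and sub: "Ker (lin v) \<subseteq> G"
  shows "qgood \<psi> M' n (ev (lin v) ` G)" "card G = q * card (ev (lin v) ` G)"
    "\<not> Ker (lin u) \<subseteq> ev (lin v) ` G" "G = {z. ev (lin v) z \<in> ev (lin v) ` G}" "G \<inter> Ker M = Ker (lin v)"
proof -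
  let ?e = "lin v"
  have S: "submod \<phi> G" and T: "G \<subseteq> tors \<phi> (Suc n)" and fin: "finite G" and soc: "card (G \<inter> Ker M) \<le> q"
    using G unfolding qgood_def by auto
  show GM: "G \<inter> Ker M = Ker ?e"
    using card_seteq[of "G \<inter> Ker M" "Ker ?e"] sub Ker_lin_M soc fin card_Ker by auto
  have eq0: "{g \<in> G. ev ?e g = 0} = Ker ?e" using sub by (auto simp: Ker_def)
  have "card G = card (ev ?e ` G) * card {g \<in> G. ev ?e g = 0}"
    by (rule card_additive[OF fin]) (auto simp: submodD(2)[OF S] ev_arg_diff)
  thus "card G = q * card (ev ?e ` G)" unfolding eq0 card_Ker by simp
  show "G = {z. ev ?e z \<in> ev ?e ` G}"
  proof
    show "{z. ev ?e z \<in> ev ?e ` G} \<subseteq> G"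
    proof
      fix z assume "z \<in> {z. ev ?e z \<in> ev ?e ` G}"
      then obtain g where g: "g \<in> G" "ev ?e z = ev ?e g" by auto
      hence "z - g \<in> Ker ?e" by (simp add: Ker_def ev_arg_diff )
      hence "z - g + g \<in> G" using submodD(3)[OF S _ g(1)] sub by blast
      thus "z \<in> G" by simp
    qed
  qed auto
  note G_eq = this
  have "submod \<psi> (ev ?e ` G)" unfolding submodule_via_def Aset_eq
  proof (intro conjI ballI)
    show "0 \<in> ev ?e ` G" using submodD(1)[OF S] by (intro image_eqI[of _ _ 0]) auto
    fix a b assume "a \<in> ev ?e ` G" "b \<in> ev ?e ` G"
    then obtain g h where "a = ev ?e g" "b = ev ?e h" "g \<in> G" "h \<in> G" by blast
    thus "a - b \<in> ev ?e ` G" using submodD(2)[OF S] by (intro image_eqI[of _ _ "g - h"]) (auto simp: ev_arg_diff)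
  next
    fix a b assume a: "a \<in> Ipow 0" and "b \<in> ev ?e ` G"
    then obtain g where "b = ev ?e g" "g \<in> G" by blast
    thus "ev (\<psi> a) b \<in> ev ?e ` G" using intertwine[OF a, of g] submodD(4)[OF S a]
      by (intro image_eqI[of _ _ "ev (\<phi> a) g"]) auto
  qed
  moreover have "ev ?e ` G \<subseteq> tors \<psi> n"
  proof
    fix b assume "b \<in> ev ?e ` G"
    then obtain g where g: "b = ev ?e g" "g \<in> G" by blast
    have "ev (\<psi> a) b = 0" if a: "a \<in> Ipow n" for a
    proof -
      have a0: "a \<in> Ipow 0" using a Ipow_mono[of 0 n] by auto
      have "ev (\<phi> c) (ev (\<phi> a) g) = 0" if c: "c \<in> Ipow 1" for c
      proof -
        have c0: "c \<in> Ipow 0" using c Ipow_mono[of 0 1] by auto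
        have "c * a \<in> Ipow (Suc n)" using Ipow_mult[OF c a] by simp
        hence "ev (\<phi> (c * a)) g = 0" using T g by (auto simp: torsion_def)
        thus ?thesis by (simp add: Fq_homD(2)[OF phi_hom c0 a0] ev_tmult)
      qed
      hence "ev (\<phi> a) g \<in> G \<inter> Ker M" using KerM submodD(4)[OF S a0 g(2)] by blast
      hence "ev ?e (ev (\<phi> a) g) = 0" unfolding GM by (simp add: Ker_def)
      thus ?thesis using intertwine[OF a0] g by simp
    qed
    thus "b \<in> tors \<psi> n" by (simp add: torsion_def)
  qed
  moreover have "card (ev ?e ` G \<inter> Ker M') \<le> q"
  proof -
    \<comment> \<open>The preimage in \<open>G\<close> of the socle of the image. \<open>M\<close>
      maps it into \<open>Ker (lin u')\<close> with kernel inside the socle of \<open>G\<close>, so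
      it has at most \<open>q * q\<close> elements; it covers the new socle with fibres of size
      \<open>q\<close>.\<close>
    define S' where "S' = {g\<in>G. ev M' (ev ?e g) = 0}"
    have finS: "finite S'" using fin by (simp add: S'_def)
    have Sd: "a - b \<in> S'" if "a \<in> S'" "b \<in> S'" for a b
      using that submodD(2)[OF S] by (auto simp: S'_def ev_arg_diff)
    have "ev ?e ` S' = ev ?e ` G \<inter> Ker M'" by (auto simp: S'_def Ker_def)
    moreover have "{g\<in>S'. ev ?e g = 0} = Ker ?e" using sub by (auto simp: S'_def Ker_def)
    ultimately have 1: "card S' = card (ev ?e ` G \<inter> Ker M') * q"
      using card_additive[OF finS Sd, of "ev ?e"] card_Ker by (simp add: ev_arg_diff )
    have Mm: "ev M' (ev ?e g) = ev (lin u') (ev M g)" for g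
      using arg_cong[OF M'_lin, of "\<lambda>f. ev f g"] by (simp only: ev_tmult)
    have "ev M ` S' \<subseteq> Ker (lin u')" unfolding S'_def Mm by (auto simp: Ker_def)
    hence "card (ev M ` S') \<le> q" using card_mono[OF fin_Ker(3)] card_Ker by metis
    moreover have "{g\<in>S'. ev M g = 0} \<subseteq> G \<inter> Ker M" by (auto simp: S'_def Ker_def)
    hence "card {g\<in>S'. ev M g = 0} \<le> q" using card_mono[of "G \<inter> Ker M"] fin soc by (meson finite_Int order_trans)
    moreover have "card S' = card (ev M ` S') * card {g\<in>S'. ev M g = 0}"
      by (rule card_additive[OF finS Sd]) (auto simp: ev_arg_diff)
    ultimately have "card S' \<le> q * q" by (simp add: mult_le_mono)
    thus ?thesis using 1 by simp
  qed
  ultimately show "qgood \<psi> M' n (ev ?e ` G)" using fin unfolding qgood_def by simp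
  show "\<not> Ker (lin u) \<subseteq> ev ?e ` G"
  proof
    assume *: "Ker (lin u) \<subseteq> ev ?e ` G"
    have "Ker M \<subseteq> G"
    proof
      fix z assume "z \<in> Ker M"
      hence "ev ?e z \<in> Ker (lin u)" by (simp add: Ker_def M_factor ev_tmult )
      thus "z \<in> G" using * G_eq by blast
    qed
    hence "q * q \<le> q" using soc card_Ker by (simp add: Int_absorb1)
    thus False using q_gt1 by simp
  qed
qed

text \<open>The socle can only grow through a nonzero element of \<open>G'\<close> on the line
  \<open>u\<close>. Being an \<open>F_q\<close>-space, \<open>G'\<close> would then contain that
  whole line.\<close>

lemma up:
  assumes G: "qgood \<psi> M' n G'" and u: "\<not> Ker (lin u) \<subseteq> G'"
  shows "qgood \<phi> M (Suc n) {z. ev (lin v) z \<in> G'}" "Ker (lin v) \<subseteq> {z. ev (lin v) z \<in> G'}"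
    "ev (lin v) ` {z. ev (lin v) z \<in> G'} = G'"
proof -
  let ?e = "lin v" let ?G = "{z. ev (lin v) z \<in> G'}"
  have S: "submod \<psi> G'" and T: "G' \<subseteq> tors \<psi> n" and fin: "finite G'"
    using G unfolding qgood_def by auto
  show Ke: "Ker ?e \<subseteq> ?G" using submodD(1)[OF S] by (auto simp: Ker_def)
  show "ev ?e ` ?G = G'" using ev_surj[of ?e] by (auto simp: image_iff) metis
  have "submod \<phi> ?G" unfolding submodule_via_def Aset_eq
    using submodD[OF S] intertwine by (auto simp: ev_arg_diff)
  moreover have "?G \<subseteq> tors \<phi> (Suc n)"
  proof
    fix g assume g: "g \<in> ?G"
    have "ev (\<phi> c) g = 0" if c: "c \<in> Ipow (Suc n)" for c
    proof -
      obtain a b where ab: "a \<in> Ipow n" "b \<in> Ipow n" "c = a * x + b * y" using Ipow_Suc_rep[OF c] by blast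
      have ab0: "a \<in> Ipow 0" "b \<in> Ipow 0" using ab Ipow_mono[of 0 n] by auto
      have xy: "x \<in> Ipow 1" "y \<in> Ipow 1" using x_Ipow y_Ipow Ipow_mono[of 1 2] by auto
      have kill: "ev (\<phi> a) g \<in> Ker M" if a: "a \<in> Ipow n" for a
      proof -
        have "a \<in> Ipow 0" using a Ipow_mono[of 0 n] by auto
        hence "ev ?e (ev (\<phi> a) g) = ev (\<psi> a) (ev ?e g)" by (rule intertwine)
        also have "\<dots> = 0" using T g a by (auto simp: torsion_def)
        finally show ?thesis using Ker_lin_M by (auto simp: Ker_def)
      qed
      have "c = x * a + y * b" using ab(3) by (simp add: mult.commute)
      hence "\<phi> c = \<phi> x \<star> \<phi> a + \<phi> y \<star> \<phi> b"
        using ab0 Fq_homD[OF phi_hom] by (simp add: Ipow_absorb)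
      hence "ev (\<phi> c) g = ev (\<phi> x) (ev (\<phi> a) g) + ev (\<phi> y) (ev (\<phi> b) g)" by (simp add: ev_add ev_tmult)
      also have "\<dots> = 0" using kill[OF ab(1)] kill[OF ab(2)] xy unfolding KerM by simp
      finally show ?thesis .
    qed
    thus "g \<in> tors \<phi> (Suc n)" by (simp add: torsion_def)
  qed
  moreover have "finite ?G" using finite_vimage_ev[OF _ fin, of ?e] by simp
  moreover have "?G \<inter> Ker M \<subseteq> Ker ?e"
  proof
    fix z assume z: "z \<in> ?G \<inter> Ker M"
    hence 1: "ev ?e z \<in> G'" "ev ?e z \<in> Ker (lin u)" by (auto simp: Ker_def M_factor ev_tmult)
    hence "ev ?e z = 0" using Ker_lin_cases[OF S psi_hom] u by blast
    thus "z \<in> Ker ?e" by (simp add: Ker_def)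
  qed
  hence "card (?G \<inter> Ker M) \<le> q" using card_mono[OF fin_Ker(1)] card_Ker by metis
  ultimately show "qgood \<phi> M (Suc n) ?G" unfolding qgood_def by blast
qed

end

context setting
begin

lemma line_stepI: "conj Z \<Longrightarrow> m \<noteq> 0 \<Longrightarrow> k \<noteq> 0 \<Longrightarrow> is_root Z m k v \<Longrightarrow> line_step q e \<zeta> t Z m k v"
  by unfold_locales

lemmas step_down = line_step.down[OF line_stepI]
lemmas step_up = line_step.up[OF line_stepI]

text \<open>Each passage to the quotient by a line of the socle divides the order by
  \<open>q\<close> and lowers the torsion level by one.\<close>

lemma qgood_card:
  assumes "conj Z" "m \<noteq> 0" "k \<noteq> 0" "qgood (dmod Z m k) (dM Z m k) n G"
  shows "card G \<le> q ^ n"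
  using assms
proof (induction n arbitrary: Z m k G)
  case 0
  have "G \<subseteq> {0}" using 0 Fq_homD(5)[OF dmod_hom(1)[OF 0(1-3)]]
    by (auto simp: qgood_def torsion_def dest!: subsetD bspec[of _ _ 1])
  thus ?case using card_mono[of "{0}" G] by simp
next
  case (Suc n)
  have S: "submod (dmod Z m k) G" and T: "G \<subseteq> tors (dmod Z m k) (Suc n)" and soc: "card (G \<inter> Ker (dM Z m k)) \<le> q"
    using Suc.prems unfolding qgood_def by auto
  show ?case
  proof (cases "G = {0}")
    case True thus ?thesis using q_gt1 by (simp del: power_Suc)
  next
    case False
    then obtain g where g: "g \<in> G" "g \<noteq> 0" "g \<in> Ker (dM Z m k)"
      using socle_nontrivial[OF Suc.prems(1-3) S T] by blast
    define v where "v = F g / g"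
    have root: "is_root Z m k v" and Kl: "Ker (lin v) = (\<lambda>c. c * g) ` Fq q" unfolding v_def using line_root[OF g(2,3)] .
    have sub: "Ker (lin v) \<subseteq> G" unfolding Kl using submod_scale[OF S dmod_hom(1)[OF Suc.prems(1-3)] _ g(1)] by auto
    note st = root_step[OF Suc.prems(1-3) root]
    note d = step_down[OF Suc.prems(1-3) root Suc.prems(4) sub]
    have "card (ev (lin v) ` G) \<le> q ^ n"
      by (rule Suc.IH[OF conj_F[OF Suc.prems(1)] st(2,3) d(1)])
    thus ?thesis using d(2) by simp
  qed
qed

definition good :: "('a \<Rightarrow> 'a poly) \<Rightarrow> 'a poly \<Rightarrow> nat \<Rightarrow> 'a set \<Rightarrow> bool" where
  "good \<phi> M n G \<longleftrightarrow> qgood \<phi> M n G \<and> card G = q ^ n"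

text \<open>On \<open>A / I\<^sup>n\<close> the kernel of multiplication by \<open>y\<close> is the
  line spanned by \<open>y ^ (n - 1)\<close>. It is used instead of the socle because it involves
  one element of \<open>A\<close> only; the socle lies inside it.\<close>

lemma primitive_y_kernel:
  assumes \<phi>: "Fq_algebra_hom q \<zeta> t \<phi>" and P: "primitive_torsion q \<zeta> t \<phi> (Ipow n) G"
  shows "card {g\<in>G. ev (\<phi> y) g = 0} \<le> q" "card G = q ^ n" "finite G" "submod \<phi> G" "G \<subseteq> tors \<phi> n"
proof -
  obtain f where S: "submod \<phi> G" "G \<subseteq> tors \<phi> n" and f: "bij_betw f (carrier (A Quot Ipow n)) G"
    and add: "\<forall>u \<in> carrier (A Quot Ipow n). \<forall>v \<in> carrier (A Quot Ipow n). f (u \<oplus>\<^bsub>A Quot Ipow n\<^esub> v) = f u + f v"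
    and act: "\<forall>a \<in> Ipow 0. \<forall>u \<in> carrier (A Quot Ipow n).
           f ((Ipow n +>\<^bsub>A\<^esub> a) \<otimes>\<^bsub>A Quot Ipow n\<^esub> u) = ev (\<phi> a) (f u)"
    using P unfolding primitive_torsion_def Aset_eq by blast
  show "submod \<phi> G" "G \<subseteq> tors \<phi> n" by (fact S)+
  define h where "h a = f (Ipow n +>\<^bsub>A\<^esub> a)" for a
  have carr: "Ipow n +>\<^bsub>A\<^esub> a \<in> carrier (A Quot Ipow n)" if "a \<in> Ipow 0" for a
    unfolding Quot_carrier using that by blast
  have h_eq: "h a = h b \<longleftrightarrow> a - b \<in> Ipow n" if "a \<in> Ipow 0" "b \<in> Ipow 0" for a b
    unfolding h_def Quot_eq[OF Ipow_ideal that, symmetric]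
    using bij_betw_imp_inj_on[OF f] carr that by (auto simp: inj_on_def)
  have h_act: "h (a * b) = ev (\<phi> a) (h b)" if "a \<in> Ipow 0" "b \<in> Ipow 0" for a b
    using bspec[OF bspec[OF act that(1)] carr[OF that(2)]] Quot_ops(2)[OF Ipow_ideal that] by (simp add: h_def)
  have h_0: "h 0 = 0"
  proof -
    have "h (0 + 0) = h 0 + h 0"
      using bspec[OF bspec[OF add carr] carr, of 0 0] Quot_ops(1)[OF Ipow_ideal, of 0 0 n] unfolding h_def by simp
    hence "h 0 + h 0 = h 0 + 0" by simp
    thus ?thesis by (simp only: add_left_cancel)
  qed
  have h_surj: "\<exists>a\<in>Ipow 0. g = h a" if "g \<in> G" for g
    using bij_betw_imp_surj_on[OF f] that unfolding Quot_carrier h_def by auto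
  show cG: "card G = q ^ n" using bij_betw_same_card[OF f] card_Ipow_Quot by simp
  thus "finite G" using card_gt_0_iff by (metis q_pos zero_less_power)
  show "card {g\<in>G. ev (\<phi> y) g = 0} \<le> q"
  proof (cases n)
    case 0
    have "card {g\<in>G. ev (\<phi> y) g = 0} \<le> card G" using \<open>finite G\<close> by (intro card_mono) auto
    thus ?thesis using cG 0 q_gt1 by simp
  next
    case (Suc n')
    have "{g\<in>G. ev (\<phi> y) g = 0} \<subseteq> (\<lambda>c. h (c * y ^ n')) ` Fq q"
    proof
      fix g assume "g \<in> {g\<in>G. ev (\<phi> y) g = 0}"
      then obtain b where b: "b \<in> Ipow 0" "g = h b" "ev (\<phi> y) (h b) = 0" using h_surj by auto
      have yb: "y * b \<in> Ipow 0" using b by (simp add: Ipow_absorb)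
      have "h (y * b) = h 0" using b h_act[of y b] h_0 by simp
      hence "y * b \<in> Ipow (Suc n')" using h_eq[OF yb zero_Ipow] Suc by simp
      hence "b \<in> Ipow n'" by (rule y_cancel[OF b(1)])
      then obtain c where c: "c \<in> Fq q" "b - c * y ^ n' \<in> Ipow (Suc n')" using Ipow_step by blast
      have "y ^ n' \<in> Ipow 0" by (induction n') (auto intro: Ipow_absorb)
      hence "h b = h (c * y ^ n')" using h_eq[of b "c * y ^ n'"] b c Suc by (simp add: Ipow_absorb Fq_Ipow)
      thus "g \<in> (\<lambda>c. h (c * y ^ n')) ` Fq q" using b c by blast
    qed
    hence "card {g\<in>G. ev (\<phi> y) g = 0} \<le> card ((\<lambda>c. h (c * y ^ n')) ` Fq q)"
      using finite_Fq by (intro card_mono) auto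
    also have "\<dots> \<le> card (Fq q :: 'a set)" by (rule card_image_le[OF finite_Fq])
    finally show ?thesis by (simp add: card_Fq)
  qed
qed

text \<open>For the converse, a good set of order \<open>q ^ n\<close> is too large to be killed by
  \<open>Ipow (n - 1)\<close>. An element \<open>\<mu>\<close> that survives has annihilator exactly
  \<open>Ipow n\<close> by \<open>Ipow_socle\<close>, so
  \<open>a \<mapsto> \<phi>\<^sub>a(\<mu>)\<close> embeds \<open>A / I\<^sup>n\<close>, and counting
  makes it onto.\<close>

lemma primitive_iff_good:
  assumes Z: "conj Z" and mk: "m \<noteq> 0" "k \<noteq> 0"
  shows "primitive_torsion q \<zeta> t (dmod Z m k) (Ipow n) G \<longleftrightarrow> good (dmod Z m k) (dM Z m k) n G"
proof
  let ?\<phi> = "dmod Z m k" and ?M = "dM Z m k"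
  note h = dmod_hom(1)[OF Z mk]
  {
    assume P: "primitive_torsion q \<zeta> t ?\<phi> (Ipow n) G"
    note p = primitive_y_kernel[OF h P]
    have "G \<inter> Ker ?M \<subseteq> {g\<in>G. ev (?\<phi> y) g = 0}" using Ker_M[OF Z mk] y_Ipow by auto
    hence "card (G \<inter> Ker ?M) \<le> card {g\<in>G. ev (?\<phi> y) g = 0}" using p(3) by (intro card_mono) auto
    thus "good ?\<phi> ?M n G" using p unfolding good_def qgood_def by simp
  next
    assume g: "good ?\<phi> ?M n G"
    hence S: "submod ?\<phi> G" and T: "G \<subseteq> tors ?\<phi> n" and fin: "finite G" and cG: "card G = q ^ n" and soc: "card (G \<inter> Ker ?M) \<le> q"
      unfolding good_def qgood_def by auto
    have "\<exists>\<mu>\<in>G. \<forall>b\<in>Ipow 0. ev (?\<phi> b) \<mu> = 0 \<longrightarrow> b \<in> Ipow n"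
    proof (cases n)
      case 0 thus ?thesis using submodD(1)[OF S] by auto
    next
      case (Suc n')
      have "\<not> G \<subseteq> tors ?\<phi> n'"
      proof
        assume "G \<subseteq> tors ?\<phi> n'"
        hence "card G \<le> q ^ n'" using S fin soc by (intro qgood_card[OF Z mk]) (auto simp: qgood_def)
        thus False using cG Suc q_gt1 by simp
      qed
      then obtain \<mu> a where \<mu>: "\<mu> \<in> G" "a \<in> Ipow n'" "ev (?\<phi> a) \<mu> \<noteq> 0" by (auto simp: torsion_def)
      have "b \<in> Ipow n" if b: "b \<in> Ipow 0" "ev (?\<phi> b) \<mu> = 0" for b
      proof (rule ccontr)
        assume "b \<notin> Ipow n"
        then obtain c where c: "c \<in> Ipow 0" "a - b * c \<in> Ipow (Suc n')"
          using Ipow_socle[OF b(1) _ \<mu>(2)] Suc by blast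
        have a0: "a \<in> Ipow 0" using \<mu>(2) Ipow_mono[of 0 n'] by auto
        have bc: "b * c \<in> Ipow 0" "a - b * c \<in> Ipow 0" using b c a0 by (auto simp: Ipow_absorb Ipow_diff)
        have "?\<phi> (c * b + (a - b * c)) = ?\<phi> (c * b) + ?\<phi> (a - b * c)"
          by (rule Fq_homD(1)[OF h Ipow_absorb[OF c(1) b(1)] bc(2)])
        moreover have "c * b + (a - b * c) = a" by (simp add: mult.commute)
        ultimately have "?\<phi> a = ?\<phi> c \<star> ?\<phi> b + ?\<phi> (a - b * c)"
          by (simp only: Fq_homD(2)[OF h c(1) b(1)])
        hence "ev (?\<phi> a) \<mu> = ev (?\<phi> c) (ev (?\<phi> b) \<mu>) + ev (?\<phi> (a - b * c)) \<mu>"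
          by (simp only: ev_add ev_tmult)
        also have "\<dots> = 0" using b(2) c(2) T \<mu>(1) Suc by (auto simp: torsion_def)
        finally show False using \<mu>(3) by simp
      qed
      thus ?thesis using \<mu>(1) by blast
    qed
    then obtain \<mu> where \<mu>: "\<mu> \<in> G" "\<And>b. b \<in> Ipow 0 \<Longrightarrow> ev (?\<phi> b) \<mu> = 0 \<Longrightarrow> b \<in> Ipow n" by blast
    have diff: "ev (?\<phi> a) \<mu> - ev (?\<phi> b) \<mu> = ev (?\<phi> (a - b)) \<mu>" if "a \<in> Ipow 0" "b \<in> Ipow 0" for a b
    proof -
      have "?\<phi> a = ?\<phi> (a - b) + ?\<phi> b" using Fq_homD(1)[OF h, of "a - b" b] that by (simp add: Ipow_diff)
      thus ?thesis by (simp add: ev_add)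
    qed
    have eq: "ev (?\<phi> a) \<mu> = ev (?\<phi> b) \<mu> \<longleftrightarrow> a - b \<in> Ipow n" if ab: "a \<in> Ipow 0" "b \<in> Ipow 0" for a b
    proof -
      have "ev (?\<phi> a) \<mu> = ev (?\<phi> b) \<mu> \<longleftrightarrow> ev (?\<phi> (a - b)) \<mu> = 0" by (simp flip: diff[OF ab])
      also have "\<dots> \<longleftrightarrow> a - b \<in> Ipow n" using \<mu> T Ipow_diff[OF ab] by (auto simp: torsion_def)
      finally show ?thesis .
    qed
    define f where "f C = ev (?\<phi> (SOME a. a \<in> Ipow 0 \<and> C = Ipow n +>\<^bsub>A\<^esub> a)) \<mu>" for C
    have f: "f (Ipow n +>\<^bsub>A\<^esub> a) = ev (?\<phi> a) \<mu>" if a: "a \<in> Ipow 0" for a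
    proof -
      define b where "b = (SOME b. b \<in> Ipow 0 \<and> Ipow n +>\<^bsub>A\<^esub> a = Ipow n +>\<^bsub>A\<^esub> b)"
      have b: "b \<in> Ipow 0 \<and> Ipow n +>\<^bsub>A\<^esub> a = Ipow n +>\<^bsub>A\<^esub> b" unfolding b_def by (rule someI[of _ a]) (simp add: a)
      hence "a - b \<in> Ipow n" using Quot_eq[OF Ipow_ideal a] by blast
      hence "ev (?\<phi> a) \<mu> = ev (?\<phi> b) \<mu>" using eq[OF a] b by blast
      thus ?thesis by (simp add: f_def b_def)
    qed
    have inj: "inj_on f (carrier (A Quot Ipow n))"
    proof (rule inj_onI)
      fix C D assume "C \<in> carrier (A Quot Ipow n)" "D \<in> carrier (A Quot Ipow n)" and CD: "f C = f D"
      then obtain a b where ab: "a \<in> Ipow 0" "b \<in> Ipow 0" "C = Ipow n +>\<^bsub>A\<^esub> a" "D = Ipow n +>\<^bsub>A\<^esub> b"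
        unfolding Quot_carrier by blast
      hence "a - b \<in> Ipow n" using CD f eq by simp
      thus "C = D" unfolding ab Quot_eq[OF Ipow_ideal ab(1,2)] .
    qed
    have "f ` carrier (A Quot Ipow n) = G"
    proof (rule card_seteq[OF fin])
      show "f ` carrier (A Quot Ipow n) \<subseteq> G" unfolding Quot_carrier using f submodD(4)[OF S _ \<mu>(1)] by auto
      show "card G \<le> card (f ` carrier (A Quot Ipow n))" by (simp add: card_image[OF inj] card_Ipow_Quot cG)
    qed
    hence "bij_betw f (carrier (A Quot Ipow n)) G" using inj by (simp add: bij_betw_def)
    moreover have "f (u \<oplus>\<^bsub>A Quot Ipow n\<^esub> v) = f u + f v"
      if uv: "u \<in> carrier (A Quot Ipow n)" "v \<in> carrier (A Quot Ipow n)" for u v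
    proof -
      obtain a b where ab: "a \<in> Ipow 0" "b \<in> Ipow 0" "u = Ipow n +>\<^bsub>A\<^esub> a" "v = Ipow n +>\<^bsub>A\<^esub> b"
        using uv unfolding Quot_carrier by blast
      thus ?thesis using Quot_ops(1)[OF Ipow_ideal ab(1,2)] Fq_homD(1)[OF h] by (simp add: f Ipow_add ev_add)
    qed
    moreover have "f ((Ipow n +>\<^bsub>A\<^esub> a) \<otimes>\<^bsub>A Quot Ipow n\<^esub> u) = ev (?\<phi> a) (f u)"
      if a: "a \<in> Ipow 0" and u: "u \<in> carrier (A Quot Ipow n)" for a u
    proof -
      obtain b where b: "b \<in> Ipow 0" "u = Ipow n +>\<^bsub>A\<^esub> b" using u unfolding Quot_carrier by blast
      thus ?thesis using Quot_ops(2)[OF Ipow_ideal a b(1)] Fq_homD(2)[OF h a b(1)] a by (simp add: f Ipow_absorb ev_tmult)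
    qed
    ultimately show "primitive_torsion q \<zeta> t ?\<phi> (Ipow n) G"
      unfolding primitive_torsion_def Aset_eq using S T by blast
  }
qed

text \<open>A chain lists lines by their invariants \<open>w\<close>; relative to a module with parameter \<open>k\<close> the line is
  \<open>v = w k / kap Z\<close>. Consecutive lines must not form the full \<open>I\<^sub>\<infinity>\<close>-torsion.\<close>

primrec chain :: "'a list \<Rightarrow> 'a \<Rightarrow> 'a \<Rightarrow> 'a \<Rightarrow> bool" where
  "chain [] Z m k = True"
| "chain (w # ws) Z m k = (is_root Z m k (w * k / kap Z) \<and>
     (ws \<noteq> [] \<longrightarrow> hd ws * next_k k (w * k / kap Z) / kap (F Z) \<noteq> m / (w * k / kap Z)) \<and>
     chain ws (F Z) (next_m Z m k (w * k / kap Z)) (next_k k (w * k / kap Z)))"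

text \<open>The composite of the isogenies along the chain, the first line acting first; the torsion
  subgroup of the chain is its kernel.\<close>

primrec cpoly :: "'a list \<Rightarrow> 'a \<Rightarrow> 'a \<Rightarrow> 'a poly" where
  "cpoly [] Z k = 1"
| "cpoly (w # ws) Z k = cpoly ws (F Z) (next_k k (w * k / kap Z)) \<star> lin (w * k / kap Z)"

lemma cpoly_nonzero: "cpoly ws Z k \<noteq> 0"
  by (induction ws arbitrary: Z k) auto

lemma Ker_cpoly_Cons:
  "Ker (cpoly (w # ws) Z k) = {z. ev (lin (w * k / kap Z)) z \<in> Ker (cpoly ws (F Z) (next_k k (w * k / kap Z)))}"
  by (simp add: Ker_def ev_tmult)

lemma good_0: assumes "Fq_algebra_hom q \<zeta> t \<phi>" shows "good \<phi> M 0 G \<longleftrightarrow> G = {0}"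
proof
  assume G: "good \<phi> M 0 G"
  hence "0 \<in> G" "card G = 1" by (auto simp: good_def qgood_def dest: submodD(1))
  thus "G = {0}" by (metis card_1_singletonE singletonD)
next
  assume G: "G = {0}"
  have "card ({0} \<inter> Ker M) \<le> card {0 :: 'a}" by (rule card_mono) auto
  thus "good \<phi> M 0 G" using q_gt1
    unfolding good_def qgood_def G submodule_via_def torsion_def by simp
qed

text \<open>That the socle is exactly the first line is carried through the induction: it is what
  turns the inequality between consecutive lines into the hypothesis of \<open>up\<close>, and back
  from \<open>down\<close>.\<close>

theorem chain_good:
  assumes "conj Z" "m \<noteq> 0" "k \<noteq> 0"
  shows "chain ws Z m k \<Longrightarrow> length ws = n \<Longrightarrow> good (dmod Z m k) (dM Z m k) n (Ker (cpoly ws Z k)) \<and>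
      (ws \<noteq> [] \<longrightarrow> Ker (cpoly ws Z k) \<inter> Ker (dM Z m k) = Ker (lin (hd ws * k / kap Z)))"
    and "good (dmod Z m k) (dM Z m k) n G \<Longrightarrow> \<exists>ws. length ws = n \<and> chain ws Z m k \<and> G = Ker (cpoly ws Z k)"
proof -
  have "(\<forall>ws. chain ws Z m k \<and> length ws = n \<longrightarrow> good (dmod Z m k) (dM Z m k) n (Ker (cpoly ws Z k)) \<and>
      (ws \<noteq> [] \<longrightarrow> Ker (cpoly ws Z k) \<inter> Ker (dM Z m k) = Ker (lin (hd ws * k / kap Z)))) \<and>
    (\<forall>G. good (dmod Z m k) (dM Z m k) n G \<longrightarrow> (\<exists>ws. length ws = n \<and> chain ws Z m k \<and> G = Ker (cpoly ws Z k)))"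
    using assms
  proof (induction n arbitrary: Z m k)
    case (0 Z m k)
    have K: "Ker 1 = {0 :: 'a}" by (simp add: Ker_def)
    show ?case using good_0[OF dmod_hom(1)[OF 0]] K by auto
  next
    case (Suc n Z m k)
    note Z = Suc.prems(1) and mk = Suc.prems(2,3)
    have kZ: "kap Z \<noteq> 0" "kap (F Z) \<noteq> 0" using kap_props(1) Z conj_F[OF Z] by auto
    show ?case
    proof (intro conjI allI impI; (elim conjE)?)
      fix ws assume ch: "chain ws Z m k" and len: "length ws = Suc n"
      obtain w ws' where ws: "ws = w # ws'" "length ws' = n" using len by (cases ws) auto
      define v where "v = w * k / kap Z"
      define k' where "k' = next_k k v"
      define m' where "m' = next_m Z m k v"
      have root: "is_root Z m k v" and ch': "chain ws' (F Z) m' k'"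
        and hd: "ws' \<noteq> [] \<longrightarrow> hd ws' * k' / kap (F Z) \<noteq> m / v"
        using ch by (simp_all add: ws v_def k'_def m'_def)
      note st = root_step[OF Z mk root, folded k'_def m'_def]
      have v0: "v \<noteq> 0" by (rule is_root_nonzero[OF root mk(1)])
      let ?G' = "Ker (cpoly ws' (F Z) k')"
      note IH = Suc.IH[OF conj_F[OF Z] st(2,3)]
      have g': "good (dmod (F Z) m' k') (dM (F Z) m' k') n ?G'"
        and s': "ws' \<noteq> [] \<longrightarrow> ?G' \<inter> Ker (dM (F Z) m' k') = Ker (lin (hd ws' * k' / kap (F Z)))"
        using IH ch' ws by auto
      have u0: "m / v \<noteq> 0" using v0 mk by simp
      have "\<not> Ker (lin (m / v)) \<subseteq> ?G'"
      proof (cases "ws' = []")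
        case True
        hence "?G' = {0}" by (simp add: Ker_def)
        thus ?thesis using card_Ker_lin[OF u0] q_gt1 card_mono[of "{0}" "Ker (lin (m / v))"] by auto
      next
        case False
        show ?thesis
        proof
          assume "Ker (lin (m / v)) \<subseteq> ?G'"
          moreover have "Ker (lin (m / v)) \<subseteq> Ker (dM (F Z) m' k')"
            unfolding next_factor[OF Z mk root, folded k'_def m'_def] by (auto simp: Ker_def ev_tmult)
          ultimately have "Ker (lin (m / v)) \<subseteq> Ker (lin (hd ws' * k' / kap (F Z)))" using s' False by blast
          moreover obtain z where z: "z \<noteq> 0" "F z = m / v * z" using Ker_lin_nonzero[OF u0] by blast
          ultimately have "ev (lin (hd ws' * k' / kap (F Z))) z = 0" by (auto simp: Ker_def ev_lin)
          hence "F z = hd ws' * k' / kap (F Z) * z" by (simp only: ev_lin right_minus_eq)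
          hence "m / v * z = hd ws' * k' / kap (F Z) * z" using z(2) by (simp only:)
          hence "m / v = hd ws' * k' / kap (F Z)" using z(1) mult_right_cancel by blast
          thus False using hd False by metis
        qed
      qed
      note up = step_up[OF Z mk root, folded k'_def m'_def, OF g'[unfolded good_def, THEN conjunct1] this]
      have GK: "Ker (cpoly ws Z k) = {z. ev (lin v) z \<in> ?G'}" unfolding ws Ker_cpoly_Cons v_def k'_def ..
      note dn = step_down[OF Z mk root, folded k'_def m'_def, OF up(1,2)]
      have "card {z. ev (lin v) z \<in> ?G'} = q * card ?G'" using dn(2) up(3) by simp
      thus "good (dmod Z m k) (dM Z m k) (Suc n) (Ker (cpoly ws Z k))"
        unfolding GK good_def using up(1) g' by (simp add: good_def)
      show "Ker (cpoly ws Z k) \<inter> Ker (dM Z m k) = Ker (lin (hd ws * k / kap Z))"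
        unfolding GK using dn(5) by (simp add: ws v_def)
    next
      fix G assume g: "good (dmod Z m k) (dM Z m k) (Suc n) G"
      hence qg: "qgood (dmod Z m k) (dM Z m k) (Suc n) G" and cG: "card G = q ^ Suc n" by (auto simp: good_def)
      have S: "submod (dmod Z m k) G" and T: "G \<subseteq> tors (dmod Z m k) (Suc n)" using qg by (auto simp: qgood_def)
      have "q ^ Suc n > 1" by (rule one_less_power[OF q_gt1]) simp
      hence "G \<noteq> {0}" using cG by auto
      then obtain z where z: "z \<in> G" "z \<noteq> 0" "z \<in> Ker (dM Z m k)"
        using socle_nontrivial[OF Z mk S T] by blast
      define v where "v = F z / z"
      have root: "is_root Z m k v" and Kl: "Ker (lin v) = (\<lambda>c. c * z) ` Fq q" unfolding v_def using line_root[OF z(2,3)] .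
      have sub: "Ker (lin v) \<subseteq> G" unfolding Kl using submod_scale[OF S dmod_hom(1)[OF Z mk] _ z(1)] by auto
      define k' where "k' = next_k k v"
      define m' where "m' = next_m Z m k v"
      note st = root_step[OF Z mk root, folded k'_def m'_def]
      note dn = step_down[OF Z mk root qg sub, folded k'_def m'_def]
      have v0: "v \<noteq> 0" by (rule is_root_nonzero[OF root mk(1)])
      have "card (ev (lin v) ` G) = q ^ n" using dn(2) cG by simp
      hence "good (dmod (F Z) m' k') (dM (F Z) m' k') n (ev (lin v) ` G)" using dn(1) by (simp add: good_def)
      then obtain ws' where ws': "length ws' = n" "chain ws' (F Z) m' k'" "ev (lin v) ` G = Ker (cpoly ws' (F Z) k')"
        using Suc.IH[OF conj_F[OF Z] st(2,3)] by blast
      define w where "w = v * kap Z / k"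
      have wv: "w * k / kap Z = v" using kZ mk by (simp add: w_def)
      have "hd ws' * k' / kap (F Z) \<noteq> m / v" if "ws' \<noteq> []"
      proof
        assume eq: "hd ws' * k' / kap (F Z) = m / v"
        have "Ker (cpoly ws' (F Z) k') \<inter> Ker (dM (F Z) m' k') = Ker (lin (hd ws' * k' / kap (F Z)))"
          using Suc.IH[OF conj_F[OF Z] st(2,3)] ws' that by blast
        thus False using dn(3) ws'(3) eq by auto
      qed
      hence "chain (w # ws') Z m k" using ws' root by (simp add: wv k'_def m'_def)
      moreover have "G = Ker (cpoly (w # ws') Z k)"
        unfolding Ker_cpoly_Cons wv using dn(4) ws'(3) by (simp add: k'_def)
      ultimately show "\<exists>ws. length ws = Suc n \<and> chain ws Z m k \<and> G = Ker (cpoly ws Z k)"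
        using ws'(1) by (intro exI[of _ "w # ws'"]) simp
    qed
  qed
  thus "chain ws Z m k \<Longrightarrow> length ws = n \<Longrightarrow> good (dmod Z m k) (dM Z m k) n (Ker (cpoly ws Z k)) \<and>
      (ws \<noteq> [] \<longrightarrow> Ker (cpoly ws Z k) \<inter> Ker (dM Z m k) = Ker (lin (hd ws * k / kap Z)))"
    "good (dmod Z m k) (dM Z m k) n G \<Longrightarrow> \<exists>ws. length ws = n \<and> chain ws Z m k \<and> G = Ker (cpoly ws Z k)"
    by blast+
qed

text \<open>The socle of the kernel returns the first line, hence \<open>w\<close>; the image under
  the first isogeny returns the kernel of the remaining chain.\<close>

lemma chain_inj:
  assumes "conj Z" "m \<noteq> 0" "k \<noteq> 0" "chain ws Z m k" "chain ws' Z m k" "length ws = length ws'"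
    "Ker (cpoly ws Z k) = Ker (cpoly ws' Z k)"
  shows "ws = ws'"
  using assms
proof (induction ws arbitrary: ws' Z m k)
  case (Cons w ws)
  note Z = Cons.prems(1) and mk = Cons.prems(2,3)
  obtain w' ws1 where ws': "ws' = w' # ws1" using Cons.prems(6) by (cases ws') auto
  have kZ: "kap Z \<noteq> 0" using kap_props(1) Z by auto
  define v where "v = w * k / kap Z"
  have root: "is_root Z m k v" using Cons.prems(4) by (simp add: v_def)
  have "Ker (lin v) = Ker (lin (w' * k / kap Z))"
    using chain_good(1)[OF Z mk Cons.prems(4) refl] chain_good(1)[OF Z mk Cons.prems(5) refl] Cons.prems(7)
    unfolding ws' v_def by simp
  hence vv: "v = w' * k / kap Z" using is_root_nonzero[OF root mk(1)] by (rule Ker_eq_imp)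
  hence ww: "w' = w" using kZ mk by (simp add: v_def)
  note st = root_step[OF Z mk root]
  have "ev (lin v) ` {z. ev (lin v) z \<in> S} = S" for S
    using ev_surj[of "lin v"] by (auto simp: image_iff) metis
  hence "Ker (cpoly ws (F Z) (next_k k v)) = Ker (cpoly ws1 (F Z) (next_k k v))"
    using Cons.prems(7) unfolding ws' ww Ker_cpoly_Cons v_def[symmetric] by metis
  moreover have "chain ws (F Z) (next_m Z m k v) (next_k k v)" "chain ws1 (F Z) (next_m Z m k v) (next_k k v)"
    using Cons.prems(4,5) by (simp_all add: ws' ww v_def)
  ultimately have "ws = ws1" using Cons.prems(6) ws' by (intro Cons.IH[OF conj_F[OF Z] st(2,3)]) simp_all
  thus ?case by (simp add: ws' ww)
qed simp

text \<open>The first line is a root of an equation of degree \<open>q + 1\<close>. Later,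
  \<open>Ker M'\<close> has \<open>q * q\<close> elements and the forbidden line only
  \<open>q\<close>, so another line remains.\<close>

lemma chain_extend:
  assumes "conj Z" "m \<noteq> 0" "k \<noteq> 0" "chain ws Z m k"
  shows "\<exists>w. chain (ws @ [w]) Z m k"
  using assms
proof (induction ws arbitrary: Z m k)
  case (Nil Z m k)
  have n: "dM Z m k \<noteq> 0" using dmod_leads(1)[OF Nil(1-3)] by auto
  have kZ: "kap Z \<noteq> 0" using kap_props(1) Nil by auto
  have "ev (dM Z m k) 0 = 0" by simp
  have "degree (dM Z m k) = 2" by (rule dmod_leads(1)[OF Nil(1-3)])
  define p where "p = Polynomial.monom 1 (Suc q) + smult (cs Z m k / (Z - F Z) + F k) [:0,1:] + [:m:]"
  have "degree p = Suc q" unfolding p_def using q_gt1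
    by (subst degree_add_eq_left, subst degree_add_eq_left) (auto simp: degree_monom_eq degree_add_eq_left)
  hence "degree p > 0" by simp
  then obtain v where "poly p v = 0" using alg_closed_imp_poly_has_root by blast
  hence "is_root Z m k v" by (simp add: p_def poly_monom is_root_def F_def algebra_simps)
  moreover have "(v * kap Z / k) * k / kap Z = v" using kZ Nil by simp
  ultimately show ?case by (intro exI[of _ "v * kap Z / k"]) simp
next
  case (Cons w ws Z m k)
  note Z = Cons.prems(1) and mk = Cons.prems(2,3)
  define v where "v = w * k / kap Z"
  have root: "is_root Z m k v" using Cons.prems(4) by (simp add: v_def)
  note st = root_step[OF Z mk root]
  have v0: "v \<noteq> 0" by (rule is_root_nonzero[OF root mk(1)])
  have kZ: "kap (F Z) \<noteq> 0" using kap_props(1) conj_F[OF Z] by auto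
  define k' where "k' = next_k k v"
  define m' where "m' = next_m Z m k v"
  have ch: "chain ws (F Z) m' k'" using Cons.prems(4) by (simp add: v_def k'_def m'_def)
  show ?case
  proof (cases ws)
    case Nil
    let ?M' = "dM (F Z) m' k'" and ?u = "m / v"
    have fac: "?M' = lin (v * m' / m) \<star> lin ?u" using next_factor[OF Z mk root] by (simp add: m'_def k'_def)
    have nz: "v * m' / m \<noteq> 0" "?u \<noteq> 0" using v0 mk st by (auto simp: m'_def)
    have "card (Ker ?M') = q * q" unfolding fac using card_Ker_lin nz by (subst Ker_tmult_card) simp_all
    hence "\<not> Ker ?M' \<subseteq> Ker (lin ?u)"
      using card_mono[OF finite_Ker[of "lin ?u"], of "Ker ?M'"] card_Ker_lin[OF nz(2)] q_gt1 by auto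
    then obtain z where z: "z \<in> Ker ?M'" "z \<notin> Ker (lin ?u)" by blast
    have z0: "z \<noteq> 0" using z(2) by (auto simp: Ker_def)
    have rt: "is_root (F Z) m' k' (F z / z)" using line_root(1)[OF z0 z(1)] .
    have ne: "F z / z \<noteq> ?u"
    proof
      assume "F z / z = ?u"
      hence "F z = ?u * z" using z0 by (metis nonzero_eq_divide_eq)
      hence "ev (lin ?u) z = 0" unfolding ev_lin by (simp only: right_minus_eq)
      thus False using z(2) unfolding Ker_def by blast
    qed
    define w2 where "w2 = F z / z * kap (F Z) / k'"
    have "w2 * k' / kap (F Z) = F z / z" using kZ st(3) by (simp add: k'_def w2_def)
    hence "chain (w # [w2]) Z m k"
      using root rt ne unfolding chain.simps v_def[symmetric] k'_def[symmetric] m'_def[symmetric] by simp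
    thus ?thesis unfolding Nil by (intro exI[of _ w2]) (simp only: append.simps)
  next
    case (Cons w1 ws1)
    obtain w2 where w2: "chain (ws @ [w2]) (F Z) m' k'"
      using Cons.IH[OF conj_F[OF Z] st(2,3), folded k'_def m'_def, OF ch] by blast
    have "chain ((w # ws) @ [w2]) Z m k"
      using w2 Cons.prems(4) Cons by (simp add: v_def[symmetric] k'_def[symmetric] m'_def[symmetric])
    thus ?thesis by blast
  qed
qed

lemma chain_butlast: "chain (ws @ [w]) Z m k \<Longrightarrow> chain ws Z m k"
  by (induction ws arbitrary: Z m k) auto

text \<open>The isogenies commute with the action of \<open>A\<close>, which reduces the claim to
  the last line; that line lies in \<open>Ker M\<close> and is killed by
  \<open>I\<^sub>\<infinity>\<close>.\<close>

lemma chain_Ipow1: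
  assumes "conj Z" "m \<noteq> 0" "k \<noteq> 0" "chain (ws @ [w]) Z m k" "g \<in> Ker (cpoly (ws @ [w]) Z k)" "a \<in> Ipow 1"
  shows "ev (dmod Z m k a) g \<in> Ker (cpoly ws Z k)"
  using assms(1-5)
proof (induction ws arbitrary: Z m k g)
  case (Nil Z m k)
  define v where "v = w * k / kap Z"
  have "g \<in> Ker (lin v)" "is_root Z m k v" using Nil by (simp_all add: v_def)
  hence "g \<in> Ker (dM Z m k)" using is_root_factor[of Z m k v] is_root_nonzero[of Z m k v] Nil(2)
    by (auto simp: Ker_def ev_tmult)
  thus ?case using Ker_M[OF Nil(1-3)] assms(6) by (simp add: Ker_def)
next
  case (Cons w1 ws Z m k)
  define v where "v = w1 * k / kap Z"
  have root: "is_root Z m k v" using Cons.prems(4) by (simp add: v_def)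
  note st = root_step[OF Cons.prems(1-3) root]
  have a0: "a \<in> Ipow 0" using assms(6) Ipow_mono[of 0 1] by auto
  have g: "ev (lin v) g \<in> Ker (cpoly (ws @ [w]) (F Z) (next_k k v))"
    using Cons.prems(5) by (simp add: Ker_def ev_tmult v_def)
  have "chain (ws @ [w]) (F Z) (next_m Z m k v) (next_k k v)" using Cons.prems(4) by (simp add: v_def)
  from Cons.IH[OF conj_F[OF Cons.prems(1)] st(2,3) this g]
  have "ev (dmod (F Z) (next_m Z m k v) (next_k k v) a) (ev (lin v) g) \<in> Ker (cpoly ws (F Z) (next_k k v))" .
  moreover have "ev (dmod (F Z) (next_m Z m k v) (next_k k v) a) (ev (lin v) g) = ev (lin v) (ev (dmod Z m k a) g)"
    using arg_cong[OF root_isogeny[OF Cons.prems(1-3) root a0], of "\<lambda>f. ev f g"] by (simp only: ev_tmult)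
  ultimately show ?case unfolding Ker_cpoly_Cons v_def[symmetric] by simp
qed

subsection \<open>Chains and points of the tower\<close>

text \<open>\<open>nabla\<close> written with \<open>Z\<close> for the power of
  \<open>\<zeta>\<close>: since \<open>F (F \<zeta>) = \<zeta>\<close>, only the parity of the
  exponent matters.\<close>

definition nab :: "'a \<Rightarrow> 'a \<Rightarrow> 'a" where
  "nab Z w = 1 / ((Z / F Z - 1) * (1 + (t - F Z) * w / Z))"

definition stepZ :: "'a \<Rightarrow> 'a \<Rightarrow> 'a \<Rightarrow> bool" where
  "stepZ Z w w' \<longleftrightarrow> 1 + (t - F Z) * w / Z \<noteq> 0 \<and> 1 - (F Z / Z - 1) * w \<noteq> 0 \<and>
     (\<Sum>i<q. nab Z w ^ i * w' ^ (q - i)) = w ^ q / (1 - (F Z / Z - 1) * w) * (nab Z w * (t - F Z)) ^ (q - 1)"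

lemma zeta_neq_0: "\<zeta> \<noteq> 0" using conj_props(5)[OF conj_zeta] .

lemma step_relation_eq: "step_relation q \<zeta> t m w w' \<longleftrightarrow> stepZ ((F ^^ m) \<zeta>) w w'"
proof -
  define Z where "Z = (F ^^ m) \<zeta>"
  have Z: "\<zeta> ^ (q ^ m) = Z" "\<zeta> ^ (q ^ (m + 1)) = F Z"
    using F_funpow[of "m + 1" \<zeta>] by (simp_all add: Z_def F_funpow[symmetric] del: power_Suc)
  have p: "\<zeta> powi (int (q ^ m) - int (q ^ (m + 1))) = Z / F Z" "\<zeta> powi (int (q ^ (m + 1)) - int (q ^ m)) = F Z / Z"
    "\<zeta> powi (- int (q ^ m)) = inverse Z"
  proof -
    have *: "\<zeta> powi (int a - int b) = \<zeta> ^ a / \<zeta> ^ b" "\<zeta> powi (- int a) = inverse (\<zeta> ^ a)" for a b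
      using zeta_neq_0 by (simp_all add: power_int_diff power_int_minus)
    thus "\<zeta> powi (int (q ^ m) - int (q ^ (m + 1))) = Z / F Z" "\<zeta> powi (int (q ^ (m + 1)) - int (q ^ m)) = F Z / Z"
      "\<zeta> powi (- int (q ^ m)) = inverse Z" unfolding * Z by simp_all
  qed
  have e: "1 + inverse Z * (t - F Z) * w = 1 + (t - F Z) * w / Z" by (simp add: divide_inverse mult_ac)
  have n: "nabla q \<zeta> t m w = nab Z w" unfolding nabla_def p Z e nab_def ..
  show ?thesis unfolding step_relation_def n p Z e stepZ_def Z_def[symmetric] ..
qed

text \<open>Identifies the sum in the tower equations as a difference of q-th powers with the root
  \<open>V = u\<close> divided out.\<close>

lemma quotient_sum:
  "(V - u) * (\<Sum>i<q. u ^ i * V ^ (q - i)) = V * (F V - F u)" for V u :: 'a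
proof -
  have "V ^ q - u ^ q = (V - u) * (\<Sum>i<q. u ^ (q - Suc i) * V ^ i)" by (rule power_diff_sumr2)
  also have "(\<Sum>i<q. u ^ (q - Suc i) * V ^ i) = (\<Sum>i<q. u ^ i * V ^ (q - Suc i))"
    by (rule sum.reindex_bij_witness[of _ "\<lambda>i. q - Suc i" "\<lambda>i. q - Suc i"]) auto
  finally have "V * (V ^ q - u ^ q) = (V - u) * (V * (\<Sum>i<q. u ^ i * V ^ (q - Suc i)))" by (simp add: mult_ac)
  also have "V * (\<Sum>i<q. u ^ i * V ^ (q - Suc i)) = (\<Sum>i<q. u ^ i * V ^ (q - i))"
    unfolding sum_distrib_left by (rule sum.cong) (auto simp: mult.left_commute Suc_diff_Suc simp flip: power_Suc)
  finally show ?thesis by (simp add: F_def)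
qed

text \<open>The factorization of \<open>M'\<close> turns the line equation into
  \<open>V (F V - F u) = u' (V - u)\<close>, and \<open>V - u\<close> is divided out. The quotient
  excludes \<open>V = u\<close> by itself: there the sum is \<open>q u ^ q = 0\<close>, while
  \<open>u'\<close> is nonzero.\<close>

lemma second_root:
  assumes Z: "conj Z" and mk: "m \<noteq> 0" "k \<noteq> 0" and root: "is_root Z m k v"
  shows "is_root (F Z) (next_m Z m k v) (next_k k v) V \<and> V \<noteq> m / v \<longleftrightarrow>
    (\<Sum>i<q. (m / v) ^ i * V ^ (q - i)) = v * next_m Z m k v / m"
proof -
  define u where "u = m / v"
  define u' where "u' = v * next_m Z m k v / m"
  define S where "S = (\<Sum>i<q. u ^ i * V ^ (q - i))"
  have v0: "v \<noteq> 0" by (rule is_root_nonzero[OF root mk(1)])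
  note st = root_step[OF Z mk root]
  have u0: "u' \<noteq> 0" using st v0 mk by (simp add: u'_def)
  have "dM (F Z) (next_m Z m k v) (next_k k v) = lin u' \<star> lin u"
    unfolding u_def u'_def by (rule next_factor[OF Z mk root])
  hence c: "cs (F Z) (next_m Z m k v) (next_k k v) / (F Z - F (F Z)) + F (next_k k v) = - (F u + u')"
    "next_m Z m k v = u' * u" unfolding dM_def lin_lin pCons_eq_iff by blast+
  have "is_root (F Z) (next_m Z m k v) (next_k k v) V \<longleftrightarrow> V * (F V - (F u + u')) + u' * u = 0"
    unfolding is_root_def c(1) unfolding c(2) by (simp add: algebra_simps)
  also have "V * (F V - (F u + u')) + u' * u = V * (F V - F u) - u' * (V - u)" by (simp add: algebra_simps)
  also have "\<dots> = (V - u) * (S - u')" unfolding quotient_sum[symmetric] S_def by (simp add: algebra_simps)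
  finally have r: "is_root (F Z) (next_m Z m k v) (next_k k v) V \<longleftrightarrow> V = u \<or> S = u'" by simp
  have "S = 0" if "V = u"
  proof -
    have "S = (\<Sum>i<q. u ^ q)" unfolding S_def that by (rule sum.cong) (auto simp flip: power_add)
    also have "\<dots> = of_nat q * u ^ q" by simp
    also have "of_nat q = (0 :: 'a)" unfolding q_def using e_pos by simp
    finally show ?thesis by simp
  qed
  hence "V \<noteq> u" if "S = u'" using that u0 by auto
  thus ?thesis using r unfolding u_def u'_def S_def by blast
qed

text \<open>With \<open>l = next_k k v / kap (F Z)\<close>, the next line is \<open>l w'\<close> and
  the forbidden one is \<open>l nab Z w\<close>. The sum is homogeneous of degree \<open>q\<close>,
  so both sides of \<open>second_root\<close> acquire the factor \<open>F l\<close>. The two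
  denominators are, up to nonzero factors, quantities that \<open>root_step\<close> shows to be
  nonzero.\<close>

lemma step_iff:
  assumes Z: "conj Z" and mk: "m \<noteq> 0" "k \<noteq> 0" and root: "is_root Z m k (w * k / kap Z)"
  defines "v \<equiv> w * k / kap Z"
  shows "stepZ Z w w' \<longleftrightarrow> is_root (F Z) (next_m Z m k v) (next_k k v) (w' * next_k k v / kap (F Z)) \<and>
    w' * next_k k v / kap (F Z) \<noteq> m / v" and "1 + (t - F Z) * w / Z \<noteq> 0" "1 - (F Z / Z - 1) * w \<noteq> 0"
proof -
  have root: "is_root Z m k v" using root by (simp add: v_def)
  note st = root_step[OF Z mk root]
  have v0: "v \<noteq> 0" by (rule is_root_nonzero[OF root mk(1)])
  define b where "b = t - F Z"
  define d where "d = Z - F Z"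
  have Z0: "Z \<noteq> 0" "F Z \<noteq> 0" using conj_props(5)[OF Z] by auto
  have d0: "d \<noteq> 0" using conj_props(2)[OF Z] by (auto simp: d_def)
  have b0: "b \<noteq> 0" using t_not_conj[OF conj_F[OF Z]] by (simp add: b_def)
  have kZ: "kap Z = Z / d" "kap (F Z) = - (F Z / d)"
    using conj_props(1)[OF Z] d0 by (simp_all add: kap_def d_def minus_divide_right)
  have v: "v = w * k * d / Z" by (simp add: v_def kZ)
  have w0: "w \<noteq> 0" using v0 by (auto simp: v)
  define D where "D = 1 + b * w / Z"
  have ED: "k * (Z - F Z) + (t - F Z) * v = k * d * D"
    unfolding b_def[symmetric] d_def[symmetric] v D_def using Z0 by (simp add: field_simps)
  hence D0: "D \<noteq> 0" using st(4) by auto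
  thus "1 + (t - F Z) * w / Z \<noteq> 0" by (simp add: D_def b_def)
  have vk: "v + k = k * (1 - (F Z / Z - 1) * w)" unfolding v d_def using Z0 by (simp add: field_simps)
  hence E0: "1 - (F Z / Z - 1) * w \<noteq> 0" using st(1) by auto
  thus "1 - (F Z / Z - 1) * w \<noteq> 0" .
  define l where "l = next_k k v / kap (F Z)"
  have l0: "l \<noteq> 0" using st(3) kZ Z0 d0 by (simp add: l_def)
  have nb: "nab Z w = F Z / (d * D)" using Z0 d0 D0 by (simp add: nab_def D_def[symmetric] b_def[symmetric] d_def field_simps)
  have "v * next_k k v = - (m * D)" using st(5) unfolding ED next_k_def using mk d0 by (simp add: d_def[symmetric])
  hence k': "next_k k v = - (m * D) / v" using v0 by (simp add: field_simps)
  have lu: "l * nab Z w = m / v" unfolding l_def k' nb kZ using Z0 d0 D0 v0 by (simp add: field_simps)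
  have pw: "z ^ (q - 1) = F z / z" if "z \<noteq> 0" for z using power_q_minus_1[OF that] .
  have n0: "nab Z w * b \<noteq> 0" using Z0 d0 D0 b0 by (simp add: nb)
  have "F l * (w ^ q / (1 - (F Z / Z - 1) * w) * (nab Z w * b) ^ (q - 1)) = v * next_m Z m k v / m"
  proof -
    define N where "N = nab Z w * b"
    define C where "C = 1 - (F Z / Z - 1) * w"
    have NC: "N \<noteq> 0" "C \<noteq> 0" using n0 E0 by (simp_all add: N_def C_def)
    have lN: "l * nab Z w * b = l * N" by (simp add: N_def)
    have "F l * (w ^ q / C * (F N / N)) = l * F (l * N) / (l * N) * F w * k / (k * C)"
      using NC l0 mk by (simp add: F_mult F_def[of w, symmetric] mult_ac)
    hence "F l * (w ^ q / (1 - (F Z / Z - 1) * w) * (nab Z w * b) ^ (q - 1)) =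
      l * F (l * nab Z w * b) / (l * nab Z w * b) * F w * k / (v + k)"
      unfolding pw[OF n0] vk lN unfolding N_def[symmetric] C_def[symmetric] .
    also have "\<dots> = l * F (m * b / v) / (m * b / v) * F w * k / (v + k)" unfolding lu by simp
    also have "F w = F v * kap (F Z) / F k"
      using kap_props(3)[OF Z] mk kap_props(1)[OF conj_F[OF Z]] by (simp add: v_def F_simps)
    also have "l * F (m * b / v) / (m * b / v) * (F v * kap (F Z) / F k) * k / (v + k) = v * next_m Z m k v / m"
    proof -
      define w2 where "w2 = v + k"
      have "w2 \<noteq> 0" "kap (F Z) \<noteq> 0" using st(1) kap_props(1)[OF conj_F[OF Z]] by (auto simp: w2_def)
      thus ?thesis unfolding l_def next_k_def next_m_def cs_def b_def[symmetric] w2_def[symmetric]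
        using v0 mk b0 by (simp add: F_mult F_divide mult_ac)
    qed
    finally show ?thesis .
  qed
  note A1 = this
  have A2: "(\<Sum>i<q. (m / v) ^ i * (w' * next_k k v / kap (F Z)) ^ (q - i)) = F l * (\<Sum>i<q. nab Z w ^ i * w' ^ (q - i))"
    unfolding lu[symmetric] sum_distrib_left
  proof (rule sum.cong)
    fix i assume "i \<in> {..<q}"
    hence "F l = l ^ i * l ^ (q - i)" unfolding F_def by (simp flip: power_add)
    thus "(l * nab Z w) ^ i * (w' * next_k k v / kap (F Z)) ^ (q - i) = F l * (nab Z w ^ i * w' ^ (q - i))"
      by (simp add: l_def power_mult_distrib power_divide)
  qed simp
  have "F l \<noteq> 0" using l0 by simp
  hence A3: "(\<Sum>i<q. (m / v) ^ i * (w' * next_k k v / kap (F Z)) ^ (q - i)) = v * next_m Z m k v / m \<longleftrightarrow>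
    (\<Sum>i<q. nab Z w ^ i * w' ^ (q - i)) = w ^ q / (1 - (F Z / Z - 1) * w) * (nab Z w * b) ^ (q - 1)"
    unfolding A2 A1[symmetric] by (auto simp only: mult_cancel_left)
  show "stepZ Z w w' \<longleftrightarrow> is_root (F Z) (next_m Z m k v) (next_k k v) (w' * next_k k v / kap (F Z)) \<and>
    w' * next_k k v / kap (F Z) \<noteq> m / v"
    unfolding second_root[OF Z mk root] A3 stepZ_def b_def[symmetric] D_def[symmetric] using D0 E0 by blast
qed

lemma chain_iff_steps:
  assumes "conj Z" "m \<noteq> 0" "k \<noteq> 0"
  shows "chain (w # ws) Z m k \<longleftrightarrow> is_root Z m k (w * k / kap Z) \<and> (\<forall>i<length ws. stepZ ((F ^^ i) Z) ((w # ws) ! i) (ws ! i))"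
  using assms
proof (induction ws arbitrary: w Z m k)
  case (Cons w' ws)
  define v where "v = w * k / kap Z"
  show ?case
  proof (cases "is_root Z m k v")
    case True
    note st = root_step[OF Cons.prems True]
    have "chain (w # w' # ws) Z m k \<longleftrightarrow> w' * next_k k v / kap (F Z) \<noteq> m / v \<and>
      chain (w' # ws) (F Z) (next_m Z m k v) (next_k k v)"
      using True by (simp only: chain.simps(2)[of w] v_def list.sel list.distinct) simp
    also have "\<dots> \<longleftrightarrow> stepZ Z w w' \<and> (\<forall>i<length ws. stepZ ((F ^^ i) (F Z)) ((w' # ws) ! i) (ws ! i))"
      unfolding Cons.IH[OF conj_F[OF Cons.prems(1)] st(2,3)]
      using step_iff(1)[OF Cons.prems, of w w', folded v_def, OF True] by blast
    also have "\<dots> \<longleftrightarrow> (\<forall>i<length (w' # ws). stepZ ((F ^^ i) Z) ((w # w' # ws) ! i) ((w' # ws) ! i))"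
      by (simp add: All_less_Suc2 funpow_swap1)
    finally show ?thesis using True by (simp add: v_def)
  qed (simp add: v_def)
qed simp

text \<open>For \<open>k = kap \<zeta>\<close> the line \<open>v\<close> is \<open>w\<close> itself,
  and with \<open>m = 1 / j\<close> the root equation multiplied by \<open>j\<close> is linear in
  \<open>j\<close>.\<close>

lemma first_relation_iff:
  assumes j: "j \<noteq> 0" shows "first_relation q \<zeta> t j w \<longleftrightarrow> is_root \<zeta> (1 / j) (kap \<zeta>) w"
proof -
  define k where "k = kap \<zeta>"
  have k0: "k \<noteq> 0" using kap_props[OF conj_zeta] by (simp add: k_def)
  define d where "d = \<zeta> - F \<zeta>"
  have d0: "d \<noteq> 0" using zeta_neq by (auto simp: d_def)
  have kd: "k = \<zeta> / d" by (simp add: k_def kap_def d_def)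
  define b where "b = t - F \<zeta>"
  have i: "inverse (1 - \<zeta> powi (1 - int q)) = F k"
    using kap_props(2)[OF conj_zeta] zeta_neq_0 zeta_neq by (simp add: powi_1_minus_q k_def field_simps)
  have p: "w ^ (q + 1) + F k * w = w * (F w + F k)" by (simp add: F_def algebra_simps)
  have fr: "first_relation q \<zeta> t j w \<longleftrightarrow> w * (F w + F k) \<noteq> 0 \<and> j = - ((1 + b * w / \<zeta>) / (w * (F w + F k)))"
    unfolding first_relation_def i p by (simp add: b_def F_def divide_inverse mult_ac)
  have rt: "is_root \<zeta> (1 / j) k w \<longleftrightarrow> j * (w * (F w + F k)) = - (1 + b * w / \<zeta>)"
  proof -
    have "j * (w * (F w + (1 / j * b / k / d + F k)) + 1 / j) = j * (w * (F w + F k)) + (1 + b * w / \<zeta>)"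
      using j d0 zeta_neq_0 by (simp add: kd field_simps)
    thus ?thesis using j unfolding is_root_def cs_def b_def[symmetric] d_def[symmetric]
      by (metis eq_neg_iff_add_eq_0 mult_eq_0_iff)
  qed
  have X0: "w * (F w + F k) \<noteq> 0" if "is_root \<zeta> (1 / j) k w"
    using root_step(1)[OF conj_zeta _ k0 that] is_root_nonzero[OF that] j F_eq_0[of "w + k"] by (simp add: F_add)
  have "C \<noteq> 0 \<and> j = - (c / C) \<longleftrightarrow> j * C = - c" if "j * C = - c \<Longrightarrow> C \<noteq> 0" for C c
    using that by (metis minus_divide_left nonzero_eq_divide_eq)
  from this[of "w * (F w + F k)" "1 + b * w / \<zeta>"] X0 show ?thesis
    unfolding fr k_def[symmetric] rt by blast
qed

lemma tower_points_iff:
  "(j, ws) \<in> tower_points q \<zeta> t n \<longleftrightarrow> j \<noteq> 0 \<and> length ws = n \<and> chain ws \<zeta> (1 / j) (kap \<zeta>)"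
proof (cases "j \<noteq> 0 \<and> length ws = n")
  case True
  have k0: "kap \<zeta> \<noteq> 0" using kap_props[OF conj_zeta] by simp
  show ?thesis
  proof (cases ws)
    case Nil thus ?thesis using True by (auto simp: tower_points_def)
  next
    case (Cons w ws')
    have n: "n = Suc (length ws')" using True Cons by simp
    \<comment> \<open>Index shift \<open>m = i + 2\<close>: the first step has \<open>m = 2\<close>,
      and two applications of \<open>F\<close> fix \<open>\<zeta>\<close>, so the chain may start
      with \<open>Z = \<zeta>\<close>.\<close>
    have "(\<forall>m. 2 \<le> m \<and> m \<le> n \<longrightarrow> step_relation q \<zeta> t m (ws ! (m - 2)) (ws ! (m - 1))) \<longleftrightarrow>
      (\<forall>i<length ws'. stepZ ((F ^^ i) \<zeta>) ((w # ws') ! i) (ws' ! i))" (is "?L \<longleftrightarrow> ?R'")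
    proof
      assume L: ?L
      show ?R'
      proof (intro allI impI)
        fix i assume "i < length ws'"
        hence "step_relation q \<zeta> t (i + 2) (ws ! i) (ws ! (i + 1))" using L[rule_format, of "i + 2"] n by simp
        thus "stepZ ((F ^^ i) \<zeta>) ((w # ws') ! i) (ws' ! i)"
          unfolding step_relation_eq by (simp add: Cons funpow_swap1)
      qed
    next
      assume r: ?R'
      show ?L
      proof (intro allI impI)
        fix m assume m: "2 \<le> m \<and> m \<le> n"
        then obtain i where i: "m = i + 2" by (metis add.commute le_Suc_ex)
        hence "stepZ ((F ^^ i) \<zeta>) ((w # ws') ! i) (ws' ! i)" using r m n by simp
        thus "step_relation q \<zeta> t m (ws ! (m - 2)) (ws ! (m - 1))"
          unfolding step_relation_eq i by (simp add: Cons funpow_swap1)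
      qed
    qed
    moreover have "chain (w # ws') \<zeta> (1 / j) (kap \<zeta>) \<longleftrightarrow>
      is_root \<zeta> (1 / j) (kap \<zeta>) w \<and> (\<forall>i<length ws'. stepZ ((F ^^ i) \<zeta>) ((w # ws') ! i) (ws' ! i))"
      using chain_iff_steps[OF conj_zeta _ k0, of "1 / j" w ws'] True k0 by (simp del: chain.simps)
    moreover have "1 \<le> n" "ws ! 0 = w" using n Cons by simp_all
    ultimately show ?thesis using True first_relation_iff[of j w]
      unfolding tower_points_def by (simp add: Cons del: chain.simps)
  qed
qed (auto simp: tower_points_def)

subsection \<open>Classification of the modules of type \<open>\<zeta>\<^sup>q\<close>\<close>

text \<open>Right division makes left ideals principal: a monic element of least degree in the left
  ideal of \<open>fx\<close> and \<open>fy\<close> divides both on the right.\<close>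

lemma left_ideal_generator:
  assumes "fx \<noteq> 0"
  obtains M a b U V where "M = a \<star> fx + b \<star> fy" "lead_coeff M = 1" "fx = U \<star> M" "fy = V \<star> M"
proof -
  define J where "J = {f. f \<noteq> 0 \<and> (\<exists>a b. f = a \<star> fx + b \<star> fy)}"
  have "fx = 1 \<star> fx + 0 \<star> fy" "fx \<noteq> 0" using assms by simp_all
  hence "fx \<in> J" unfolding J_def by blast
  define n where "n = (LEAST n. \<exists>f\<in>J. degree f = n)"
  have "\<exists>f\<in>J. degree f = n" unfolding n_def by (rule LeastI[of _ "degree fx"]) (use \<open>fx \<in> J\<close> in blast)
  then obtain f0 where f0: "f0 \<in> J" "degree f0 = n" by blast
  have least: "degree f \<ge> n" if "f \<in> J" for f unfolding n_def by (rule Least_le) (use that in blast)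
  have f00: "f0 \<noteq> 0" using f0 by (simp add: J_def)
  obtain a0 b0 where ab0: "f0 = a0 \<star> fx + b0 \<star> fy" using f0 unfolding J_def by blast
  define c where "c = inverse (lead_coeff f0)"
  define M where "M = smult c f0"
  have c0: "c \<noteq> 0" using f00 by (simp add: c_def)
  have M: "M = smult c a0 \<star> fx + smult c b0 \<star> fy" by (simp add: M_def ab0 smult_add_right smult_tmult)
  have lM: "lead_coeff M = 1" using f00 by (simp add: M_def c_def)
  have dM: "degree M = n" using f0 c0 by (simp add: M_def)
  have div: "\<exists>h. f = h \<star> M" if fJ: "\<exists>a b. f = a \<star> fx + b \<star> fy" for f
  proof -
    obtain h r where hr: "f = h \<star> M + r" "r = 0 \<or> degree r < degree M"
      using tmult_division[of UNIV M f] lM by auto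
    obtain a b where ab: "f = a \<star> fx + b \<star> fy" using fJ by blast
    have "r = f - h \<star> M" using hr by simp
    also have "\<dots> = (a - h \<star> smult c a0) \<star> fx + (b - h \<star> smult c b0) \<star> fy"
      unfolding ab M by (simp add: tmult_add tmult_diff tmult_assoc)
    finally have "r \<noteq> 0 \<Longrightarrow> r \<in> J" unfolding J_def by blast
    hence "r = 0" using hr(2) least[of r] dM by (cases "r = 0") auto
    thus ?thesis using hr by auto
  qed
  have "fx = 1 \<star> fx + 0 \<star> fy" "fy = 0 \<star> fx + 1 \<star> fy" by simp_all
  then obtain U V where "fx = U \<star> M" "fy = V \<star> M" using div[of fx] div[of fy] by metis
  thus ?thesis using that M lM by blast
qed

lemma tmult_const: "f \<star> [:c:] \<star> [:d:] = f \<star> [:c * d:]"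
  by (simp add: tmult_assoc const_tmult)

text \<open>\<open>M\<close> generates the left ideal attached to \<open>I\<^sub>\<infinity>\<close>
  and \<open>B\<close> is \<open>M\<close> times \<open>t\<close>. Removing the leading part of
  \<open>B\<close> leaves a polynomial \<open>S\<close> of smaller degree; an invertibility argument
  then forces all of \<open>M\<close>, \<open>U\<close>, \<open>V\<close> to have degree 2, and
  comparing coefficients leaves two free parameters.\<close>

lemma classification:
  assumes fx: "degree fx = 4" "coeff fx 0 = x" and fy: "degree fy = 4" "coeff fy 0 = y"
    and lead: "lead_coeff fy = F \<zeta> * lead_coeff fx"
    and comm: "fx \<star> fy = fy \<star> fx" and rel: "fy \<star> fy - smult tr (fx \<star> fy) + smult nm (fx \<star> fx) = fx"
  shows "\<exists>m k. m \<noteq> 0 \<and> k \<noteq> 0 \<and> fx = dU \<zeta> m k \<star> dM \<zeta> m k \<and> fy = dV \<zeta> m k \<star> dM \<zeta> m k"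
proof -
  have fx0: "fx \<noteq> 0" and fy0: "fy \<noteq> 0" using fx fy by auto
  obtain M a b U V where M: "M = a \<star> fx + b \<star> fy" "lead_coeff M = 1" and UV: "fx = U \<star> M" "fy = V \<star> M"
    by (rule left_ideal_generator[OF fx0])
  \<comment> \<open>Formally \<open>M\<close> times \<open>t\<close>, where \<open>t\<close> turns
    \<open>fx\<close> into \<open>fy\<close> and \<open>fy\<close> into
    \<open>fy\<^sup>2 / fx = 1 + tr fy - nm fx\<close> by the quadratic relation.\<close>
  define B where "B = a \<star> fy + b \<star> (1 + smult tr fy - smult nm fx)"
  have yy: "fy \<star> fy = fx + smult tr (fy \<star> fx) - smult nm (fx \<star> fx)" using rel comm by (simp add: algebra_simps)
  have M0: "M \<noteq> 0" and U0: "U \<noteq> 0" and V0: "V \<noteq> 0" using UV fx0 fy0 by auto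
  have 1: "B \<star> fx = M \<star> fy"
    unfolding B_def M(1) by (simp add: tmult_add tmult_diff smult_tmult tmult_assoc comm yy)
  have "U \<star> B \<star> fx = U \<star> (M \<star> fy)" by (simp only: tmult_assoc 1)
  also have "\<dots> = fx \<star> fy" by (simp only: UV(1) tmult_assoc)
  finally have "U \<star> B \<star> fx = fy \<star> fx" by (simp only: comm)
  hence 2: "U \<star> B = fy" using fx0 tmult_right_cancel by blast
  have "V \<star> B \<star> fx = V \<star> (M \<star> fy)" by (simp only: tmult_assoc 1)
  also have "\<dots> = fy \<star> fy" by (simp only: UV(2) tmult_assoc)
  also have "\<dots> = (1 + smult tr fy - smult nm fx) \<star> fx" by (simp add: tmult_add tmult_diff smult_tmult yy)
  finally have "V \<star> B \<star> fx = (1 + smult tr fy - smult nm fx) \<star> fx" .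
  hence 3: "V \<star> B = 1 + smult tr fy - smult nm fx" using fx0 tmult_right_cancel by blast
  define d where "d = degree U"
  have B0: "B \<noteq> 0" using 2 fy0 by auto
  have degs: "d + degree M = 4" "degree V = d" "degree B = degree M"
    using degree_tmult[OF U0 M0] degree_tmult[OF V0 M0] degree_tmult[OF U0 B0] fx fy by (auto simp: UV[symmetric] 2 d_def)
  \<comment> \<open>The degree \<open>d\<close> of \<open>U\<close> is not known yet, so the type
    only yields that \<open>F\<close>, applied \<open>d\<close> times, takes \<open>r\<close> to
    \<open>F \<zeta>\<close>. This makes \<open>r\<close> a conjugate; the value
    \<open>d = 2\<close> later gives \<open>r = F \<zeta>\<close>.\<close>
  define r where "r = lead_coeff B"
  have lV: "lead_coeff V = F \<zeta> * lead_coeff U"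
    using lead_coeff_tmult[OF U0 M0] lead_coeff_tmult[OF V0 M0] lead unfolding UV[symmetric] M(2) by (simp add: Fn_props)
  have "lead_coeff fy = lead_coeff U * (F ^^ d) r" using lead_coeff_tmult[OF U0 B0] by (simp add: 2 d_def r_def)
  moreover have "lead_coeff fy = lead_coeff V" using lead_coeff_tmult[OF V0 M0] M(2) by (simp add: UV[symmetric] Fn_props)
  ultimately have Fr: "(F ^^ d) r = F \<zeta>" using lV U0 by (simp add: mult.commute)
  have "conj r"
  proof -
    have "conj r" if "conj ((F ^^ n) r)" for n using that
    proof (induction n)
      case (Suc n)
      hence "F ((F ^^ n) r) = \<zeta> \<or> F ((F ^^ n) r) = F \<zeta>" by (simp add: conj_def)
      hence "F ((F ^^ n) r) = F (F \<zeta>) \<or> F ((F ^^ n) r) = F \<zeta>" by simp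
      hence "conj ((F ^^ n) r)" unfolding F_inj conj_def by blast
      thus ?case by (rule Suc.IH)
    qed simp
    thus ?thesis using Fr conj_F[OF conj_zeta] by metis
  qed
  define S where "S = B - smult r M"
  define W where "W = V - U \<star> [:r:]"
  have BS: "B = S + [:r:] \<star> M" by (simp add: S_def const_tmult)
  have US: "U \<star> S = W \<star> M" using 2 UV by (simp add: S_def W_def tmult_diff tmult_assoc const_tmult)
  have dS: "S = 0 \<or> degree S < degree M"
  proof -
    have "degree S \<le> degree M" unfolding S_def using degs by (intro degree_diff_le) (auto intro: order.trans[OF degree_smult_le])
    moreover have "coeff S (degree M) = 0" using M(2) degs(3) by (simp add: S_def r_def)
    ultimately show ?thesis by (metis le_neq_implies_less leading_coeff_0_iff)
  qed
  have rr: "r * r - tr * r + nm = 0" "tr - r = F r"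
    using conj_props(3,4)[OF \<open>conj r\<close>] by (simp_all flip: conj_props(3,4)[OF \<open>conj r\<close>] add: algebra_simps)
  \<comment> \<open>The defining identity \<open>V B - tr V M + nm U M = 1\<close> with
    \<open>B = S + r M\<close> and \<open>V = W + U r\<close>. The terms in \<open>U\<close> drop
    out because \<open>r\<close> is a root of \<open>rp\<close>.\<close>
  have star: "V \<star> S - W \<star> [:F r:] \<star> M = 1"
  proof -
    have V: "V = W + U \<star> [:r:]" by (simp add: W_def)
    have "V \<star> B - smult tr fy + smult nm fx = 1" using 3 by simp
    moreover have "V \<star> B = V \<star> S + W \<star> [:r:] \<star> M + U \<star> [:r * r:] \<star> M"
      unfolding BS tmult_add(2) by (simp add: V tmult_add flip: tmult_assoc) (simp add: tmult_assoc const_tmult)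
    moreover have "smult tr fy = smult tr (W \<star> M) + U \<star> [:tr * r:] \<star> M"
    proof -
      have "smult tr fy = smult tr (W \<star> M) + smult tr (U \<star> [:r:] \<star> M)" unfolding UV(2) by (simp add: V tmult_add smult_add_right)
      also have "smult tr (U \<star> [:r:] \<star> M) = U \<star> [:tr * r:] \<star> M"
        using tmult_smult[OF tr_Fq, of U "[:r:]"] by (simp add: smult_tmult[symmetric])
      finally show ?thesis .
    qed
    moreover have "smult nm fx = U \<star> [:nm:] \<star> M" unfolding UV(1) using tmult_Fq[OF nm_Fq, of U] by (simp add: smult_tmult)
    moreover have "U \<star> [:r * r:] \<star> M - U \<star> [:tr * r:] \<star> M + U \<star> [:nm:] \<star> M = U \<star> [:r * r - tr * r + nm:] \<star> M"
      by (simp only: tmult_diff[symmetric] tmult_add[symmetric]) simp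
    moreover have "smult tr (W \<star> M) = W \<star> [:tr:] \<star> M" using tmult_Fq[OF tr_Fq, of W] by (simp add: smult_tmult)
    ultimately have "V \<star> S + W \<star> [:r:] \<star> M - W \<star> [:tr:] \<star> M = 1"
      unfolding rr(1) by (simp add: algebra_simps)
    moreover have "W \<star> [:tr:] \<star> M = W \<star> [:r:] \<star> M + W \<star> [:F r:] \<star> M"
      unfolding rr(2)[symmetric] tmult_add[symmetric] by simp
    ultimately show ?thesis by simp
  qed
  have SW: "S \<noteq> 0 \<and> W \<noteq> 0"
  proof -
    have "S = 0 \<longleftrightarrow> W = 0" using US U0 M0 tmult_eq_0 by metis
    moreover have "\<not> (S = 0 \<and> W = 0)" using star by auto
    ultimately show ?thesis by blast
  qed
  have dUS: "d + degree S = degree W + degree M"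
    using degree_tmult[OF U0, of S] degree_tmult[OF _ M0, of W] SW US by (simp add: d_def)
  have inv: "degree h = 0" if "f \<star> h = 1 \<or> h \<star> f = 1" for f h
  proof -
    have "f \<noteq> 0" "h \<noteq> 0" using that by auto
    thus ?thesis using degree_tmult[of f h] degree_tmult[of h f] that by auto
  qed
  \<comment> \<open>If \<open>d\<close> is smaller, \<open>W\<close> is constant and
    \<open>star\<close> shows that \<open>S\<close> is a unit; if it is larger, \<open>S\<close> is
    constant and \<open>W\<close> is a unit. With both of degree 0 the degrees of \<open>U\<close>
    and \<open>M\<close> agree, so \<open>d = 2\<close> after all.\<close>
  have d2: "d = 2"
  proof (rule ccontr)
    assume "d \<noteq> 2"
    then consider "d \<le> 1" | "d \<ge> 3" by linarith
    thus False
    proof cases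
      case 1
      hence "degree W = 0" using dUS dS SW by auto
      then obtain w where w': "W = [:w:]" by (rule degree_eq_zeroE)
      hence w: "W = [:w:]" "w \<noteq> 0" using SW by auto
      have "M = [:inverse w:] \<star> (W \<star> M)" using w by (simp add: const_tmult)
      hence "(V - W \<star> [:F r:] \<star> [:inverse w:] \<star> U) \<star> S = 1"
        using star US by (simp add: tmult_diff tmult_assoc)
      hence "degree S = 0" using inv by blast
      thus False using dUS degs \<open>degree W = 0\<close> \<open>d \<noteq> 2\<close> by simp
    next
      case 2
      hence "degree S = 0" using dS degs SW by auto
      then obtain s where s': "S = [:s:]" by (rule degree_eq_zeroE)
      hence s: "S = [:s:]" "s \<noteq> 0" using SW by auto
      have "U = U \<star> S \<star> [:inverse s:]" using s tmult_const[of U s "inverse s"] by (simp add: one_pCons[symmetric])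
      hence U: "U = W \<star> (M \<star> [:inverse s:])" unfolding US by (simp add: tmult_assoc)
      have "V = W + U \<star> [:r:]" by (simp add: W_def)
      hence V: "V = W \<star> (1 + M \<star> [:inverse s:] \<star> [:r:])" using U by (simp add: tmult_add tmult_assoc)
      have "W \<star> ((1 + M \<star> [:inverse s:] \<star> [:r:]) \<star> S - [:F r:] \<star> M) = 1"
        using star unfolding V by (simp only: tmult_diff(2) tmult_assoc)
      hence "degree W = 0" using inv by blast
      thus False using dUS degs \<open>degree S = 0\<close> \<open>d \<noteq> 2\<close> by simp
    qed
  qed
  have "F (F r) = F \<zeta>" using Fr d2 by (simp add: numeral_2_eq_2)
  hence r: "r = F \<zeta>" using conj_props(1)[OF \<open>conj r\<close>] by simp
  define Z where "Z = \<zeta>"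
  have FZ: "F (F Z) = Z" by (simp add: Z_def)
  have dM2: "degree M = 2" and dU2: "degree U = 2" using degs d2 by (auto simp: d_def)
  have list2: "f = [:coeff f 0, coeff f 1, coeff f 2:]" if "degree f \<le> 2" for f :: "'a poly"
  proof (rule poly_eqI)
    fix n show "coeff f n = coeff [:coeff f 0, coeff f 1, coeff f 2:] n"
      using that by (cases "n \<le> 2") (auto simp: numeral_2_eq_2 le_Suc_eq coeff_eq_0)
  qed
  have list1: "f = [:coeff f 0, coeff f 1:]" if "degree f \<le> 1" for f :: "'a poly"
  proof (rule poly_eqI)
    fix n show "coeff f n = coeff [:coeff f 0, coeff f 1:] n"
      using that by (cases "n \<le> 1") (auto simp: le_Suc_eq coeff_eq_0)
  qed
  obtain m0 m1 where M': "M = [:m0, m1, 1:]" using list2[of M] M(2) dM2 by auto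
  obtain x0 x1 x2 where U': "U = [:x0, x1, x2:]" using list2[of U] dU2 by auto
  obtain s0 s1 where S': "S = [:s0, s1:]" using list1[of S] dS dM2 SW by auto
  have "degree W \<le> 1" using dUS dS SW d2 dM2 by auto
  then obtain w0 w1 where W': "W = [:w0, w1:]" using list1[of W] by auto
  have V': "V = [:w0 + x0 * F Z, w1 + x1 * Z, x2 * F Z:]"
  proof -
    have "V = W + U \<star> [:r:]" by (simp add: W_def)
    thus ?thesis unfolding U' W' r Z_def[symmetric] by (simp add: tmult_pCons Fp_simps FZ mult.commute)
  qed
  define a where "a = t - Z"
  define b where "b = t - F Z"
  have ab0: "a \<noteq> 0" "b \<noteq> 0" using t_not_conj[OF conj_zeta] t_not_conj[OF conj_F[OF conj_zeta]] by (auto simp: a_def b_def Z_def)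
  define D where "D = Z - F Z"
  have D0: "D \<noteq> 0" using zeta_neq by (auto simp: D_def Z_def)
  have FD: "F D = - D" by (simp add: D_def F_simps FZ)
  have Z1: "F Z = Z - D" by (simp add: D_def)
  have xy: "x = 1 / (a * b)" "y = t / (a * b)" using rho_eq(2)[OF conj_zeta] by (simp_all add: xy_eq(1,2) a_def b_def Z_def)
  have c0: "x0 * m0 = x" "(w0 + x0 * F Z) * m0 = y"
    using fx(2) fy(2) unfolding UV coeff_tmult_0 U' V' M' by simp_all
  have m0: "m0 \<noteq> 0" using c0(1) by auto
  have "x0 = x / m0" using c0(1) m0 by (simp add: eq_divide_eq)
  hence x0: "x0 = 1 / (a * b * m0)" by (simp add: xy)
  have w0: "w0 = 1 / (a * m0)"
  proof -
    have "w0 * m0 = (w0 + x0 * F Z) * m0 - F Z * (x0 * m0)" by (simp add: algebra_simps)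
    also have "\<dots> = y - F Z * x" by (simp only: c0)
    also have "\<dots> = b / (a * b)" by (simp add: xy b_def diff_divide_distrib)
    also have "\<dots> = 1 / a" using ab0 by simp
    finally show ?thesis using m0 ab0 by (simp add: field_simps)
  qed
  have e1: "w1 = x2 * F (F s1)" "w1 * F m1 + w0 = x1 * F s1 + x2 * F (F s0)" "w0 * m1 + w1 * F m0 = x0 * s1 + x1 * F s0"
     "x0 * s0 = w0 * m0"
    using US unfolding U' S' W' M' by (simp_all add: tmult_pCons Fp_simps algebra_simps)
  have s0: "s0 = b * m0" using e1(4) m0 ab0 by (simp add: x0 w0 field_simps)
  have star': "V \<star> S - W \<star> [:Z:] \<star> M = 1" using star unfolding r by (simp add: Z_def)
  have e2: "w1 * F s1 + x1 * Z * F s1 + x2 * F Z * F (F s0) = w1 * F Z * F m1 + w0 * Z"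
    "w0 * s1 + x0 * F Z * s1 + w1 * F s0 + x1 * Z * F s0 = w0 * Z * m1 + w1 * F Z * F m0"
    using star' unfolding V' S' W' M' by (simp_all add: tmult_pCons Fp_simps one_pCons algebra_simps)
  \<comment> \<open>\<open>q1\<close>, \<open>q1'\<close> and \<open>q2\<close> add
    \<open>F Z\<close> or \<open>Z\<close> times an equation of \<open>e1\<close> to one of
    \<open>e2\<close>. Each elimination leaves \<open>Z\<close> only in the difference
    \<open>D\<close>, and the unknowns can then be solved for one after another.\<close>
  have q1: "w1 * F s1 + D * x1 * F s1 = D * w0"
  proof -
    have "w1 * F s1 + D * x1 * F s1 - D * w0 =
      (w1 * F s1 + x1 * Z * F s1 + x2 * F Z * F (F s0) - (w1 * F Z * F m1 + w0 * Z)) +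
      F Z * (w1 * F m1 + w0 - (x1 * F s1 + x2 * F (F s0)))" by (simp add: D_def algebra_simps)
    also have "\<dots> = 0" unfolding e1(2) e2(1) by simp
    finally show ?thesis by simp
  qed
  have q1': "w1 * F s1 + D * w1 * F m1 = D * x2 * F (F s0)"
  proof -
    have "w1 * F s1 + D * w1 * F m1 - D * x2 * F (F s0) =
      (w1 * F s1 + x1 * Z * F s1 + x2 * F Z * F (F s0) - (w1 * F Z * F m1 + w0 * Z)) +
      Z * (w1 * F m1 + w0 - (x1 * F s1 + x2 * F (F s0)))" by (simp add: D_def algebra_simps)
    also have "\<dots> = 0" unfolding e1(2) e2(1) by simp
    finally show ?thesis by simp
  qed
  have q2: "w1 * (F s0 + D * F m0) = s1 * (D * x0 - w0)"
  proof -
    have "w1 * (F s0 + D * F m0) - s1 * (D * x0 - w0) =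
      (w0 * s1 + x0 * F Z * s1 + w1 * F s0 + x1 * Z * F s0 - (w0 * Z * m1 + w1 * F Z * F m0)) +
      Z * (w0 * m1 + w1 * F m0 - (x0 * s1 + x1 * F s0))" by (simp add: D_def algebra_simps)
    also have "\<dots> = 0" unfolding e1(3) e2(2) by simp
    finally show ?thesis by simp
  qed
  have s1: "s1 \<noteq> 0"
  proof
    assume "s1 = 0"
    hence "D * w0 = 0" using q1 e1(1) by simp
    thus False using D0 w0 m0 ab0 by simp
  qed
  define k where "k = s0 / s1"
  have k0: "k \<noteq> 0" using s1 s0 m0 ab0 by (simp add: k_def)
  have s1k: "s1 = m0 * b / k" using s1 s0 m0 ab0 by (simp add: k_def)
  have cs: "cs Z m0 k = s1" by (simp add: cs_def b_def[symmetric] s1k)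
  have bD: "b = a + D" "F b = F a - D" by (simp_all add: a_def b_def D_def F_simps FZ)
  have Fs: "F s0 + D * F m0 = F (a * m0)" by (simp only: s0 F_mult bD(2)) (simp add: algebra_simps)
  have "D * x0 - w0 = - (1 / s0)" unfolding x0 w0 s0 using ab0 m0 by (simp add: bD divide_simps)
  hence "w1 * F (a * m0) = - (s1 / s0)" using q2 unfolding Fs by simp
  also have "\<dots> = - (1 / k)" by (simp add: k_def)
  finally have w1: "w1 = - (1 / (k * F (a * m0)))" using ab0 m0 k0 by (simp add: F_mult field_simps)
  have w10: "w1 \<noteq> 0" using w1 k0 ab0 m0 by simp
  have "x2 = w1 / F (F s1)" using e1(1) s1 by simp
  hence x2: "x2 = - 1 / (k * F (a * m0) * F (F s1))" by (simp add: w1)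
  have "x1 = - w1 / D + w0 / F s1" using q1 D0 s1 by (simp add: field_simps)
  hence x1: "x1 = 1 / (k * F (a * m0) * D) + 1 / (a * m0 * F s1)" unfolding w1 w0 by simp
  have m1: "m1 = s1 / D + F k"
  proof -
    have "F (F s1) \<noteq> 0" using s1 by simp
    hence "x2 * F (F s0) = w1 * F (F k)" by (simp add: e1(1) k_def F_divide)
    hence "w1 * (F s1 + D * F m1) = w1 * (D * F (F k))" using q1' by (simp add: algebra_simps)
    hence "F s1 + D * F m1 = D * F (F k)" using w10 by simp
    hence "D * (F m1 - F (F k)) = - F s1" by (simp add: algebra_simps eq_neg_iff_add_eq_0)
    hence "F m1 - F (F k) = - F s1 / D" using D0 by (metis nonzero_mult_div_cancel_left)
    hence "F m1 = F (s1 / D + F k)" using D0 by (simp add: F_simps FD algebra_simps)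
    thus ?thesis unfolding F_inj .
  qed
  have "M = dM \<zeta> m0 k" unfolding M' m1 dM_def Z_def[symmetric] cs D_def ..
  moreover have "U = dU \<zeta> m0 k" unfolding U' x0 x1 x2 dU_def Z_def[symmetric] cs a_def[symmetric] b_def[symmetric] D_def ..
  moreover have "V = dV \<zeta> m0 k"
  proof -
    have 0: "w0 + x0 * F Z = t / (a * b * m0)"
    proof -
      have "w0 + x0 * F Z = (b + F Z) / (a * b * m0)" unfolding w0 x0 using ab0 m0 by (simp add: field_simps)
      thus ?thesis by (simp add: b_def)
    qed
    have 1: "w1 + x1 * Z = F Z / (k * F (a * m0) * D) + Z / (a * m0 * F s1)"
      unfolding w1 x1 Z1 using D0 k0 ab0 m0 s1 by (simp add: field_simps)
    have 2: "x2 * F Z = - F Z / (k * F (a * m0) * F (F s1))" unfolding x2 by simp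
    show ?thesis unfolding V' 0 1 2 dV_def Z_def[symmetric] cs a_def[symmetric] b_def[symmetric] D_def ..
  qed
  ultimately show ?thesis using m0 k0 UV by blast
qed

subsection \<open>Points of the modular curve\<close>

lemma ev_const: "ev [:c:] z = c * z"
  by (simp add: ev_pCons)

lemma hom_classification:
  assumes \<phi>: "drinfeld_module q \<zeta> t 2 \<phi>" "zeta_q_type q \<zeta> t \<phi>"
  shows "\<exists>m k. m \<noteq> 0 \<and> k \<noteq> 0 \<and> (\<forall>a\<in>Ipow 0. \<phi> a = dmod \<zeta> m k a)"
proof -
  have h: "Fq_algebra_hom q \<zeta> t \<phi>" and c0: "a \<in> Ipow 0 \<Longrightarrow> coeff (\<phi> a) 0 = a"
    and dg: "a \<in> Ipow 0 - {0} \<Longrightarrow> real (degree (\<phi> a)) = real 2 * A_deg q \<zeta> t a" for a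
    using \<phi>(1) unfolding drinfeld_module_def Aset_eq by auto
  have z: "poly [:0, 1:] \<zeta> \<noteq> 0" using zeta_neq_0 by simp
  have "x = poly 1 t / \<rho> ^ 1" "y = poly [:0, 1:] t / \<rho> ^ 1" by (simp_all add: xA_def yA_def)
  moreover have "[:0, 1:] \<in> coeffs_in (Fq q :: 'a set)" "1 \<in> coeffs_in (Fq q :: 'a set)"
    by (auto simp: coeffs_in_def coeff_pCons one_pCons split: nat.splits intro: Fq_simps)
  ultimately have A: "A_deg q \<zeta> t x = 2" "A_deg q \<zeta> t y = 2"
    using A_deg_eq[of 1 1 x] A_deg_eq[of "[:0, 1:]" 1 y] z by simp_all
  have n0: "x \<noteq> 0" "y \<noteq> 0" using t_notin_Fq rho_neq_0 by (auto simp: xA_def yA_def in_Fq)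
  have fx: "degree (\<phi> x) = 4" "coeff (\<phi> x) 0 = x" and fy: "degree (\<phi> y) = 4" "coeff (\<phi> y) 0 = y"
    using dg[of x] dg[of y] c0 A n0 by simp_all
  have "\<phi> x \<noteq> 0" using fx by auto
  hence lead: "lead_coeff (\<phi> y) = F \<zeta> * lead_coeff (\<phi> x)"
    using \<phi>(2) unfolding zeta_q_type_def leading_def F_def[symmetric] by (simp add: field_simps)
  have comm: "\<phi> x \<star> \<phi> y = \<phi> y \<star> \<phi> x"
    by (simp flip: Fq_homD(2)[OF h]) (simp add: mult.commute)
  have sm: "smult c f = \<phi> c \<star> f" if "c \<in> Fq q" for c f using Fq_homD(3)[OF h that] by (simp add: const_tmult)
  have m0: "u * v \<in> Ipow 0" if "u \<in> Ipow 0" "v \<in> Ipow 0" for u v using Ipow_mult[of u 0 v 0] that by simp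
  have "\<phi> (y * y + nm * (x * x)) = \<phi> (x + tr * (x * y))"
    using xy_relation by (simp add: algebra_simps)
  hence rel: "\<phi> y \<star> \<phi> y - smult tr (\<phi> x \<star> \<phi> y) + smult nm (\<phi> x \<star> \<phi> x) = \<phi> x"
    using m0 Fq_Ipow tr_Fq nm_Fq by (simp add: Fq_homD(1,2)[OF h] sm algebra_simps)
  obtain m k where mk: "m \<noteq> 0" "k \<noteq> 0" "\<phi> x = dU \<zeta> m k \<star> dM \<zeta> m k" "\<phi> y = dV \<zeta> m k \<star> dM \<zeta> m k"
    using classification[OF fx fy lead comm rel] by blast
  have "\<phi> a = dmod \<zeta> m k a" if "a \<in> Ipow 0" for a
    using hom_unique[OF h dmod_hom(1)[OF conj_zeta mk(1,2)] _ _ that] mk(3,4) dmod_hom(2,3)[OF conj_zeta mk(1,2)] by simp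
  thus ?thesis using mk by blast
qed

text \<open>Serves to normalize \<open>k\<close>: the factor \<open>F c / c\<close> takes any
  nonzero value over the algebraically closed field.\<close>

lemma dmod_scale:
  assumes Z: "conj Z" and mk: "m \<noteq> 0" "k \<noteq> 0" and c: "c \<noteq> 0" and a: "a \<in> Ipow 0"
  shows "[:c:] \<star> dmod Z m k a = dmod Z (m * F (F c) / c) (k * F c / c) a \<star> [:c:]"
proof -
  define m' where "m' = m * F (F c) / c"
  define k' where "k' = k * F c / c"
  have mk': "m' \<noteq> 0" "k' \<noteq> 0" using mk c by (auto simp: m'_def k'_def)
  have D0: "Z - F Z \<noteq> 0" using conj_props[OF Z] by auto
  have s: "cs Z m' k' = cs Z m k * F (F c) / F c" using c mk by (simp add: cs_def m'_def k'_def field_simps)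
  have M: "dM Z m' k' \<star> [:c:] = [:F (F c):] \<star> dM Z m k" and B: "dB Z m' k' \<star> [:c:] = [:F (F c):] \<star> dB Z m k"
    unfolding dM_def dB_def s using c D0
    by (simp_all add: tmult_pCons Fp_simps const_tmult F_simps m'_def k'_def) (simp_all add: field_simps)
  note iso = isogeny_data[OF module_data_D[OF Z mk] module_data_D[OF Z mk'] M B]
  note h = dmod_hom[OF Z mk] and h' = dmod_hom[OF Z mk']
  have "[:c:] \<star> dmod Z m k a = dmod Z m' k' a \<star> [:c:]"
  proof (rule hom_intertwine[OF h(1) h'(1) _ _ a])
    show "[:c:] \<star> dmod Z m k x = dmod Z m' k' x \<star> [:c:]"
      unfolding h h' by (simp only: tmult_assoc M) (simp only: iso flip: tmult_assoc)
    show "[:c:] \<star> dmod Z m k y = dmod Z m' k' y \<star> [:c:]"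
      unfolding h h' by (simp only: tmult_assoc M) (simp only: iso flip: tmult_assoc)
  qed
  thus ?thesis by (simp only: m'_def k'_def)
qed

text \<open>The isomorphism carries \<open>M\<close> and \<open>B\<close> to their counterparts up
  to a constant \<open>g0\<close> on the left. The coefficients of \<open>\<tau>\<^sup>2\<close>
  give \<open>F (F c) = g0\<close>; those of \<open>\<tau>\<close> in \<open>M\<close> and
  \<open>B\<close> together, with the common \<open>k\<close>, give \<open>F c = g0\<close>. Hence
  \<open>c\<close> is fixed by \<open>F\<close>, and the constant terms agree.\<close>

lemma dmod_iso_unique:
  assumes Z: "conj Z" and m: "m \<noteq> 0" "m' \<noteq> 0" and k: "k \<noteq> 0" and c: "c \<noteq> 0"
    and iso: "\<And>a. a \<in> Ipow 0 \<Longrightarrow> [:c:] \<star> dmod Z m k a = dmod Z m' k a \<star> [:c:]"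
  shows "m' = m" "F c = c"
proof -
  note D = module_data_D[OF Z m(1) k] and D' = module_data_D[OF Z m(2) k]
  note d = D[unfolded module_data_def] and d' = D'[unfolded module_data_def]
  define M where "M = dM Z m k"
  define B where "B = dB Z m k"
  define U where "U = dU Z m k"
  define V where "V = dV Z m k"
  define M' where "M' = dM Z m' k"
  define B' where "B' = dB Z m' k"
  define U' where "U' = dU Z m' k"
  define V' where "V' = dV Z m' k"
  have isox: "[:c:] \<star> (U \<star> M) = U' \<star> M' \<star> [:c:]" and isoy: "[:c:] \<star> (V \<star> M) = V' \<star> M' \<star> [:c:]"
    using iso[OF xy_Ipow0(1)] iso[OF xy_Ipow0(2)]
    unfolding dmod_hom(2,3)[OF Z m(1) k] dmod_hom(2,3)[OF Z m(2) k]
    by (simp_all only: U_def M_def V_def U'_def M'_def V'_def)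
  have M0: "M \<noteq> 0" "M' \<noteq> 0" "U' \<noteq> 0"
    using dmod_leads(1,2)[OF Z m(1) k] dmod_leads(1,2)[OF Z m(2) k] by (auto simp: M_def M'_def U'_def)
  \<comment> \<open>Read off from \<open>M' c\<close>, inserting the identity
    \<open>B' V' - tr M' V' + nm M' U' = 1\<close> on its left and moving \<open>c\<close> across
    \<open>U' M'\<close> and \<open>V' M'\<close>.\<close>
  define g where "g = (B' - smult tr M') \<star> [:c:] \<star> V + smult nm M' \<star> [:c:] \<star> U"
  have gM: "M' \<star> [:c:] = g \<star> M"
  proof -
    have "B' \<star> V' - smult tr (M' \<star> V') + smult nm (M' \<star> U') = 1"
      using module_data_props(3)[OF D'] by (simp only: B'_def V'_def M'_def U'_def)
    hence "(B' \<star> V' - smult tr (M' \<star> V') + smult nm (M' \<star> U')) \<star> (M' \<star> [:c:]) = M' \<star> [:c:]" by simp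
    moreover have "(B' \<star> V' - smult tr (M' \<star> V') + smult nm (M' \<star> U')) \<star> (M' \<star> [:c:]) =
      (B' - smult tr M') \<star> (V' \<star> M' \<star> [:c:]) + smult nm M' \<star> (U' \<star> M' \<star> [:c:])"
      by (simp add: tmult_add tmult_diff smult_tmult tmult_assoc)
    ultimately show ?thesis unfolding isox[symmetric] isoy[symmetric] g_def by (simp add: tmult_add tmult_assoc)
  qed
  have cc: "[:c:] \<noteq> 0" using c by simp
  have "g \<noteq> 0" using gM M0 cc by auto
  hence "degree g + degree M = degree M'" using gM degree_tmult[OF _ M0(1), of g] degree_tmult[OF M0(2) cc] by simp
  hence "degree g = 0" using dmod_leads(1)[OF Z m(1) k] dmod_leads(1)[OF Z m(2) k] by (simp add: M_def M'_def)
  then obtain g0 where g0: "g = [:g0:]" by (rule degree_eq_zeroE)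
  have Ug: "U' \<star> g = [:c:] \<star> U"
    by (rule tmult_right_cancel[OF M0(1)]) (simp only: tmult_assoc gM[symmetric] isox)
  have Vg: "V' \<star> g = [:c:] \<star> V"
    by (rule tmult_right_cancel[OF M0(1)]) (simp only: tmult_assoc gM[symmetric] isoy)
  have "U' \<star> (B' \<star> [:c:]) = V' \<star> M' \<star> [:c:]"
    using d' by (simp add: U'_def B'_def V'_def M'_def flip: tmult_assoc)
  also have "\<dots> = V' \<star> g \<star> M" by (simp only: tmult_assoc gM)
  also have "\<dots> = [:c:] \<star> (U \<star> B)" using d by (simp only: Vg tmult_assoc U_def B_def V_def M_def)
  also have "\<dots> = U' \<star> (g \<star> B)" by (simp only: Ug flip: tmult_assoc)
  finally have gB: "B' \<star> [:c:] = g \<star> B" by (rule tmult_left_cancel[OF M0(3)])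
  define s where "s = cs Z m k / (Z - F Z)"
  define s' where "s' = cs Z m' k / (Z - F Z)"
  have 1: "F (F c) = g0" "m' * c = g0 * m" "(s' + F k) * F c = g0 * (s + F k)"
    using gM unfolding g0 M_def M'_def dM_def s_def[symmetric] s'_def[symmetric]
    by (simp_all add: tmult_pCons Fp_simps const_tmult)
  have 2: "(Z * s' + F Z * F k) * F c = g0 * (Z * s + F Z * F k)"
    using gB unfolding g0 B_def B'_def dB_def s_def s'_def
    by (simp add: tmult_pCons Fp_simps const_tmult)
  have "(Z - F Z) * (F k * F c - g0 * F k) = Z * ((s' + F k) * F c - g0 * (s + F k)) -
      ((Z * s' + F Z * F k) * F c - g0 * (Z * s + F Z * F k))" by (simp add: algebra_simps)
  also have "\<dots> = 0" unfolding 1(3) 2 by simp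
  finally have "F c = g0" using conj_props[OF Z] k by auto
  hence "F (F c) = F c" using 1 by simp
  thus Fc: "F c = c" by simp
  thus "m' = m" using 1 c by simp
qed

lemma primitive_transport:
  assumes c: "c \<noteq> 0" and iso: "\<And>a. a \<in> Ipow 0 \<Longrightarrow> [:c:] \<star> \<phi> a = \<psi> a \<star> [:c:]"
    and G: "primitive_torsion q \<zeta> t \<phi> (Ipow n) G"
  shows "primitive_torsion q \<zeta> t \<psi> (Ipow n) ((\<lambda>z. c * z) ` G)"
proof -
  have ev: "ev (\<psi> a) (c * z) = c * ev (\<phi> a) z" if "a \<in> Ipow 0" for a z
    using arg_cong[OF iso[OF that], of "\<lambda>f. ev f z"] by (simp add: ev_tmult ev_const)
  have sub: "a \<in> Ipow n \<Longrightarrow> a \<in> Ipow 0" for a using Ipow_mono[of 0 n] by auto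
  obtain f where S: "submod \<phi> G" "G \<subseteq> tors \<phi> n" and f: "bij_betw f (carrier (A Quot Ipow n)) G"
    and add: "\<forall>u \<in> carrier (A Quot Ipow n). \<forall>v \<in> carrier (A Quot Ipow n). f (u \<oplus>\<^bsub>A Quot Ipow n\<^esub> v) = f u + f v"
    and act: "\<forall>a \<in> Ipow 0. \<forall>u \<in> carrier (A Quot Ipow n).
           f ((Ipow n +>\<^bsub>A\<^esub> a) \<otimes>\<^bsub>A Quot Ipow n\<^esub> u) = ev (\<phi> a) (f u)"
    using G unfolding primitive_torsion_def Aset_eq by blast
  show ?thesis unfolding primitive_torsion_def Aset_eq
  proof (intro conjI exI[of _ "\<lambda>u. c * f u"] ballI)
    show "(\<lambda>z. c * z) ` G \<subseteq> tors \<psi> n" using S(2) by (auto simp: torsion_def ev sub)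
    show "submod \<psi> ((\<lambda>z. c * z) ` G)" using S(1) unfolding submodule_via_def Aset_eq
      by (auto simp: ev image_iff right_diff_distrib[symmetric])
    have "bij_betw ((\<lambda>z. c * z) \<circ> f) (carrier (A Quot Ipow n)) ((\<lambda>z. c * z) ` G)"
      by (rule bij_betw_trans[OF f]) (use c in \<open>auto simp: bij_betw_def inj_on_def\<close>)
    thus "bij_betw (\<lambda>u. c * f u) (carrier (A Quot Ipow n)) ((\<lambda>z. c * z) ` G)" by (simp add: comp_def)
    fix u assume u: "u \<in> carrier (A Quot Ipow n)"
    show "v \<in> carrier (A Quot Ipow n) \<Longrightarrow> c * f (u \<oplus>\<^bsub>A Quot Ipow n\<^esub> v) = c * f u + c * f v" for v
      using add u by (simp add: distrib_left)
    show "a \<in> Ipow 0 \<Longrightarrow> c * f ((Ipow n +>\<^bsub>A\<^esub> a) \<otimes>\<^bsub>A Quot Ipow n\<^esub> u) = ev (\<psi> a) (c * f u)" for a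
      using act u by (simp add: ev)
  qed
qed

lemma primitive_cong:
  assumes "\<And>a. a \<in> Ipow 0 \<Longrightarrow> \<phi> a = \<psi> a"
  shows "primitive_torsion q \<zeta> t \<phi> (Ipow n) G \<longleftrightarrow> primitive_torsion q \<zeta> t \<psi> (Ipow n) G"
  using primitive_transport[of 1 \<phi> \<psi> n G] primitive_transport[of 1 \<psi> \<phi> n G] assms
  by (auto simp: one_pCons[symmetric])

lemma primitive_iff_chain:
  assumes "j \<noteq> 0"
  shows "primitive_torsion q \<zeta> t (mmod j) (Ipow n) G \<longleftrightarrow>
    (\<exists>ws. length ws = n \<and> chain ws \<zeta> (1 / j) (kap \<zeta>) \<and> G = Ker (cpoly ws \<zeta> (kap \<zeta>)))"
proof -
  have k: "1 / j \<noteq> 0" "kap \<zeta> \<noteq> 0" using kap_props[OF conj_zeta] assms by auto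
  have "primitive_torsion q \<zeta> t (mmod j) (Ipow n) G \<longleftrightarrow> good (dmod \<zeta> (1 / j) (kap \<zeta>)) (dM \<zeta> (1 / j) (kap \<zeta>)) n G"
    using primitive_cong[of "mmod j" "dmod \<zeta> (1 / j) (kap \<zeta>)"] minimal_model_hom(4)[OF assms] primitive_iff_good[OF conj_zeta k] by simp
  thus ?thesis using chain_good[OF conj_zeta k, where n = n] by blast
qed

abbreviation "\<Gamma> \<equiv> \<lambda>(j :: 'a) ws. Ker (cpoly ws \<zeta> (kap \<zeta>))"
abbreviation "model_pairs n \<equiv> {(j, G). j \<noteq> 0 \<and> primitive_torsion q \<zeta> t (mmod j) (Ipow n) G}"

lemma tower_bij: "bij_betw (\<lambda>(j, ws). (j, \<Gamma> j ws)) (tower_points q \<zeta> t n) (model_pairs n)"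
  unfolding bij_betw_def
proof
  show "inj_on (\<lambda>(j, ws). (j, \<Gamma> j ws)) (tower_points q \<zeta> t n)"
  proof (rule inj_onI, clarsimp)
    fix j ws ws' assume 1: "(j, ws) \<in> tower_points q \<zeta> t n" "(j, ws') \<in> tower_points q \<zeta> t n"
      and 2: "\<Gamma> j ws = \<Gamma> j ws'"
    have k: "1 / j \<noteq> 0" "kap \<zeta> \<noteq> 0" using kap_props[OF conj_zeta] 1 by (auto simp: tower_points_iff)
    show "ws = ws'" using 1 2 chain_inj[OF conj_zeta k] by (auto simp: tower_points_iff)
  qed
  show "(\<lambda>(j, ws). (j, \<Gamma> j ws)) ` tower_points q \<zeta> t n = model_pairs n"
  proof (intro equalityI subsetI)
    fix P assume "P \<in> model_pairs n"
    then obtain j ws where "P = (j, \<Gamma> j ws)" "(j, ws) \<in> tower_points q \<zeta> t n"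
      by (auto simp: tower_points_iff primitive_iff_chain)
    thus "P \<in> (\<lambda>(j, ws). (j, \<Gamma> j ws)) ` tower_points q \<zeta> t n"
      by (intro image_eqI[of _ _ "(j, ws)"]) simp_all
  qed (auto simp: tower_points_iff primitive_iff_chain)
qed

lemma mmod_conj:
  assumes "drinfeld_module q \<zeta> t 2 \<phi>" "zeta_q_type q \<zeta> t \<phi>"
  shows "\<exists>c j. c \<noteq> 0 \<and> j \<noteq> 0 \<and> (\<forall>a\<in>Ipow 0. [:c:] \<star> \<phi> a = mmod j a \<star> [:c:])"
proof -
  obtain m k where mk: "m \<noteq> 0" "k \<noteq> 0" and \<phi>: "\<And>a. a \<in> Ipow 0 \<Longrightarrow> \<phi> a = dmod \<zeta> m k a"
    using hom_classification[OF assms] by blast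
  have kap: "kap \<zeta> \<noteq> 0" using kap_props[OF conj_zeta] by simp
  \<comment> \<open>Solves \<open>F c / c = kap \<zeta> / k\<close>; after rescaling by this
    \<open>c\<close> the constant term is \<open>1 / j\<close>.\<close>
  obtain c where c: "c \<noteq> 0" "F c = kap \<zeta> / k * c" using Ker_lin_nonzero[of "kap \<zeta> / k"] kap mk by auto
  define j where "j = c / (m * F (F c))"
  have j: "j \<noteq> 0" "m * F (F c) / c = 1 / j" using c mk by (auto simp: j_def)
  have "k * F c / c = kap \<zeta>" using c mk by simp
  hence "[:c:] \<star> \<phi> a = mmod j a \<star> [:c:]" if "a \<in> Ipow 0" for a
    using dmod_scale[OF conj_zeta mk c(1) that] by (simp add: \<phi> that j minimal_model_hom(4))
  thus ?thesis using c j by blast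
qed

lemma equiv_pair_equiv: "equiv (modular_pairs q \<zeta> t N) (pair_equiv q \<zeta> t N)"
proof (rule equivI)
  show "pair_equiv q \<zeta> t N \<subseteq> modular_pairs q \<zeta> t N \<times> modular_pairs q \<zeta> t N"
    by (auto simp: pair_equiv_def)
  show "refl_on (modular_pairs q \<zeta> t N) (pair_equiv q \<zeta> t N)"
  proof (rule refl_onI)
    fix P assume P: "P \<in> modular_pairs q \<zeta> t N"
    thus "(P, P) \<in> pair_equiv q \<zeta> t N" unfolding pair_equiv_def
      by (cases P) (auto intro!: exI[of _ 1] simp: one_pCons[symmetric])
  qed
  show "sym (pair_equiv q \<zeta> t N)"
  proof (rule symI)
    fix P Q assume "(P, Q) \<in> pair_equiv q \<zeta> t N"
    then obtain \<phi> G \<psi> H c where PQ: "P = (\<phi>, G)" "Q = (\<psi>, H)" "P \<in> modular_pairs q \<zeta> t N" "Q \<in> modular_pairs q \<zeta> t N"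
      "c \<noteq> 0" "\<And>a. a \<in> Ipow 0 \<Longrightarrow> [:c:] \<star> \<phi> a = \<psi> a \<star> [:c:]" "(\<lambda>z. c * z) ` G = H"
      unfolding pair_equiv_def Aset_eq by auto
    have "[:inverse c:] \<star> \<psi> a = \<phi> a \<star> [:inverse c:]" if "a \<in> Ipow 0" for a
    proof (rule tmult_right_cancel)
      have u: "[:inverse c:] \<star> [:c:] = 1" using PQ(5) by (simp add: const_tmult one_pCons)
      have "[:inverse c:] \<star> \<psi> a \<star> [:c:] = [:inverse c:] \<star> [:c:] \<star> \<phi> a" by (simp only: tmult_assoc PQ(6)[OF that])
      thus "[:inverse c:] \<star> \<psi> a \<star> [:c:] = \<phi> a \<star> [:inverse c:] \<star> [:c:]" by (simp add: tmult_assoc u)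
    qed (use PQ(5) in simp)
    moreover have "(\<lambda>z. inverse c * z) ` H = G" using PQ(5) unfolding PQ(7)[symmetric] image_image
      by (simp add: mult.assoc[symmetric])
    moreover have "inverse c \<noteq> 0" using PQ(5) by simp
    ultimately show "(Q, P) \<in> pair_equiv q \<zeta> t N" using PQ(3,4) unfolding pair_equiv_def Aset_eq PQ(1,2) by blast
  qed
  show "trans (pair_equiv q \<zeta> t N)"
  proof (rule transI)
    fix P Q S assume "(P, Q) \<in> pair_equiv q \<zeta> t N" "(Q, S) \<in> pair_equiv q \<zeta> t N"
    then obtain \<phi> G \<psi> H \<xi> I c d where PQ: "P = (\<phi>, G)" "S = (\<xi>, I)" "P \<in> modular_pairs q \<zeta> t N" "S \<in> modular_pairs q \<zeta> t N"
      "c \<noteq> 0" "d \<noteq> 0" "\<And>a. a \<in> Ipow 0 \<Longrightarrow> [:c:] \<star> \<phi> a = \<psi> a \<star> [:c:]" "\<And>a. a \<in> Ipow 0 \<Longrightarrow> [:d:] \<star> \<psi> a = \<xi> a \<star> [:d:]"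
      "(\<lambda>z. d * z) ` ((\<lambda>z. c * z) ` G) = I"
      unfolding pair_equiv_def Aset_eq by auto
    have dc: "[:d * c:] = [:d:] \<star> [:c:]" by (simp add: const_tmult)
    have "[:d * c:] \<star> \<phi> a = \<xi> a \<star> [:d * c:]" if "a \<in> Ipow 0" for a
      unfolding dc tmult_assoc PQ(7)[OF that] by (simp only: PQ(8)[OF that] flip: tmult_assoc)
    moreover have "(\<lambda>z. d * c * z) ` G = I" using PQ(9) unfolding image_image by (simp add: mult.assoc)
    moreover have "d * c \<noteq> 0" using PQ(5,6) by simp
    ultimately show "(P, S) \<in> pair_equiv q \<zeta> t N" using PQ(3,4) unfolding pair_equiv_def Aset_eq PQ(1,2) by blast
  qed
qed

text \<open>Equivalent models have the same \<open>j\<close> and differ by some \<open>c\<close> in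
  \<open>F_q\<close>, which maps every submodule \<open>G\<close> onto itself. Surjectivity is
  \<open>mmod_conj\<close> with the torsion carried along.\<close>

lemma modular_bij:
  "bij_betw (\<lambda>(j, G). modular_point q \<zeta> t (Ipow n) (mmod j) G) (model_pairs n) (modular_curve q \<zeta> t (Ipow n))"
proof -
  note eqv = equiv_pair_equiv[of "Ipow n"]
  have mp: "(mmod j, G) \<in> modular_pairs q \<zeta> t (Ipow n)" if "(j, G) \<in> model_pairs n" for j G
    using that minimal_model_drinfeld by (simp add: modular_pairs_def)
  have "inj_on (\<lambda>(j, G). modular_point q \<zeta> t (Ipow n) (mmod j) G) (model_pairs n)"
  proof (rule inj_onI, clarify)
    fix j G j' G'
    assume j0: "j \<noteq> 0" "j' \<noteq> 0" and P: "primitive_torsion q \<zeta> t (mmod j) (Ipow n) G" "primitive_torsion q \<zeta> t (mmod j') (Ipow n) G'"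
      and eq: "modular_point q \<zeta> t (Ipow n) (mmod j) G = modular_point q \<zeta> t (Ipow n) (mmod j') G'"
    have "((mmod j, G), (mmod j', G')) \<in> pair_equiv q \<zeta> t (Ipow n)"
      by (rule eq_equiv_class[OF eq[unfolded modular_point_def] eqv]) (use mp j0 P in simp)
    then obtain c where c: "c \<noteq> 0" "\<And>a. a \<in> Ipow 0 \<Longrightarrow> [:c:] \<star> mmod j a = mmod j' a \<star> [:c:]" "(\<lambda>z. c * z) ` G = G'"
      unfolding pair_equiv_def Aset_eq by auto
    have k: "1 / j \<noteq> 0" "1 / j' \<noteq> 0" "kap \<zeta> \<noteq> 0" using kap_props[OF conj_zeta] j0 by auto
    have "1 / j' = 1 / j" "F c = c"
      using dmod_iso_unique[OF conj_zeta k c(1)] c(2) minimal_model_hom(4)[OF j0(1)] minimal_model_hom(4)[OF j0(2)] by simp_all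
    hence jj: "j' = j" and cF: "c \<in> Fq q" by (simp_all add: in_Fq)
    have S: "submod (mmod j) G" using P(1) unfolding primitive_torsion_def by blast
    have sc: "u \<in> G \<Longrightarrow> d * u \<in> G" if "d \<in> Fq q" for d u
      by (rule submod_scale[OF S minimal_model_hom(1)[OF j0(1)] that])
    have "inverse c \<in> Fq q" using cF by (simp add: in_Fq F_inverse)
    hence "g \<in> (\<lambda>z. c * z) ` G" if "g \<in> G" for g
      using c(1) sc[OF \<open>inverse c \<in> Fq q\<close> that] by (intro image_eqI[of _ _ "inverse c * g"]) auto
    hence "(\<lambda>z. c * z) ` G = G" using sc[OF cF] by auto
    thus "j = j' \<and> G = G'" using jj c(3) by simp
  qed
  moreover have "(\<lambda>(j, G). modular_point q \<zeta> t (Ipow n) (mmod j) G) ` model_pairs n = modular_curve q \<zeta> t (Ipow n)"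
  proof
    show "(\<lambda>(j, G). modular_point q \<zeta> t (Ipow n) (mmod j) G) ` model_pairs n \<subseteq> modular_curve q \<zeta> t (Ipow n)"
      using mp unfolding modular_curve_def modular_point_def by (auto intro!: quotientI)
    show "modular_curve q \<zeta> t (Ipow n) \<subseteq> (\<lambda>(j, G). modular_point q \<zeta> t (Ipow n) (mmod j) G) ` model_pairs n"
    proof
      fix C assume "C \<in> modular_curve q \<zeta> t (Ipow n)"
      then obtain \<phi> G where C: "C = pair_equiv q \<zeta> t (Ipow n) `` {(\<phi>, G)}" and P: "(\<phi>, G) \<in> modular_pairs q \<zeta> t (Ipow n)"
        unfolding modular_curve_def by (auto elim!: quotientE)
      have \<phi>: "drinfeld_module q \<zeta> t 2 \<phi>" "zeta_q_type q \<zeta> t \<phi>" "primitive_torsion q \<zeta> t \<phi> (Ipow n) G"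
        using P by (auto simp: modular_pairs_def)
      obtain c j where c: "c \<noteq> 0" "j \<noteq> 0" "\<And>a. a \<in> Ipow 0 \<Longrightarrow> [:c:] \<star> \<phi> a = mmod j a \<star> [:c:]"
        using mmod_conj[OF \<phi>(1,2)] by blast
      let ?H = "(\<lambda>z. c * z) ` G"
      have H: "(j, ?H) \<in> model_pairs n" using primitive_transport[OF c(1,3) \<phi>(3)] c(2) by simp
      have "((\<phi>, G), (mmod j, ?H)) \<in> pair_equiv q \<zeta> t (Ipow n)"
        using P mp[OF H] c unfolding pair_equiv_def Aset_eq by blast
      hence "C = modular_point q \<zeta> t (Ipow n) (mmod j) ?H"
        unfolding C modular_point_def by (rule equiv_class_eq[OF eqv])
      thus "C \<in> (\<lambda>(j, G). modular_point q \<zeta> t (Ipow n) (mmod j) G) ` model_pairs n"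
        using H by (intro image_eqI[of _ _ "(j, ?H)"]) auto
    qed
  qed
  ultimately show ?thesis by (simp add: bij_betw_def)
qed

lemma tower_modular_bij:
  "bij_betw (\<lambda>(j, ws). modular_point q \<zeta> t (Ipow n) (mmod j) (\<Gamma> j ws)) (tower_points q \<zeta> t n) (modular_curve q \<zeta> t (Ipow n))"
proof -
  have "(\<lambda>(j, ws). modular_point q \<zeta> t (Ipow n) (mmod j) (\<Gamma> j ws)) =
    (\<lambda>(j, G). modular_point q \<zeta> t (Ipow n) (mmod j) G) \<circ> (\<lambda>(j, ws). (j, \<Gamma> j ws))" by auto
  thus ?thesis using bij_betw_trans[OF tower_bij modular_bij] by simp
qed

text \<open>The single element \<open>y\<close> suffices: its kernel on the larger group has at most
  \<open>q\<close> elements, so its image has at least \<open>q ^ n\<close>, and by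
  \<open>chain_Ipow1\<close> the image lies in the shorter group, which has exactly that
  many.\<close>

lemma Iinf_times_\<Gamma>:
  assumes "(j, ws @ [w]) \<in> tower_points q \<zeta> t (Suc n)"
  shows "(j, ws) \<in> tower_points q \<zeta> t n" "Iinf_times q \<zeta> t (mmod j) (\<Gamma> j (ws @ [w])) = \<Gamma> j ws"
proof -
  have j: "j \<noteq> 0" and len: "length ws = n" and ch: "chain (ws @ [w]) \<zeta> (1 / j) (kap \<zeta>)"
    using assms by (auto simp: tower_points_iff)
  show tw: "(j, ws) \<in> tower_points q \<zeta> t n" using chain_butlast[OF ch] j len by (simp add: tower_points_iff)
  have k: "1 / j \<noteq> 0" "kap \<zeta> \<noteq> 0" using kap_props[OF conj_zeta] j by auto
  let ?G = "\<Gamma> j (ws @ [w])" and ?\<phi> = "mmod j"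
  have PG: "primitive_torsion q \<zeta> t ?\<phi> (Ipow (Suc n)) ?G" and PH: "primitive_torsion q \<zeta> t ?\<phi> (Ipow n) (\<Gamma> j ws)"
    unfolding primitive_iff_chain[OF j] using ch chain_butlast[OF ch] len
    by (auto intro: exI[of _ "ws @ [w]"])
  note h = minimal_model_hom(1)[OF j]
  note pG = primitive_y_kernel[OF h PG] and pH = primitive_y_kernel[OF h PH]
  have sub: "ev (?\<phi> a) g \<in> \<Gamma> j ws" if "a \<in> Ipow 1" "g \<in> ?G" for a g
  proof -
    have "a \<in> Ipow 0" using Ipow_mono[of 0 1] that by auto
    thus ?thesis using chain_Ipow1[OF conj_zeta k ch that(2,1)] by (simp add: minimal_model_hom(4)[OF j])
  qed
  have "card ?G = card (ev (?\<phi> y) ` ?G) * card {g\<in>?G. ev (?\<phi> y) g = 0}"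
    by (rule card_additive[OF pG(3)]) (auto simp: ev_arg_diff intro: submodD(2)[OF pG(4)])
  also have "\<dots> \<le> card (ev (?\<phi> y) ` ?G) * q" using pG(1) by (intro mult_le_mono) auto
  finally have "q ^ n \<le> card (ev (?\<phi> y) ` ?G)" using pG(2) by (simp add: mult.commute)
  moreover have im: "ev (?\<phi> y) ` ?G \<subseteq> \<Gamma> j ws" using sub y_Ipow by auto
  ultimately have "ev (?\<phi> y) ` ?G = \<Gamma> j ws" using pH(2) by (intro card_seteq[OF pH(3)]) auto
  thus "Iinf_times q \<zeta> t (mmod j) ?G = \<Gamma> j ws" using sub y_Ipow unfolding Iinf_times_def Iinf_eq by (auto simp: set_eq_iff image_iff) metis
qed

subsection \<open>Fields of definition\<close>

lemma sfield_F: "sfield E \<Longrightarrow> z \<in> E \<Longrightarrow> F z \<in> E"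
  by (simp add: F_def sfield_power)

lemma over_H_least: assumes "sfield E" "Fq q \<subseteq> E" "t \<in> E" "\<zeta> \<in> E" "S \<subseteq> E" shows "over_H q \<zeta> t S \<subseteq> E"
  unfolding over_H_def Hfield_def using assms by (intro generate_field_least Un_least) auto

lemma over_H_props:
  shows "sfield (over_H q \<zeta> t S)" "Fq q \<subseteq> over_H q \<zeta> t S" "t \<in> over_H q \<zeta> t S" "\<zeta> \<in> over_H q \<zeta> t S"
    "S \<subseteq> over_H q \<zeta> t S" "Hfield q \<zeta> t \<subseteq> over_H q \<zeta> t S"
proof -
  have *: "Hfield q \<zeta> t \<union> S \<subseteq> over_H q \<zeta> t S" unfolding over_H_def by (rule generate_field_superset)
  have "Fq q \<union> {t, \<zeta>} \<subseteq> Hfield q \<zeta> t" unfolding Hfield_def by (rule generate_field_superset)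
  thus "Fq q \<subseteq> over_H q \<zeta> t S" "t \<in> over_H q \<zeta> t S" "\<zeta> \<in> over_H q \<zeta> t S"
    "S \<subseteq> over_H q \<zeta> t S" "Hfield q \<zeta> t \<subseteq> over_H q \<zeta> t S" using * by blast+
  show "sfield (over_H q \<zeta> t S)" unfolding over_H_def by (rule sfield_generate)
qed

lemma next_in:
  assumes E: "sfield E" "t \<in> E" "Z \<in> E" "m \<in> E" "k \<in> E" "v \<in> E"
  shows "next_k k v \<in> E" "next_m Z m k v \<in> E" "kap Z \<in> E" "dM Z m k \<in> coeffs_in E"
  unfolding next_k_def next_m_def kap_def cs_def dM_def
  using E sfieldD[OF E(1)] sfield_F[OF E(1)]
  by (auto intro!: coeffs_in_intros[OF E(1)])

lemma cpoly_coeffs: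
  assumes "sfield E" "Z \<in> E" "k \<in> E" "set ws \<subseteq> E"
  shows "cpoly ws Z k \<in> coeffs_in E"
  using assms(2-)
proof (induction ws arbitrary: Z k)
  case Nil thus ?case using coeffs_in_intros(2)[OF assms(1)] by simp
next
  case (Cons w ws)
  note E = sfieldD[OF assms(1)] sfield_F[OF assms(1)]
  have v: "w * k / kap Z \<in> E" using Cons.prems E by (auto simp: kap_def)
  have "next_k k (w * k / kap Z) \<in> E" using v Cons.prems E by (simp add: next_k_def)
  hence "cpoly ws (F Z) (next_k k (w * k / kap Z)) \<in> coeffs_in E"
    using Cons.IH Cons.prems E by simp
  moreover have "lin (w * k / kap Z) \<in> coeffs_in E" using v E by (auto intro!: coeffs_in_intros[OF assms(1)])
  ultimately show ?case by (simp add: coeffs_in_intros[OF assms(1)])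
qed

text \<open>The line \<open>v\<close> is recovered from the right remainder of the additive polynomial of \<open>G\<close> by that of
  the \<open>I\<^sub>\<infinity>\<close>-torsion, which is a nonzero multiple of \<open>\<tau> - v\<close>.\<close>

lemma chain_in_field:
  assumes "sfield E" "t \<in> E"
  shows "conj Z \<Longrightarrow> m \<noteq> 0 \<Longrightarrow> k \<noteq> 0 \<Longrightarrow> Z \<in> E \<Longrightarrow> m \<in> E \<Longrightarrow> k \<in> E \<Longrightarrow> chain ws Z m k \<Longrightarrow>
    cpoly ws Z k \<in> coeffs_in E \<Longrightarrow> set ws \<subseteq> E"
proof (induction ws arbitrary: Z m k)
  case (Cons w ws Z m k)
  note Z = Cons.prems(1) and mk = Cons.prems(2,3) and inE = Cons.prems(4-6)
  note E = sfieldD[OF assms(1)] sfield_F[OF assms(1)]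
  define v where "v = w * k / kap Z"
  have root: "is_root Z m k v" and ch: "chain ws (F Z) (next_m Z m k v) (next_k k v)"
    using Cons.prems(7) by (simp_all add: v_def)
  note st = root_step[OF Z mk root]
  have v0: "v \<noteq> 0" by (rule is_root_nonzero[OF root mk(1)])
  define C where "C = cpoly ws (F Z) (next_k k v)"
  have CE: "C \<star> lin v \<in> coeffs_in E" using Cons.prems(8) by (simp add: C_def v_def)
  let ?M = "dM Z m k"
  have M: "?M \<in> coeffs_in E" "lead_coeff ?M = 1"
    using next_in(4)[OF assms inE, of 0] E by (auto simp: dM_def)
  have M0: "?M \<noteq> 0" and dM: "degree ?M = 2" using dmod_leads(1)[OF Z mk] by auto
  obtain h r where hr: "r \<in> coeffs_in E" "C \<star> lin v = h \<star> ?M + r" "r = 0 \<or> degree r < 2"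
    using tmult_division[OF assms(1) M CE] dM by auto
  have int: "Ker (C \<star> lin v) \<inter> Ker ?M = Ker (lin v)"
    using chain_good(1)[OF Z mk Cons.prems(7) refl] by (simp add: C_def v_def)
  obtain z where z: "z \<noteq> 0" "F z = v * z" using Ker_lin_nonzero[OF v0] by blast
  have "z \<in> Ker (C \<star> lin v) \<inter> Ker ?M" unfolding int using z by (simp add: Ker_def ev_lin)
  hence rz: "ev r z = 0" using hr(2) by (auto simp: Ker_def ev_add ev_tmult)
  have "r \<noteq> 0"
  proof
    assume "r = 0"
    hence "Ker ?M \<subseteq> Ker (C \<star> lin v)" using hr(2) by (auto simp: Ker_def ev_tmult)
    hence "Ker ?M = Ker (lin v)" using int by blast
    moreover have "card (Ker ?M) = q * q" "card (Ker (lin v)) = q"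
      using line_step.card_Ker[OF line_stepI[OF Z mk root]] by blast+
    ultimately show False using q_gt1 by simp
  qed
  have r: "r = [:coeff r 0, coeff r 1:]"
  proof (rule poly_eqI)
    fix n show "coeff r n = coeff [:coeff r 0, coeff r 1:] n"
      using hr(3) by (cases "n \<le> 1") (auto simp: le_Suc_eq coeff_eq_0)
  qed
  have "ev [:coeff r 0, coeff r 1:] z = 0" using rz r by simp
  hence "(coeff r 0 + coeff r 1 * v) * z = 0" using z by (simp add: ev_pCons algebra_simps)
  hence r01: "coeff r 0 + coeff r 1 * v = 0" using z by simp
  have "coeff r 1 \<noteq> 0" using r01 r \<open>r \<noteq> 0\<close> by auto
  hence "v = - coeff r 0 / coeff r 1" using r01 by (simp add: field_simps eq_neg_iff_add_eq_0)
  moreover have "coeff r 0 \<in> E" "coeff r 1 \<in> E" using hr(1) by (auto simp: coeffs_in_def)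
  ultimately have vE: "v \<in> E" using E by simp
  note nx = next_in[OF assms inE vE]
  have "w = v * kap Z / k" using mk kap_props[OF Z] by (simp add: v_def)
  hence wE: "w \<in> E" using vE nx inE E by simp
  \<comment> \<open>Dividing by the now rational \<open>lin v\<close> over \<open>E\<close> must
    return \<open>C\<close>, because quotients are unique; so the rest of the chain is defined over
    \<open>E\<close> as well.\<close>
  have linE: "lin v \<in> coeffs_in E" "lead_coeff (lin v) = 1" using vE E by (auto intro!: coeffs_in_intros[OF assms(1)])
  obtain h' r' where h': "h' \<in> coeffs_in E" "C \<star> lin v = h' \<star> lin v + r'" "r' = 0 \<or> degree r' < degree (lin v)"
    using tmult_division[OF assms(1) linE CE] by blast
  have "h' \<star> lin v = C \<star> lin v" using tmult_division_unique(2)[OF h'(2)[symmetric] h'(3)] .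
  hence "h' = C" by (rule tmult_right_cancel[rotated]) simp
  hence "C \<in> coeffs_in E" using h' by simp
  hence "set ws \<subseteq> E" using Cons.IH[OF conj_F[OF Z] st(2,3) _ nx(2,1) ch] inE E by (simp add: C_def)
  thus ?case using wE by simp
qed simp

lemma cpoly_monic: "degree (cpoly ws Z k) = length ws \<and> coeff (cpoly ws Z k) (length ws) = 1"
proof (induction ws arbitrary: Z k)
  case (Cons w ws)
  show ?case using Cons[of "F Z" "next_k k (w * k / kap Z)"]
      lead_coeff_tmult[OF cpoly_nonzero[of ws "F Z" "next_k k (w * k / kap Z)"], of "lin (w * k / kap Z)"]
      degree_tmult[OF cpoly_nonzero[of ws "F Z" "next_k k (w * k / kap Z)"], of "lin (w * k / kap Z)"]
    by (simp add: Fn_props)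
qed simp

text \<open>Both sides are monic of the same degree, and their difference would have too many zeros.
  The hypothesis on the cardinality says that the zeros of \<open>qpoly f\<close> are
  simple.\<close>

lemma prod_Ker:
  assumes f: "lead_coeff f = 1" and card: "card (Ker f) = q ^ degree f"
  shows "(\<Prod>\<mu>\<in>Ker f. [:- \<mu>, 1:]) = qpoly f"
proof (rule ccontr)
  assume neq: "(\<Prod>\<mu>\<in>Ker f. [:- \<mu>, 1:]) \<noteq> qpoly f"
  have f0: "f \<noteq> 0" using f by auto
  have fin: "finite (Ker f)" by (rule finite_Ker[OF f0])
  define D where "D = (\<Prod>\<mu>\<in>Ker f. [:- \<mu>, 1:]) - qpoly f"
  have dP: "degree (\<Prod>\<mu>\<in>Ker f. [:- \<mu>, 1:]) = q ^ degree f"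
    by (subst degree_prod_eq_sum_degree) (auto simp: card)
  have "lead_coeff (\<Prod>\<mu>\<in>Ker f. [:- \<mu>, 1:]) = 1" by (simp add: lead_coeff_prod)
  hence "coeff D (q ^ degree f) = 0" using dP f by (simp add: D_def coeff_qpoly)
  moreover have "degree D \<le> q ^ degree f" unfolding D_def using dP degree_qpoly[OF f0] by (intro degree_diff_le) auto
  moreover have "D \<noteq> 0" using neq by (simp add: D_def)
  ultimately have dD: "degree D < q ^ degree f" by (metis le_neq_implies_less leading_coeff_0_iff)
  have "Ker f \<subseteq> {z. poly D z = 0}"
  proof
    fix z assume z: "z \<in> Ker f"
    hence "poly (\<Prod>\<mu>\<in>Ker f. [:- \<mu>, 1:]) z = 0" using fin by (simp add: poly_prod)
    thus "z \<in> {z. poly D z = 0}" using z by (simp add: D_def poly_qpoly Ker_def)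
  qed
  hence "card (Ker f) \<le> card {z. poly D z = 0}" by (rule card_mono[OF poly_roots_finite[OF \<open>D \<noteq> 0\<close>]])
  also have "\<dots> \<le> degree D" by (rule card_poly_roots_bound[OF \<open>D \<noteq> 0\<close>])
  finally show False using dD card by simp
qed

lemma tower_field_definition:
  assumes "(j, ws) \<in> tower_points q \<zeta> t n"
  shows "finite (\<Gamma> j ws)" "tower_field q \<zeta> t j ws = field_of_definition q \<zeta> t j (\<Gamma> j ws)"
proof -
  have j: "j \<noteq> 0" and ch: "chain ws \<zeta> (1 / j) (kap \<zeta>)" and len: "length ws = n" using assms by (simp_all add: tower_points_iff)
  have k: "1 / j \<noteq> 0" "kap \<zeta> \<noteq> 0" using kap_props[OF conj_zeta] j by auto
  define f where "f = cpoly ws \<zeta> (kap \<zeta>)"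
  show "finite (\<Gamma> j ws)" by (rule finite_Ker[OF cpoly_nonzero])
  have "card (Ker f) = q ^ n"
    using chain_good(1)[OF conj_zeta k ch len] by (simp add: good_def f_def)
  hence P: "(\<Prod>\<mu>\<in>Ker f. [:- \<mu>, 1:]) = qpoly f"
    using cpoly_monic[of ws \<zeta> "kap \<zeta>"] len by (intro prod_Ker) (simp_all add: f_def)
  have sub: "f \<in> coeffs_in E \<longleftrightarrow> range (coeff (qpoly f)) \<subseteq> E" if "sfield E" for E
  proof
    assume "f \<in> coeffs_in E"
    thus "range (coeff (qpoly f)) \<subseteq> E" using coeff_qpoly[of f] coeff_qpoly_0[of _ f] sfieldD(2)[OF that]
      by (auto simp: coeffs_in_def) (metis rangeE)
  next
    assume "range (coeff (qpoly f)) \<subseteq> E"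
    thus "f \<in> coeffs_in E" unfolding coeffs_in_def using coeff_qpoly[of f] by (auto simp: subset_iff) (metis rangeI)
  qed
  have fd: "field_of_definition q \<zeta> t j (\<Gamma> j ws) = over_H q \<zeta> t ({j} \<union> range (coeff (qpoly f)))"
    unfolding field_of_definition_def using P by (simp add: f_def)
  let ?S = "{j} \<union> range (coeff (qpoly f))" and ?T = "{j} \<union> set ws"
  note S = over_H_props[of ?S] and T = over_H_props[of ?T]
  show "tower_field q \<zeta> t j ws = field_of_definition q \<zeta> t j (\<Gamma> j ws)"
    unfolding fd tower_field_def
  proof (rule antisym)
    have "1 / j \<in> over_H q \<zeta> t ?S" "kap \<zeta> \<in> over_H q \<zeta> t ?S"
      using S(5) sfieldD[OF S(1)] next_in(3)[OF S(1,3,4)] by (auto intro: sfieldD(8)[OF S(1)])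
    moreover have "f \<in> coeffs_in (over_H q \<zeta> t ?S)" using sub[OF S(1)] S(5) by auto
    ultimately have "set ws \<subseteq> over_H q \<zeta> t ?S"
      using chain_in_field[OF S(1,3) conj_zeta k S(4) _ _ ch] by (simp add: f_def)
    thus "over_H q \<zeta> t ?T \<subseteq> over_H q \<zeta> t ?S" using S by (intro over_H_least) auto
    have "kap \<zeta> \<in> over_H q \<zeta> t ?T" using T(5) next_in(3)[OF T(1,3,4)] by auto
    hence "f \<in> coeffs_in (over_H q \<zeta> t ?T)" using cpoly_coeffs[OF T(1,4), of "kap \<zeta>" ws] T(5) by (simp add: f_def)
    thus "over_H q \<zeta> t ?S \<subseteq> over_H q \<zeta> t ?T" using T sub[OF T(1)] by (intro over_H_least) auto
  qed
qed

section \<open>Equivariance under automorphisms over H\<close>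

lemma ring_isoD:
  assumes \<sigma>: "\<sigma> \<in> ring_iso ambient (ambient :: 'a ring)"
  shows "\<sigma> (a + b) = \<sigma> a + \<sigma> b" "\<sigma> (a * b) = \<sigma> a * \<sigma> b" "\<sigma> 0 = 0" "\<sigma> (- a) = - \<sigma> a" "\<sigma> (a - b) = \<sigma> a - \<sigma> b"
    "\<sigma> (a / b) = \<sigma> a / \<sigma> b" "\<sigma> (F a) = F (\<sigma> a)" "\<sigma> a = \<sigma> b \<longleftrightarrow> a = b" "bij \<sigma>" "\<sigma> 1 = 1"
proof -
  have h: "\<sigma> \<in> ring_hom ambient ambient" and b: "bij \<sigma>" using \<sigma> by (auto simp: ring_iso_def)
  show b': "bij \<sigma>" by (rule b)
  have a: "\<sigma> (a + b) = \<sigma> a + \<sigma> b" and m: "\<sigma> (a * b) = \<sigma> a * \<sigma> b" and 1: "\<sigma> 1 = 1" for a b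
    using ring_hom_add[OF h, of a b] ring_hom_mult[OF h, of a b] ring_hom_one[OF h] by simp_all
  have z: "\<sigma> 0 = 0" using a[of 0 0] by (metis add.right_neutral add_left_cancel)
  have mi: "\<sigma> (- a) = - \<sigma> a" for a using a[of a "- a"] z by (simp add: eq_neg_iff_add_eq_0 add.commute)
  have inj: "\<sigma> a = \<sigma> b \<longleftrightarrow> a = b" for a b using b by (auto simp: bij_def inj_def)
  show "\<sigma> a = \<sigma> b \<longleftrightarrow> a = b" by (rule inj)
  show "\<sigma> (a + b) = \<sigma> a + \<sigma> b" "\<sigma> (a * b) = \<sigma> a * \<sigma> b" "\<sigma> 0 = 0" "\<sigma> (- a) = - \<sigma> a" "\<sigma> 1 = 1"
    using a m z mi 1 by simp_all
  show "\<sigma> (a - b) = \<sigma> a - \<sigma> b" using a[of a "- b"] mi by simp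
  show "\<sigma> (a / b) = \<sigma> a / \<sigma> b"
  proof (cases "b = 0")
    case False
    hence "\<sigma> b \<noteq> 0" using inj[of b 0] z by simp
    thus ?thesis using m[of "a / b" b] False by (simp add: field_simps)
  qed (simp add: z)
  have "\<sigma> (a ^ n) = \<sigma> a ^ n" for n by (induction n) (auto simp: m 1)
  thus "\<sigma> (F a) = F (\<sigma> a)" by (simp add: F_def)
qed

context
  fixes \<sigma> assumes \<sigma>: "\<sigma> \<in> ring_iso ambient (ambient :: 'a ring)" and fixH: "\<And>h. h \<in> Hfield q \<zeta> t \<Longrightarrow> \<sigma> h = h"
begin

lemma fix_conj: assumes "conj Z" shows "\<sigma> Z = Z" "\<sigma> (F Z) = F Z" "\<sigma> t = t" "\<sigma> (kap Z) = kap Z"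
proof -
  have "{t, \<zeta>} \<subseteq> Hfield q \<zeta> t" unfolding Hfield_def using generate_field_superset[of "Fq q \<union> {t, \<zeta>}"] by blast
  hence z: "\<sigma> t = t" "\<sigma> \<zeta> = \<zeta>" using fixH by auto
  thus Z: "\<sigma> Z = Z" "\<sigma> (F Z) = F Z" "\<sigma> t = t" using assms by (auto simp: conj_def ring_isoD(7)[OF \<sigma>])
  thus "\<sigma> (kap Z) = kap Z" by (simp add: kap_def ring_isoD[OF \<sigma>])
qed

text \<open>All these quantities are rational expressions over \<open>H\<close> together with q-th
  powers, and a field automorphism commutes with both.\<close>

lemma next_conj:
  assumes "conj Z"
  shows "\<sigma> (next_k k v) = next_k (\<sigma> k) (\<sigma> v)" "\<sigma> (next_m Z m k v) = next_m Z (\<sigma> m) (\<sigma> k) (\<sigma> v)"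
    "\<sigma> (w * k / kap Z) = \<sigma> w * \<sigma> k / kap Z" "is_root Z (\<sigma> m) (\<sigma> k) (\<sigma> v) \<longleftrightarrow> is_root Z m k v"
proof -
  show "\<sigma> (next_k k v) = next_k (\<sigma> k) (\<sigma> v)" "\<sigma> (next_m Z m k v) = next_m Z (\<sigma> m) (\<sigma> k) (\<sigma> v)"
    "\<sigma> (w * k / kap Z) = \<sigma> w * \<sigma> k / kap Z"
    by (simp_all add: next_k_def next_m_def cs_def ring_isoD[OF \<sigma>] fix_conj[OF assms])
  have "\<sigma> (v * (F v + (cs Z m k / (Z - F Z) + F k)) + m) =
    \<sigma> v * (F (\<sigma> v) + (cs Z (\<sigma> m) (\<sigma> k) / (Z - F Z) + F (\<sigma> k))) + \<sigma> m"
    by (simp add: cs_def ring_isoD(1-7)[OF \<sigma>] fix_conj[OF assms])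
  thus "is_root Z (\<sigma> m) (\<sigma> k) (\<sigma> v) \<longleftrightarrow> is_root Z m k v"
    unfolding is_root_def by (metis ring_isoD(3,8)[OF \<sigma>])
qed

lemma Ker_conj: "conj Z \<Longrightarrow> \<sigma> z \<in> Ker (cpoly (map \<sigma> ws) Z (\<sigma> k)) \<longleftrightarrow> z \<in> Ker (cpoly ws Z k)"
proof (induction ws arbitrary: Z k z)
  case Nil show ?case using ring_isoD(8)[OF \<sigma>, of z 0] by (simp add: Ker_def ring_isoD(3)[OF \<sigma>])
next
  case (Cons w ws)
  have "\<sigma> (ev (lin (w * k / kap Z)) z) = ev (lin (\<sigma> w * \<sigma> k / kap Z)) (\<sigma> z)"
    unfolding ev_lin by (simp only: ring_isoD[OF \<sigma>] fix_conj[OF Cons.prems])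
  thus ?case using Cons.IH[OF conj_F[OF Cons.prems], of "ev (lin (w * k / kap Z)) z" "next_k k (w * k / kap Z)"]
    unfolding list.map Ker_cpoly_Cons next_conj[OF Cons.prems] by simp
qed

lemma chain_conj: "conj Z \<Longrightarrow> chain (map \<sigma> ws) Z (\<sigma> m) (\<sigma> k) \<longleftrightarrow> chain ws Z m k"
proof (induction ws arbitrary: Z m k)
  case (Cons w ws Z m k)
  note Z = Cons.prems
  define v where "v = w * k / kap Z"
  have v: "\<sigma> w * \<sigma> k / kap Z = \<sigma> v" unfolding v_def next_conj[OF Z] ..
  have hd: "hd (map \<sigma> ws) * next_k (\<sigma> k) (\<sigma> v) / kap (F Z) = \<sigma> m / \<sigma> v \<longleftrightarrow>
    hd ws * next_k k v / kap (F Z) = m / v" if "ws \<noteq> []"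
  proof -
    have "hd (map \<sigma> ws) * next_k (\<sigma> k) (\<sigma> v) / kap (F Z) = \<sigma> (hd ws * next_k k v / kap (F Z))"
      using that by (simp add: hd_map next_conj[OF conj_F[OF Z]] next_conj(1)[OF Z])
    moreover have "\<sigma> m / \<sigma> v = \<sigma> (m / v)" by (simp add: ring_isoD[OF \<sigma>])
    ultimately show ?thesis by (simp only: ring_isoD(8)[OF \<sigma>])
  qed
  show ?case using Cons.IH[OF conj_F[OF Z], of "next_m Z m k v" "next_k k v"] hd
    by (auto simp: v v_def[symmetric] next_conj[OF Z])
qed simp

lemma tower_conj:
  assumes "(j, ws) \<in> tower_points q \<zeta> t n"
  shows "(\<sigma> j, map \<sigma> ws) \<in> tower_points q \<zeta> t n" "\<sigma> ` \<Gamma> j ws = \<Gamma> (\<sigma> j) (map \<sigma> ws)"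
proof -
  have j: "j \<noteq> 0" and ch: "chain ws \<zeta> (1 / j) (kap \<zeta>)" and len: "length ws = n" using assms by (simp_all add: tower_points_iff)
  note k = fix_conj(4)[OF conj_zeta]
  have "\<sigma> (1 / j) = 1 / \<sigma> j" "\<sigma> j \<noteq> 0" using j ring_isoD(8)[OF \<sigma>, of j 0] by (simp_all add: ring_isoD[OF \<sigma>])
  thus "(\<sigma> j, map \<sigma> ws) \<in> tower_points q \<zeta> t n"
    using chain_conj[OF conj_zeta, of ws "1 / j" "kap \<zeta>"] ch len by (simp add: tower_points_iff k)
  show "\<sigma> ` \<Gamma> j ws = \<Gamma> (\<sigma> j) (map \<sigma> ws)"
  proof (intro equalityI subsetI)
    fix z assume "z \<in> \<sigma> ` \<Gamma> j ws"
    thus "z \<in> \<Gamma> (\<sigma> j) (map \<sigma> ws)" using Ker_conj[OF conj_zeta, of _ ws "kap \<zeta>"] by (auto simp: k)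
  next
    fix z assume z: "z \<in> \<Gamma> (\<sigma> j) (map \<sigma> ws)"
    obtain u where "z = \<sigma> u" using ring_isoD(9)[OF \<sigma>] by (metis bij_pointE)
    thus "z \<in> \<sigma> ` \<Gamma> j ws" using z Ker_conj[OF conj_zeta, of u ws "kap \<zeta>"] by (simp add: k)
  qed
qed

end

end

subsection \<open>Valuation rings and total ramification\<close>

text \<open>A valuation ring of the whole ambient field. Its value group is not discrete in general,
  so no valuation map is introduced; units and powers of a parameter replace it on the subfields in
  question.\<close>

definition vring :: "'a::field set \<Rightarrow> bool" where
  "vring V \<longleftrightarrow> 1 \<in> V \<and> (\<forall>a\<in>V. \<forall>b\<in>V. a - b \<in> V \<and> a * b \<in> V) \<and> (\<forall>z. z \<in> V \<or> inverse z \<in> V)"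

definition subr :: "'a::field set \<Rightarrow> bool" where
  "subr V \<longleftrightarrow> 1 \<in> V \<and> (\<forall>a\<in>V. \<forall>b\<in>V. a - b \<in> V \<and> a * b \<in> V)"

lemma subrD:
  assumes "subr V"
  shows "1 \<in> V" "0 \<in> V" "a \<in> V \<Longrightarrow> b \<in> V \<Longrightarrow> a - b \<in> V" "a \<in> V \<Longrightarrow> b \<in> V \<Longrightarrow> a * b \<in> V"
    "a \<in> V \<Longrightarrow> - a \<in> V" "a \<in> V \<Longrightarrow> b \<in> V \<Longrightarrow> a + b \<in> V" "a \<in> V \<Longrightarrow> a ^ n \<in> V"
proof -
  show 1: "1 \<in> V" "a \<in> V \<Longrightarrow> b \<in> V \<Longrightarrow> a - b \<in> V" "a \<in> V \<Longrightarrow> b \<in> V \<Longrightarrow> a * b \<in> V" for a b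
    using assms by (auto simp: subr_def)
  show 0: "0 \<in> V" using 1(2)[of 1 1] 1(1) by simp
  show m: "a \<in> V \<Longrightarrow> - a \<in> V" for a using 1(2)[of 0 a] 0 by simp
  show "a \<in> V \<Longrightarrow> b \<in> V \<Longrightarrow> a + b \<in> V" using 1(2)[of a "- b"] m by simp
  show "a \<in> V \<Longrightarrow> a ^ n \<in> V" by (induction n) (auto simp: 1)
qed

lemma subr_sum: "subr V \<Longrightarrow> (\<And>i. i \<in> I \<Longrightarrow> f i \<in> V) \<Longrightarrow> sum f I \<in> V"
  by (induction I rule: infinite_finite_induct) (auto simp: subrD)

lemma subr_adjoin:
  assumes V: "subr V"
  shows "subr {poly f z |f. \<forall>i. coeff f i \<in> V}" "V \<subseteq> {poly f z |f. \<forall>i. coeff f i \<in> V}"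
    "z \<in> {poly f z |f. \<forall>i. coeff f i \<in> V}"
proof -
  let ?T = "{poly f z |f. \<forall>i. coeff f i \<in> V}"
  note D = subrD[OF V]
  show "V \<subseteq> ?T"
  proof
    fix a assume "a \<in> V" thus "a \<in> ?T"
      by (intro CollectI exI[of _ "[:a:]"]) (auto simp: coeff_pCons D split: nat.splits)
  qed
  show "z \<in> ?T" by (intro CollectI exI[of _ "[:0,1:]"]) (auto simp: coeff_pCons D split: nat.splits)
  show "subr ?T" unfolding subr_def
  proof (intro conjI ballI)
    show "1 \<in> ?T" using \<open>V \<subseteq> ?T\<close> D(1) by blast
    fix a b assume "a \<in> ?T" "b \<in> ?T"
    then obtain f g where fg: "a = poly f z" "b = poly g z" "\<forall>i. coeff f i \<in> V" "\<forall>i. coeff g i \<in> V" by auto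
    show "a - b \<in> ?T" by (intro CollectI exI[of _ "f - g"]) (use fg in \<open>auto simp: D\<close>)
    have "coeff (f * g) i \<in> V" for i unfolding coeff_mult using fg by (intro subr_sum[OF V]) (auto simp: D)
    thus "a * b \<in> ?T" by (intro CollectI exI[of _ "f * g"]) (use fg in auto)
  qed
qed

text \<open>Chevalley's argument. If neither \<open>z\<close> nor \<open>inverse z\<close> is in
  \<open>M\<close>, maximality puts \<open>inverse \<pi>\<close> into both adjunctions, which yields
  polynomials with coefficients in \<open>\<pi> M\<close> taking the value 1 at \<open>z\<close> and
  at its inverse. Taken of least degree they contradict each other.\<close>

lemma maximal_vring:
  fixes M :: "'a::field set"
  assumes M: "subr M" and p: "\<pi> \<in> M" "\<pi> \<noteq> 0" "inverse \<pi> \<notin> M"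
    and max: "\<And>T. subr T \<Longrightarrow> M \<subseteq> T \<Longrightarrow> inverse \<pi> \<notin> T \<Longrightarrow> T = M"
  shows "vring M"
proof -
  note D = subrD[OF M]
  have no: "\<pi> * a \<noteq> 1" if "a \<in> M" for a
  proof
    assume "\<pi> * a = 1"
    hence "inverse \<pi> = a" by (rule inverse_unique)
    thus False using p(3) that by simp
  qed
  \<comment> \<open>Localizing at \<open>c = 1 - \<pi> a\<close> does not create
    \<open>inverse \<pi>\<close>, because every power of \<open>c\<close> is again 1 minus a
    multiple of \<open>\<pi>\<close>; by maximality the localization is \<open>M\<close>.\<close>
  have unit: "inverse (1 - \<pi> * a) \<in> M" if a: "a \<in> M" for a
  proof -
    define c where "c = 1 - \<pi> * a"
    have c: "c \<in> M" "c \<noteq> 0" using a p no[OF a] by (auto simp: c_def D)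
    have cn: "\<exists>a'\<in>M. c ^ n = 1 - \<pi> * a'" for n
    proof (induction n)
      case 0 show ?case using D by (intro bexI[of _ 0]) auto
    next
      case (Suc n)
      then obtain a' where a': "a' \<in> M" "c ^ n = 1 - \<pi> * a'" by blast
      have "c ^ Suc n = (1 - \<pi> * a) * (1 - \<pi> * a')" by (simp add: a'(2)) (simp add: c_def)
      also have "\<dots> = 1 - \<pi> * (a + a' - \<pi> * a * a')" by (simp add: algebra_simps)
      finally show ?case using a a' p by (intro bexI[of _ "a + a' - \<pi> * a * a'"]) (auto simp: D)
    qed
    define T where "T = {b * inverse c ^ n |b n. b \<in> M}"
    have TI: "b * inverse c ^ n \<in> T" if "b \<in> M" for b n using that by (auto simp: T_def)
    have "subr T" unfolding subr_def
    proof (intro conjI ballI)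
      show "1 \<in> T" using TI[of 1 0] D by simp
      fix u v assume "u \<in> T" "v \<in> T"
      then obtain b n b' n' where uv: "u = b * inverse c ^ n" "v = b' * inverse c ^ n'" "b \<in> M" "b' \<in> M" by (auto simp: T_def)
      have "u - v = (b * c ^ n' - b' * c ^ n) * inverse c ^ (n + n')" using c by (simp add: uv field_simps power_add)
      thus "u - v \<in> T" using TI[of "b * c ^ n' - b' * c ^ n" "n + n'"] uv c by (simp add: D)
      have "u * v = b * b' * inverse c ^ (n + n')" by (simp only: uv power_add mult_ac)
      thus "u * v \<in> T" using TI[of "b * b'" "n + n'"] uv(3,4) by (simp only: D)
    qed
    moreover have "M \<subseteq> T" using TI[of _ 0] by auto
    moreover have "inverse \<pi> \<notin> T"
    proof
      assume "inverse \<pi> \<in> T"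
      then obtain b n where b: "inverse \<pi> = b * inverse c ^ n" "b \<in> M" by (auto simp: T_def)
      obtain a' where a': "a' \<in> M" "c ^ n = 1 - \<pi> * a'" using cn by blast
      have "\<pi> * b = \<pi> * (b * inverse c ^ n) * c ^ n" using c by (simp add: field_simps)
      also have "\<dots> = c ^ n" using p by (simp flip: b(1))
      finally have "\<pi> * (b + a') = 1" using a' by (simp add: algebra_simps)
      thus False using no[of "b + a'"] b a' by (simp add: D)
    qed
    ultimately have "T = M" by (rule max)
    thus ?thesis using TI[of 1 1] D by (simp add: c_def)
  qed
  have low: False if z: "z \<noteq> 0" and g: "\<forall>i. \<exists>a\<in>M. coeff g i = \<pi> * a" "poly g z = 1"
    and least: "\<And>g'. \<forall>i. \<exists>a\<in>M. coeff g' i = \<pi> * a \<Longrightarrow> poly g' z = 1 \<Longrightarrow> degree g \<le> degree g'"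
    and h: "\<forall>i. \<exists>a\<in>M. coeff h i = \<pi> * a" "poly h (inverse z) = 1" and le: "degree h \<le> degree g"
  for z g h
  proof -
    define n where "n = degree g"
    define c where "c = 1 - coeff h 0"
    obtain a0 where a0: "a0 \<in> M" "coeff h 0 = \<pi> * a0" using h by blast
    have c: "inverse c \<in> M" "c \<noteq> 0" using unit[OF a0(1)] no[OF a0(1)] a0 by (auto simp: c_def)
    have n0: "n > 0"
    proof (rule ccontr)
      assume "\<not> n > 0"
      hence "g = [:coeff g 0:]" using degree_eq_zeroE[of g] by (metis n_def coeff_pCons_0 gr0I)
      hence "coeff g 0 = 1" using g(2) by (metis mult_zero_right poly_pCons poly_0 add.right_neutral)
      thus False using g(1) no by metis
    qed
    \<comment> \<open>The relation for \<open>inverse z\<close>, multiplied by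
      \<open>z ^ n / c\<close>, expresses \<open>z ^ n\<close> through lower powers; inserting this
      for the leading monomial of \<open>g\<close> lowers its degree.\<close>
    define g' where "g' = g - Polynomial.monom (coeff g n) n +
      (\<Sum>i\<in>{1..degree h}. Polynomial.monom (coeff g n * coeff h i * inverse c) (n - i))"
    have "poly h (inverse z) = coeff h 0 + (\<Sum>i\<in>{1..degree h}. coeff h i * inverse z ^ i)"
      unfolding poly_altdef atMost_atLeast0 by (simp add: sum.atLeast_Suc_atMost)
    hence cs: "(\<Sum>i\<in>{1..degree h}. coeff h i * inverse z ^ i) = c" using h(2) by (simp add: c_def algebra_simps)
    have "poly (\<Sum>i\<in>{1..degree h}. Polynomial.monom (coeff g n * coeff h i * inverse c) (n - i)) z =
      (\<Sum>i\<in>{1..degree h}. coeff g n * inverse c * z ^ n * (coeff h i * inverse z ^ i))"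
      unfolding poly_sum
    proof (rule sum.cong[OF refl])
      fix i assume "i \<in> {1..degree h}"
      hence "i \<le> n" using le by (simp add: n_def)
      hence "z ^ (n - i) = z ^ n * inverse z ^ i" using z by (simp add: power_diff field_simps)
      thus "poly (Polynomial.monom (coeff g n * coeff h i * inverse c) (n - i)) z = coeff g n * inverse c * z ^ n * (coeff h i * inverse z ^ i)"
        by (simp add: poly_monom)
    qed
    also have "\<dots> = coeff g n * inverse c * z ^ n * c" by (simp only: sum_distrib_left[symmetric] cs)
    also have "\<dots> = coeff g n * z ^ n" using c by simp
    finally have v: "poly g' z = 1" using g by (simp add: g'_def poly_monom)
    have "\<exists>a\<in>M. coeff g' l = \<pi> * a" for l
    proof -
      have 1: "\<exists>a\<in>M. coeff (Polynomial.monom (coeff g n * coeff h i * inverse c) (n - i)) l = \<pi> * a" for i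
      proof -
        obtain a b where "a \<in> M" "b \<in> M" "coeff g n = \<pi> * a" "coeff h i = \<pi> * b" using g h by blast
        thus ?thesis using c p by (cases "n - i = l") (auto intro!: bexI[of _ "a * \<pi> * b * inverse c"] bexI[of _ 0] simp: D)
      qed
      then obtain a where a: "\<And>i. a i \<in> M" "\<And>i. coeff (Polynomial.monom (coeff g n * coeff h i * inverse c) (n - i)) l = \<pi> * a i" by metis
      obtain b where b: "b \<in> M" "coeff g l = \<pi> * b" using g by blast
      have "coeff g' l = \<pi> * ((if l = n then 0 else b) + (\<Sum>i\<in>{1..degree h}. a i))"
        unfolding g'_def coeff_add coeff_diff coeff_sum a(2) using b(2) by (cases "l = n") (simp_all add: sum_distrib_left distrib_left)
      thus ?thesis using b a(1) by (auto intro!: bexI[of _ "(if l = n then 0 else b) + (\<Sum>i\<in>{1..degree h}. a i)"] subrD(6)[OF M] subr_sum[OF M] simp: D)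
    qed
    hence "n \<le> degree g'" using least[of g'] v by (simp add: n_def)
    moreover have "degree g' < n"
    proof -
      have "coeff g' l = 0" if "l \<ge> n" for l
        using that n0 by (auto simp: g'_def coeff_sum n_def coeff_eq_0 intro!: sum.neutral)
      thus ?thesis using n0 by (metis degree_0 leading_coeff_0_iff linorder_not_le)
    qed
    ultimately show False by simp
  qed
  have ex: "\<exists>g. (\<forall>i. \<exists>a\<in>M. coeff g i = \<pi> * a) \<and> poly g z = 1" if "z \<notin> M" for z
  proof -
    note adj = subr_adjoin[OF M, of z]
    have "inverse \<pi> \<in> {poly f z |f. \<forall>i. coeff f i \<in> M}" using max[OF adj(1,2)] adj(3) that by blast
    then obtain f where f: "inverse \<pi> = poly f z" "\<forall>i. coeff f i \<in> M" by auto
    have "poly (smult \<pi> f) z = 1" using p by (simp flip: f(1))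
    thus ?thesis using f by (intro exI[of _ "smult \<pi> f"]) auto
  qed
  have least: "\<exists>g. (\<forall>i. \<exists>a\<in>M. coeff g i = \<pi> * a) \<and> poly g z = 1 \<and>
      (\<forall>g'. (\<forall>i. \<exists>a\<in>M. coeff g' i = \<pi> * a) \<longrightarrow> poly g' z = 1 \<longrightarrow> degree g \<le> degree g')" if "z \<notin> M" for z
    using ex_has_least_nat[of "\<lambda>g. (\<forall>i. \<exists>a\<in>M. coeff g i = \<pi> * a) \<and> poly g z = 1" _ degree] ex[OF that] by metis
  have "z \<in> M \<or> inverse z \<in> M" for z
  proof (rule ccontr)
    assume z: "\<not> (z \<in> M \<or> inverse z \<in> M)"
    hence z0: "z \<noteq> 0" "inverse z \<noteq> 0" using D by auto
    obtain g where g: "\<forall>i. \<exists>a\<in>M. coeff g i = \<pi> * a" "poly g z = 1"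
      "\<And>g'. \<forall>i. \<exists>a\<in>M. coeff g' i = \<pi> * a \<Longrightarrow> poly g' z = 1 \<Longrightarrow> degree g \<le> degree g'" using least[of z] z by blast
    obtain h where h: "\<forall>i. \<exists>a\<in>M. coeff h i = \<pi> * a" "poly h (inverse z) = 1"
      "\<And>g'. \<forall>i. \<exists>a\<in>M. coeff g' i = \<pi> * a \<Longrightarrow> poly g' (inverse z) = 1 \<Longrightarrow> degree h \<le> degree g'" using least[of "inverse z"] z by blast
    show False
    proof (cases "degree h \<le> degree g")
      case True show False by (rule low[OF z0(1) g h(1,2) True])
    next
      case False show False by (rule low[OF z0(2) h g(1)]) (use g(2) False in simp_all)
    qed
  qed
  thus ?thesis using M by (simp add: vring_def subr_def)
qed

lemma vring_exists:
  fixes R0 :: "'a::field set"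
  assumes R0: "subr R0" and p: "\<pi> \<in> R0" "\<pi> \<noteq> 0" "inverse \<pi> \<notin> R0"
  shows "\<exists>V. vring V \<and> R0 \<subseteq> V \<and> inverse \<pi> \<notin> V"
proof -
  let ?A = "{S. subr S \<and> R0 \<subseteq> S \<and> inverse \<pi> \<notin> S}"
  have "\<exists>M\<in>?A. \<forall>S\<in>?A. M \<subseteq> S \<longrightarrow> S = M"
  proof (rule subset_Zorn_nonempty)
    show "?A \<noteq> {}" using R0 p by blast
    fix C assume C: "C \<noteq> {}" "subset.chain ?A C"
    hence CA: "\<And>S. S \<in> C \<Longrightarrow> S \<in> ?A" and lin: "\<And>S T. S \<in> C \<Longrightarrow> T \<in> C \<Longrightarrow> S \<subseteq> T \<or> T \<subseteq> S"
      by (auto simp: subset_chain_def)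
    have "subr (\<Union>C)" unfolding subr_def
    proof (intro conjI ballI)
      show "1 \<in> \<Union>C" using C(1) CA subrD(1) by fastforce
      fix a b assume "a \<in> \<Union>C" "b \<in> \<Union>C"
      then obtain S where S: "S \<in> C" "a \<in> S" "b \<in> S" using lin by blast
      hence "subr S" using CA by blast
      thus "a - b \<in> \<Union>C" "a * b \<in> \<Union>C" using S subrD(3,4) by blast+
    qed
    thus "\<Union>C \<in> ?A" using CA C(1) by blast
  qed
  then obtain M where M': "M \<in> ?A" and max: "\<forall>S\<in>?A. M \<subseteq> S \<longrightarrow> S = M" by (rule bexE)
  hence M: "subr M" "R0 \<subseteq> M" "inverse \<pi> \<notin> M" by auto
  have "vring M"
  proof (rule maximal_vring[OF M(1) _ p(2) M(3)])
    show "\<pi> \<in> M" using M p by auto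
    fix T assume "subr T" "M \<subseteq> T" "inverse \<pi> \<notin> T"
    thus "T = M" using max M(2) by auto
  qed
  thus ?thesis using M by blast
qed

context
  fixes V :: "'a::field set" assumes V: "vring V"
begin

definition vunit where "vunit u \<longleftrightarrow> u \<noteq> 0 \<and> u \<in> V \<and> inverse u \<in> V"
definition vmax where "vmax = {z\<in>V. z = 0 \<or> inverse z \<notin> V}"
text \<open>On \<open>E\<close> the valuation takes only multiples of the value of
  \<open>\<pi>\<close>, which may be a zero or a pole. \<open>\<pi>\<close> itself may lie outside
  \<open>E\<close>; \<open>pole_base\<close> uses this freedom.\<close>

definition vparam where "vparam E \<pi> \<longleftrightarrow> (\<forall>z\<in>E. z \<noteq> 0 \<longrightarrow> (\<exists>u n. vunit u \<and> z = u * \<pi> powi n))"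

lemma vring_subr: "subr V" using V by (simp add: vring_def subr_def)
lemmas vringD = subrD[OF vring_subr]

lemma vunit_props:
  "vunit 1" "vunit a \<Longrightarrow> vunit b \<Longrightarrow> vunit (a * b)" "vunit a \<Longrightarrow> vunit (inverse a)"
  "vunit a \<Longrightarrow> vunit (a powi n)" "vunit a \<Longrightarrow> vunit b \<Longrightarrow> vunit (a / b)" "vunit a \<Longrightarrow> vunit (a ^ k)" "vunit a \<Longrightarrow> vunit (- a)"
proof -
  show m: "vunit a \<Longrightarrow> vunit b \<Longrightarrow> vunit (a * b)" and i: "vunit a \<Longrightarrow> vunit (inverse a)" and 1: "vunit 1" for a b
    by (auto simp: vunit_def vringD)
  show p: "vunit a \<Longrightarrow> vunit (a ^ k)" for k a by (induction k) (auto simp: m 1)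
  show "vunit a \<Longrightarrow> vunit (a powi n)" by (auto simp: power_int_def p i)
  show "vunit a \<Longrightarrow> vunit b \<Longrightarrow> vunit (a / b)" by (simp add: divide_inverse m i)
  show "vunit a \<Longrightarrow> vunit (- a)" by (auto simp: vunit_def vringD)
qed

lemma vmax_props:
  shows "z \<in> V \<Longrightarrow> z \<notin> vmax \<longleftrightarrow> vunit z" "z \<in> vmax \<Longrightarrow> z \<in> V" "0 \<in> vmax" "vunit u \<Longrightarrow> u \<notin> vmax" "vunit u \<Longrightarrow> u \<in> V"
    "z \<notin> V \<Longrightarrow> inverse z \<in> vmax"
  using V by (auto simp: vmax_def vunit_def vringD vring_def)

lemma vmax_mult: "a \<in> V \<Longrightarrow> b \<in> vmax \<Longrightarrow> a * b \<in> vmax" "b \<in> vmax \<Longrightarrow> a \<in> V \<Longrightarrow> b * a \<in> vmax"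
proof -
  show *: "a * b \<in> vmax" if "a \<in> V" "b \<in> vmax" for a b
  proof (rule ccontr)
    assume n: "a * b \<notin> vmax"
    have "a * b \<in> V" using that vmax_props(2) vringD(4) by blast
    hence u: "vunit (a * b)" using n vmax_props(1) by blast
    hence "a * inverse (a * b) \<in> V" using that by (auto simp: vunit_def intro: vringD)
    moreover have "a * inverse (a * b) = inverse b" using u by (auto simp: vunit_def)
    ultimately have "inverse b \<in> V" by (simp only:)
    thus False using that u by (auto simp: vmax_def vunit_def)
  qed
  show "b \<in> vmax \<Longrightarrow> a \<in> V \<Longrightarrow> b * a \<in> vmax" using *[of a b] by (simp add: mult.commute)
qed

lemma vmax_add: assumes "a \<in> vmax" "b \<in> vmax" shows "a + b \<in> vmax"
proof (cases "a = 0 \<or> b = 0")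
  case False
  have "a + b \<in> vmax" if "a \<in> vmax" "b \<in> vmax" "b \<noteq> 0" "a / b \<in> V" for a b
  proof -
    have "1 + a / b \<in> V" using that by (auto intro: vringD)
    hence "(1 + a / b) * b \<in> vmax" using that by (intro vmax_mult)
    moreover have "(1 + a / b) * b = a + b" using that by (simp add: field_simps)
    ultimately show ?thesis by simp
  qed
  from this[of a b] this[of b a] show ?thesis using assms False V
    by (auto simp: vring_def add.commute) (metis inverse_divide)
qed (use assms in auto)

lemma vmax_minus: "a \<in> vmax \<Longrightarrow> - a \<in> vmax"
  using vmax_mult(1)[of "- 1" a] vringD by simp

lemma vmax_diff: "a \<in> vmax \<Longrightarrow> b \<in> vmax \<Longrightarrow> a - b \<in> vmax"
  using vmax_add[of a "- b"] vmax_minus by simp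

lemma vmax_sum: "(\<And>i. i \<in> I \<Longrightarrow> f i \<in> vmax) \<Longrightarrow> sum f I \<in> vmax"
  by (induction I rule: infinite_finite_induct) (auto simp: vmax_props vmax_add)

lemma vunit_add: assumes "vunit u" "a \<in> vmax" shows "vunit (u + a)"
proof -
  have "u + a \<in> V" by (rule vringD(6)[OF vmax_props(5)[OF assms(1)] vmax_props(2)[OF assms(2)]])
  moreover have "u + a \<notin> vmax" using vmax_diff[of "u + a" a] assms vmax_props(4) by auto
  ultimately show ?thesis using vmax_props(1) by blast
qed

lemma vmax_power: assumes "z ^ n \<in> vmax" shows "z \<in> vmax"
proof (rule ccontr)
  assume n: "z \<notin> vmax"
  show False
  proof (cases "z \<in> V")
    case True
    hence "vunit (z ^ n)" using n vmax_props(1) vunit_props(6) by blast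
    thus False using assms vmax_props(4) by blast
  next
    case False
    hence "inverse z \<in> V" "z \<noteq> 0" using vmax_props(2,6) vringD(2) by auto
    hence "inverse (z ^ n) \<in> V" using vringD(7)[of "inverse z" n] by (simp add: power_inverse)
    thus False using assms \<open>z \<noteq> 0\<close> by (auto simp: vmax_def)
  qed
qed

lemma vmax_power_diff: assumes "a - b \<in> vmax" "a \<in> V" "b \<in> V" shows "a ^ n - b ^ n \<in> vmax"
proof (induction n)
  case 0 show ?case using vmax_props by simp
next
  case (Suc n)
  have "a ^ Suc n - b ^ Suc n = a * (a ^ n - b ^ n) + (a - b) * b ^ n" by (simp add: algebra_simps)
  moreover have "a * (a ^ n - b ^ n) \<in> vmax" by (rule vmax_mult(1)[OF assms(2) Suc])
  moreover have "(a - b) * b ^ n \<in> vmax" by (rule vmax_mult(2)[OF assms(1) vringD(7)[OF assms(3)]])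
  ultimately show ?case by (simp only: vmax_add)
qed

text \<open>The exponents are distinct, so the term with the least one dominates and the others,
  divided by its power of \<open>\<theta>\<close>, lie in the maximal ideal.\<close>

lemma vunit_sum:
  fixes ee :: "'b \<Rightarrow> int"
  assumes I: "finite I" "I \<noteq> {}" and inj: "inj_on ee I" and u: "\<And>i. i \<in> I \<Longrightarrow> vunit (u i)" and th: "\<theta> \<in> vmax" "\<theta> \<noteq> 0"
  shows "\<exists>v n. vunit v \<and> (\<Sum>i\<in>I. u i * \<theta> powi ee i) = v * \<theta> powi n"
proof -
  obtain k where k: "k \<in> I" "\<And>i. i \<in> I \<Longrightarrow> ee k \<le> ee i"
    using ex_is_arg_min_if_finite[OF I, of ee] by (auto simp: is_arg_min_def not_less)
  have "u i * \<theta> powi (ee i - ee k) \<in> vmax" if "i \<in> I - {k}" for i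
  proof -
    have "ee i \<noteq> ee k" using inj that k by (auto simp: inj_on_def)
    hence "ee i - ee k > 0" using k(2)[of i] that by simp
    then obtain l where "ee i - ee k = int (Suc l)" by (metis pos_int_cases gr0_implies_Suc)
    hence "\<theta> powi (ee i - ee k) = \<theta> ^ l * \<theta>" by (simp add: power_int_def nat_add_distrib)
    moreover have "u i * \<theta> ^ l \<in> V"
      by (rule vringD(4)[OF vmax_props(5)[OF u] vringD(7)[OF vmax_props(2)[OF th(1)]]]) (use that in simp)
    hence "(u i * \<theta> ^ l) * \<theta> \<in> vmax" by (rule vmax_mult(1)[OF _ th(1)])
    ultimately show ?thesis by (simp only: mult.assoc)
  qed
  hence "(\<Sum>i\<in>I - {k}. u i * \<theta> powi (ee i - ee k)) \<in> vmax" by (rule vmax_sum)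
  hence "vunit (u k + (\<Sum>i\<in>I - {k}. u i * \<theta> powi (ee i - ee k)))" using u[OF k(1)] by (intro vunit_add)
  moreover have "(\<Sum>i\<in>I. u i * \<theta> powi ee i) = (u k + (\<Sum>i\<in>I - {k}. u i * \<theta> powi (ee i - ee k))) * \<theta> powi ee k"
    unfolding sum.remove[OF I(1) k(1)] distrib_right sum_distrib_right using th(2)
    by (simp add: mult.assoc power_int_diff)
  ultimately show ?thesis by blast
qed

text \<open>A \<open>q\<close>-th root of a uniformizer is a uniformizer of a totally ramified extension: the terms
  \<open>a\<^sub>i \<theta>\<^sup>i\<close> with \<open>i < q\<close> have different valuations.\<close>

lemma ramified_poly:
  assumes E: "vparam E \<pi>" and q: "(q::nat) > 0" and th: "\<theta> ^ q = u0 * \<pi>" "vunit u0" "\<theta> \<in> vmax \<or> inverse \<theta> \<in> vmax" "\<theta> \<noteq> 0"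
    and p: "\<And>i. coeff p i \<in> E" "p \<noteq> 0" "degree p < q"
  shows "\<exists>v n. vunit v \<and> poly p \<theta> = v * \<theta> powi n"
proof -
  define I where "I = {i. i \<le> degree p \<and> coeff p i \<noteq> 0}"
  have I: "finite I" "I \<noteq> {}" using p(2) by (auto simp: I_def)
  have u0: "u0 \<noteq> 0" using th by (auto simp: vunit_def)
  have "\<exists>u n. vunit u \<and> coeff p i = u * \<theta> powi (int q * n)" if "i \<in> I" for i
  proof -
    have "coeff p i \<noteq> 0" using that by (simp add: I_def)
    hence "\<exists>u n. vunit u \<and> coeff p i = u * \<pi> powi n" using E p(1)[of i] by (simp add: vparam_def)
    then obtain u n where u: "vunit u" "coeff p i = u * \<pi> powi n" by (elim exE conjE)
    have "\<pi> = inverse u0 * \<theta> ^ q" using th u0 by simp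
    hence "\<pi> powi n = inverse u0 powi n * \<theta> powi (int q * n)"
      by (simp add: power_int_mult_distrib power_int_mult)
    hence "coeff p i = (u * inverse u0 powi n) * \<theta> powi (int q * n)" using u by simp
    moreover have "vunit (u * inverse u0 powi n)"
      by (rule vunit_props(2)[OF u(1) vunit_props(4)[OF vunit_props(3)[OF th(2)]]])
    ultimately show ?thesis by (intro exI conjI)
  qed
  then obtain u n where un: "\<And>i. i \<in> I \<Longrightarrow> vunit (u i)" "\<And>i. i \<in> I \<Longrightarrow> coeff p i = u i * \<theta> powi (int q * n i)" by metis
  define ee where "ee i = int q * n i + int i" for i
  have inj: "inj_on ee I"
  proof (rule inj_onI)
    fix i i' assume i: "i \<in> I" "i' \<in> I" and eq: "ee i = ee i'"
    \<comment> \<open>The exponent of the i-th term is \<open>i\<close> modulo \<open>q\<close>, and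
      \<open>i < q\<close>; hence different terms have different exponents.\<close>
    have "int i = ee i mod int q" "int i' = ee i' mod int q" using i p(3) by (auto simp: ee_def I_def)
    thus "i = i'" using eq by simp
  qed
  have "poly p \<theta> = (\<Sum>i\<in>I. coeff p i * \<theta> ^ i)"
    unfolding poly_altdef by (rule sum.mono_neutral_right) (auto simp: I_def)
  also have "\<dots> = (\<Sum>i\<in>I. u i * \<theta> powi ee i)"
    by (rule sum.cong[OF refl]) (simp add: un ee_def power_int_add th(4))
  finally have eq: "poly p \<theta> = (\<Sum>i\<in>I. u i * \<theta> powi ee i)" .
  show ?thesis
  proof (cases "\<theta> \<in> vmax")
    case True
    show ?thesis unfolding eq by (rule vunit_sum[OF I inj un(1) True th(4)])
  next
    \<comment> \<open>If \<open>\<theta>\<close> is a pole the same estimate applies to its inverse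
      with all exponents negated.\<close>
    case False
    have inj': "inj_on (\<lambda>i. - ee i) I" using inj by (auto simp: inj_on_def)
    have th': "inverse \<theta> \<in> vmax" "inverse \<theta> \<noteq> 0" using False th(3,4) by simp_all
    have "\<exists>v n. vunit v \<and> (\<Sum>i\<in>I. u i * inverse \<theta> powi - ee i) = v * inverse \<theta> powi n"
      by (rule vunit_sum[OF I inj' un(1) th'])
    then obtain v l where v: "vunit v" "(\<Sum>i\<in>I. u i * inverse \<theta> powi - ee i) = v * inverse \<theta> powi l" by (elim exE conjE)
    have i: "inverse \<theta> powi l = \<theta> powi - l" for l by (simp add: power_int_minus power_int_inverse)
    have "poly p \<theta> = v * \<theta> powi - l" using v(2) by (simp only: eq i minus_minus)
    thus ?thesis using v(1) by (intro exI conjI)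
  qed
qed

end

context setting
begin

section \<open>Dimension of a simple extension\<close>

lemma Span_poly:
  assumes L: "sfield L" and n: "n > 0"
  shows "ring.Span ambient L (ring.exp_base ambient w n) = {poly g w |g. g \<in> coeffs_in L \<and> degree g < n}"
proof -
  interpret R: field "ambient :: 'a ring" by (rule field_from_type_algebra)
  show ?thesis
  proof (subst R.Span_eq_eval_img[OF sfield_subfield[OF L]], simp, intro equalityI subsetI)
    fix z assume "z \<in> (\<lambda>p. R.eval p w) ` {p \<in> carrier (univ_poly ambient L). length p \<le> n}"
    then obtain p where p: "p \<in> carrier (univ_poly ambient L)" "length p \<le> n" "z = poly (Poly (rev p)) w"
      by (auto simp: ambient_eval)
    have pL: "set p \<subseteq> L" using p(1) by (auto simp: univ_poly_def polynomial_def)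
    have "Poly (rev p) \<in> coeffs_in L"
      using pL L by (auto simp: coeffs_in_def nth_default_def sfieldD subset_iff) (metis length_rev nth_mem set_rev)
    moreover have "degree (Poly (rev p)) < n"
    proof (rule le_less_trans[OF degree_le[of "n - 1"]])
      show "\<forall>i>n - 1. coeff (Poly (rev p)) i = 0" using p(2) by (auto simp: nth_default_def)
    qed (use n in simp)
    ultimately show "z \<in> {poly g w |g. g \<in> coeffs_in L \<and> degree g < n}" using p(3) by blast
  next
    fix z assume "z \<in> {poly g w |g. g \<in> coeffs_in L \<and> degree g < n}"
    then obtain g where g: "z = poly g w" "g \<in> coeffs_in L" "degree g < n" by blast
    have "set (coeffs g) \<subseteq> range (coeff g)" by (simp only: range_coeff subset_insertI)
    also have "\<dots> \<subseteq> L" using g(2) by (auto simp: coeffs_in_def)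
    finally have "polynomial\<^bsub>ambient\<^esub> L (rev (coeffs g))"
      by (cases "g = 0") (auto simp: polynomial_def coeffs_def hd_rev last_coeffs_eq_coeff_degree simp flip: coeffs_def)
    moreover have "length (rev (coeffs g)) \<le> n" using g(3) by (cases "g = 0") (simp_all add: length_coeffs_degree)
    ultimately show "z \<in> (\<lambda>p. R.eval p w) ` {p \<in> carrier (univ_poly ambient L). length p \<le> n}"
      by (intro image_eqI[of _ _ "rev (coeffs g)"]) (simp_all add: univ_poly_def ambient_eval g(1))
  qed
qed

lemma subfield_sfield: assumes sf: "subfield E ambient" shows "sfield E"
proof -
  interpret R: field "ambient :: 'a ring" by (rule field_from_type_algebra)
  note E = subringE[OF subfieldE(1)[OF sf]]
  show ?thesis unfolding sfield_def
  proof (intro conjI ballI)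
    fix a b assume ab: "a \<in> E" "b \<in> E"
    show "a + b \<in> E" "a * b \<in> E" "- a \<in> E" using E(5-7) ab by simp_all
    show "inverse a \<in> E"
      using R.subfield_m_inv(1)[OF sf, of a] ab E(2) by (cases "a = 0") (simp_all add: ambient_inv)
  qed (use E in simp)
qed

text \<open>The assumption \<open>min\<close> stands in for irreducibility of \<open>p\<close>: it
  makes the powers of \<open>w\<close> below \<open>n\<close> independent, while the monic
  \<open>p\<close> makes them span. Valuations and degree arguments deliver it directly.\<close>

lemma simple_dimension:
  assumes L: "sfield L" and p: "p \<in> coeffs_in L" "lead_coeff p = 1" "degree p = n" "poly p w = 0" and n: "n > 0"
    and min: "\<And>g. g \<in> coeffs_in L \<Longrightarrow> g \<noteq> 0 \<Longrightarrow> degree g < n \<Longrightarrow> poly g w \<noteq> 0"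
  shows "ring.dimension ambient n L (generate_field ambient (L \<union> {w}))"
    "generate_field ambient (L \<union> {w}) = {poly g w |g. g \<in> coeffs_in L \<and> degree g < n}"
proof -
  let ?E = "generate_field ambient (L \<union> {w})" and ?S = "{poly g w |g. g \<in> coeffs_in L \<and> degree g < n}"
  interpret R: field "ambient :: 'a ring" by (rule field_from_type_algebra)
  note sub = sfield_subfield[OF L] and D = sfieldD[OF L]
  have alg: "(R.algebraic over L) w"
  proof -
    have "\<not> R.transcendental L w" using transcendental_iff[OF L] p n by force
    thus ?thesis by (simp add: over_def)
  qed
  have SI: "poly g w \<in> ?S" if "g \<in> coeffs_in L" "degree g < n" for g using that by blast
  have "R.simple_extension L w \<subseteq> ?S"
  proof
    fix z assume "z \<in> R.simple_extension L w"
    thus "z \<in> ?S"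
    proof (induction rule: R.simple_extension.induct)
      case zero show ?case using SI[of 0] n by (simp add: coeffs_in_intros[OF L])
    next
      case (lin k1 k2)
      then obtain g where g: "k1 = poly g w" "g \<in> coeffs_in L" "degree g < n" by blast
      \<comment> \<open>Multiply by \<open>w\<close>, add \<open>k2\<close>, and subtract the
        multiple of \<open>p\<close> that removes degree \<open>n\<close>.\<close>
      define h where "h = pCons k2 g - smult (coeff (pCons k2 g) n) p"
      have "coeff (pCons k2 g) n \<in> L" using g lin by (cases n) (auto simp: coeffs_in_def D)
      hence hL: "h \<in> coeffs_in L" using g lin p by (auto simp: h_def intro!: coeffs_in_intros[OF L])
      have "degree h < n"
      proof -
        have "coeff h i = 0" if "i \<ge> n" for i
        proof (cases "i = n")
          case True thus ?thesis using p by (simp add: h_def)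
        next
          case False
          hence "i > n" using that by simp
          thus ?thesis using p(3) g(3) by (simp add: h_def coeff_eq_0 coeff_pCons split: nat.splits)
        qed
        thus ?thesis using n by (metis degree_0 leading_coeff_0_iff linorder_not_le)
      qed
      moreover have "poly h w = k1 * w + k2" using p g by (simp add: h_def mult.commute)
      ultimately show ?case using SI[OF hL] by simp
    qed
  qed
  moreover have "?E \<subseteq> R.simple_extension L w"
  proof (rule generate_field_least)
    have sf: "subfield (R.simple_extension L w) ambient" using R.simple_extension_is_subfield[OF sub] alg by simp
    show "sfield (R.simple_extension L w)" by (rule subfield_sfield[OF sf])
    show "L \<union> {w} \<subseteq> R.simple_extension L w"
      using R.simple_extension_incl[of L w] R.simple_extension_mem[OF subfieldE(1)[OF sub], of w] by auto
  qed
  moreover have "?S \<subseteq> ?E"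
  proof
    fix z assume "z \<in> ?S"
    then obtain g where g: "z = poly g w" "g \<in> coeffs_in L" by blast
    have 1: "L \<subseteq> ?E" "w \<in> ?E" using generate_field_superset[of "L \<union> {w}"] by auto
    show "z \<in> ?E" unfolding g(1) poly_altdef using g(2) 1
      by (intro sfield_sum[OF sfield_generate] sfieldD(4)[OF sfield_generate] sfield_power[OF sfield_generate]) (auto simp: coeffs_in_def)
  qed
  ultimately show ES: "?E = ?S" by blast
  have "R.independent L (R.exp_base w k)" if "k \<le> n" for k using that
  proof (induction k)
    case 0 show ?case by (simp add: R.exp_base_def)
  next
    case (Suc k)
    have "w ^ k \<notin> R.Span L (R.exp_base w k)"
    proof (cases "k = 0")
      case True thus ?thesis by (simp add: R.exp_base_def)
    next
      case False
      show ?thesis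
      proof
        assume "w ^ k \<in> R.Span L (R.exp_base w k)"
        then obtain g where g: "w ^ k = poly g w" "g \<in> coeffs_in L" "degree g < k" using Span_poly[OF L, of k w] False by auto
        let ?h = "Polynomial.monom 1 k - g"
        have "coeff ?h k = 1" using g(3) by (simp add: coeff_eq_0)
        hence h0: "?h \<noteq> 0" by auto
        have "degree ?h \<le> k" using g(3) by (intro degree_diff_le) (auto simp: degree_monom_le)
        hence "poly ?h w \<noteq> 0" using Suc.prems h0 g(2) by (intro min) (auto intro!: coeffs_in_intros[OF L] D)
        thus False using g(1) by (simp add: poly_monom)
      qed
    qed
    hence "R.independent L (w ^ k # R.exp_base w k)" using Suc by (intro R.independent.li_Cons) auto
    thus ?case by (simp add: R.exp_base_def)
  qed
  hence "R.dimension (length (R.exp_base w n)) L (R.Span L (R.exp_base w n))" by (intro R.dimension_independent) simp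
  thus "R.dimension n L ?E" unfolding ES Span_poly[OF L n] by (simp add: R.exp_base_def)
qed

subsection \<open>The degrees of the tower\<close>

abbreviation "H \<equiv> Hfield q \<zeta> t"

lemma sfield_H: "sfield H" unfolding Hfield_def by (rule sfield_generate)

lemma in_H: "t \<in> H" "conj Z \<Longrightarrow> Z \<in> H" "conj Z \<Longrightarrow> kap Z \<in> H" "c \<in> H \<Longrightarrow> F c \<in> H"
proof -
  have z: "t \<in> H" "\<zeta> \<in> H" unfolding Hfield_def using generate_field_superset[of "Fq q \<union> {t, \<zeta>}"] by auto
  show "t \<in> H" by (rule z)
  show F: "c \<in> H \<Longrightarrow> F c \<in> H" for c by (rule sfield_F[OF sfield_H])
  show c: "conj Z \<Longrightarrow> Z \<in> H" for Z using z F by (auto simp: conj_def)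
  show "conj Z \<Longrightarrow> kap Z \<in> H" unfolding kap_def using c F sfieldD[OF sfield_H] by simp
qed

lemma generate_field_fraction:
  assumes E: "sfield E" and z: "z \<in> generate_field ambient (E \<union> {w})"
  obtains f g where "f \<in> coeffs_in E" "g \<in> coeffs_in E" "poly g w \<noteq> 0" "z = poly f w / poly g w"
proof -
  let ?K = "{poly f w / poly g w | f g. f \<in> coeffs_in E \<and> g \<in> coeffs_in E \<and> poly g w \<noteq> 0}"
  note I = coeffs_in_intros[OF E]
  have KI: "poly f w / poly g w \<in> ?K" if "f \<in> coeffs_in E" "g \<in> coeffs_in E" "poly g w \<noteq> 0" for f g
    using that by blast
  have "sfield ?K" unfolding sfield_def
  proof (intro conjI ballI)
    show "1 \<in> ?K" using KI[of 1 1] by (simp add: I)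
    fix a b assume "a \<in> ?K" "b \<in> ?K"
    then obtain f g f' g' where *: "a = poly f w / poly g w" "b = poly f' w / poly g' w"
      "f \<in> coeffs_in E" "g \<in> coeffs_in E" "poly g w \<noteq> 0"
      "f' \<in> coeffs_in E" "g' \<in> coeffs_in E" "poly g' w \<noteq> 0" by blast
    have "a + b = poly (f * g' + f' * g) w / poly (g * g') w" using *(5,8) by (simp add: *(1,2) field_simps)
    also have "\<dots> \<in> ?K" by (intro KI I *) (use * in simp)
    finally show "a + b \<in> ?K" .
    have "a * b = poly (f * f') w / poly (g * g') w" by (simp add: *(1,2))
    also have "\<dots> \<in> ?K" by (intro KI I *) (use * in simp)
    finally show "a * b \<in> ?K" .
    have "- a = poly (0 - f) w / poly g w" by (simp add: *(1))
    also have "\<dots> \<in> ?K" by (intro KI I *)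
    finally show "- a \<in> ?K" .
    show "inverse a \<in> ?K"
    proof (cases "poly f w = 0")
      case True thus ?thesis using KI[of 0 1] by (simp add: *(1) I)
    next
      case False thus ?thesis using KI[of g f] * by simp
    qed
  qed
  moreover have "c \<in> ?K" if "c \<in> E" for c
    using KI[of "[:c:]" 1] that by (simp add: I)
  moreover have "w \<in> ?K" using KI[of "[:0,1:]" 1] sfieldD[OF E] by (simp add: I)
  ultimately have "generate_field ambient (E \<union> {w}) \<subseteq> ?K" by (intro generate_field_least) auto
  hence "z \<in> ?K" using z by blast
  thus ?thesis using that by blast
qed

lemma tower_field_snoc: "tower_field q \<zeta> t j (ws @ [w]) = generate_field ambient (tower_field q \<zeta> t j ws \<union> {w})"
proof
  let ?E = "tower_field q \<zeta> t j ws" and ?E' = "tower_field q \<zeta> t j (ws @ [w])"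
  note T = over_H_props[of "{j} \<union> set ws", folded tower_field_def]
  note T' = over_H_props[of "{j} \<union> set (ws @ [w])", folded tower_field_def]
  have s: "?E \<union> {w} \<subseteq> generate_field ambient (?E \<union> {w})" by (rule generate_field_superset)
  show "?E' \<subseteq> generate_field ambient (?E \<union> {w})"
    unfolding tower_field_def[of q \<zeta> t j "ws @ [w]"] by (rule over_H_least[OF sfield_generate]) (use s T in auto)
  have "?E \<subseteq> ?E'" unfolding tower_field_def[of q \<zeta> t j ws] by (rule over_H_least) (use T' in auto)
  thus "generate_field ambient (?E \<union> {w}) \<subseteq> ?E'" using T' by (intro generate_field_least) auto
qed

lemma first_relation_eq:
  assumes "first_relation q \<zeta> t j w"
  shows "w * (F w + F (kap \<zeta>)) \<noteq> 0" "j * (w * (F w + F (kap \<zeta>))) = - (1 + (t - F \<zeta>) / \<zeta> * w)"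
proof -
  have i: "inverse (1 - \<zeta> powi (1 - int q)) = F (kap \<zeta>)"
    using kap_props(2)[OF conj_zeta] zeta_neq_0 zeta_neq by (simp add: powi_1_minus_q field_simps)
  have p: "w ^ (q + 1) + F (kap \<zeta>) * w = w * (F w + F (kap \<zeta>))" by (simp add: F_def algebra_simps)
  have 1: "w * (F w + F (kap \<zeta>)) \<noteq> 0 \<and> j = - ((1 + inverse \<zeta> * (t - \<zeta> ^ q) * w) / (w * (F w + F (kap \<zeta>))))"
    using assms unfolding first_relation_def i p .
  thus n: "w * (F w + F (kap \<zeta>)) \<noteq> 0" by blast
  have "j * (w * (F w + F (kap \<zeta>))) = - (1 + inverse \<zeta> * (t - \<zeta> ^ q) * w)" using 1 n by simp
  thus "j * (w * (F w + F (kap \<zeta>))) = - (1 + (t - F \<zeta>) / \<zeta> * w)" by (simp add: divide_inverse F_def mult_ac)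
qed

lemma j_in_field:
  assumes "sfield E" "H \<subseteq> E" "w \<in> E" "first_relation q \<zeta> t j w"
  shows "j \<in> E"
proof -
  note D = sfieldD[OF assms(1)] sfield_F[OF assms(1)]
  have h: "t \<in> E" "\<zeta> \<in> E" "kap \<zeta> \<in> E" using in_H conj_zeta assms(2) by auto
  note r = first_relation_eq[OF assms(4)]
  have "j = - (1 + (t - F \<zeta>) / \<zeta> * w) / (w * (F w + F (kap \<zeta>)))" using r by (metis nonzero_mult_div_cancel_right)
  also have "\<dots> \<in> E" using h assms(3) by (intro D)
  finally show ?thesis .
qed

lemma tower_field_w:
  assumes "(j, ws) \<in> tower_points q \<zeta> t n" "n \<ge> 1"
  shows "tower_field q \<zeta> t j ws = over_H q \<zeta> t (set ws)"
proof
  note T = over_H_props[of "{j} \<union> set ws"] and S = over_H_props[of "set ws"]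
  have "first_relation q \<zeta> t j (ws ! 0)" "ws ! 0 \<in> set ws" using assms by (auto simp: tower_points_def)
  hence "j \<in> over_H q \<zeta> t (set ws)" using j_in_field[OF S(1,6)] S(5) by blast
  thus "tower_field q \<zeta> t j ws \<subseteq> over_H q \<zeta> t (set ws)"
    unfolding tower_field_def using S by (intro over_H_least) auto
  show "over_H q \<zeta> t (set ws) \<subseteq> tower_field q \<zeta> t j ws"
    unfolding tower_field_def using T by (intro over_H_least) auto
qed

text \<open>\<open>j\<close> is a rational function of \<open>w\<close> over \<open>H\<close>, so an
  algebraic \<open>w\<close> would make \<open>j\<close> algebraic.\<close>

lemma transcendental_w:
  assumes j: "ring.transcendental ambient H j" and r: "first_relation q \<zeta> t j w"
  shows "ring.transcendental ambient H w"
proof (rule ccontr)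
  interpret R: field "ambient :: 'a ring" by (rule field_from_type_algebra)
  assume w: "\<not> ring.transcendental ambient H w"
  have sub: "subfield H ambient" by (rule sfield_subfield[OF sfield_H])
  let ?E = "{x. (R.algebraic over H) x}"
  have E: "sfield ?E" using subfield_sfield[OF R.subfield_of_algebraics[OF sub]] by simp
  have "H \<subseteq> ?E" using R.algebraic_self[OF subfieldE(1)[OF sub]] by auto
  moreover have "w \<in> ?E" using w by (simp add: over_def)
  ultimately have "j \<in> ?E" using j_in_field[OF E _ _ r] by blast
  thus False using j by (simp add: over_def)
qed

lemma clear_denominators:
  assumes "g \<in> coeffs_in (over_H q \<zeta> t {j})"
  shows "\<exists>s B. s \<in> coeffs_in H \<and> poly s j \<noteq> 0 \<and> (\<forall>i. B i \<in> coeffs_in H \<and> coeff g i * poly s j = poly (B i) j)"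
  using assms
proof (induction g)
  case 0
  show ?case by (intro exI[of _ 1] exI[of _ "\<lambda>_. 0"]) (simp add: coeffs_in_intros[OF sfield_H])
next
  case (pCons a g)
  have ag: "a \<in> over_H q \<zeta> t {j}" "g \<in> coeffs_in (over_H q \<zeta> t {j})" using pCons.prems by (simp_all add: coeffs_in_pCons)
  obtain s B where s: "s \<in> coeffs_in H" "poly s j \<noteq> 0" "\<And>i. B i \<in> coeffs_in H" "\<And>i. coeff g i * poly s j = poly (B i) j"
    using pCons.IH[OF ag(2)] by blast
  obtain f h where fh: "f \<in> coeffs_in H" "h \<in> coeffs_in H" "poly h j \<noteq> 0" "a = poly f j / poly h j"
    using generate_field_fraction[OF sfield_H, of a j] ag(1) unfolding over_H_def by blast
  let ?B = "\<lambda>i. case i of 0 \<Rightarrow> f * s | Suc i \<Rightarrow> h * B i"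
  have "?B i \<in> coeffs_in H \<and> coeff (pCons a g) i * poly (h * s) j = poly (?B i) j" for i
    using s fh by (cases i) (simp_all add: coeffs_in_intros[OF sfield_H] mult_ac flip: s(4))
  thus ?case using s fh by (intro exI[of _ "h * s"] exI[of _ ?B]) (simp add: coeffs_in_intros[OF sfield_H])
qed

text \<open>With \<open>j = N(w)/D(w)\<close> in lowest terms, a relation of degree at most \<open>q\<close> for \<open>w\<close> over \<open>H(j)\<close>
  becomes an identity of polynomials in \<open>w\<close> whose top coefficient in \<open>j\<close> is divisible by \<open>D\<close>, of degree \<open>q + 1\<close>.\<close>

lemma first_degree:
  assumes j: "ring.transcendental ambient H j" and r: "first_relation q \<zeta> t j w"
    and g: "g \<in> coeffs_in (over_H q \<zeta> t {j})" "g \<noteq> 0" "degree g < q + 1"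
  shows "poly g w \<noteq> 0"
proof
  assume gw: "poly g w = 0"
  note HI = coeffs_in_intros[OF sfield_H] and HD = sfieldD[OF sfield_H]
  obtain s B where s: "s \<in> coeffs_in H" "poly s j \<noteq> 0" "\<And>i. B i \<in> coeffs_in H" "\<And>i. coeff g i * poly s j = poly (B i) j"
    using clear_denominators[OF g(1)] by blast
  define c where "c = F (kap \<zeta>)"
  define b where "b = (t - F \<zeta>) / \<zeta>"
  define N where "N = - [:1, b:]"
  define D where "D = pCons 0 (Polynomial.monom 1 q + [:c:])"
  have b0: "b \<noteq> 0" using t_not_conj[OF conj_F[OF conj_zeta]] zeta_neq_0 by (simp add: b_def)
  have bc: "b \<in> H" "c \<in> H" using in_H conj_zeta HD by (simp_all add: b_def c_def)
  have "degree (Polynomial.monom 1 q + [:c:]) = q" using q_pos by (subst degree_add_eq_left) (simp_all add: degree_monom_eq)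
  hence dD: "degree D = Suc q" unfolding D_def by (subst degree_pCons_eq) auto
  have D0: "D \<noteq> 0" using dD by auto
  have Dz: "poly D z = z * (F z + c)" for z by (simp add: D_def poly_monom F_def)
  have jw: "j * poly D w = poly N w" using first_relation_eq(2)[OF r] by (simp add: Dz N_def c_def b_def mult.commute)
  have ND: "N \<in> coeffs_in H" "D \<in> coeffs_in H" using bc HD
    by (auto simp: N_def D_def coeffs_in_pCons intro!: HI)
  have trw: "p = 0" if "p \<in> coeffs_in H" "poly p w = 0" for p
    using transcendental_w[OF j r] transcendental_iff[OF sfield_H] that by blast
  define I where "I = {i. i \<le> q \<and> B i \<noteq> 0}"
  have "I \<noteq> {}"
  proof
    assume "I = {}"
    hence "B (degree g) = 0" using g(3) by (auto simp: I_def)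
    hence "coeff g (degree g) * poly s j = 0" using s(4)[of "degree g"] by simp
    thus False using s(2) g(2) by simp
  qed
  moreover have "finite I" by (simp add: I_def)
  ultimately have fi: "finite ((\<lambda>i. degree (B i)) ` I)" "(\<lambda>i. degree (B i)) ` I \<noteq> {}" by auto
  define d where "d = Max ((\<lambda>i. degree (B i)) ` I)"
  obtain k where k: "k \<in> I" "degree (B k) = d" using Max_in[OF fi] unfolding d_def by auto
  have le: "degree (B i) \<le> d" if "i \<le> q" for i
  proof (cases "B i = 0")
    case False
    hence "i \<in> I" using that by (simp add: I_def)
    thus ?thesis unfolding d_def by (intro Max_ge fi) auto
  qed simp
  \<comment> \<open>\<open>C l\<close> collects the coefficients of \<open>j ^ l\<close> as a
    polynomial in \<open>w\<close>, and \<open>P\<close> is the sum of \<open>C l * j ^ l\<close>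
    after \<open>j = N / D\<close> and multiplication by \<open>D ^ d\<close>.\<close>
  define C where "C l = (\<Sum>i\<le>q. Polynomial.monom (coeff (B i) l) i)" for l
  define P where "P = (\<Sum>l\<le>d. C l * N ^ l * D ^ (d - l))"
  have CH: "C l \<in> coeffs_in H" for l
    using s(3) unfolding C_def coeffs_in_def by (auto simp: coeff_sum intro!: sfield_sum[OF sfield_H] HD)
  have PH: "P \<in> coeffs_in H"
  proof -
    have "C l * N ^ l * D ^ (d - l) \<in> coeffs_in H" for l by (intro HI CH ND)
    thus ?thesis unfolding P_def coeffs_in_def by (auto simp: coeff_sum intro!: sfield_sum[OF sfield_H])
  qed
  have "poly P w = (\<Sum>l\<le>d. poly (C l) w * j ^ l * poly D w ^ d)"
    unfolding P_def poly_sum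
  proof (rule sum.cong[OF refl])
    fix l assume "l \<in> {..d}"
    hence "poly D w ^ d = poly D w ^ l * poly D w ^ (d - l)" by (simp flip: power_add)
    thus "poly (C l * N ^ l * D ^ (d - l)) w = poly (C l) w * j ^ l * poly D w ^ d"
      by (simp add: jw[symmetric] power_mult_distrib)
  qed
  also have "\<dots> = (\<Sum>l\<le>d. poly (C l) w * j ^ l) * poly D w ^ d" by (simp only: sum_distrib_right)
  also have "(\<Sum>l\<le>d. poly (C l) w * j ^ l) = (\<Sum>l\<le>d. \<Sum>i\<le>q. coeff (B i) l * w ^ i * j ^ l)"
    by (simp add: C_def poly_sum poly_monom sum_distrib_right)
  also have "\<dots> = (\<Sum>i\<le>q. \<Sum>l\<le>d. coeff (B i) l * w ^ i * j ^ l)" by (rule sum.swap)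
  also have "\<dots> = (\<Sum>i\<le>q. w ^ i * poly (B i) j)"
  proof (rule sum.cong[OF refl])
    fix i assume "i \<in> {..q}"
    hence "poly (B i) j = (\<Sum>l\<le>d. coeff (B i) l * j ^ l)"
      unfolding poly_altdef using le[of i] by (intro sum.mono_neutral_left) (auto simp: coeff_eq_0)
    thus "(\<Sum>l\<le>d. coeff (B i) l * w ^ i * j ^ l) = w ^ i * poly (B i) j"
      by (simp add: sum_distrib_left mult_ac)
  qed
  also have "\<dots> = (\<Sum>i\<le>q. coeff g i * w ^ i) * poly s j"
    unfolding sum_distrib_right by (rule sum.cong[OF refl]) (simp add: mult_ac flip: s(4))
  also have "(\<Sum>i\<le>q. coeff g i * w ^ i) = poly g w"
    unfolding poly_altdef using g(3) by (intro sum.mono_neutral_right) (auto simp: coeff_eq_0)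
  finally have "poly P w = 0" using gw by simp
  hence P0: "P = 0" by (rule trw[OF PH])
  have "P = C d * N ^ d + (\<Sum>l<d. C l * N ^ l * D ^ (d - l))"
    unfolding P_def by (simp add: lessThan_Suc_atMost[symmetric] add.commute)
  hence "C d * N ^ d = - (\<Sum>l<d. C l * N ^ l * D ^ (d - l))" using P0 by (simp add: eq_neg_iff_add_eq_0)
  moreover have "D dvd (\<Sum>l<d. C l * N ^ l * D ^ (d - l))" by (intro dvd_sum dvd_mult dvd_power) auto
  ultimately have dv: "D dvd C d * N ^ d" by simp
  \<comment> \<open>The root of \<open>N\<close>. Since \<open>D\<close> does not vanish there,
    \<open>D\<close> minus its value \<open>e0\<close> is a multiple of \<open>N\<close>, a Bezout
    relation that shows \<open>N\<close> and \<open>D\<close> to be coprime. A common root would be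
    \<open>- kap \<zeta>\<close>, which means \<open>t = \<zeta>\<close>.\<close>
  define r0 where "r0 = - inverse b"
  define e0 where "e0 = poly D r0"
  have e0: "e0 \<noteq> 0"
  proof -
    have "r0 + kap \<zeta> \<noteq> 0"
    proof
      assume "r0 + kap \<zeta> = 0"
      hence "\<zeta> / (\<zeta> - F \<zeta>) = \<zeta> / (t - F \<zeta>)" by (simp add: r0_def b_def kap_def)
      hence "t = \<zeta>" using zeta_neq_0 zeta_neq t_not_conj[OF conj_F[OF conj_zeta]] by (auto simp: field_simps)
      thus False using t_not_conj[OF conj_zeta] by simp
    qed
    hence "F r0 + c \<noteq> 0" by (simp add: c_def F_add[symmetric] del: F_add)
    thus ?thesis using b0 by (simp add: e0_def Dz r0_def)
  qed
  have "poly (D - [:e0:]) r0 = 0" by (simp add: e0_def)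
  then obtain Q where Q: "D - [:e0:] = [:- r0, 1:] * Q" unfolding poly_eq_0_iff_dvd by (elim dvdE)
  have N: "N = smult (- b) [:- r0, 1:]" using b0 by (simp add: N_def r0_def)
  have cop: "D dvd p" if "D dvd p * N" for p
  proof -
    have "D dvd p * N * smult (- inverse b) Q" using that by (rule dvd_mult2)
    moreover have "N * smult (- inverse b) Q = D - [:e0:]"
      unfolding N Q mult_smult_left mult_smult_right smult_smult using b0 by simp
    ultimately have "D dvd p * (D - [:e0:])" by (simp only: mult.assoc)
    then obtain h where "p * (D - [:e0:]) = D * h" by (elim dvdE)
    hence "smult e0 p = D * (p - h)" by (simp add: algebra_simps)
    hence "D dvd smult e0 p" by (rule dvdI)
    thus ?thesis using e0 by (simp add: dvd_smult_iff)
  qed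
  have "D dvd p" if "D dvd p * N ^ l" for p l using that
  proof (induction l)
    case 0 thus ?case by simp
  next
    case (Suc l)
    have "p * N ^ Suc l = p * N ^ l * N" by (simp only: power_Suc mult_ac)
    hence "D dvd p * N ^ l * N" using Suc.prems by (simp only:)
    hence "D dvd p * N ^ l" by (rule cop)
    thus ?case by (rule Suc.IH)
  qed
  from this[OF dv] have "D dvd C d" .
  moreover have "degree (C d) \<le> q" unfolding C_def by (intro degree_sum_le) (auto intro: order.trans[OF degree_monom_le])
  ultimately have "C d = 0" using dvd_imp_degree_le[of D "C d"] dD by auto
  hence "coeff (C d) k = 0" by simp
  moreover have "coeff (C d) k = coeff (B k) d" using k(1) by (simp add: C_def coeff_sum I_def)
  ultimately show False using k by (auto simp: I_def)
qed

lemma first_dimension: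
  assumes j: "ring.transcendental ambient H j" "j \<noteq> 0" and r: "first_relation q \<zeta> t j w"
  shows "ring.dimension ambient (q + 1) (tower_field q \<zeta> t j []) (tower_field q \<zeta> t j [w])"
proof -
  note T = over_H_props[of "{j}"]
  have T0: "tower_field q \<zeta> t j [] = over_H q \<zeta> t {j}" by (simp add: tower_field_def)
  note TD = sfieldD[OF T(1)] sfield_F[OF T(1)]
  have kz: "kap \<zeta> \<in> over_H q \<zeta> t {j}" using T(6) in_H(3)[OF conj_zeta] by auto
  define c where "c = cs \<zeta> (1 / j) (kap \<zeta>) / (\<zeta> - F \<zeta>) + F (kap \<zeta>)"
  have c: "c \<in> over_H q \<zeta> t {j}" and m: "1 / j \<in> over_H q \<zeta> t {j}"
    unfolding c_def cs_def using T(3,4,5) kz by (auto intro!: TD)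
  define p where "p = Polynomial.monom 1 (q + 1) + [:1 / j, c:]"
  have dq: "degree [:1 / j, c:] < q + 1" using q_gt1 by simp
  have dp: "degree p = q + 1" unfolding p_def using dq by (subst degree_add_eq_left) (simp_all add: degree_monom_eq del: degree_pCons_eq_if)
  have lp: "lead_coeff p = 1" unfolding dp unfolding p_def using q_gt1 by (simp add: coeff_pCons split: nat.splits)
  have pE: "p \<in> coeffs_in (over_H q \<zeta> t {j})" unfolding p_def using c m TD by (intro coeffs_in_intros[OF T(1)])
  have "is_root \<zeta> (1 / j) (kap \<zeta>) w" using r first_relation_iff[OF j(2)] by simp
  hence "poly p w = 0" unfolding is_root_def c_def[symmetric] by (simp add: p_def poly_monom F_def algebra_simps)
  from simple_dimension(1)[OF T(1) pE lp dp this _ first_degree[OF j(1) r]]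
  have "ring.dimension ambient (q + 1) (over_H q \<zeta> t {j}) (generate_field ambient (over_H q \<zeta> t {j} \<union> {w}))" by simp
  thus ?thesis using tower_field_snoc[of j "[]" w] by (simp add: T0)
qed

lemma pcompose_coeffs: "sfield E \<Longrightarrow> f \<in> coeffs_in E \<Longrightarrow> g \<in> coeffs_in E \<Longrightarrow> pcompose f g \<in> coeffs_in E"
  by (induction f) (auto simp: pcompose_pCons coeffs_in_pCons intro!: coeffs_in_intros)

section \<open>Ramification at a pole of the first variable\<close>

context
  fixes V assumes V: "vring V" and HV: "H \<subseteq> V"
begin

lemmas vD = vringD[OF V] and vU = vunit_props[OF V] and vM = vmax_props[OF V] and vM_mult = vmax_mult[OF V]
  and vU_def = vunit_def[OF V] and vM_def = vmax_def[OF V] and vP_def = vparam_def[OF V]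

lemma H_unit: "h \<in> H \<Longrightarrow> h \<noteq> 0 \<Longrightarrow> vunit V h"
  using HV sfieldD(6)[OF sfield_H] by (auto simp: vU_def)

definition cg where "cg a b \<longleftrightarrow> a \<in> V \<and> b \<in> V \<and> a - b \<in> vmax V"

lemma cg_props:
  "a \<in> V \<Longrightarrow> cg a a" "cg a b \<Longrightarrow> cg a' b' \<Longrightarrow> cg (a + a') (b + b')" "cg a b \<Longrightarrow> cg a' b' \<Longrightarrow> cg (a - a') (b - b')"
  "cg a b \<Longrightarrow> cg a' b' \<Longrightarrow> cg (a * a') (b * b')" "cg a b \<Longrightarrow> vunit V b \<Longrightarrow> vunit V a"
proof -
  show "a \<in> V \<Longrightarrow> cg a a" by (simp add: cg_def vM)
  show "cg a b \<Longrightarrow> cg a' b' \<Longrightarrow> cg (a + a') (b + b')"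
    using vmax_add[OF V, of "a - b" "a' - b'"] by (auto simp: cg_def add_diff_add intro: vD)
  show "cg a b \<Longrightarrow> cg a' b' \<Longrightarrow> cg (a - a') (b - b')"
    using vmax_diff[OF V, of "a - b" "a' - b'"] by (auto simp: cg_def algebra_simps intro: vD)
  show "cg (a * a') (b * b')" if "cg a b" "cg a' b'"
  proof -
    have "a * (a' - b') + (a - b) * b' \<in> vmax V" using that by (intro vmax_add[OF V] vM_mult) (auto simp: cg_def)
    moreover have "a * (a' - b') + (a - b) * b' = a * a' - b * b'" by (simp add: algebra_simps)
    ultimately show ?thesis using that by (auto simp: cg_def intro: vD)
  qed
  show "vunit V a" if "cg a b" "vunit V b"
    using vunit_add[OF V that(2), of "a - b"] that(1) by (simp add: cg_def)
qed

text \<open>The summand with \<open>i = 0\<close> dominates: relative to \<open>z ^ q\<close> each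
  other one is a positive power of \<open>n / z\<close>, hence in the maximal ideal.\<close>

lemma pole_sum:
  assumes y: "inverse z \<in> vmax V" "z \<noteq> 0" and n: "n \<in> V"
  shows "\<exists>u. vunit V u \<and> (\<Sum>i<q. n ^ i * z ^ (q - i)) = u * z ^ q"
proof -
  define u where "u = 1 + (\<Sum>i\<in>{..<q} - {0}. (n * inverse z) ^ i)"
  have nz: "n * inverse z \<in> vmax V" by (rule vM_mult(1)[OF n y(1)])
  have "(n * inverse z) ^ i \<in> vmax V" if "i \<noteq> 0" for i
  proof -
    have "(n * inverse z) ^ i = (n * inverse z) ^ (i - 1) * (n * inverse z)"
      by (rule power_minus_mult[symmetric]) (use that in simp)
    thus ?thesis using vM_mult(1)[OF vD(7)[OF vM(2)[OF nz]] nz] by (simp only:)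
  qed
  hence "vunit V u" unfolding u_def by (intro vunit_add[OF V] vU vmax_sum[OF V]) auto
  moreover have "(\<Sum>i<q. n ^ i * z ^ (q - i)) = (\<Sum>i<q. (n * inverse z) ^ i * z ^ q)"
    using y(2) by (intro sum.cong refl) (simp add: power_mult_distrib power_inverse power_diff field_simps)
  moreover have "(\<Sum>i<q. (n * inverse z) ^ i) = u"
    unfolding u_def by (subst sum.remove[of _ 0]) auto
  ultimately show ?thesis by (auto simp flip: sum_distrib_right)
qed

lemma vparam_inverse: "vparam V E (inverse \<pi>) \<longleftrightarrow> vparam V E \<pi>"
proof -
  have "vparam V E (inverse \<pi>)" if par: "vparam V E \<pi>" for \<pi>
    unfolding vP_def
  proof (intro ballI impI)
    fix z assume "z \<in> E" "z \<noteq> 0"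
    then obtain u n where "vunit V u" "z = u * \<pi> powi n" using par unfolding vP_def by blast
    thus "\<exists>u n. vunit V u \<and> z = u * inverse \<pi> powi n"
      by (intro exI[of _ u] exI[of _ "- n"]) (simp add: power_int_minus power_int_inverse)
  qed
  from this[of \<pi>] this[of "inverse \<pi>"] show ?thesis by auto
qed

text \<open>The step equation is monic of degree \<open>q\<close> in \<open>w'\<close>. By
  \<open>ramified_poly\<close> a nonzero polynomial of smaller degree, rewritten in
  \<open>\<theta> = w' + c\<close>, is a unit times a power of \<open>\<theta>\<close>. So it does
  not vanish, which gives the degree, and all elements of the extension have this form, which gives
  the new parameter.\<close>

lemma step_extension:
  assumes E: "sfield E" "H \<subseteq> E" "w \<in> E" and Z: "conj Z" and st: "stepZ Z w w'" and c: "c \<in> E"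
    and par: "vparam V E \<pi>" and th: "(w' + c) ^ q = u0 * \<pi>" "vunit V u0" "w' + c \<in> vmax V \<or> inverse (w' + c) \<in> vmax V" "w' + c \<noteq> 0"
  shows "ring.dimension ambient q E (generate_field ambient (E \<union> {w'}))" "vparam V (generate_field ambient (E \<union> {w'})) (w' + c)"
proof -
  note D = sfieldD[OF E(1)] sfield_F[OF E(1)] sfield_power[OF E(1)] and I = coeffs_in_intros[OF E(1)]
  have h: "t \<in> E" "Z \<in> E" using in_H(1,2) Z E(2) by auto
  define n where "n = nab Z w"
  define r where "r = w ^ q / (1 - (F Z / Z - 1) * w) * (n * (t - F Z)) ^ (q - 1)"
  have nE: "n \<in> E" unfolding n_def nab_def using h E(3) by (intro D)
  have rE: "r \<in> E" unfolding r_def using h E(3) nE by (intro D)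
  define p where "p = (\<Sum>i<q. Polynomial.monom (n ^ i) (q - i)) - [:r:]"
  have co: "coeff p l = (\<Sum>i<q. if q - i = l then n ^ i else 0) - (if l = 0 then r else 0)" for l
    by (simp add: p_def coeff_sum coeff_pCons split: nat.splits)
  have lq: "coeff p q = 1"
  proof -
    have "(\<Sum>i<q. if q - i = q then n ^ i else 0) = (\<Sum>i\<in>{0}. n ^ i)"
      using q_pos by (intro sum.mono_neutral_cong_right) auto
    thus ?thesis using q_neq_0 by (simp add: co)
  qed
  moreover have "degree p \<le> q"
    using q_pos by (intro degree_le) (auto simp: co intro!: sum.neutral)
  ultimately have dp: "degree p = q" by (metis le_antisym le_degree zero_neq_one)
  have "(\<Sum>i<q. if q - i = l then n ^ i else 0) \<in> E" for l
    by (rule sfield_sum[OF E(1)]) (simp add: D(2) sfield_power[OF E(1) nE])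
  moreover have "(if l = 0 then r else 0) \<in> E" for l :: nat using rE D(2) by simp
  ultimately have "coeff p l \<in> E" for l unfolding co by (rule D(7))
  hence pE: "p \<in> coeffs_in E" by (simp add: coeffs_in_def)
  have "poly p w' = 0" using st unfolding stepZ_def by (simp add: p_def poly_sum poly_monom n_def r_def)
  have val: "\<exists>v l. vunit V v \<and> poly g w' = v * (w' + c) powi l" if g: "g \<in> coeffs_in E" "g \<noteq> 0" "degree g < q" for g
  proof -
    let ?g = "pcompose g [:- c, 1:]"
    have "poly ?g (w' + c) = poly g w'" by (simp add: poly_pcompose)
    moreover have "?g \<in> coeffs_in E" using g(1) c D by (intro pcompose_coeffs[OF E(1)] I) auto
    moreover have "degree ?g < q" using g(3) by (simp add: degree_pcompose)
    moreover have "?g \<noteq> 0" using g(2) pcompose_eq_0[of g "[:- c, 1:]"] by auto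
    ultimately show ?thesis using ramified_poly[OF V par q_pos th, of ?g] by (auto simp: coeffs_in_def)
  qed
  have min: "poly g w' \<noteq> 0" if "g \<in> coeffs_in E" "g \<noteq> 0" "degree g < q" for g
    using val[OF that] th(4) by (auto simp: vU_def)
  have lp: "lead_coeff p = 1" using lq dp by simp
  note sd = simple_dimension[OF E(1) pE lp dp \<open>poly p w' = 0\<close> q_pos]
  have sd2: "generate_field ambient (E \<union> {w'}) = {poly g w' |g. g \<in> coeffs_in E \<and> degree g < q}"
    by (rule sd(2)) (rule min)
  show "ring.dimension ambient q E (generate_field ambient (E \<union> {w'}))" by (rule sd(1)) (rule min)
  show "vparam V (generate_field ambient (E \<union> {w'})) (w' + c)" unfolding vP_def
  proof (intro ballI impI)
    fix z assume z: "z \<in> generate_field ambient (E \<union> {w'})" "z \<noteq> 0"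
    then obtain g where g: "z = poly g w'" "g \<in> coeffs_in E" "degree g < q" unfolding sd2 by blast
    have "g \<noteq> 0" using z(2) g(1) by auto
    thus "\<exists>u n. vunit V u \<and> z = u * (w' + c) powi n" using val[OF g(2) _ g(3)] g(1) by simp
  qed
qed

text \<open>Put \<open>s = 1 / w\<close>. Then \<open>nab\<close> is a multiple of \<open>s\<close>
  and the right side is congruent to \<open>- kap Z\<close>, so \<open>w'\<close> tends to
  \<open>- kap (F Z)\<close>, whose q-th power is \<open>- kap Z\<close>. For
  \<open>\<theta> = w' + kap (F Z)\<close> this leaves \<open>\<theta> ^ q = u0 s\<close>, and the
  work is to show that \<open>u0\<close> is a unit.\<close>

lemma step_from_pole:
  assumes E: "sfield E" "H \<subseteq> E" "w \<in> E" and Z: "conj Z" and st: "stepZ Z w w'"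
    and par: "vparam V E w" and w: "inverse w \<in> vmax V" "w \<noteq> 0"
  shows "ring.dimension ambient q E (generate_field ambient (E \<union> {w'}))"
    "vparam V (generate_field ambient (E \<union> {w'})) (w' + kap (F Z))" "w' + kap (F Z) \<in> vmax V" "w' + kap (F Z) \<noteq> 0"
proof -
  note HD = sfieldD[OF sfield_H] and Z' = conj_F[OF Z] and K = kap_props[OF Z]
  define W where "W = F Z"
  define k where "k = kap Z"
  define k' where "k' = kap W"
  define a where "a = t - Z"
  define b where "b = t - W"
  have FW: "F W = Z" using conj_props[OF Z] by (simp add: W_def)
  have kk: "F k = k'" "F k' = k" "k \<noteq> 0" "k' \<noteq> 0" using K kap_props(1)[OF Z'] by (simp_all add: k_def k'_def W_def)
  have nz: "a \<noteq> 0" "b \<noteq> 0" "Z \<noteq> 0" "W \<noteq> 0" "Z - W \<noteq> 0"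
    using t_not_conj[OF Z] t_not_conj[OF Z'] conj_props[OF Z] by (auto simp: a_def b_def W_def)
  have kZ: "k * (Z - W) = Z" "k' * (W - Z) = W" using nz by (simp_all add: k_def k'_def kap_def FW W_def[symmetric])
  have inH: "Z \<in> H" "W \<in> H" "k \<in> H" "k' \<in> H" "a \<in> H" "b \<in> H" "F b \<in> H"
    using in_H Z Z' HD by (simp_all add: W_def k_def k'_def a_def b_def)
  hence inV: "Z \<in> V" "W \<in> V" "k \<in> V" "k' \<in> V" "a \<in> V" "b \<in> V" "F b \<in> V" using HV by auto
  define s where "s = inverse w"
  have s: "s \<in> vmax V" "s \<in> V" "s \<noteq> 0" "w = 1 / s" using w vM(2) by (auto simp: s_def divide_inverse)
  define rr where "rr = s ^ (q - 1)"
  have Fs: "F s = s * rr" using power_q_minus_1[OF s(3)] s by (simp add: rr_def)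
  have rr: "rr \<in> vmax V"
  proof -
    have "rr = s ^ (q - 2) * s" using q_gt1 unfolding rr_def
      by (metis Suc_diff_Suc numeral_2_eq_2 power_Suc2 One_nat_def)
    thus ?thesis using vM_mult(1)[OF vD(7)[OF s(2)] s(1)] by (simp only:)
  qed
  have rV: "rr \<in> V" using rr vM(2) by blast
  have cgs: "cg (Z * s + b) b" "cg (1 + k * s) 1" "cg (W * F s + F b) (F b)" "cg (b * W * ((1 + k * s) * rr)) 0"
    unfolding cg_def Fs using inV s rr rV by (auto intro!: vD vM_mult(1))
  have u1: "vunit V (Z * s + b)" "vunit V (1 + k * s)" "vunit V (W * F s + F b)"
    using cg_props(5)[OF cgs(1)] cg_props(5)[OF cgs(2)] cg_props(5)[OF cgs(3)] H_unit[of b] H_unit[of "F b"] inH nz vU(1) by auto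
  have ub: "vunit V b" using H_unit inH nz by blast
  note n0 = u1[unfolded vU_def]
  define \<nu> where "\<nu> = k * W / (Z * s + b)"
  have nuV: "\<nu> \<in> V" unfolding \<nu>_def using u1(1) inV by (auto simp: vU_def divide_inverse intro!: vD)
  have nu0: "\<nu> * b \<noteq> 0" using n0 nz kk by (simp add: \<nu>_def)
  define n where "n = nab Z w"
  have kd: "k = Z / (Z - W)" by (simp add: k_def kap_def W_def)
  have n: "n = s * \<nu>"
  proof -
    have "(Z / W - 1) * (1 + b * w / Z) = (Z - W) / W * ((Z * s + b) / (Z * s))" using nz s(3) by (simp add: s(4) field_simps)
    hence "n = 1 / ((Z - W) / W * ((Z * s + b) / (Z * s)))" by (simp add: n_def nab_def W_def[symmetric] b_def[symmetric])
    also have "\<dots> = s * (Z / (Z - W) * W / (Z * s + b))" by simp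
    finally show ?thesis by (simp only: \<nu>_def kd)
  qed
  have nM: "n \<in> vmax V" and nV: "n \<in> V" unfolding n
    using vM_mult(2)[OF s(1) nuV] vM(2) by blast+
  define r where "r = w ^ q / (1 - (W / Z - 1) * w) * (n * b) ^ (q - 1)"
  have rel: "(\<Sum>i<q. n ^ i * w' ^ (q - i)) = r"
    using st unfolding stepZ_def by (simp add: n_def r_def W_def b_def)
  define G where "G = F b * (b * k - Z) + b * W * ((1 + k * s) * rr)"
  define De where "De = b * (1 + k * s) * (W * F s + F b)"
  have uDe: "vunit V De" unfolding De_def by (intro vU ub u1)
  define A where "A = k * G / De"
  \<comment> \<open>\<open>k (W / Z - 1) = - 1\<close> turns the denominator into
    \<open>(1 + k s) / (k s)\<close>; in the last factor \<open>s\<close> cancels against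
    \<open>w\<close>, and the power \<open>q - 1\<close> is a quotient of \<open>F\<close> by the
    identity.\<close>
  have r1: "r = - (k * F b * (Z * s + b) / De)"
  proof -
    have "k * (W / Z - 1) = - 1" using nz by (simp add: kd field_simps)
    moreover have "s * w = 1" using s(3) by (simp add: s(4))
    moreover have "k * s * (1 - (W / Z - 1) * w) = k * s - s * w * (k * (W / Z - 1))" by (simp add: algebra_simps)
    ultimately have "k * s * (1 - (W / Z - 1) * w) = k * s + 1" by simp
    hence d: "1 - (W / Z - 1) * w = (1 + k * s) / (k * s)" using kk(3) s(3) by (simp add: field_simps)
    have "w ^ q * (n * b) ^ (q - 1) = w * (\<nu> * b) ^ (q - 1)"
    proof -
      have "w ^ q = w * w ^ (q - 1)" using q_pos by (simp add: power_eq_if)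
      moreover have "w ^ (q - 1) * (n * b) ^ (q - 1) = (\<nu> * b) ^ (q - 1)"
        unfolding power_mult_distrib[symmetric] n using s(3) by (simp add: s(4))
      ultimately show ?thesis by simp
    qed
    hence "r = w * (\<nu> * b) ^ (q - 1) / ((1 + k * s) / (k * s))" unfolding r_def d by simp
    also have "\<dots> = k * (\<nu> * b) ^ (q - 1) / (1 + k * s)" using s(3) by (simp add: s(4))
    also have "(\<nu> * b) ^ (q - 1) = F (\<nu> * b) / (\<nu> * b)" by (rule power_q_minus_1[OF nu0])
    also have "F (\<nu> * b) = k' * Z * F b / (W * F s + F b)"
      by (simp add: \<nu>_def F_simps kk FW W_def[symmetric])
    also have "\<nu> * b = k * W * b / (Z * s + b)" by (simp add: \<nu>_def)
    also have "k * (k' * Z * F b / (W * F s + F b) / (k * W * b / (Z * s + b))) / (1 + k * s) = k' * Z / W * F b * (Z * s + b) / De"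
      using kk by (simp add: De_def mult_ac)
    also have "k' * Z / W = - k"
    proof -
      have "k' = W / (W - Z)" by (simp add: k'_def kap_def FW)
      hence "k' * Z / W = Z / (W - Z)" using nz by simp
      also have "\<dots> = - k" unfolding kd using minus_divide_right[of Z "Z - W"] by simp
      finally show ?thesis .
    qed
    finally show ?thesis by simp
  qed
  have A: "r + k = s * A"
  proof -
    have De0: "De \<noteq> 0" using uDe by (simp add: vU_def)
    hence "r + k = k * (De - F b * (Z * s + b)) / De" unfolding r1 by (simp add: field_simps)
    also have "De - F b * (Z * s + b) = s * G" unfolding De_def G_def Fs by (simp add: algebra_simps)
    finally show ?thesis by (simp add: A_def)
  qed
  have GV: "G \<in> V" unfolding G_def using inV s rV by (auto intro!: vD)
  have AV: "A \<in> V" using GV inV uDe by (auto simp: A_def vU_def divide_inverse intro!: vD)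
  have rVV: "r \<in> V"
  proof -
    have "r = s * A - k" using A by (simp add: algebra_simps)
    thus ?thesis using s AV inV by (auto intro!: vD)
  qed
  have w'V: "w' \<in> V"
  proof (rule ccontr)
    assume nV': "w' \<notin> V"
    have y: "inverse w' \<in> vmax V" by (rule vM(6)[OF nV'])
    have w'0: "w' \<noteq> 0" using nV' vD(2) by auto
    obtain u where u: "vunit V u" "r = u * w' ^ q" using pole_sum[OF y w'0 nV] rel by metis
    have "w' ^ q = inverse u * r" using u by (simp add: vU_def)
    moreover have "inverse u * r \<in> V" using u(1) rVV by (intro vD(4)) (simp_all add: vU_def)
    ultimately have "w' ^ q \<in> V" by (simp only:)
    moreover have "inverse w' ^ q = inverse w' ^ (q - 1) * inverse w'" using q_pos by (metis power_minus_mult)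
    hence "inverse w' ^ q \<in> vmax V" using vM_mult(1)[OF vD(7)[OF vM(2)[OF y]] y] by (simp only:)
    ultimately have "w' ^ q * inverse w' ^ q \<in> vmax V" by (rule vM_mult(1))
    hence "1 \<in> vmax V" using w'0 by (simp add: power_inverse)
    thus False using vM(4)[OF vU(1)] by blast
  qed
  \<comment> \<open>Separates the term \<open>w' ^ q\<close> from the sum. As \<open>n\<close> is in
    the maximal ideal, \<open>S\<close> is congruent to \<open>w' ^ (q - 1)\<close>.\<close>
  define S where "S = (\<Sum>i<q - 1. n ^ i * w' ^ (q - 1 - i))"
  have SV: "S \<in> V" unfolding S_def using nV w'V by (intro subr_sum[OF vring_subr[OF V]]) (auto intro!: vD)
  have S1: "S - w' ^ (q - 1) \<in> vmax V"
  proof -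
    have "S = w' ^ (q - 1) + (\<Sum>i\<in>{..<q - 1} - {0}. n ^ i * w' ^ (q - 1 - i))"
      unfolding S_def using q_gt1 by (subst sum.remove[of _ 0]) auto
    moreover have "n ^ i * w' ^ (q - 1 - i) \<in> vmax V" if "i \<in> {..<q - 1} - {0}" for i
    proof -
      have "n ^ i = n ^ (i - 1) * n" by (rule power_minus_mult[symmetric]) (use that in auto)
      hence "n ^ i \<in> vmax V" using vM_mult(1)[OF vD(7)[OF nV] nM] by (simp only:)
      thus ?thesis by (rule vM_mult(2)[OF _ vD(7)[OF w'V]])
    qed
    hence "(\<Sum>i\<in>{..<q - 1} - {0}. n ^ i * w' ^ (q - 1 - i)) \<in> vmax V" by (rule vmax_sum[OF V])
    ultimately show ?thesis by simp
  qed
  have rel': "w' ^ q + n * S = r"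
  proof -
    have "(\<Sum>i<q. n ^ i * w' ^ (q - i)) = (\<Sum>i<Suc (q - 1). n ^ i * w' ^ (q - i))" using q_pos by simp
    also have "\<dots> = w' ^ q + (\<Sum>i<q - 1. n ^ Suc i * w' ^ (q - Suc i))" unfolding sum.lessThan_Suc_shift by simp
    also have "(\<Sum>i<q - 1. n ^ Suc i * w' ^ (q - Suc i)) = n * S" unfolding S_def sum_distrib_left by (simp add: mult.assoc)
    finally show ?thesis using rel by simp
  qed
  define \<theta> where "\<theta> = w' + k'"
  define u0 where "u0 = A - \<nu> * S"
  have th: "\<theta> ^ q = u0 * s"
  proof -
    have "\<theta> ^ q = w' ^ q + k" using F_add[of w' k'] kk(2) by (simp add: \<theta>_def F_def)
    also have "w' ^ q = r - n * S" using rel' by (simp add: algebra_simps)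
    finally show ?thesis using A by (simp add: u0_def n algebra_simps)
  qed
  have u0V: "u0 \<in> V" unfolding u0_def using AV nuV SV by (auto intro!: vD)
  have thM: "\<theta> \<in> vmax V" by (rule vmax_power[OF V, of _ q]) (unfold th, rule vM_mult(1)[OF u0V s(1)])
  \<comment> \<open>\<open>w'\<close> is congruent to \<open>- k'\<close>, and
    \<open>(- k') ^ (q - 1) = F (- k') / (- k') = k / k'\<close>.\<close>
  have cS: "cg S (k / k')"
  proof -
    have "w' ^ (q - 1) - (- k') ^ (q - 1) \<in> vmax V"
      by (rule vmax_power_diff[OF V]) (use thM w'V inV in \<open>auto simp: \<theta>_def intro: vD\<close>)
    moreover have "(- k') ^ (q - 1) = k / k'" using power_q_minus_1[of "- k'"] kk by (simp add: F_minus)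
    ultimately have "(S - w' ^ (q - 1)) + (w' ^ (q - 1) - k / k') \<in> vmax V" using S1 by (intro vmax_add[OF V]) simp_all
    moreover have "k / k' \<in> V" using HV sfieldD(8)[OF sfield_H inH(3,4)] by blast
    ultimately show ?thesis using SV by (simp add: cg_def)
  qed
  \<comment> \<open>Cleared of its denominators, which are units, \<open>u0\<close> becomes a
    polynomial expression whose residue can be computed by \<open>cg_props\<close>; it is
    \<open>k * k * b * b * F b\<close>, a nonzero element of \<open>H\<close>.\<close>
  have uu: "u0 * (De * (Z * s + b)) = k * G * (Z * s + b) - k * W * (b * (1 + k * s) * (W * F s + F b)) * S"
  proof -
    have "De \<noteq> 0" using uDe by (simp add: vU_def)
    hence "A * De = k * G" by (simp add: A_def)
    moreover have "\<nu> * (Z * s + b) = k * W" using n0 by (simp add: \<nu>_def)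
    moreover have "u0 * (De * (Z * s + b)) = (A * De) * (Z * s + b) - (\<nu> * (Z * s + b)) * De * S"
      by (simp add: u0_def algebra_simps)
    ultimately show ?thesis by (simp only: De_def)
  qed
  have "cg (k * G * (Z * s + b) - k * W * (b * (1 + k * s) * (W * F s + F b)) * S)
    (k * (F b * (b * k - Z) + 0) * b - k * W * (b * 1 * F b) * (k / k'))"
    unfolding G_def
    by (intro cg_props(2,3,4) cgs cS cg_props(1) vD inV)
  moreover have "k * (F b * (b * k - Z) + 0) * b - k * W * (b * 1 * F b) * (k / k') = k * k * b * b * F b"
  proof -
    have "b * k - Z = k * b - k * (Z - W)" using kZ by simp
    moreover have "W * (k / k') = k * (W - Z)" using kZ(2) kk(4) by (metis mult.commute nonzero_mult_div_cancel_left times_divide_eq_right)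
    moreover have "k * (F b * (b * k - Z) + 0) * b - k * W * (b * 1 * F b) * (k / k') =
      k * b * F b * ((b * k - Z) - W * (k / k'))" by (simp add: algebra_simps)
    ultimately show ?thesis by (simp add: algebra_simps)
  qed
  moreover have "vunit V (k * k * b * b * F b)" by (rule H_unit) (use inH nz kk HD in auto)
  ultimately have "vunit V (u0 * (De * (Z * s + b)))" unfolding uu using cg_props(5) by simp
  moreover have "vunit V (De * (Z * s + b))" by (intro vU uDe u1)
  ultimately have "vunit V (u0 * (De * (Z * s + b)) / (De * (Z * s + b)))" by (rule vU(5))
  hence u0: "vunit V u0" using \<open>vunit V (De * (Z * s + b))\<close> by (simp add: vU_def)
  have th0: "\<theta> \<noteq> 0"
  proof
    assume "\<theta> = 0"
    hence "u0 * s = 0 ^ q" using th by simp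
    hence "u0 * s = 0" using q_pos by (simp only: zero_power)
    thus False using u0 s by (simp add: vU_def)
  qed
  have par': "vparam V E s" using par by (simp add: s_def vparam_inverse)
  have k'E: "k' \<in> E" using inH E(2) by auto
  note ext = step_extension[OF E Z st k'E par', folded \<theta>_def, OF th u0 disjI1[OF thM] th0]
  show "ring.dimension ambient q E (generate_field ambient (E \<union> {w'}))" by (rule ext(1))
  show "vparam V (generate_field ambient (E \<union> {w'})) (w' + kap (F Z))" "w' + kap (F Z) \<in> vmax V" "w' + kap (F Z) \<noteq> 0"
    using ext(2) thM th0 by (simp_all add: \<theta>_def k'_def W_def)
qed

text \<open>At \<open>w = - kap Z\<close> the factor \<open>1 - (F Z / Z - 1) w\<close> equals
  \<open>\<pi> / k\<close> with \<open>\<pi> = w + kap Z\<close>, while \<open>nab\<close> and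
  \<open>w\<close> are units. The right side is thus a unit over \<open>\<pi>\<close>, so
  \<open>w'\<close> has a pole with \<open>w' ^ q\<close> a unit over \<open>\<pi>\<close>.\<close>

lemma step_to_pole:
  assumes E: "sfield E" "H \<subseteq> E" "w \<in> E" and Z: "conj Z" and st: "stepZ Z w w'"
    and par: "vparam V E (w + kap Z)" and w: "w + kap Z \<in> vmax V" "w + kap Z \<noteq> 0"
  shows "ring.dimension ambient q E (generate_field ambient (E \<union> {w'}))"
    "vparam V (generate_field ambient (E \<union> {w'})) w'" "inverse w' \<in> vmax V" "w' \<noteq> 0"
proof -
  note HD = sfieldD[OF sfield_H] and Z' = conj_F[OF Z] and K = kap_props[OF Z]
  define W where "W = F Z"
  define k where "k = kap Z"
  define b where "b = t - W"
  define \<pi> where "\<pi> = w + k"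
  have p: "\<pi> \<in> vmax V" "\<pi> \<noteq> 0" "\<pi> \<in> V" using w vM(2) by (auto simp: \<pi>_def k_def)
  have k0: "k \<noteq> 0" using K by (simp add: k_def)
  have nz: "t - Z \<noteq> 0" "b \<noteq> 0" "Z \<noteq> 0" "W \<noteq> 0" "Z - W \<noteq> 0"
    using t_not_conj[OF Z] t_not_conj[OF Z'] conj_props[OF Z] by (auto simp: b_def W_def)
  have kd: "k = Z / (Z - W)" by (simp add: k_def kap_def W_def)
  have inH: "t \<in> H" "Z \<in> H" "W \<in> H" "k \<in> H" "b \<in> H" using in_H Z Z' HD by (simp_all add: W_def k_def b_def)
  have u: "vunit V (- k)" "vunit V k" "vunit V b" "vunit V ((Z - W) / (W * Z))" "vunit V (- (k * (t - Z)))"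
    by (rule H_unit; use inH nz k0 HD in auto)+
  have "vunit V (- k + \<pi>)" by (rule vunit_add[OF V u(1) p(1)])
  hence uw: "vunit V w" by (simp add: \<pi>_def)
  have bV: "b \<in> V" using inH HV by auto
  have Zb: "Z + b * w = - (k * (t - Z)) + b * \<pi>"
  proof -
    have "Z = k * (Z - W)" using nz by (simp add: kd)
    hence "Z + b * w = k * (Z - W) + b * w" by simp
    thus ?thesis by (simp add: \<pi>_def b_def algebra_simps)
  qed
  have uZb: "vunit V (Z + b * w)" unfolding Zb by (rule vunit_add[OF V u(5) vM_mult(1)[OF bV p(1)]])
  define n where "n = nab Z w"
  have n: "n = inverse ((Z - W) / (W * Z) * (Z + b * w))"
  proof -
    have "(Z / W - 1) * (1 + b * w / Z) = (Z - W) / (W * Z) * (Z + b * w)" using nz by (simp add: field_simps)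
    thus ?thesis by (simp add: n_def nab_def W_def[symmetric] b_def[symmetric] inverse_eq_divide)
  qed
  have un: "vunit V n" unfolding n by (intro vU u uZb)
  define \<rho>' where "\<rho>' = k * w ^ q * (n * b) ^ (q - 1)"
  have ur: "vunit V \<rho>'" unfolding \<rho>'_def by (intro vU u uw un)
  have rel: "(\<Sum>i<q. n ^ i * w' ^ (q - i)) = \<rho>' * inverse \<pi>"
  proof -
    have "1 - (W / Z - 1) * w = \<pi> / k" using nz by (simp add: \<pi>_def kd field_simps)
    thus ?thesis using st unfolding stepZ_def by (simp add: n_def \<rho>'_def W_def[symmetric] b_def[symmetric] divide_inverse mult_ac)
  qed
  have nV: "n \<in> V" by (rule vM(5)[OF un])
  have w'V: "w' \<notin> V"
  proof
    assume "w' \<in> V"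
    hence "(\<Sum>i<q. n ^ i * w' ^ (q - i)) \<in> V" using nV by (intro subr_sum[OF vring_subr[OF V]]) (auto intro!: vD)
    hence "inverse \<rho>' * (\<rho>' * inverse \<pi>) \<in> V" using ur unfolding rel by (auto simp: vU_def intro!: vD)
    moreover have "inverse \<rho>' * \<rho>' = 1" using ur by (simp add: vU_def)
    hence "inverse \<rho>' * (\<rho>' * inverse \<pi>) = inverse \<pi>" by (simp only: mult.assoc[symmetric] mult_1_left)
    ultimately have "inverse \<pi> \<in> V" by (simp only:)
    thus False using p by (auto simp: vM_def)
  qed
  show y: "inverse w' \<in> vmax V" by (rule vM(6)[OF w'V])
  show w'0: "w' \<noteq> 0" using w'V vD(2) by auto
  obtain v where v: "vunit V v" "\<rho>' * inverse \<pi> = v * w' ^ q" using pole_sum[OF y w'0 nV] rel by metis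
  have th: "(w' + 0) ^ q = (\<rho>' / v) * inverse \<pi>" using v by (simp add: vU_def field_simps)
  have par': "vparam V E (inverse \<pi>)" using par by (simp add: \<pi>_def k_def vparam_inverse)
  have "inverse (w' + 0) \<in> vmax V" "w' + 0 \<noteq> 0" using y w'0 by simp_all
  note ext = step_extension[OF E Z st sfieldD(2)[OF E(1)] par' th vU(5)[OF ur v(1)] disjI2[OF this(1)] this(2)]
  show "ring.dimension ambient q E (generate_field ambient (E \<union> {w'}))" by (rule ext(1))
  show "vparam V (generate_field ambient (E \<union> {w'})) w'" using ext(2) by simp
qed

text \<open>Nonzero elements of \<open>H\<close> are units, so the value of a polynomial in
  \<open>w\<close> is governed by its leading term, and quotients of such values exhaust
  \<open>H(w)\<close>.\<close>

lemma pole_base: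
  assumes w: "inverse w \<in> vmax V" "w \<noteq> 0" and tr: "\<And>p. p \<in> coeffs_in H \<Longrightarrow> poly p w = 0 \<Longrightarrow> p = 0"
  shows "vparam V (generate_field ambient (H \<union> {w})) w"
proof -
  have val: "\<exists>u n. vunit V u \<and> poly f w = u * w powi n" if f: "f \<in> coeffs_in H" "f \<noteq> 0" for f
  proof -
    \<comment> \<open>\<open>ramified_poly\<close> is used with the exponent \<open>N\<close> in
      place of \<open>q\<close>, so that it covers all degrees up to that of \<open>f\<close>; for
      \<open>H\<close> any parameter will do, with exponent 0.\<close>
    define N where "N = Suc (degree f)"
    have par: "vparam V H (w ^ N)" unfolding vP_def
    proof (intro ballI impI)
      fix z assume "z \<in> H" "z \<noteq> 0"
      thus "\<exists>u n. vunit V u \<and> z = u * (w ^ N) powi n" by (intro exI[of _ z] exI[of _ 0]) (simp add: H_unit)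
    qed
    show ?thesis by (rule ramified_poly[OF V par, of N w 1]) (use f w vU(1) in \<open>auto simp: N_def coeffs_in_def\<close>)
  qed
  show ?thesis unfolding vP_def
  proof (intro ballI impI)
    fix z assume z: "z \<in> generate_field ambient (H \<union> {w})" "z \<noteq> 0"
    then obtain f g where fg: "f \<in> coeffs_in H" "g \<in> coeffs_in H" "poly g w \<noteq> 0" "z = poly f w / poly g w"
      using generate_field_fraction[OF sfield_H] by metis
    have "f \<noteq> 0" "g \<noteq> 0" using z fg by auto
    then obtain u l v n where "vunit V u" "poly f w = u * w powi l" "vunit V v" "poly g w = v * w powi n"
      using val fg by metis
    thus "\<exists>u n. vunit V u \<and> z = u * w powi n" using w(2) vU(5)
      by (intro exI[of _ "u / v"] exI[of _ "l - n"]) (simp add: fg(4) power_int_diff)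
  qed
qed

text \<open>The last entry is the variable of index \<open>n + 1\<close>, so even \<open>n\<close>
  is the pole case. The induction alternates between \<open>step_from_pole\<close> and
  \<open>step_to_pole\<close>, each supplying the hypotheses of the other.\<close>

lemma tower_ramified:
  assumes "(j, ws) \<in> tower_points q \<zeta> t (Suc n)" "ring.transcendental ambient H j" "inverse (ws ! 0) \<in> vmax V"
  shows "(if even n then vparam V (tower_field q \<zeta> t j ws) (last ws) \<and> inverse (last ws) \<in> vmax V \<and> last ws \<noteq> 0
     else vparam V (tower_field q \<zeta> t j ws) (last ws + kap ((F ^^ n) \<zeta>)) \<and> last ws + kap ((F ^^ n) \<zeta>) \<in> vmax V \<and>
       last ws + kap ((F ^^ n) \<zeta>) \<noteq> 0) \<and>
    (n > 0 \<longrightarrow> ring.dimension ambient q (tower_field q \<zeta> t j (butlast ws)) (tower_field q \<zeta> t j ws))"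
  using assms
proof (induction n arbitrary: ws)
  case 0
  then obtain w where ws: "ws = [w]" by (auto simp: tower_points_def length_Suc_conv)
  have r: "first_relation q \<zeta> t j w" using 0(1) by (simp add: tower_points_def ws)
  have w0: "w \<noteq> 0" using first_relation_eq(1)[OF r] by auto
  have "tower_field q \<zeta> t j ws = generate_field ambient (H \<union> {w})"
    using tower_field_w[OF 0(1)] by (simp add: ws over_H_def)
  moreover have "vparam V (generate_field ambient (H \<union> {w})) w"
    using transcendental_w[OF 0(2) r] transcendental_iff[OF sfield_H] 0(3) w0 by (intro pole_base) (auto simp: ws)
  ultimately show ?case using 0(3) w0 by (simp add: ws)
next
  case (Suc n us)
  have len: "length us = Suc (Suc n)" using Suc.prems(1) by (simp add: tower_points_def)
  then obtain ws w' where us: "us = ws @ [w']" by (cases us rule: rev_cases) auto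
  have lw: "length ws = Suc n" using len us by simp
  hence wn: "ws \<noteq> []" by auto
  have tw: "(j, ws) \<in> tower_points q \<zeta> t (Suc n)" using Iinf_times_\<Gamma>(1) Suc.prems(1) us by simp
  have ws0: "ws ! 0 = us ! 0" and wsn: "ws ! n = last ws"
    using lw us by (simp_all add: nth_append last_conv_nth[OF wn])
  have "step_relation q \<zeta> t (n + 2) (us ! n) (us ! Suc n)"
    using Suc.prems(1) by (auto simp: tower_points_def dest: spec[of _ "n + 2"])
  moreover have "us ! n = last ws" "us ! Suc n = w'" using lw us wsn by (simp_all add: nth_append)
  \<comment> \<open>The step joining entries \<open>n + 1\<close> and \<open>n + 2\<close> is the
    one with \<open>m = n + 2\<close>, and two applications of \<open>F\<close> fix
    \<open>\<zeta>\<close>.\<close>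
  moreover have "(F ^^ (n + 2)) \<zeta> = (F ^^ n) \<zeta>" using conj_props[OF conj_zeta] by (simp add: funpow_swap1)
  ultimately have st: "stepZ ((F ^^ n) \<zeta>) (last ws) w'" unfolding step_relation_eq by simp
  have Z: "conj ((F ^^ n) \<zeta>)" by (induction n) (auto simp: conj_zeta conj_F)
  define E where "E = tower_field q \<zeta> t j ws"
  note T = over_H_props[of "{j} \<union> set ws", folded tower_field_def, folded E_def]
  have lE: "last ws \<in> E" using T(5) last_in_set[OF wn] by auto
  have E': "tower_field q \<zeta> t j us = generate_field ambient (E \<union> {w'})" unfolding us E_def by (rule tower_field_snoc)
  have IH: "if even n then vparam V E (last ws) \<and> inverse (last ws) \<in> vmax V \<and> last ws \<noteq> 0
     else vparam V E (last ws + kap ((F ^^ n) \<zeta>)) \<and> last ws + kap ((F ^^ n) \<zeta>) \<in> vmax V \<and> last ws + kap ((F ^^ n) \<zeta>) \<noteq> 0"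
    using Suc.IH[OF tw Suc.prems(2)] Suc.prems(3) ws0 unfolding E_def by auto
  have bl: "butlast us = ws" "last us = w'" by (simp_all add: us)
  show ?case
  proof (cases "even n")
    case True
    hence "vparam V E (last ws)" "inverse (last ws) \<in> vmax V" "last ws \<noteq> 0" using IH by auto
    from step_from_pole[OF T(1,6) lE Z st this] show ?thesis using True by (simp add: E' bl E_def[symmetric])
  next
    case False
    hence "vparam V E (last ws + kap ((F ^^ n) \<zeta>))" "last ws + kap ((F ^^ n) \<zeta>) \<in> vmax V" "last ws + kap ((F ^^ n) \<zeta>) \<noteq> 0"
      using IH by auto
    from step_to_pole[OF T(1,6) lE Z st this] show ?thesis using False by (simp add: E' bl E_def[symmetric])
  qed
qed

end

text \<open>\<open>w\<close> is not in \<open>H[1 / w]\<close>, since \<open>w = f(1 / w)\<close>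
  would be an algebraic equation over \<open>H\<close>. So \<open>1 / w\<close> has no inverse in
  that ring, and \<open>vring_exists\<close> keeps it a non-unit in some valuation ring.\<close>

lemma pole_exists:
  assumes tr: "\<And>p. p \<in> coeffs_in H \<Longrightarrow> poly p w = 0 \<Longrightarrow> p = 0"
  shows "\<exists>V. vring V \<and> H \<subseteq> V \<and> inverse w \<in> vmax V"
proof -
  note HD = sfieldD[OF sfield_H] and HI = coeffs_in_intros[OF sfield_H]
  have w0: "w \<noteq> 0" using tr[of "[:0, 1:]"] HD by (auto simp: HI)
  define R0 where "R0 = {poly f (inverse w) |f. \<forall>i. coeff f i \<in> H}"
  have "subr H" unfolding subr_def using HD by simp
  note adj = subr_adjoin[OF this, of "inverse w", folded R0_def]
  have "inverse (inverse w) \<notin> R0"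
  proof
    assume "inverse (inverse w) \<in> R0"
    then obtain f where f: "w = poly f (inverse w)" "f \<in> coeffs_in H" by (auto simp: R0_def coeffs_in_def)
    \<comment> \<open>The equation \<open>w = f(1 / w)\<close> multiplied by
      \<open>w ^ degree f\<close>; the reflected polynomial does not reach the degree of the
      monomial, so \<open>p\<close> is nonzero.\<close>
    define p where "p = Polynomial.monom 1 (Suc (degree f)) - reflect_poly f"
    have "coeff (reflect_poly f) i \<in> H" for i using f(2) HD by (simp add: coeff_reflect_poly coeffs_in_def)
    hence "p \<in> coeffs_in H" unfolding p_def using HD by (intro HI) (auto simp: coeffs_in_def)
    moreover have "poly (reflect_poly f) w = w ^ degree f * w" using poly_reflect_poly_nz[OF w0, of f] f(1) by simp
    hence "poly p w = 0" by (simp add: p_def poly_monom mult.commute)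
    ultimately have "p = 0" by (rule tr)
    hence "coeff p (Suc (degree f)) = 0" by simp
    moreover have "coeff (reflect_poly f) (Suc (degree f)) = 0"
      using degree_reflect_poly_le[of f] by (intro coeff_eq_0) simp
    ultimately show False by (simp add: p_def)
  qed
  then obtain V where V: "vring V" "R0 \<subseteq> V" "inverse (inverse w) \<notin> V"
    using vring_exists[OF adj(1) adj(3)] w0 by auto
  moreover have "inverse w \<in> V" using V adj(3) by blast
  ultimately show ?thesis using adj(2) by (intro exI[of _ V]) (auto simp: vmax_def[OF V(1)])
qed

lemma tower_dimension:
  assumes tw: "(j, ws) \<in> tower_points q \<zeta> t k" and j: "ring.transcendental ambient H j"
  shows "k = 1 \<Longrightarrow> ring.dimension ambient (q + 1) (tower_field q \<zeta> t j (butlast ws)) (tower_field q \<zeta> t j ws)"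
    "k \<ge> 2 \<Longrightarrow> ring.dimension ambient q (tower_field q \<zeta> t j (butlast ws)) (tower_field q \<zeta> t j ws)"
proof -
  assume k: "k = 1"
  then obtain w where ws: "ws = [w]" using tw by (auto simp: tower_points_def length_Suc_conv)
  have "first_relation q \<zeta> t j w" "j \<noteq> 0" using tw by (auto simp: tower_points_def ws k)
  thus "ring.dimension ambient (q + 1) (tower_field q \<zeta> t j (butlast ws)) (tower_field q \<zeta> t j ws)"
    using first_dimension[OF j] by (simp add: ws)
next
  assume k: "k \<ge> 2"
  have r: "first_relation q \<zeta> t j (ws ! 0)" using tw k by (auto simp: tower_points_def)
  obtain V where V: "vring V" "H \<subseteq> V" "inverse (ws ! 0) \<in> vmax V"
    using pole_exists[of "ws ! 0"] transcendental_w[OF j r] transcendental_iff[OF sfield_H] by blast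
  have "(j, ws) \<in> tower_points q \<zeta> t (Suc (k - 1))" using tw k by simp
  from tower_ramified[OF V(1,2) this j V(3)] k
  show "ring.dimension ambient q (tower_field q \<zeta> t j (butlast ws)) (tower_field q \<zeta> t j ws)" by simp
qed

lemma tower_extend:
  assumes "(j, ws) \<in> tower_points q \<zeta> t k"
  shows "\<exists>w. (j, ws @ [w]) \<in> tower_points q \<zeta> t (Suc k)"
proof -
  have "1 / j \<noteq> 0" "kap \<zeta> \<noteq> 0" using kap_props[OF conj_zeta] assms by (auto simp: tower_points_iff)
  from chain_extend[OF conj_zeta this, of ws] assms show ?thesis by (auto simp: tower_points_iff)
qed

end

theorem theorem2:
  fixes q e :: nat and \<zeta> t :: "'a::alg_closed_field"
  assumes "prime CHAR('a)" and "e > 0" and "q = CHAR('a) ^ e"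
    and "\<zeta> ^ (q ^ 2) = \<zeta>" and "\<zeta> \<notin> Fq q"
    and "ring.transcendental ambient (Fq q) t"
  shows
    "(\<forall>k j ws. (j, ws) \<in> tower_points q \<zeta> t k \<longrightarrow>
        (\<exists>w. (j, ws @ [w]) \<in> tower_points q \<zeta> t (Suc k))) \<and>
     (\<forall>k j ws. (j, ws) \<in> tower_points q \<zeta> t k \<and>
        ring.transcendental ambient (Hfield q \<zeta> t) j \<longrightarrow>
        (k = 0 \<longrightarrow> tower_field q \<zeta> t j ws = over_H q \<zeta> t {j}) \<and>
        (k \<ge> 1 \<longrightarrow> tower_field q \<zeta> t j ws = over_H q \<zeta> t (set ws)) \<and>
        (k = 1 \<longrightarrow> ring.dimension ambient (q + 1)
                     (tower_field q \<zeta> t j (butlast ws)) (tower_field q \<zeta> t j ws)) \<and>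
        (k \<ge> 2 \<longrightarrow> ring.dimension ambient q
                     (tower_field q \<zeta> t j (butlast ws)) (tower_field q \<zeta> t j ws))) \<and>
     (\<forall>j. j \<noteq> 0 \<longrightarrow>
        drinfeld_module q \<zeta> t 2 (minimal_model q \<zeta> t j) \<and>
        zeta_q_type q \<zeta> t (minimal_model q \<zeta> t j) \<and>
        minimal_model q \<zeta> t j (xA q \<zeta> t) = model_x q \<zeta> t j \<and>
        minimal_model q \<zeta> t j (yA q \<zeta> t) = model_y q \<zeta> t j) \<and>
     (\<exists>\<Gamma>. \<forall>k.
        bij_betw (\<lambda>(j, ws). (j, \<Gamma> j ws)) (tower_points q \<zeta> t k)
          {(j, G). j \<noteq> 0 \<and>
             primitive_torsion q \<zeta> t (minimal_model q \<zeta> t j) (Iinf_power q \<zeta> t k) G} \<and>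
        bij_betw
          (\<lambda>(j, ws). modular_point q \<zeta> t (Iinf_power q \<zeta> t k) (minimal_model q \<zeta> t j) (\<Gamma> j ws))
          (tower_points q \<zeta> t k)
          (modular_curve q \<zeta> t (Iinf_power q \<zeta> t k)) \<and>
        (\<forall>j ws w. (j, ws @ [w]) \<in> tower_points q \<zeta> t (Suc k) \<longrightarrow>
           (j, ws) \<in> tower_points q \<zeta> t k \<and>
           Iinf_times q \<zeta> t (minimal_model q \<zeta> t j) (\<Gamma> j (ws @ [w])) = \<Gamma> j ws) \<and>
        (\<forall>j ws. (j, ws) \<in> tower_points q \<zeta> t k \<longrightarrow>
           finite (\<Gamma> j ws) \<and>
           tower_field q \<zeta> t j ws = field_of_definition q \<zeta> t j (\<Gamma> j ws)) \<and>
        (\<forall>\<sigma> j ws. \<sigma> \<in> ring_iso ambient ambient \<and> (\<forall>h \<in> Hfield q \<zeta> t. \<sigma> h = h) \<and>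
           (j, ws) \<in> tower_points q \<zeta> t k \<longrightarrow>
           (\<sigma> j, map \<sigma> ws) \<in> tower_points q \<zeta> t k \<and>
           \<sigma> ` \<Gamma> j ws = \<Gamma> (\<sigma> j) (map \<sigma> ws)))"
proof -
  interpret setting q e \<zeta> t by unfold_locales (use assms in auto)
  show ?thesis
  proof (intro conjI allI impI exI[of _ \<Gamma>]; (elim conjE)?)
    fix k :: nat
    show "bij_betw (\<lambda>(j, ws). (j, \<Gamma> j ws)) (tower_points q \<zeta> t k)
          {(j, G). j \<noteq> 0 \<and> primitive_torsion q \<zeta> t (minimal_model q \<zeta> t j) (Iinf_power q \<zeta> t k) G}"
      using tower_bij[of k] by (simp only: Iinf_power_eq)
    show "bij_betw
          (\<lambda>(j, ws). modular_point q \<zeta> t (Iinf_power q \<zeta> t k) (minimal_model q \<zeta> t j) (\<Gamma> j ws))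
          (tower_points q \<zeta> t k) (modular_curve q \<zeta> t (Iinf_power q \<zeta> t k))"
      using tower_modular_bij[of k] by (simp only: Iinf_power_eq)
    fix j w :: 'a and ws and \<sigma> :: "'a \<Rightarrow> 'a"
    show "(j, ws) \<in> tower_points q \<zeta> t k \<Longrightarrow> \<exists>w. (j, ws @ [w]) \<in> tower_points q \<zeta> t (Suc k)"
      by (rule tower_extend)
    show "(j, ws) \<in> tower_points q \<zeta> t k \<Longrightarrow> k = 0 \<Longrightarrow> tower_field q \<zeta> t j ws = over_H q \<zeta> t {j}"
      by (simp add: tower_field_def tower_points_def)
    show "(j, ws) \<in> tower_points q \<zeta> t k \<Longrightarrow> k \<ge> 1 \<Longrightarrow> tower_field q \<zeta> t j ws = over_H q \<zeta> t (set ws)"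
      by (rule tower_field_w)
    show "(j, ws) \<in> tower_points q \<zeta> t k \<Longrightarrow> ring.transcendental ambient (Hfield q \<zeta> t) j \<Longrightarrow> k = 1 \<Longrightarrow>
        ring.dimension ambient (q + 1) (tower_field q \<zeta> t j (butlast ws)) (tower_field q \<zeta> t j ws)"
      by (rule tower_dimension(1))
    show "(j, ws) \<in> tower_points q \<zeta> t k \<Longrightarrow> ring.transcendental ambient (Hfield q \<zeta> t) j \<Longrightarrow> k \<ge> 2 \<Longrightarrow>
        ring.dimension ambient q (tower_field q \<zeta> t j (butlast ws)) (tower_field q \<zeta> t j ws)"
      by (rule tower_dimension(2))
    show "j \<noteq> 0 \<Longrightarrow> drinfeld_module q \<zeta> t 2 (minimal_model q \<zeta> t j)"
      "j \<noteq> 0 \<Longrightarrow> zeta_q_type q \<zeta> t (minimal_model q \<zeta> t j)"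
      by (fact minimal_model_drinfeld)+
    show "j \<noteq> 0 \<Longrightarrow> minimal_model q \<zeta> t j (xA q \<zeta> t) = model_x q \<zeta> t j"
      "j \<noteq> 0 \<Longrightarrow> minimal_model q \<zeta> t j (yA q \<zeta> t) = model_y q \<zeta> t j"
      by (fact minimal_model_hom(2,3))+
    show "(j, ws @ [w]) \<in> tower_points q \<zeta> t (Suc k) \<Longrightarrow> (j, ws) \<in> tower_points q \<zeta> t k"
      "(j, ws @ [w]) \<in> tower_points q \<zeta> t (Suc k) \<Longrightarrow>
        Iinf_times q \<zeta> t (minimal_model q \<zeta> t j) (\<Gamma> j (ws @ [w])) = \<Gamma> j ws"
      by (fact Iinf_times_\<Gamma>)+
    show "(j, ws) \<in> tower_points q \<zeta> t k \<Longrightarrow> finite (\<Gamma> j ws)"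
      "(j, ws) \<in> tower_points q \<zeta> t k \<Longrightarrow> tower_field q \<zeta> t j ws = field_of_definition q \<zeta> t j (\<Gamma> j ws)"
      by (fact tower_field_definition)+
    show "\<sigma> \<in> ring_iso ambient ambient \<Longrightarrow> \<forall>h\<in>Hfield q \<zeta> t. \<sigma> h = h \<Longrightarrow> (j, ws) \<in> tower_points q \<zeta> t k \<Longrightarrow>
        (\<sigma> j, map \<sigma> ws) \<in> tower_points q \<zeta> t k"
      "\<sigma> \<in> ring_iso ambient ambient \<Longrightarrow> \<forall>h\<in>Hfield q \<zeta> t. \<sigma> h = h \<Longrightarrow> (j, ws) \<in> tower_points q \<zeta> t k \<Longrightarrow>
        \<sigma> ` \<Gamma> j ws = \<Gamma> (\<sigma> j) (map \<sigma> ws)"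
      using tower_conj[of \<sigma> j ws k] by blast+
  qed
qed

end
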